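(* Every indecomposable object in $\mathcal C_{\beta\gamma,\mathbb Z}$ is isomorphic to a quotient of a finite direct sum of modules $\sigma^n\mathcal R_k$ for various $n\in\mathbb Z$ and $k\in\mathbb Z_{\ge0}$.
   Context: $\beta\gamma$ is the unital $\mathbb C$-algebra generated by $\beta_n,\gamma_n$ ($n\in\mathbb Z$) with $[\beta_m,\beta_n]=[\gamma_m,\gamma_n]=0$, $[\beta_m,\gamma_n]=-\delta_{m,-n}$. Modules of the $\beta\gamma$ vertex operator algebra are smooth $\beta\gamma$-modules (each vector is killed by $\beta_n,\gamma_n$ for $n\gg0$) graded by generalized eigenvalues of $L_0=\sum_{k\ge1}k(\beta_{-k}\gamma_k-\gamma_{-k}\beta_k)$. Put $J_0=\sum_{n\ge0}\gamma_{-n}\beta_n+\sum_{n\ge1}\beta_{-n}\gamma_n$. Let $\beta\gamma_{\ge0}$ be the subalgebra generated by $\beta_n,\gamma_n$, $n\ge0$. In all inductions below, $\beta_n,\gamma_n$ with $n\ge1$ act by $0$ on the inducing space. Define $\mathcal V=\mathrm{Ind}_{\beta\gamma_{\ge0}}^{\beta\gamma}\mathbb C[\gamma_0]$; for $\lambda=\mu+\mathbb Z\in(\mathbb C\setminus\mathbb Z)/\mathbb Z$, $\mathcal W_\lambda=\mathrm{Ind}_{\beta\gamma_{\ge0}}^{\beta\gamma}\gamma_0^\mu\mathbb C[\gamma_0^{\pm1}]$; and for $k\ge1$ $$\mathcal W_0^{+,k}=\mathrm{Ind}_{\beta\gamma_{\ge0}}^{\beta\gamma}\bigoplus_{j<k}\mathbb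 C[\gamma_0^{\pm1}](\log\gamma_0)^j,\qquad \mathcal W_0^{-,k}=\mathrm{Ind}_{\beta\gamma_{\ge0}}^{\beta\gamma}\bigoplus_{j<k}\mathbb C[\beta_0^{\pm1}](\log\beta_0)^j,$$ where $\beta_0=-\partial/\partial\gamma_0$ in $\mathcal V,\mathcal W_\lambda,\mathcal W_0^{+,k}$ and $\gamma_0=\partial/\partial\beta_0$ in $\mathcal W_0^{-,k}$. Spectral flow: $\sigma(\beta_n)=\beta_{n-1}$, $\sigma(\gamma_n)=\gamma_{n+1}$; $\sigma^nM$ is $M$ with action $\alpha\star v=\sigma^{-n}(\alpha)v$. $\mathcal C_{\beta\gamma}$ is the abelian category of smooth finite-length modules generated by $\sigma^n\mathcal V$, $\sigma^n\mathcal W_\lambda$ and closed under extensions (modules with a finite filtration whose subquotients are among these simple modules). $\mathcal C_{\beta\gamma,\mathbb Z}$ is the full subcategory of objects on which all generalized eigenvalues of $J_0$ are integers. The modules $\mathcal W_0^{\pm,k}$ are uniserial of length $2k$; listing composition factors from socle (left) to head (right), $\mathcal W_0^{-,k}$ is $\sigma^{-1}\mathcal V,\mathcal V,\dots,\sigma^{-1}\mathcal V,\mathcal V$, and $\mathcal W_0^{+,k}$ is $\mathcal V,\sigma^{-1}\mathcal V,\dots,\mathcal V,\sigma^{-1}\mathcal V$. So $\mathcal W_0^{-,m}$ and $\sigma\mathcal W_0^{+,m}$ both have head $\mathcal V$. For $k\ge1$ the roof $\mathcal R_k=\mathcal R_{k,k}$ is the following: let $L_k$ be the length-$k$ quotient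 of $\mathcal W_0^{-,m}$ and $R_k$ the length-$k$ quotient of $\sigma\mathcal W_0^{+,m}$ ($m$ large); $\mathcal R_k$ is the submodule of $L_k\oplus R_k$ generated by the diagonal of the common head $\mathcal V$ (equivalently, the fiber product $L_k\times_{\mathcal V}R_k$ over the heads). In particular $\mathcal R_1=\mathcal V$; set $\mathcal R_0=0$. *)

theory Defs
  imports Complex_Main "HOL-Library.Poly_Mapping" "HOL-Algebra.AbelCoset" "HOL-Algebra.Module"
begin

section \<open>Modules over the beta-gamma algebra\<close>

definition complex_ring :: "complex ring" where
  "complex_ring =
    \<lparr>carrier = UNIV, mult = (*), one = 1, zero = 0, add = (+)\<rparr>"

text \<open>The generators of the algebra: the modes beta_n and gamma_n, n an integer.\<close>

datatype mode = Beta_mode int | Gamma_mode int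

text \<open>The scalar [a,b], for generators a and b.\<close>

fun mode_comm :: "mode \<Rightarrow> mode \<Rightarrow> complex" where
  "mode_comm (Beta_mode m) (Gamma_mode n) = (if m = - n then - 1 else 0)"
| "mode_comm (Gamma_mode m) (Beta_mode n) = (if n = - m then 1 else 0)"
| "mode_comm (Beta_mode m) (Beta_mode n) = 0"
| "mode_comm (Gamma_mode m) (Gamma_mode n) = 0"

text \<open>
  A module over the algebra presented by the modes and their commutators is a complex vector
  space with an operator for each mode, subject to the commutation relations. The fields
  \<open>mult\<close> and \<open>one\<close> inherited from the library's module record carry no information.
\<close>

record 'v bg_module = "(complex, 'v) module" +
  act :: "mode \<Rightarrow> 'v \<Rightarrow> 'v"

locale bg_module = module complex_ring M for M :: "'v bg_module" (structure) +
  assumes act_closed: "x \<in> carrier M \<Longrightarrow> act M a x \<in> carrier M"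
    and act_add: "x \<in> carrier M \<Longrightarrow> y \<in> carrier M \<Longrightarrow>
      act M a (x \<oplus> y) = act M a x \<oplus> act M a y"
    and act_smult: "x \<in> carrier M \<Longrightarrow> act M a (c \<odot> x) = c \<odot> act M a x"
    and act_comm: "x \<in> carrier M \<Longrightarrow>
      act M a (act M b x) \<ominus> act M b (act M a x) = mode_comm a b \<odot> x"

definition bg_submodule :: "'v set \<Rightarrow> 'v bg_module \<Rightarrow> bool" where
  "bg_submodule N M \<longleftrightarrow>
    submodule N complex_ring M \<and> (\<forall>a. \<forall>x\<in>N. act M a x \<in> N)"

definition bg_span :: "'v bg_module \<Rightarrow> 'v set \<Rightarrow> 'v set" where
  "bg_span M S = \<Inter>{N. bg_submodule N M \<and> S \<subseteq> N}"

abbreviation bg_restrict :: "'v bg_module \<Rightarrow> 'v set \<Rightarrow> 'v bg_module" where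
  "bg_restrict M N \<equiv> M\<lparr>carrier := N\<rparr>"

definition bg_quot :: "'v bg_module \<Rightarrow> 'v set \<Rightarrow> 'v set bg_module" where
  "bg_quot M N =
    \<lparr>carrier = a_rcosets\<^bsub>M\<^esub> N, mult = undefined, one = undefined,
     zero = N, add = (\<lambda>X Y. X <+>\<^bsub>M\<^esub> Y),
     smult = (\<lambda>c X. \<Union>x\<in>X. N +>\<^bsub>M\<^esub> (c \<odot>\<^bsub>M\<^esub> x)),
     act = (\<lambda>a X. \<Union>x\<in>X. N +>\<^bsub>M\<^esub> act M a x)\<rparr>"

definition bg_direct_sum :: "'i set \<Rightarrow> ('i \<Rightarrow> 'v bg_module) \<Rightarrow> ('i \<Rightarrow> 'v) bg_module" where
  "bg_direct_sum I M =  \<comment> \<open>only meaningful for finite I\<close>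
    \<lparr>carrier = (\<Pi>\<^sub>E i\<in>I. carrier (M i)), mult = undefined, one = undefined,
     zero = (\<lambda>i\<in>I. \<zero>\<^bsub>M i\<^esub>), add = (\<lambda>x y. \<lambda>i\<in>I. x i \<oplus>\<^bsub>M i\<^esub> y i),
     smult = (\<lambda>c x. \<lambda>i\<in>I. c \<odot>\<^bsub>M i\<^esub> x i),
     act = (\<lambda>a x. \<lambda>i\<in>I. act (M i) a (x i))\<rparr>"

definition bg_sum2 :: "'v bg_module \<Rightarrow> 'w bg_module \<Rightarrow> ('v \<times> 'w) bg_module" where
  "bg_sum2 M N =
    \<lparr>carrier = carrier M \<times> carrier N, mult = undefined, one = undefined,
     zero = (\<zero>\<^bsub>M\<^esub>, \<zero>\<^bsub>N\<^esub>),
     add = (\<lambda>(x, y) (x', y'). (x \<oplus>\<^bsub>M\<^esub> x', y \<oplus>\<^bsub>N\<^esub> y')),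
     smult = (\<lambda>c (x, y). (c \<odot>\<^bsub>M\<^esub> x, c \<odot>\<^bsub>N\<^esub> y)),
     act = (\<lambda>a (x, y). (act M a x, act N a y))\<rparr>"

definition bg_hom :: "'v bg_module \<Rightarrow> 'w bg_module \<Rightarrow> ('v \<Rightarrow> 'w) set" where
  "bg_hom M N =
    {f \<in> carrier M \<rightarrow> carrier N.
      (\<forall>x\<in>carrier M. \<forall>y\<in>carrier M. f (x \<oplus>\<^bsub>M\<^esub> y) = f x \<oplus>\<^bsub>N\<^esub> f y) \<and>
      (\<forall>c. \<forall>x\<in>carrier M. f (c \<odot>\<^bsub>M\<^esub> x) = c \<odot>\<^bsub>N\<^esub> f x) \<and>
      (\<forall>a. \<forall>x\<in>carrier M. f (act M a x) = act N a (f x))}"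

definition bg_iso :: "'v bg_module \<Rightarrow> 'w bg_module \<Rightarrow> ('v \<Rightarrow> 'w) set" where
  "bg_iso M N = {f \<in> bg_hom M N. bij_betw f (carrier M) (carrier N)}"

definition bg_isomorphic :: "'v bg_module \<Rightarrow> 'w bg_module \<Rightarrow> bool"
    (infix \<open>\<cong>\<^sub>b\<^sub>g\<close> 60) where
  "M \<cong>\<^sub>b\<^sub>g N \<longleftrightarrow> bg_iso M N \<noteq> {}"

definition bg_simple :: "'v bg_module \<Rightarrow> bool" where
  "bg_simple M \<longleftrightarrow> carrier M \<noteq> {\<zero>\<^bsub>M\<^esub>} \<and>
    (\<forall>N. bg_submodule N M \<longrightarrow> N = {\<zero>\<^bsub>M\<^esub>} \<or> N = carrier M)"

definition bg_indecomposable :: "'v bg_module \<Rightarrow> bool" where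
  "bg_indecomposable M \<longleftrightarrow> carrier M \<noteq> {\<zero>\<^bsub>M\<^esub>} \<and>
    (\<forall>A B. bg_submodule A M \<and> bg_submodule B M \<and>
        A \<inter> B = {\<zero>\<^bsub>M\<^esub>} \<and> A <+>\<^bsub>M\<^esub> B = carrier M \<longrightarrow>
      A = {\<zero>\<^bsub>M\<^esub>} \<or> B = {\<zero>\<^bsub>M\<^esub>})"

definition bg_filtration ::
    "('v set bg_module \<Rightarrow> bool) \<Rightarrow> 'v bg_module \<Rightarrow> nat \<Rightarrow> bool" where
  "bg_filtration P M r \<longleftrightarrow>
    (\<exists>F :: nat \<Rightarrow> 'v set.
      F 0 = {\<zero>\<^bsub>M\<^esub>} \<and> F r = carrier M \<and> (\<forall>i\<le>r. bg_submodule (F i) M) \<and>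
      (\<forall>i<r. F i \<subseteq> F (Suc i) \<and> P (bg_quot (bg_restrict M (F (Suc i))) (F i))))"

abbreviation bg_length :: "'v bg_module \<Rightarrow> nat \<Rightarrow> bool" where
  "bg_length M r \<equiv> bg_filtration bg_simple M r"

definition bg_maximal :: "'v set \<Rightarrow> 'v bg_module \<Rightarrow> bool" where
  "bg_maximal N M \<longleftrightarrow> bg_submodule N M \<and> N \<noteq> carrier M \<and>
    (\<forall>N'. bg_submodule N' M \<and> N \<subseteq> N' \<longrightarrow> N' = N \<or> N' = carrier M)"

definition bg_radical :: "'v bg_module \<Rightarrow> 'v set" where
  "bg_radical M = carrier M \<inter> \<Inter>{N. bg_maximal N M}"

definition bg_head :: "'v bg_module \<Rightarrow> 'v set bg_module" where
  "bg_head M = bg_quot M (bg_radical M)"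

section \<open>Spectral flow\<close>

definition sigma_mode :: "int \<Rightarrow> mode \<Rightarrow> mode" where
  "sigma_mode n a =
    (case a of Beta_mode m \<Rightarrow> Beta_mode (m - n) | Gamma_mode m \<Rightarrow> Gamma_mode (m + n))"

definition spectral_flow :: "int \<Rightarrow> 'v bg_module \<Rightarrow> 'v bg_module" where
  "spectral_flow n M = M\<lparr>act := (\<lambda>a. act M (sigma_mode (- n) a))\<rparr>"

section \<open>Induced modules\<close>

abbreviation pm_scale :: "complex \<Rightarrow> ('a \<Rightarrow>\<^sub>0 complex) \<Rightarrow> ('a \<Rightarrow>\<^sub>0 complex)" where
  "pm_scale c \<equiv> Poly_Mapping.map ((*) c)"

text \<open>
  \<^typ>\<open>'a \<Rightarrow>\<^sub>0 complex\<close> is the vector space with basis \<^typ>\<open>'a\<close>; this is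
  the linear extension of a map given on the basis.
\<close>

definition lin_ext :: "('a \<Rightarrow> ('b \<Rightarrow>\<^sub>0 complex)) \<Rightarrow> ('a \<Rightarrow>\<^sub>0 complex) \<Rightarrow> ('b \<Rightarrow>\<^sub>0 complex)" where
  "lin_ext g f = (\<Sum>x\<in>Poly_Mapping.keys f. pm_scale (Poly_Mapping.lookup f x) (g x))"

abbreviation free_vectors :: "'a set \<Rightarrow> ('a \<Rightarrow>\<^sub>0 complex) set" where
  "free_vectors S \<equiv> {f. Poly_Mapping.keys f \<subseteq> S}"

fun nonneg_mode :: "mode \<Rightarrow> bool" where
  "nonneg_mode (Beta_mode n) = (n \<ge> 0)"
| "nonneg_mode (Gamma_mode n) = (n \<ge> 0)"

text \<open>
  The induced module is the tensor product of the whole algebra with E over the subalgebra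
  generated by the nonnegative modes, presented by generators and relations: the basis element
  (w,v) stands for the product of the word w of modes, tensored with v. The relations are the
  commutation relations inside w, balancing over the nonnegative modes, and linearity in v.
  Only the action of the nonnegative modes on E is used. The module \<open>free_words E\<close>
  violates the commutation relations; closing the relations under the action of the modes makes
  it unnecessary to write an arbitrary prefix in front of them.
\<close>

definition free_words :: "'v bg_module \<Rightarrow> (mode list \<times> 'v \<Rightarrow>\<^sub>0 complex) bg_module" where
  "free_words E =
    \<lparr>carrier = free_vectors (UNIV \<times> carrier E), mult = undefined, one = undefined,
     zero = 0, add = (+), smult = pm_scale,
     act = (\<lambda>a. lin_ext (\<lambda>(w, v). Poly_Mapping.single (a # w, v) 1))\<rparr>"

definition ind_relations :: "'v bg_module \<Rightarrow> (mode list \<times> 'v \<Rightarrow>\<^sub>0 complex) set" where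
  "ind_relations E =
    {Poly_Mapping.single (a # b # w, v) 1 - Poly_Mapping.single (b # a # w, v) 1
       - Poly_Mapping.single (w, v) (mode_comm a b) | a b w v. v \<in> carrier E} \<union>
    {Poly_Mapping.single ([a], v) 1 - Poly_Mapping.single ([], act E a v) 1
       | a v. nonneg_mode a \<and> v \<in> carrier E} \<union>
    {Poly_Mapping.single ([], u \<oplus>\<^bsub>E\<^esub> v) 1
       - Poly_Mapping.single ([], u) 1 - Poly_Mapping.single ([], v) 1
       | u v. u \<in> carrier E \<and> v \<in> carrier E} \<union>
    {Poly_Mapping.single ([], c \<odot>\<^bsub>E\<^esub> v) 1 - Poly_Mapping.single ([], v) c
       | c v. v \<in> carrier E}"

definition Ind :: "'v bg_module \<Rightarrow> (mode list \<times> 'v \<Rightarrow>\<^sub>0 complex) set bg_module" where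
  "Ind E = bg_quot (free_words E) (bg_span (free_words E) (ind_relations E))"

section \<open>The inducing spaces and the modules V and W\<close>

text \<open>
  The basis element (n,j) stands for the function x^(mu+n) (log x)^j of a variable x, where the
  exponent mu is a parameter of the derivative.
\<close>

type_synonym logfun = "int \<times> nat \<Rightarrow>\<^sub>0 complex"

definition logfun_times :: "logfun \<Rightarrow> logfun" where
  "logfun_times = lin_ext (\<lambda>(n, j). Poly_Mapping.single (n + 1, j) 1)"

definition logfun_deriv :: "complex \<Rightarrow> logfun \<Rightarrow> logfun" where
  "logfun_deriv \<mu> = lin_ext (\<lambda>(n, j).
     Poly_Mapping.single (n - 1, j) (\<mu> + of_int n)
     + Poly_Mapping.single (n - 1, j - 1) (of_nat j))"

definition logfun_space ::
    "(int \<times> nat) set \<Rightarrow> (logfun \<Rightarrow> logfun) \<Rightarrow> (logfun \<Rightarrow> logfun) \<Rightarrow> logfun bg_module" where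
  "logfun_space S \<beta>0 \<gamma>0 =
    \<lparr>carrier = free_vectors S, mult = undefined, one = undefined,
     zero = 0, add = (+), smult = pm_scale,
     act = (\<lambda>a f. if a = Beta_mode 0 then \<beta>0 f else if a = Gamma_mode 0 then \<gamma>0 f else 0)\<rparr>"

text \<open>The variable is gamma_0, except in \<open>W_minus\<close>, where it is beta_0.\<close>

type_synonym ind_vec = "(mode list \<times> logfun \<Rightarrow>\<^sub>0 complex) set"

definition V_mod :: "ind_vec bg_module" where
  "V_mod = Ind (logfun_space ({0..} \<times> {0}) (\<lambda>f. - logfun_deriv 0 f) logfun_times)"

text \<open>\<open>W_mod \<mu>\<close>, for mu not an integer, is W_lambda for the coset lambda of mu.\<close>

definition W_mod :: "complex \<Rightarrow> ind_vec bg_module" where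
  "W_mod \<mu> = Ind (logfun_space (UNIV \<times> {0}) (\<lambda>f. - logfun_deriv \<mu> f) logfun_times)"

definition W_plus :: "nat \<Rightarrow> ind_vec bg_module" where
  "W_plus k = Ind (logfun_space (UNIV \<times> {..<k}) (\<lambda>f. - logfun_deriv 0 f) logfun_times)"

definition W_minus :: "nat \<Rightarrow> ind_vec bg_module" where
  "W_minus k = Ind (logfun_space (UNIV \<times> {..<k}) logfun_times (logfun_deriv 0))"

section \<open>The categories\<close>

definition bg_smooth :: "'v bg_module \<Rightarrow> bool" where
  "bg_smooth M \<longleftrightarrow> (\<forall>v\<in>carrier M. \<exists>N. \<forall>n\<ge>N.
     act M (Beta_mode n) v = \<zero>\<^bsub>M\<^esub> \<and> act M (Gamma_mode n) v = \<zero>\<^bsub>M\<^esub>)"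

text \<open>The library's \<open>finsum\<close> is zero on infinite index sets, so restrict to the support.\<close>

definition supp_sum :: "'v bg_module \<Rightarrow> (int \<Rightarrow> 'v) \<Rightarrow> int set \<Rightarrow> 'v" where
  "supp_sum M g A = finsum M g {n \<in> A. g n \<noteq> \<zero>\<^bsub>M\<^esub>}"

definition L0 :: "'v bg_module \<Rightarrow> 'v \<Rightarrow> 'v" where
  "L0 M v = supp_sum M (\<lambda>k. of_int k \<odot>\<^bsub>M\<^esub>
     (act M (Beta_mode (- k)) (act M (Gamma_mode k) v)
      \<ominus>\<^bsub>M\<^esub> act M (Gamma_mode (- k)) (act M (Beta_mode k) v))) {1..}"

definition J0 :: "'v bg_module \<Rightarrow> 'v \<Rightarrow> 'v" where
  "J0 M v =
     supp_sum M (\<lambda>n. act M (Gamma_mode (- n)) (act M (Beta_mode n) v)) {0..}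
     \<oplus>\<^bsub>M\<^esub> supp_sum M (\<lambda>n. act M (Beta_mode (- n)) (act M (Gamma_mode n) v)) {1..}"

definition gen_eigenspace :: "'v bg_module \<Rightarrow> ('v \<Rightarrow> 'v) \<Rightarrow> complex \<Rightarrow> 'v set" where
  "gen_eigenspace M T \<mu> =
    {v \<in> carrier M. \<exists>p. ((\<lambda>x. T x \<ominus>\<^bsub>M\<^esub> \<mu> \<odot>\<^bsub>M\<^esub> x) ^^ p) v = \<zero>\<^bsub>M\<^esub>}"

text \<open>Generalized eigenspaces are always independent, so only spanning is required.\<close>

definition L0_graded :: "'v bg_module \<Rightarrow> bool" where
  "L0_graded M \<longleftrightarrow> (\<forall>v\<in>carrier M. \<exists>S f. finite S \<and>
     (\<forall>\<mu>\<in>S. f \<mu> \<in> gen_eigenspace M (L0 M) \<mu>) \<and> v = finsum M f S)"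

definition C_simple :: "'v bg_module \<Rightarrow> bool" where
  "C_simple S \<longleftrightarrow> (\<exists>n. S \<cong>\<^sub>b\<^sub>g spectral_flow n V_mod) \<or>
     (\<exists>n \<mu>. \<mu> \<notin> \<int> \<and> S \<cong>\<^sub>b\<^sub>g spectral_flow n (W_mod \<mu>))"

definition C_bg :: "'v bg_module \<Rightarrow> bool" where
  "C_bg M \<longleftrightarrow> bg_module M \<and> bg_smooth M \<and> L0_graded M \<and> (\<exists>r. bg_filtration C_simple M r)"

definition C_bg_int :: "'v bg_module \<Rightarrow> bool" where
  "C_bg_int M \<longleftrightarrow> C_bg M \<and> (\<forall>\<mu>. gen_eigenspace M (J0 M) \<mu> \<noteq> {\<zero>\<^bsub>M\<^esub>} \<longrightarrow> \<mu> \<in> \<int>)"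

section \<open>The roofs\<close>

definition length_quot :: "'v bg_module \<Rightarrow> nat \<Rightarrow> 'v set bg_module" where
  "length_quot M k = bg_quot M (THE N. bg_submodule N M \<and> bg_length (bg_quot M N) k)"

text \<open>
  The composite of M -> head M with an isomorphism from head M to V, if there is one. By Schur's
  lemma the isomorphism is unique up to a scalar, so the choice does not affect the fiber product
  below up to isomorphism.
\<close>

definition head_map :: "'v bg_module \<Rightarrow> 'v \<Rightarrow> ind_vec" where
  "head_map M x = (SOME \<phi>. \<phi> \<in> bg_iso (bg_head M) V_mod) (bg_radical M +>\<^bsub>M\<^esub> x)"

text \<open>
  The uniserial modules \<open>W_minus m\<close> and \<open>W_plus m\<close> have length 2m; their quotients
  of length k do not depend on m, up to isomorphism, as soon as k is at most 2m. We use m = k.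
\<close>

definition roof_left :: "nat \<Rightarrow> ind_vec set bg_module" where
  "roof_left k = length_quot (W_minus k) k"

definition roof_right :: "nat \<Rightarrow> ind_vec set bg_module" where
  "roof_right k = length_quot (spectral_flow 1 (W_plus k)) k"

definition roof :: "nat \<Rightarrow> (ind_vec set \<times> ind_vec set) bg_module" where
  "roof k =
    (let L = roof_left k; R = roof_right k; S = bg_sum2 L R
     in bg_restrict S
          (if k = 0 then {\<zero>\<^bsub>S\<^esub>}
           else {(x, y) \<in> carrier S. head_map L x = head_map R y}))"

end

theory Submission
  imports Defs
begin

text \<open>The operators \<open>wt n\<close> = \<open>\<gamma>\<^bsub>-n\<^esub> \<beta>\<^bsub>n\<^esub>\<close> commute with each other, and \<open>\<beta>\<^bsub>n\<^esub>\<close> and \<open>\<gamma>\<^bsub>-n\<^esub>\<close> shift the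
  eigenvalue of \<open>wt n\<close> by one and leave the others alone, so that modules can be studied through
  their joint generalized eigenvectors. On \<open>\<sigma>\<^sup>j V\<close> the eigenvalue of \<open>wt n\<close> is a nonpositive integer
  for \<open>n \<ge> - j\<close> and a positive integer for \<open>n < - j\<close>; the vacuum has the eigenvalues 0 and 1.

  Each composition factor of M is some \<open>\<sigma>\<^sup>j V\<close>, since a factor W would contribute a nonintegral
  eigenvalue of \<open>J\<^sub>0\<close>. The operators \<open>wt n\<close> are locally finite on M, so the vacuum vector of the factor
  lifts to a joint generalized eigenvector y with the same eigenvalues. No composition factor
  admits the eigenvalues that y would have after applying a mode annihilating the vacuum, up to
  the two modes \<open>\<beta>\<^sub>0\<close> and \<open>\<gamma>\<^sub>1\<close> (for \<open>j = 0\<close>), and applying both of these modes in turn also gives 0.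
  These relations, with nilpotency of \<open>\<gamma>\<^sub>0 \<beta>\<^sub>0\<close> and \<open>\<beta>\<^bsub>-1\<^esub> \<gamma>\<^sub>1\<close>, are what holds at the generator of a roof,
  and a roof that is long enough maps onto the submodule generated by y: the graph of this
  homomorphism is generated by the pair of generators, and it is a graph because a submodule of a
  module generated by such a vector is itself generated by its vectors with the eigenvalues of
  the vacuum or of its two neighbours. Taking one roof for each composition factor exhausts M.\<close>

section \<open>Submodules, homomorphisms and quotients\<close>

text \<open>Why three weights suffice: \<open>lower n (raise n _)\<close> is \<open>wt n\<close> and
  \<open>raise n (lower n _)\<close> is \<open>wt n - 1\<close>, so a mode can be undone unless it
  crosses between the eigenvalues 0 and 1. The relations leave two such crossings,
  \<open>raise 0\<close> and \<open>lower (- 1)\<close>. On the weight of y, the module generated by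
  y consists of polynomials in the nilpotent operators \<open>wt 0\<close> and \<open>wt'\<close>,
  without mixed terms; the left leg of a roof sees the first variable, the right leg the second. A
  roof therefore maps to y as soon as its legs are long compared with the nilpotency orders at y,
  and its length is chosen after y. Working with a graph avoids a presentation of the roof, which is
  given only as a fiber product.

  Why the other modes must annihilate y: on each factor the integers split at a threshold - j, with
  eigenvalues \<ge> 1 to its left and \<le> 0 from it on, so no nonzero joint generalized
  eigenvector has an eigenvalue 1 to the right of an eigenvalue 0.\<close>

lemma complex_ring_simps [simp]:
  "carrier complex_ring = UNIV" "x \<otimes>\<^bsub>complex_ring\<^esub> y = x * y" "\<one>\<^bsub>complex_ring\<^esub> = 1"
  "\<zero>\<^bsub>complex_ring\<^esub> = 0" "x \<oplus>\<^bsub>complex_ring\<^esub> y = x + y"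
  by (simp_all add: complex_ring_def)

lemma cring_complex_ring: "cring complex_ring"
proof (intro cringI abelian_groupI comm_monoidI)
  fix x :: complex
  assume "x \<in> carrier complex_ring"
  show "\<exists>y\<in>carrier complex_ring. y \<oplus>\<^bsub>complex_ring\<^esub> x = \<zero>\<^bsub>complex_ring\<^esub>"
    by (rule bexI[of _ "- x"]) auto
qed (auto simp: algebra_simps)

text \<open>Free words violate the commutation relations, hence this weaker notion.\<close>

locale bg_premodule = module complex_ring M for M :: "'v bg_module" (structure) +
  assumes act_closed: "x \<in> carrier M \<Longrightarrow> act M a x \<in> carrier M"
    and act_add: "x \<in> carrier M \<Longrightarrow> y \<in> carrier M \<Longrightarrow>
      act M a (x \<oplus> y) = act M a x \<oplus> act M a y"
    and act_smult: "x \<in> carrier M \<Longrightarrow> act M a (c \<odot> x) = c \<odot> act M a x"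

sublocale bg_module \<subseteq> bg_premodule
  by unfold_locales (auto simp: act_closed act_add act_smult)

text \<open>The hypothesis on \<open>(- 1) \<odot> x\<close> provides the additive inverse, which a
  structure given by \<open>add\<close> and \<open>smult\<close> does not name.\<close>

lemma bg_premoduleI:
  fixes M :: "'v bg_module" (structure)
  assumes "\<zero> \<in> carrier M"
    and "\<And>x y. x \<in> carrier M \<Longrightarrow> y \<in> carrier M \<Longrightarrow> x \<oplus> y \<in> carrier M"
    and "\<And>x y z. x \<in> carrier M \<Longrightarrow> y \<in> carrier M \<Longrightarrow> z \<in> carrier M \<Longrightarrow>
      (x \<oplus> y) \<oplus> z = x \<oplus> (y \<oplus> z)"
    and "\<And>x y. x \<in> carrier M \<Longrightarrow> y \<in> carrier M \<Longrightarrow> x \<oplus> y = y \<oplus> x"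
    and "\<And>x. x \<in> carrier M \<Longrightarrow> \<zero> \<oplus> x = x"
    and "\<And>x. x \<in> carrier M \<Longrightarrow> (- 1) \<odot> x \<oplus> x = \<zero>"
    and "\<And>c x. x \<in> carrier M \<Longrightarrow> c \<odot> x \<in> carrier M"
    and "\<And>c d x. x \<in> carrier M \<Longrightarrow> (c + d) \<odot> x = c \<odot> x \<oplus> d \<odot> x"
    and "\<And>c x y. x \<in> carrier M \<Longrightarrow> y \<in> carrier M \<Longrightarrow> c \<odot> (x \<oplus> y) = c \<odot> x \<oplus> c \<odot> y"
    and "\<And>c d x. x \<in> carrier M \<Longrightarrow> (c * d) \<odot> x = c \<odot> (d \<odot> x)"
    and "\<And>x. x \<in> carrier M \<Longrightarrow> 1 \<odot> x = x"
    and "\<And>a x. x \<in> carrier M \<Longrightarrow> act M a x \<in> carrier M"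
    and "\<And>a x y. x \<in> carrier M \<Longrightarrow> y \<in> carrier M \<Longrightarrow>
      act M a (x \<oplus> y) = act M a x \<oplus> act M a y"
    and "\<And>a c x. x \<in> carrier M \<Longrightarrow> act M a (c \<odot> x) = c \<odot> act M a x"
  shows "bg_premodule M"
proof (intro bg_premodule.intro moduleI bg_premodule_axioms.intro cring_complex_ring abelian_groupI)
  fix x assume "x \<in> carrier M"
  then show "\<exists>y\<in>carrier M. y \<oplus> x = \<zero>"
    using assms(6,7) by (intro bexI[of _ "(- 1) \<odot> x"]) auto
qed (assumption | rule assms(1-5) | simp add: assms(7-14))+

section \<open>Scalars, submodules and spans\<close>

context bg_premodule
begin

lemma sm_closed [simp, intro]: "x \<in> carrier M \<Longrightarrow> c \<odot> x \<in> carrier M"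
  by (rule smult_closed) auto

lemma act_closed' [simp, intro]: "x \<in> carrier M \<Longrightarrow> act M a x \<in> carrier M"
  by (rule act_closed)

lemma sm_l_distr: "x \<in> carrier M \<Longrightarrow> (c + d) \<odot> x = c \<odot> x \<oplus> d \<odot> x"
  using smult_l_distr[of c d x] by simp

lemma sm_r_distr: "x \<in> carrier M \<Longrightarrow> y \<in> carrier M \<Longrightarrow> c \<odot> (x \<oplus> y) = c \<odot> x \<oplus> c \<odot> y"
  using smult_r_distr[of c x y] by simp

lemma sm_assoc: "x \<in> carrier M \<Longrightarrow> c \<odot> (d \<odot> x) = (c * d) \<odot> x"
  using smult_assoc1[of c d x] by simp

lemma sm_one [simp]: "x \<in> carrier M \<Longrightarrow> 1 \<odot> x = x"
  using smult_one by simp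

lemma sm_zero [simp]: "x \<in> carrier M \<Longrightarrow> 0 \<odot> x = \<zero>"
  using smult_l_null by simp

lemma sm_r_zero [simp]: "c \<odot> \<zero> = \<zero>"
  using smult_r_null by simp

lemma neg_eq: "x \<in> carrier M \<Longrightarrow> \<ominus> x = (- 1) \<odot> x"
  using sm_l_distr[of x 1 "- 1"] by (metis add.right_inverse minus_equality sm_closed sm_one sm_zero a_comm)

lemma minus_eq': "x \<in> carrier M \<Longrightarrow> y \<in> carrier M \<Longrightarrow> x \<ominus> y = x \<oplus> (- 1) \<odot> y"
  by (simp add: a_minus_def neg_eq)

lemma act_zero [simp]: "act M a \<zero> = \<zero>"
  using act_smult[of \<zero> a 0] by simp

lemma act_minus: "x \<in> carrier M \<Longrightarrow> y \<in> carrier M \<Longrightarrow> act M a (x \<ominus> y) = act M a x \<ominus> act M a y"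
  by (simp add: minus_eq' act_add act_smult)

lemma minus_zero_iff: "x \<in> carrier M \<Longrightarrow> y \<in> carrier M \<Longrightarrow> x \<ominus> y = \<zero> \<longleftrightarrow> x = y"
  by (metis a_minus_def add.inv_equality minus_equality minus_minus a_inv_closed r_neg)

lemma sub_add [simp]: "x \<in> carrier M \<Longrightarrow> y \<in> carrier M \<Longrightarrow> (x \<ominus> y) \<oplus> y = x"
  by (simp add: a_minus_def a_assoc l_neg)

lemma add_sub: "x \<in> carrier M \<Longrightarrow> y \<in> carrier M \<Longrightarrow> (x \<oplus> y) \<ominus> y = x"
  by (simp add: a_minus_def a_assoc r_neg)

lemma sub_sub_add: "x \<in> carrier M \<Longrightarrow> y \<in> carrier M \<Longrightarrow> z \<in> carrier M \<Longrightarrow>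
    (z \<ominus> x) \<oplus> (x \<ominus> y) = z \<ominus> y"
  by (simp add: a_minus_def a_assoc r_neg1)

lemmas lin_simps = minus_eq' neg_eq act_add act_smult sm_r_distr sm_assoc a_ac

text \<open>Simp rules that merge multiples of one vector, also in front of a further summand. They
  work against \<open>sm_l_distr\<close>, so proofs that split a scalar deactivate them.\<close>

lemma sm_collect [simp]:
  assumes "x \<in> carrier M" "z \<in> carrier M"
  shows "c \<odot> x \<oplus> d \<odot> x = (c + d) \<odot> x" "x \<oplus> d \<odot> x = (1 + d) \<odot> x"
    "c \<odot> x \<oplus> x = (c + 1) \<odot> x"
    "c \<odot> x \<oplus> (d \<odot> x \<oplus> z) = (c + d) \<odot> x \<oplus> z" "x \<oplus> (d \<odot> x \<oplus> z) = (1 + d) \<odot> x \<oplus> z"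
    "c \<odot> x \<oplus> (x \<oplus> z) = (c + 1) \<odot> x \<oplus> z"
  using assms by (simp_all add: sm_l_distr a_assoc)

lemma bg_submoduleI:
  assumes "N \<subseteq> carrier M" "\<zero> \<in> N" "\<And>x y. x \<in> N \<Longrightarrow> y \<in> N \<Longrightarrow> x \<oplus> y \<in> N"
    "\<And>c x. x \<in> N \<Longrightarrow> c \<odot> x \<in> N" "\<And>a x. x \<in> N \<Longrightarrow> act M a x \<in> N"
  shows "bg_submodule N M"
  unfolding bg_submodule_def
proof (intro conjI allI ballI submoduleI)
  show "\<ominus> x \<in> N" if "x \<in> N" for x
    using assms(1) assms(4)[OF that, of "- 1"] that by (simp add: neg_eq subsetD)
qed (simp_all add: assms)

lemma bg_submoduleD:
  assumes "bg_submodule N M"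
  shows "N \<subseteq> carrier M" "\<zero> \<in> N" "x \<in> N \<Longrightarrow> x \<in> carrier M"
    "x \<in> N \<Longrightarrow> y \<in> N \<Longrightarrow> x \<oplus> y \<in> N" "x \<in> N \<Longrightarrow> c \<odot> x \<in> N" "x \<in> N \<Longrightarrow> act M a x \<in> N"
    "x \<in> N \<Longrightarrow> y \<in> N \<Longrightarrow> x \<ominus> y \<in> N"
proof -
  have *: "submodule N complex_ring M"
    using assms by (simp add: bg_submodule_def)
  note E = submoduleE[OF *]
  show sub: "N \<subseteq> carrier M" by (rule E(1))
  then show "x \<in> N \<Longrightarrow> x \<in> carrier M" by (rule subsetD)
  show add: "x \<oplus> y \<in> N" if "x \<in> N" "y \<in> N" for x y
    using E(5) that by blast
  show sm: "c \<odot> x \<in> N" if "x \<in> N" for c x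
    using E(4)[of c x] that by simp
  show "x \<ominus> y \<in> N" if "x \<in> N" "y \<in> N"
    using add[OF that(1) sm[OF that(2), of "- 1"]] sub that by (simp add: minus_eq' subsetD)
  obtain z where z: "z \<in> N" using E(2) by auto
  then show "\<zero> \<in> N"
    using sm[OF z, of 0] subsetD[OF sub z] by simp
  show "x \<in> N \<Longrightarrow> act M a x \<in> N"
    using assms by (simp add: bg_submodule_def)
qed

lemma bg_submodule_carrier: "bg_submodule (carrier M) M"
  by (rule bg_submoduleI) auto

lemma bg_submodule_zero: "bg_submodule {\<zero>} M"
  by (rule bg_submoduleI) auto

lemma bg_submodule_Int:
  assumes "bg_submodule A M" "bg_submodule B M"
  shows "bg_submodule (A \<inter> B) M"
  using bg_submoduleD[OF assms(1)] bg_submoduleD[OF assms(2)] by (intro bg_submoduleI) auto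

lemma bg_span_subset: "bg_submodule N M \<Longrightarrow> S \<subseteq> N \<Longrightarrow> bg_span M S \<subseteq> N"
  by (auto simp: bg_span_def)

lemma bg_span_superset: "S \<subseteq> bg_span M S"
  by (auto simp: bg_span_def)

lemma bg_span_incl: "x \<in> S \<Longrightarrow> x \<in> bg_span M S"
  by (auto simp: bg_span_def)

lemma bg_span_submodule:
  assumes "S \<subseteq> carrier M"
  shows "bg_submodule (bg_span M S) M"
proof (rule bg_submoduleI)
  show "bg_span M S \<subseteq> carrier M"
    using bg_span_subset[OF bg_submodule_carrier assms] .
  show "\<zero> \<in> bg_span M S"
    using bg_submoduleD(2) by (auto simp: bg_span_def)
  show "x \<oplus> y \<in> bg_span M S" if "x \<in> bg_span M S" "y \<in> bg_span M S" for x y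
    using that bg_submoduleD(4) by (auto simp: bg_span_def)
  show "c \<odot> x \<in> bg_span M S" if "x \<in> bg_span M S" for c x
    using that bg_submoduleD(5) by (auto simp: bg_span_def)
  show "act M a x \<in> bg_span M S" if "x \<in> bg_span M S" for a x
    using that bg_submoduleD(6) by (auto simp: bg_span_def)
qed

lemma bg_span_mono: "S \<subseteq> T \<Longrightarrow> bg_span M S \<subseteq> bg_span M T"
  by (auto simp: bg_span_def)

lemma bg_span_in_submodule: "bg_submodule N M \<Longrightarrow> x \<in> N \<Longrightarrow> y \<in> bg_span M {x} \<Longrightarrow> y \<in> N"
  using bg_span_subset[of N "{x}"] by auto

lemma restrict_premodule:
  assumes "bg_submodule N M"
  shows "bg_premodule (bg_restrict M N)"
proof (rule bg_premoduleI)
  note D = bg_submoduleD[OF assms]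
  fix x assume "x \<in> carrier (bg_restrict M N)"
  then have "x \<in> carrier M" using D(3) by simp
  then show "- 1 \<odot>\<^bsub>bg_restrict M N\<^esub> x \<oplus>\<^bsub>bg_restrict M N\<^esub> x = \<zero>\<^bsub>bg_restrict M N\<^esub>"
    by simp
qed (simp_all add:  bg_submoduleD[OF assms] a_ac act_add act_smult sm_r_distr sm_assoc sm_l_distr del: sm_collect)

lemma restrict_submodule_iff:
  assumes "bg_submodule N M"
  shows "bg_submodule K (bg_restrict M N) \<longleftrightarrow> bg_submodule K M \<and> K \<subseteq> N"
proof
  note R = restrict_premodule[OF assms]
  {
    assume K: "bg_submodule K (bg_restrict M N)"
    show "bg_submodule K M \<and> K \<subseteq> N"
    proof (intro conjI bg_submoduleI)
      show "K \<subseteq> carrier M" "K \<subseteq> N"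
        using bg_premodule.bg_submoduleD(1)[OF R K] bg_submoduleD(1)[OF assms] by auto
    qed (use bg_premodule.bg_submoduleD[OF R K] in simp_all)
  next
    assume K: "bg_submodule K M \<and> K \<subseteq> N"
    then have "bg_submodule K M" ..
    from bg_submoduleD[OF this] K show "bg_submodule K (bg_restrict M N)"
      by (intro bg_premodule.bg_submoduleI[OF R]) simp_all
  }
qed

end

lemma (in bg_module) act_swap:
  assumes "x \<in> carrier M"
  shows "act M a (act M b x) = act M b (act M a x) \<oplus> mode_comm a b \<odot> x"
  using act_comm[OF assms, of a b] sub_add[of "act M a (act M b x)" "act M b (act M a x)"] assms
  by (simp add: a_comm)

lemma bg_moduleI:
  fixes M :: "'v bg_module" (structure)
  assumes "bg_premodule M"
    and "\<And>a b x. x \<in> carrier M \<Longrightarrow>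
      act M a (act M b x) = act M b (act M a x) \<oplus> mode_comm a b \<odot> x"
  shows "bg_module M"
proof -
  interpret bg_premodule M by fact
  show ?thesis
  proof unfold_locales
    fix a b x assume x: "x \<in> carrier M"
    show "act M a (act M b x) \<ominus> act M b (act M a x) = mode_comm a b \<odot> x"
      unfolding assms(2)[OF x, of a b] using x add_sub[of "mode_comm a b \<odot> x" "act M b (act M a x)"]
      by (simp add: a_comm)
  qed (simp_all add: act_add act_smult)
qed

lemma (in bg_module) restrict_module:
  assumes "bg_submodule N M"
  shows "bg_module (bg_restrict M N)"
proof (rule bg_moduleI[OF restrict_premodule[OF assms]])
  fix a b x assume "x \<in> carrier (bg_restrict M N)"
  then show "act (bg_restrict M N) a (act (bg_restrict M N) b x) =
      act (bg_restrict M N) b (act (bg_restrict M N) a x)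
        \<oplus>\<^bsub>bg_restrict M N\<^esub> mode_comm a b \<odot>\<^bsub>bg_restrict M N\<^esub> x"
    using act_swap[of x a b] bg_submoduleD(3)[OF assms] by simp
qed

section \<open>Homomorphisms, images and preimages\<close>

lemma bg_homI:
  assumes "\<And>x. x \<in> carrier M \<Longrightarrow> f x \<in> carrier N"
    "\<And>x y. x \<in> carrier M \<Longrightarrow> y \<in> carrier M \<Longrightarrow> f (x \<oplus>\<^bsub>M\<^esub> y) = f x \<oplus>\<^bsub>N\<^esub> f y"
    "\<And>c x. x \<in> carrier M \<Longrightarrow> f (c \<odot>\<^bsub>M\<^esub> x) = c \<odot>\<^bsub>N\<^esub> f x"
    "\<And>a x. x \<in> carrier M \<Longrightarrow> f (act M a x) = act N a (f x)"
  shows "f \<in> bg_hom M N"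
  using assms by (auto simp: bg_hom_def)

lemma bg_homD:
  assumes "f \<in> bg_hom M N"
  shows "x \<in> carrier M \<Longrightarrow> f x \<in> carrier N"
    "x \<in> carrier M \<Longrightarrow> y \<in> carrier M \<Longrightarrow> f (x \<oplus>\<^bsub>M\<^esub> y) = f x \<oplus>\<^bsub>N\<^esub> f y"
    "x \<in> carrier M \<Longrightarrow> f (c \<odot>\<^bsub>M\<^esub> x) = c \<odot>\<^bsub>N\<^esub> f x"
    "x \<in> carrier M \<Longrightarrow> f (act M a x) = act N a (f x)"
  using assms by (auto simp: bg_hom_def)

lemma bg_hom_comp:
  assumes "f \<in> bg_hom A B" "g \<in> bg_hom B C"
  shows "g \<circ> f \<in> bg_hom A C"
  using bg_homD[OF assms(1)] bg_homD[OF assms(2)] by (intro bg_homI) auto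

text \<open>The axioms are equations and pass to every surjective image, so quotients become modules
  without coset arithmetic. The zero needs its own hypothesis: \<open>bg_hom\<close> does not
  mention it, and it can be derived only once Q is known to be a module.\<close>

lemma premodule_of_surj:
  assumes "bg_premodule M" "f \<in> bg_hom M Q" "f ` carrier M = carrier Q" "f \<zero>\<^bsub>M\<^esub> = \<zero>\<^bsub>Q\<^esub>"
  shows "bg_premodule Q"
proof -
  interpret M: bg_premodule M by fact
  note h = bg_homD(2-4)[OF assms(2), symmetric] and hc = bg_homD(1)[OF assms(2)]
  have c: "\<exists>x\<in>carrier M. y = f x" if "y \<in> carrier Q" for y
    using assms(3) that by auto
  note z = assms(4)[symmetric]
  show ?thesis
  proof (rule bg_premoduleI)
    show "\<zero>\<^bsub>Q\<^esub> \<in> carrier Q" using hc[of "\<zero>\<^bsub>M\<^esub>"] by (simp add: z)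
    fix x assume "x \<in> carrier Q"
    then obtain x' where x: "x' \<in> carrier M" "x = f x'" using c by blast
    show "\<zero>\<^bsub>Q\<^esub> \<oplus>\<^bsub>Q\<^esub> x = x" "1 \<odot>\<^bsub>Q\<^esub> x = x" "(- 1) \<odot>\<^bsub>Q\<^esub> x \<oplus>\<^bsub>Q\<^esub> x = \<zero>\<^bsub>Q\<^esub>"
      using x by (simp_all add: h z)
    fix b d a
    show "b \<odot>\<^bsub>Q\<^esub> x \<in> carrier Q" "act Q a x \<in> carrier Q"
      using x hc by (simp_all add: h)
    show "(b + d) \<odot>\<^bsub>Q\<^esub> x = b \<odot>\<^bsub>Q\<^esub> x \<oplus>\<^bsub>Q\<^esub> d \<odot>\<^bsub>Q\<^esub> x" "(b * d) \<odot>\<^bsub>Q\<^esub> x = b \<odot>\<^bsub>Q\<^esub> (d \<odot>\<^bsub>Q\<^esub> x)"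
      "act Q a (b \<odot>\<^bsub>Q\<^esub> x) = b \<odot>\<^bsub>Q\<^esub> act Q a x"
      using x by (simp_all add: h M.sm_assoc M.act_smult)
    fix y assume "y \<in> carrier Q"
    then obtain y' where y: "y' \<in> carrier M" "y = f y'" using c by blast
    show "x \<oplus>\<^bsub>Q\<^esub> y \<in> carrier Q"
      using x y hc by (simp add: h)
    show "x \<oplus>\<^bsub>Q\<^esub> y = y \<oplus>\<^bsub>Q\<^esub> x" "b \<odot>\<^bsub>Q\<^esub> (x \<oplus>\<^bsub>Q\<^esub> y) = b \<odot>\<^bsub>Q\<^esub> x \<oplus>\<^bsub>Q\<^esub> b \<odot>\<^bsub>Q\<^esub> y"
      "act Q a (x \<oplus>\<^bsub>Q\<^esub> y) = act Q a x \<oplus>\<^bsub>Q\<^esub> act Q a y"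
      using x y by (simp_all add: h M.a_comm M.sm_r_distr M.act_add)
    fix z assume "z \<in> carrier Q"
    then obtain z' where z: "z' \<in> carrier M" "z = f z'" using c by blast
    show "(x \<oplus>\<^bsub>Q\<^esub> y) \<oplus>\<^bsub>Q\<^esub> z = x \<oplus>\<^bsub>Q\<^esub> (y \<oplus>\<^bsub>Q\<^esub> z)"
      using x y z by (simp add: h M.a_assoc)
  qed
qed

locale bg_morphism = M: bg_premodule M + Q: bg_premodule Q
  for M :: "'v bg_module" and Q :: "'w bg_module" +
  fixes f
  assumes hom: "f \<in> bg_hom M Q"
begin

lemmas f_closed [simp, intro] = bg_homD(1)[OF hom]
lemmas f_add = bg_homD(2)[OF hom]
lemmas f_sm = bg_homD(3)[OF hom]
lemmas f_act = bg_homD(4)[OF hom]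

lemma f_zero [simp]: "f \<zero>\<^bsub>M\<^esub> = \<zero>\<^bsub>Q\<^esub>"
  using f_sm[of "\<zero>\<^bsub>M\<^esub>" 0] by simp

lemma f_minus: "x \<in> carrier M \<Longrightarrow> y \<in> carrier M \<Longrightarrow> f (x \<ominus>\<^bsub>M\<^esub> y) = f x \<ominus>\<^bsub>Q\<^esub> f y"
  by (simp add: M.minus_eq' Q.minus_eq' f_add f_sm)

lemma image_submodule:
  assumes "bg_submodule N M"
  shows "bg_submodule (f ` N) Q"
proof -
  note D = M.bg_submoduleD[OF assms]
  show ?thesis
  proof (rule Q.bg_submoduleI)
    show "\<zero>\<^bsub>Q\<^esub> \<in> f ` N" using D(2) f_zero by (metis imageI)
    fix x y a c assume "x \<in> f ` N"
    then obtain x' where x': "x' \<in> N" "x = f x'" by auto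
    show "c \<odot>\<^bsub>Q\<^esub> x \<in> f ` N" "act Q a x \<in> f ` N"
      using x' D(5)[of x' c] D(6)[of x' a] D(3) by (auto simp: f_sm[symmetric] f_act[symmetric])
    assume "y \<in> f ` N"
    then obtain y' where y': "y' \<in> N" "y = f y'" by auto
    show "x \<oplus>\<^bsub>Q\<^esub> y \<in> f ` N"
      using x' y' D(4)[of x' y'] D(3) by (auto simp: f_add[symmetric])
  qed (use D in auto)
qed

lemma preimage_submodule:
  assumes "bg_submodule N Q"
  shows "bg_submodule {x \<in> carrier M. f x \<in> N} M"
  using Q.bg_submoduleD[OF assms]
  by (intro M.bg_submoduleI) (auto simp: f_add f_sm f_act)

text \<open>Minimality of the two spans, tested on the preimage and on the image of a
  submodule.\<close>

lemma span_image:
  assumes "S \<subseteq> carrier M"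
  shows "f ` bg_span M S = bg_span Q (f ` S)"
proof
  have S: "f ` S \<subseteq> carrier Q" using assms by auto
  have "bg_span M S \<subseteq> {x \<in> carrier M. f x \<in> bg_span Q (f ` S)}"
    using assms by (intro M.bg_span_subset preimage_submodule Q.bg_span_submodule S)
      (auto intro: Q.bg_span_incl)
  then show "f ` bg_span M S \<subseteq> bg_span Q (f ` S)" by auto
  show "bg_span Q (f ` S) \<subseteq> f ` bg_span M S"
    by (intro Q.bg_span_subset image_submodule M.bg_span_submodule assms)
      (auto intro: M.bg_span_incl)
qed

end

section \<open>Cosets and quotient modules\<close>

lemma (in bg_premodule) a_rcoset_mem:
  assumes "bg_submodule N M" "x \<in> carrier M" "y \<in> carrier M"
  shows "y \<in> N +> x \<longleftrightarrow> y \<ominus> x \<in> N"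
proof -
  note D = bg_submoduleD[OF assms(1)]
  have "y \<in> N +> x \<longleftrightarrow> (\<exists>h\<in>N. y = h \<oplus> x)"
    by (auto simp: a_r_coset_def')
  also have "\<dots> \<longleftrightarrow> y \<ominus> x \<in> N"
    using assms D(3) by (metis add_sub sub_add)
  finally show ?thesis .
qed

lemma (in bg_premodule) a_rcoset_eq:
  assumes "bg_submodule N M" "x \<in> carrier M" "y \<in> carrier M"
  shows "N +> x = N +> y \<longleftrightarrow> x \<ominus> y \<in> N"
proof
  note D = bg_submoduleD[OF assms(1)]
  assume "N +> x = N +> y"
  moreover have "x \<in> N +> x"
    using a_rcoset_mem[OF assms(1,2,2)] D(2) minus_zero_iff[OF assms(2,2)] by simp
  ultimately show "x \<ominus> y \<in> N"
    using a_rcoset_mem[OF assms(1,3,2)] by simp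
next
  note D = bg_submoduleD[OF assms(1)]
  assume *: "x \<ominus> y \<in> N"
  have sub: "N +> z \<subseteq> carrier M" if "z \<in> carrier M" for z
    using that D(1) by (auto simp: a_r_coset_def')
  have "y \<ominus> x = (- 1) \<odot> (x \<ominus> y)"
    using assms(2,3) by (simp add: minus_eq' sm_r_distr sm_assoc a_comm)
  then have **: "y \<ominus> x \<in> N"
    using D(5)[OF *] by simp
  have "z \<ominus> x \<in> N \<longleftrightarrow> z \<ominus> y \<in> N" if "z \<in> carrier M" for z
  proof
    assume "z \<ominus> x \<in> N"
    from D(4)[OF this *] show "z \<ominus> y \<in> N" by (simp only: sub_sub_add assms that)
  next
    assume "z \<ominus> y \<in> N"
    from D(4)[OF this **] show "z \<ominus> x \<in> N" by (simp only: sub_sub_add assms that)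
  qed
  then have "z \<in> N +> x \<longleftrightarrow> z \<in> N +> y" if "z \<in> carrier M" for z
    using that a_rcoset_mem[OF assms(1,2)] a_rcoset_mem[OF assms(1,3)] by simp
  moreover have "z \<in> carrier M" if "z \<in> N +> x \<or> z \<in> N +> y" for z
    using that sub[OF assms(2)] sub[OF assms(3)] by auto
  ultimately show "N +> x = N +> y" by blast
qed

definition bg_proj :: "'v bg_module \<Rightarrow> 'v set \<Rightarrow> 'v \<Rightarrow> 'v set" where
  "bg_proj M N x = N +>\<^bsub>M\<^esub> x"

context bg_premodule
begin

lemma bg_proj_self: "bg_submodule N M \<Longrightarrow> x \<in> carrier M \<Longrightarrow> x \<in> bg_proj M N x"
  using a_rcoset_mem[of N x x] minus_zero_iff[of x x] bg_submoduleD(2) by (simp add: bg_proj_def)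

lemma bg_proj_mem: "bg_submodule N M \<Longrightarrow> x \<in> carrier M \<Longrightarrow> y \<in> bg_proj M N x \<Longrightarrow>
    y \<in> carrier M \<and> y \<ominus> x \<in> N"
  using a_rcoset_mem[of N x y] bg_submoduleD(1) by (auto simp: bg_proj_def a_r_coset_def')

lemma bg_proj_surj: "bg_proj M N ` carrier M = carrier (bg_quot M N)"
  by (auto simp: bg_quot_def bg_proj_def A_RCOSETS_def')

lemma abelian_subgroup_of_submodule:
  assumes "bg_submodule N M"
  shows "abelian_subgroup N M"
proof (rule abelian_subgroupI3)
  show "additive_subgroup N M"
    using assms by (intro additive_subgroupI) (simp add: bg_submodule_def submodule_def)
qed (rule abelian_group_axioms)

lemma bg_proj_hom:
  assumes N: "bg_submodule N M"
  shows "bg_proj M N \<in> bg_hom M (bg_quot M N)"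
proof (rule bg_homI)
  note D = bg_submoduleD[OF N]
  fix x y c a assume x: "x \<in> carrier M"
  then show "bg_proj M N x \<in> carrier (bg_quot M N)"
    using bg_proj_surj by auto
  \<comment> \<open>\<open>bg_quot\<close> defines its operations as unions over all
    representatives. The union is constant because T maps N into itself, and nonempty because x
    itself is a representative.\<close>
  have UN: "(\<Union>z\<in>bg_proj M N x. N +> T z) = bg_proj M N (T x)"
    if cl: "\<And>z. z \<in> carrier M \<Longrightarrow> T z \<in> carrier M" and T: "\<And>z. z \<in> N \<Longrightarrow> T z \<in> N"
      and diff: "\<And>z. z \<in> carrier M \<Longrightarrow> T (z \<ominus> x) = T z \<ominus> T x" for T
  proof -
    have "N +> T z = N +> T x" if "z \<in> bg_proj M N x" for z
    proof -
      have "z \<in> carrier M" "z \<ominus> x \<in> N" using bg_proj_mem[OF N x that] by auto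
      then show ?thesis
        using T[of "z \<ominus> x"] diff[of z] iffD2[OF a_rcoset_eq[OF N cl cl]] x by simp
    qed
    then have "(\<Union>z\<in>bg_proj M N x. N +> T z) = (\<Union>z\<in>bg_proj M N x. N +> T x)"
      by (intro SUP_cong refl)
    moreover have "bg_proj M N x \<noteq> {}" using bg_proj_self[OF N x] by blast
    ultimately show ?thesis by (simp add: bg_proj_def)
  qed
  have "(\<Union>z\<in>bg_proj M N x. N +> (c \<odot> z)) = bg_proj M N (c \<odot> x)"
    by (rule UN) (use D(5) x in \<open>auto simp: minus_eq' sm_r_distr sm_assoc mult.commute\<close>)
  then show "bg_proj M N (c \<odot> x) = c \<odot>\<^bsub>bg_quot M N\<^esub> bg_proj M N x"
    by (simp add: bg_quot_def)
  have "(\<Union>z\<in>bg_proj M N x. N +> act M a z) = bg_proj M N (act M a x)"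
    by (rule UN) (use D(6) x in \<open>auto simp: act_minus\<close>)
  then show "bg_proj M N (act M a x) = act (bg_quot M N) a (bg_proj M N x)"
    by (simp add: bg_quot_def)
  assume y: "y \<in> carrier M"
  show "bg_proj M N (x \<oplus> y) = bg_proj M N x \<oplus>\<^bsub>bg_quot M N\<^esub> bg_proj M N y"
    using abelian_subgroup.a_rcos_sum[OF abelian_subgroup_of_submodule[OF N] x y] by (simp add: bg_quot_def bg_proj_def)
qed

lemma bg_proj_zero: "bg_submodule N M \<Longrightarrow> bg_proj M N \<zero> = \<zero>\<^bsub>bg_quot M N\<^esub>"
  using bg_submoduleD(1) by (simp add: bg_proj_def bg_quot_def)

lemma bg_quot_premodule: "bg_submodule N M \<Longrightarrow> bg_premodule (bg_quot M N)"
  by (rule premodule_of_surj[OF bg_premodule_axioms bg_proj_hom bg_proj_surj bg_proj_zero])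

lemma bg_proj_morphism: "bg_submodule N M \<Longrightarrow> bg_morphism M (bg_quot M N) (bg_proj M N)"
  using bg_quot_premodule bg_proj_hom by (simp add: bg_morphism_def bg_morphism_axioms_def bg_premodule_axioms)

lemma bg_proj_eq_iff: "bg_submodule N M \<Longrightarrow> x \<in> carrier M \<Longrightarrow> y \<in> carrier M \<Longrightarrow>
    bg_proj M N x = bg_proj M N y \<longleftrightarrow> x \<ominus> y \<in> N"
  by (simp add: bg_proj_def a_rcoset_eq)

lemma bg_proj_eq_zero_iff: "bg_submodule N M \<Longrightarrow> x \<in> carrier M \<Longrightarrow>
    bg_proj M N x = \<zero>\<^bsub>bg_quot M N\<^esub> \<longleftrightarrow> x \<in> N"
  using bg_proj_eq_iff[of N x \<zero>] bg_proj_zero[of N] by (simp add: lin_simps)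

lemma bg_quot_cases:
  assumes "X \<in> carrier (bg_quot M N)"
  obtains x where "x \<in> carrier M" "X = bg_proj M N x"
  using assms bg_proj_surj[of N] by auto

text \<open>Starts from a premodule and asks for the commutation relations only modulo N; this turns
  free words modulo relations into a module.\<close>

lemma bg_quot_moduleI:
  assumes N: "bg_submodule N M"
    and "\<And>a b x. x \<in> carrier M \<Longrightarrow>
      act M a (act M b x) \<ominus> (act M b (act M a x) \<oplus> mode_comm a b \<odot> x) \<in> N"
  shows "bg_module (bg_quot M N)"
proof (rule bg_moduleI[OF bg_quot_premodule[OF N]])
  interpret bg_morphism M "bg_quot M N" "bg_proj M N"
    by (rule bg_proj_morphism[OF N])
  fix a b X assume "X \<in> carrier (bg_quot M N)"
  then obtain x where x: "x \<in> carrier M" "X = bg_proj M N x" by (rule bg_quot_cases)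
  have "bg_proj M N (act M a (act M b x)) = bg_proj M N (act M b (act M a x) \<oplus> mode_comm a b \<odot> x)"
    using x assms(2) by (subst bg_proj_eq_iff[OF N]) auto
  then show "act (bg_quot M N) a (act (bg_quot M N) b X) =
      act (bg_quot M N) b (act (bg_quot M N) a X) \<oplus>\<^bsub>bg_quot M N\<^esub> mode_comm a b \<odot>\<^bsub>bg_quot M N\<^esub> X"
    using x by (simp add: f_act f_add f_sm)
qed

end

lemma (in bg_module) bg_quot_module: "bg_submodule N M \<Longrightarrow> bg_module (bg_quot M N)"
proof (rule bg_quot_moduleI)
  fix a b x assume N: "bg_submodule N M" and x: "x \<in> carrier M"
  then show "act M a (act M b x) \<ominus> (act M b (act M a x) \<oplus> mode_comm a b \<odot> x) \<in> N"
    using act_swap[OF x, of a b] minus_zero_iff[of "act M a (act M b x)" "act M a (act M b x)"]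
      bg_submoduleD(2)[OF N] by simp
qed

section \<open>Weights\<close>

context bg_premodule
begin

definition linop :: "('v \<Rightarrow> 'v) \<Rightarrow> bool" where
  "linop T \<longleftrightarrow> (\<forall>x\<in>carrier M. T x \<in> carrier M) \<and>
    (\<forall>x\<in>carrier M. \<forall>y\<in>carrier M. T (x \<oplus> y) = T x \<oplus> T y) \<and>
    (\<forall>c. \<forall>x\<in>carrier M. T (c \<odot> x) = c \<odot> T x)"

lemma linopD:
  assumes "linop T"
  shows "x \<in> carrier M \<Longrightarrow> T x \<in> carrier M"
    "x \<in> carrier M \<Longrightarrow> y \<in> carrier M \<Longrightarrow> T (x \<oplus> y) = T x \<oplus> T y"
    "x \<in> carrier M \<Longrightarrow> T (c \<odot> x) = c \<odot> T x"
  using assms by (auto simp: linop_def)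

lemma linop_zero: "linop T \<Longrightarrow> T \<zero> = \<zero>"
  using linopD(3)[of T \<zero> 0] linopD(1)[of T \<zero>] by simp

lemma linop_pow:
  assumes "linop T"
  shows "linop (T ^^ m)"
proof (induction m)
  case 0
  then show ?case by (simp add: linop_def)
next
  case (Suc m)
  then show ?case using assms by (simp add: linop_def)
qed

lemma pow_zero: "linop T \<Longrightarrow> (T ^^ m) \<zero> = \<zero>"
  by (rule linop_zero[OF linop_pow])

lemma pow_closed: "linop T \<Longrightarrow> x \<in> carrier M \<Longrightarrow> (T ^^ m) x \<in> carrier M"
  by (rule linopD(1)[OF linop_pow])

lemma pow_intertwine:
  assumes "linop T'" "\<And>x. x \<in> carrier M \<Longrightarrow> T (S x) = S (T' x)" "x \<in> carrier M"
  shows "(T ^^ m) (S x) = S ((T' ^^ m) x)"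
proof (induction m)
  case (Suc m)
  then show ?case using assms pow_closed[OF assms(1)] by simp
qed simp

definition nil :: "('v \<Rightarrow> 'v) \<Rightarrow> 'v \<Rightarrow> bool" where
  "nil T v \<longleftrightarrow> (\<exists>m. (T ^^ m) v = \<zero>)"

lemma pow_mono_zero:
  assumes "linop T" "(T ^^ m) v = \<zero>" "m \<le> k"
  shows "(T ^^ k) v = \<zero>"
proof -
  have "T ^^ k = T ^^ (k - m) \<circ> T ^^ m"
    using assms(3) by (simp flip: funpow_add)
  then show ?thesis
    using assms pow_zero by simp
qed

lemma nil_zero: "nil T \<zero>"
  unfolding nil_def by (rule exI[of _ 0]) simp

lemma nil_add:
  assumes "linop T" "x \<in> carrier M" "y \<in> carrier M" "nil T x" "nil T y"
  shows "nil T (x \<oplus> y)"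
proof -
  obtain m k where mk: "(T ^^ m) x = \<zero>" "(T ^^ k) y = \<zero>"
    using assms by (auto simp: nil_def)
  then have "(T ^^ max m k) x = \<zero>" "(T ^^ max m k) y = \<zero>"
    using pow_mono_zero[OF assms(1)] by auto
  then show ?thesis
    unfolding nil_def using assms
    by (intro exI[of _ "max m k"]) (simp add: linopD(2)[OF linop_pow])
qed

text \<open>Source of all weight shifts: take \<open>T' = wts n c\<close> and
  \<open>T = wts n (c + 1)\<close> for \<open>S = raise n\<close>, and T = T' for an S that commutes
  with it.\<close>

lemma nil_intertwine:
  assumes "linop T'" "linop S" "\<And>x. x \<in> carrier M \<Longrightarrow> T (S x) = S (T' x)" "x \<in> carrier M" "nil T' x"
  shows "nil T (S x)"
proof -
  obtain m where "(T' ^^ m) x = \<zero>"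
    using assms by (auto simp: nil_def)
  then show ?thesis
    unfolding nil_def using pow_intertwine[of T' T S, OF assms(1,3,4), of m] linop_zero[OF assms(2)] by auto
qed

lemma linop_sm: "linop (\<lambda>x. c \<odot> x)"
  by (auto simp: linop_def sm_r_distr sm_assoc mult.commute)

lemma linop_act: "linop (act M a)"
  by (auto simp: linop_def act_add act_smult)

lemma linop_comp: "linop S \<Longrightarrow> linop T \<Longrightarrow> linop (\<lambda>x. S (T x))"
  by (simp add: linop_def)

lemma linop_add: "linop S \<Longrightarrow> linop T \<Longrightarrow> linop (\<lambda>x. S x \<oplus> T x)"
  by (auto simp: linop_def sm_r_distr a_ac)

lemma nil_sm: "linop T \<Longrightarrow> x \<in> carrier M \<Longrightarrow> nil T x \<Longrightarrow> nil T (c \<odot> x)"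
  using nil_intertwine[of T "\<lambda>x. c \<odot> x" T] by (simp add: linop_sm linopD)

text \<open>The modes in conjugate pairs: \<open>raise n\<close> and \<open>lower n\<close> change the eigenvalue of
  \<open>wt n\<close> by one and commute with \<open>wt m\<close> for all other m.\<close>

definition raise :: "int \<Rightarrow> 'v \<Rightarrow> 'v" where
  "raise n = act M (Beta_mode n)"

definition lower :: "int \<Rightarrow> 'v \<Rightarrow> 'v" where
  "lower n = act M (Gamma_mode (- n))"

definition wt :: "int \<Rightarrow> 'v \<Rightarrow> 'v" where
  "wt n x = lower n (raise n x)"

definition wts :: "int \<Rightarrow> complex \<Rightarrow> 'v \<Rightarrow> 'v" where
  "wts n c x = wt n x \<oplus> (- c) \<odot> x"

definition gen_weight :: "(int \<Rightarrow> complex) \<Rightarrow> 'v \<Rightarrow> bool" where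
  "gen_weight w v \<longleftrightarrow> v \<in> carrier M \<and> (\<forall>n. nil (wts n (w n)) v)"

lemma linops [simp, intro]: "linop (raise n)" "linop (lower n)" "linop (wt n)" "linop (wts n c)"
proof -
  show 1: "linop (raise n)" "linop (lower n)" for n
    unfolding raise_def lower_def by (rule linop_act)+
  show 2: "linop (wt n)"
    unfolding wt_def[abs_def] using linop_comp[OF 1(2) 1(1)] .
  show "linop (wts n c)"
    unfolding wts_def[abs_def] using linop_add[OF 2 linop_sm] .
qed

lemma op_closed [simp, intro]:
  assumes "x \<in> carrier M"
  shows "raise n x \<in> carrier M" "lower n x \<in> carrier M" "wt n x \<in> carrier M" "wts n c x \<in> carrier M"
  using assms by (simp_all add: linopD)

lemma op_zero [simp]: "raise n \<zero> = \<zero>" "lower n \<zero> = \<zero>" "wt n \<zero> = \<zero>" "wts n c \<zero> = \<zero>"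
  by (simp_all add: linop_zero)

lemma op_add:
  assumes "x \<in> carrier M" "y \<in> carrier M"
  shows "raise n (x \<oplus> y) = raise n x \<oplus> raise n y" "lower n (x \<oplus> y) = lower n x \<oplus> lower n y"
    "wt n (x \<oplus> y) = wt n x \<oplus> wt n y" "wts n c (x \<oplus> y) = wts n c x \<oplus> wts n c y"
  using assms by (simp_all add: linopD)

lemma op_sm:
  assumes "x \<in> carrier M"
  shows "raise n (c \<odot> x) = c \<odot> raise n x" "lower n (c \<odot> x) = c \<odot> lower n x"
    "wt n (c \<odot> x) = c \<odot> wt n x" "wts n d (c \<odot> x) = c \<odot> wts n d x"
  using assms by (simp_all add: linopD)

lemma op_submodule:
  assumes "bg_submodule S M" "x \<in> S"
  shows "raise n x \<in> S" "lower n x \<in> S" "wt n x \<in> S" "wts n c x \<in> S"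
  using bg_submoduleD[OF assms(1)] assms(2) by (simp_all add: raise_def lower_def wt_def wts_def)

lemma submodule_pow:
  "bg_submodule S M \<Longrightarrow> x \<in> S \<Longrightarrow> (wts n c ^^ m) x \<in> S"
  by (induction m) (auto intro: op_submodule)

lemma wts_commute: "linop S \<Longrightarrow> x \<in> carrier M \<Longrightarrow> S (wt n x) = wt n (S x) \<Longrightarrow>
    S (wts n c x) = wts n c (S x)"
  by (simp add: wts_def linopD)

lemma wts_wts_same: "x \<in> carrier M \<Longrightarrow> wts n c (wts n d x) = wts n d (wts n c x)"
  by (intro wts_commute) (auto simp: wts_commute[of "wt n"])

lemma add_sub_add: "a \<in> carrier M \<Longrightarrow> b \<in> carrier M \<Longrightarrow> c \<in> carrier M \<Longrightarrow>
    (a \<oplus> b) \<ominus> (a \<oplus> c) = b \<ominus> c"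
  by (simp add: a_comm[of a b] a_minus_def minus_add a_assoc r_neg2 r_neg1)

lemma wts_diff: "v \<in> carrier M \<Longrightarrow> wts n k v \<ominus> wts n l v = (l - k) \<odot> v"
  by (simp add: wts_def add_sub_add) (simp add: minus_eq' sm_assoc)

text \<open>Modulo S, the vector v is killed by \<open>wt n - k\<close> and by a power of
  \<open>wt n - l\<close>, and these are coprime polynomials. The induction removes one factor of
  the power at a time, since \<open>wts_diff\<close> is a nonzero multiple of v.\<close>

lemma invert_weight:
  assumes S: "bg_submodule S M"
    and "v \<in> carrier M" "(wts n l ^^ m) v \<in> S" "wts n k v \<in> S" "k \<noteq> l"
  shows "v \<in> S"
  using assms(2-4)
proof (induction m arbitrary: v)
  case (Suc m)
  note D = bg_submoduleD[OF S]
  have "wts n k (wts n l v) = wts n l (wts n k v)"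
    using Suc.prems(1) by (rule wts_wts_same)
  then have "wts n k (wts n l v) \<in> S"
    using op_submodule(4)[OF S Suc.prems(3)] by simp
  moreover have "(wts n l ^^ m) (wts n l v) \<in> S"
    using Suc.prems(2) by (simp add: funpow_swap1)
  ultimately have "wts n l v \<in> S"
    using Suc.IH[of "wts n l v"] op_closed(4)[OF Suc.prems(1)] by blast
  then have "wts n k v \<ominus> wts n l v \<in> S"
    using Suc.prems(3) D(7) by blast
  moreover note wts_diff[OF Suc.prems(1), of n k l]
  ultimately have "inverse (l - k) \<odot> ((l - k) \<odot> v) \<in> S"
    using D(5) by metis
  then show ?case
    using Suc.prems(1) assms(5) by (simp add: sm_assoc)
qed simp

text \<open>Away from its eigenvalue, a shifted weight operator is invertible on v, even modulo a
  submodule. This is how single mode steps get undone.\<close>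

lemma invert_gen_weight:
  assumes "bg_submodule S M" "gen_weight w v" "wts n k v \<in> S" "k \<noteq> w n"
  shows "v \<in> S"
proof -
  obtain m where "(wts n (w n) ^^ m) v = \<zero>"
    using assms(2) by (auto simp: gen_weight_def nil_def)
  then show ?thesis
    using invert_weight[OF assms(1), where v=v and n=n and m=m and l="w n" and k=k] assms bg_submoduleD(2)[OF assms(1)]
    by (auto simp: gen_weight_def)
qed

lemma gen_weight_closed: "gen_weight w v \<Longrightarrow> v \<in> carrier M"
  by (simp add: gen_weight_def)

lemma gen_weight_zero: "gen_weight w \<zero>"
  by (simp add: gen_weight_def nil_zero)

lemma gen_weight_add: "gen_weight w x \<Longrightarrow> gen_weight w y \<Longrightarrow> gen_weight w (x \<oplus> y)"
  by (auto simp: gen_weight_def intro: nil_add)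

lemma gen_weight_sm: "gen_weight w x \<Longrightarrow> gen_weight w (c \<odot> x)"
  by (auto simp: gen_weight_def intro: nil_sm)

end

section \<open>Commutation of the conjugate pairs with the weight operators\<close>

context bg_module
begin

lemma raise_raise: "x \<in> carrier M \<Longrightarrow> raise m (raise n x) = raise n (raise m x)"
  by (simp add: raise_def act_swap[of x "Beta_mode m"])

lemma lower_lower: "x \<in> carrier M \<Longrightarrow> lower m (lower n x) = lower n (lower m x)"
  by (simp add: lower_def act_swap[of x "Gamma_mode (- m)"])

lemma raise_lower: "x \<in> carrier M \<Longrightarrow> m \<noteq> n \<Longrightarrow> raise m (lower n x) = lower n (raise m x)"
  by (simp add: raise_def lower_def act_swap[of x "Beta_mode m"])

text \<open>Comes from the commutator - 1 of a beta mode with its conjugate gamma mode. The two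
  orders of the product are thus \<open>wt n\<close> and \<open>wt n - 1\<close>, which singles out
  the eigenvalues 0 and 1.\<close>

lemma raise_lower_same: "x \<in> carrier M \<Longrightarrow> raise n (lower n x) = wt n x \<oplus> (- 1) \<odot> x"
  by (simp add: wt_def raise_def lower_def act_swap[of x "Beta_mode n"])

lemma wt_raise: "x \<in> carrier M \<Longrightarrow> wt n (raise n x) = raise n (wt n x) \<oplus> raise n x"
  using raise_lower_same[of "raise n x" n] by (simp add: wt_def lin_simps)

lemma wt_lower: "x \<in> carrier M \<Longrightarrow> wt n (lower n x) = lower n (wt n x) \<oplus> (- 1) \<odot> lower n x"
  by (simp add: wt_def[of n "lower n x"] raise_lower_same op_add op_sm)

lemma wt_raise_other: "x \<in> carrier M \<Longrightarrow> m \<noteq> n \<Longrightarrow> wt m (raise n x) = raise n (wt m x)"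
  by (simp add: wt_def raise_lower raise_raise[of x m n])

lemma wt_lower_other: "x \<in> carrier M \<Longrightarrow> m \<noteq> n \<Longrightarrow> wt m (lower n x) = lower n (wt m x)"
  by (simp add: wt_def raise_lower lower_lower[of _ m n])

lemma wt_wt: "x \<in> carrier M \<Longrightarrow> wt m (wt n x) = wt n (wt m x)"
proof (cases "m = n")
  case False
  assume x: "x \<in> carrier M"
  have "wt m (wt n x) = lower n (raise n (wt m x))"
    using False x by (simp add: wt_def[of n] wt_lower_other wt_raise_other)
  then show ?thesis by (simp add: wt_def)
qed simp

lemma wts_raise: "x \<in> carrier M \<Longrightarrow> wts n c (raise n x) = raise n (wts n (c - 1) x)"
  by (simp add: wts_def wt_raise op_add op_sm a_assoc)

lemma wts_lower: "x \<in> carrier M \<Longrightarrow> wts n c (lower n x) = lower n (wts n (c + 1) x)"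
  by (simp add: wts_def wt_lower op_add op_sm a_assoc minus_diff_commute[of 1 c])

lemma wts_raise_other: "x \<in> carrier M \<Longrightarrow> m \<noteq> n \<Longrightarrow> wts m c (raise n x) = raise n (wts m c x)"
  by (simp add: wts_def wt_raise_other op_add op_sm)

lemma wts_lower_other: "x \<in> carrier M \<Longrightarrow> m \<noteq> n \<Longrightarrow> wts m c (lower n x) = lower n (wts m c x)"
  by (simp add: wts_def wt_lower_other op_add op_sm)

lemma wts_wt: "x \<in> carrier M \<Longrightarrow> wts m c (wt n x) = wt n (wts m c x)"
  by (rule wts_commute[symmetric]) (auto simp: wt_wt[of _ m n])

lemma wts_wts: "x \<in> carrier M \<Longrightarrow> wts m c (wts n d x) = wts n d (wts m c x)"
  by (rule wts_commute) (auto simp: wts_wt)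

lemma gen_weight_raise:
  assumes "gen_weight w v"
  shows "gen_weight (w(n := w n + 1)) (raise n v)"
  unfolding gen_weight_def
proof (intro conjI allI)
  fix m
  show "nil (wts m ((w(n := w n + 1)) m)) (raise n v)"
    using assms nil_intertwine[of "wts m (w m)" "raise n" "wts m ((w(n := w n + 1)) m)" v]
    by (cases "m = n") (auto simp: gen_weight_def wts_raise wts_raise_other)
qed (use assms in \<open>auto simp: gen_weight_def\<close>)

lemma gen_weight_lower:
  assumes "gen_weight w v"
  shows "gen_weight (w(n := w n - 1)) (lower n v)"
  unfolding gen_weight_def
proof (intro conjI allI)
  fix m
  show "nil (wts m ((w(n := w n - 1)) m)) (lower n v)"
    using assms nil_intertwine[of "wts m (w m)" "lower n" "wts m ((w(n := w n - 1)) m)" v]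
    by (cases "m = n") (auto simp: gen_weight_def wts_lower wts_lower_other)
qed (use assms in \<open>auto simp: gen_weight_def\<close>)

lemma gen_weight_wts:
  assumes "gen_weight w v"
  shows "gen_weight w (wts n c v)"
  using assms nil_intertwine[of "wts m (w m)" "wts n c" "wts m (w m)" v for m]
  by (auto simp: gen_weight_def wts_wts[of _ _ _ n c])

lemma gen_weight_wts_pow: "gen_weight w v \<Longrightarrow> gen_weight w ((wts n c ^^ m) v)"
  by (induction m) (auto intro: gen_weight_wts)

lemma linop_finsum:
  assumes "linop T" "finite D" "g \<in> D \<rightarrow> carrier M"
  shows "T (finsum M g D) = (\<Oplus>i\<in>D. T (g i))"
  using assms(2,3)
proof (induction D)
  case (insert x F)
  then have "g \<in> F \<rightarrow> carrier M" "g x \<in> carrier M" by auto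
  with insert show ?case
    using linopD[OF assms(1)] by (simp add: Pi_def)
qed (simp add: linop_zero[OF assms(1)])

lemma finsum_remove:
  assumes "finite D" "d \<in> D" "g \<in> D \<rightarrow> carrier M"
  shows "finsum M g D = g d \<oplus> finsum M g (D - {d})"
proof -
  have "finsum M g (insert d (D - {d})) = g d \<oplus> finsum M g (D - {d})"
    using assms by (intro finsum_insert) auto
  then show ?thesis using assms(2) by (simp add: insert_absorb)
qed

text \<open>A second weight \<open>w e\<close> differs from \<open>w d\<close> at some n. A power of
  \<open>wt n - w e n\<close> kills the component of e and leaves a shorter sum in S, to which the
  induction applies.\<close>

lemma separate_weights:
  assumes S: "bg_submodule S M"
    and "finite D" "inj_on w D" "\<And>d. d \<in> D \<Longrightarrow> gen_weight (w d) (g d)" "finsum M g D \<in> S" "d \<in> D"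
  shows "g d \<in> S"
  using assms(2-)
proof (induction "card D" arbitrary: D d g rule: less_induct)
  case less
  note D = bg_submoduleD[OF S]
  have g: "g \<in> A \<rightarrow> carrier M" if "A \<subseteq> D" for A
    using less.prems(3) that by (auto simp: gen_weight_def)
  show ?case
  proof (cases "D = {d}")
    case True
    then show ?thesis using less.prems(4) g[of D] by simp
  next
    case False
    have rest: "g e \<in> S" if e: "d' \<in> D" "g d' \<in> S" "e \<in> D" for d' e
    proof (cases "e = d'")
      case False
      have cl: "finsum M g (D - {d'}) \<in> carrier M" "g d' \<in> carrier M"
        using e g[of D] by (auto intro!: finsum_closed)
      have "finsum M g (D - {d'}) = finsum M g D \<ominus> g d'"
        unfolding finsum_remove[OF less.prems(1) e(1) g[OF subset_refl]] a_comm[OF cl(2,1)]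
        using cl by (simp add: add_sub)
      then have "finsum M g (D - {d'}) \<in> S"
        using e less.prems(4) D(7) by simp
      then show ?thesis
        using e False less.prems(1-3) psubset_card_mono[of D "D - {d'}"]
        by (intro less.hyps[of "D - {d'}" g e]) (auto simp: inj_on_diff)
    qed (use e in simp)
    obtain e where e: "e \<in> D" "e \<noteq> d"
      using False less.prems(5) by auto
    then have "w e \<noteq> w d"
      using less.prems(2,5) by (auto dest: inj_onD)
    then obtain n where n: "w e n \<noteq> w d n" by auto
    obtain m where m: "(wts n (w e n) ^^ m) (g e) = \<zero>"
      using less.prems(3)[OF e(1)] by (auto simp: gen_weight_def nil_def)
    let ?T = "wts n (w e n) ^^ m"
    have T: "linop ?T" by (intro linop_pow linops)
    have gT: "(\<lambda>i. ?T (g i)) \<in> D \<rightarrow> carrier M"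
      using g[of D] linopD(1)[OF T] by auto
    have "?T (finsum M g D) = (\<Oplus>i\<in>D. ?T (g i))"
      by (rule linop_finsum[OF T less.prems(1) g[OF subset_refl]])
    also have "\<dots> = ?T (g e) \<oplus> (\<Oplus>i\<in>D - {e}. ?T (g i))"
      by (rule finsum_remove[OF less.prems(1) e(1) gT])
    also have "\<dots> = (\<Oplus>i\<in>D - {e}. ?T (g i))"
      unfolding m using gT by (intro l_zero finsum_closed) auto
    finally have "(\<Oplus>i\<in>D - {e}. ?T (g i)) \<in> S"
      using submodule_pow[OF S less.prems(4)] by metis
    moreover have "card (D - {e}) < card D"
      using e(1) less.prems(1) by (intro psubset_card_mono) auto
    ultimately have "?T (g d) \<in> S"
      using less.prems(1,2,5) e less.prems(3)
      by (intro less.hyps[of "D - {e}" "\<lambda>i. ?T (g i)" d]) (auto simp: inj_on_diff intro!: gen_weight_wts_pow)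
    \<comment> \<open>On the weight \<open>w d\<close>, the operator \<open>wt n\<close> has an
      eigenvalue other than \<open>w e n\<close>, so each factor of \<open>?T\<close> can be
      cancelled modulo S.\<close>
    have pull: "(wts n (w e n) ^^ k) x \<in> S \<Longrightarrow> gen_weight (w d) x \<Longrightarrow> x \<in> S" for k x
    proof (induction k arbitrary: x)
      case (Suc k)
      have "(wts n (w e n) ^^ k) (wts n (w e n) x) \<in> S"
        using Suc.prems(1) by (simp add: funpow_swap1)
      from Suc.IH[OF this gen_weight_wts[OF Suc.prems(2)]] show ?case
        using invert_gen_weight[OF S Suc.prems(2)] n by blast
    qed simp
    show ?thesis
      using pull[OF \<open>?T (g d) \<in> S\<close> less.prems(3)[OF less.prems(5)]] .
  qed
qed

end

section \<open>Modules generated by a vector of the weight of the vacuum\<close>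

context bg_module
begin

text \<open>Equal to \<open>wt (- 1) - 1\<close>: shifted so as to be nilpotent where
  \<open>wt (- 1)\<close> has the eigenvalue 1 of the vacuum.\<close>

definition wt' :: "'v \<Rightarrow> 'v" where
  "wt' x = raise (- 1) (lower (- 1) x)"

text \<open>\<open>raise 0\<close> and \<open>lower (- 1)\<close> commute, so their product is
  recorded in one order. The nilpotency orders are left open; they will decide the length of the
  roof.\<close>

definition roof_relations :: "'v \<Rightarrow> bool" where
  "roof_relations u \<longleftrightarrow> u \<in> carrier M \<and> (\<forall>n\<ge>1. raise n u = \<zero>) \<and> (\<forall>n\<le>- 2. lower n u = \<zero>) \<and>
    raise 0 (lower (- 1) u) = \<zero> \<and> nil (wt 0) u \<and> nil wt' u"

text \<open>The algebra generated by \<open>wt 0\<close> and \<open>wt'\<close>, applied to u. Under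
  \<open>roof_relations\<close> it is the full weight space of the vacuum in the module generated by
  u, see \<open>vac_weight_space\<close>.\<close>

inductive_set vac_space :: "'v \<Rightarrow> 'v set" for u where
  base: "u \<in> vac_space u"
| wt: "y \<in> vac_space u \<Longrightarrow> wt 0 y \<in> vac_space u"
| wt': "y \<in> vac_space u \<Longrightarrow> wt' y \<in> vac_space u"
| add: "y \<in> vac_space u \<Longrightarrow> z \<in> vac_space u \<Longrightarrow> y \<oplus> z \<in> vac_space u"
| sm: "y \<in> vac_space u \<Longrightarrow> c \<odot> y \<in> vac_space u"

text \<open>Vectors with the weights of the vacua of V, of \<open>\<sigma>\<^sup>-\<^sup>1 V\<close>
  and of \<open>\<sigma> V\<close>.\<close>

definition standard :: "'v \<Rightarrow> 'v set" where
  "standard u = vac_space u \<union> raise 0 ` vac_space u \<union> lower (- 1) ` vac_space u"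

definition vac_weight :: "int \<Rightarrow> int" where
  "vac_weight n = (if n \<ge> 0 then 0 else 1)"

text \<open>The span of the words in the modes applied to u, with the weights recorded; the two
  step rules only allow steps that the inverse step undoes up to an invertible factor.\<close>

inductive pure :: "'v \<Rightarrow> (int \<Rightarrow> int) \<Rightarrow> 'v \<Rightarrow> bool" for u where
  base: "y \<in> vac_space u \<Longrightarrow> pure u vac_weight y"
| base_raise: "y \<in> vac_space u \<Longrightarrow> pure u (vac_weight(0 := 1)) (raise 0 y)"
| base_lower: "y \<in> vac_space u \<Longrightarrow> pure u (vac_weight(- 1 := 0)) (lower (- 1) y)"
| step_lower: "pure u w v \<Longrightarrow> w n \<le> 0 \<Longrightarrow> w' = w(n := w n - 1) \<Longrightarrow> pure u w' (lower n v)"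
| step_raise: "pure u w v \<Longrightarrow> w n \<ge> 1 \<Longrightarrow> w' = w(n := w n + 1) \<Longrightarrow> pure u w' (raise n v)"
| zero: "pure u w \<zero>"
| add: "pure u w v \<Longrightarrow> pure u w v' \<Longrightarrow> pure u w (v \<oplus> v')"
| sm: "pure u w v \<Longrightarrow> pure u w (c \<odot> v)"

text \<open>Records the weights alone, so that \<open>pure_in_span\<close> can descend along a path
  of weights and apply the inverse step to an arbitrary vector of the weight, not just to one that
  arose by that step.\<close>

inductive reach :: "(int \<Rightarrow> int) \<Rightarrow> bool" where
  reach_vac: "reach vac_weight"
| reach_vac_raise: "reach (vac_weight(0 := 1))"
| reach_vac_lower: "reach (vac_weight(- 1 := 0))"
| reach_lower: "reach w \<Longrightarrow> w n \<le> 0 \<Longrightarrow> reach (w(n := w n - 1))"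
| reach_raise: "reach w \<Longrightarrow> w n \<ge> 1 \<Longrightarrow> reach (w(n := w n + 1))"

lemma linop_wt': "linop wt'"
  unfolding wt'_def[abs_def] using linop_comp[OF linops(1,2)] .

lemma wt'_closed [simp]: "x \<in> carrier M \<Longrightarrow> wt' x \<in> carrier M"
  by (simp add: wt'_def)

lemma wt'_eq: "x \<in> carrier M \<Longrightarrow> wt' x = wts (- 1) 1 x"
  by (simp add: wt'_def wts_def raise_lower_same)

lemma wt_eq_wts: "x \<in> carrier M \<Longrightarrow> wt 0 x = wts 0 0 x"
  by (simp add: wts_def)

lemma wt_via_wt': "x \<in> carrier M \<Longrightarrow> wt (- 1) x = wt' x \<oplus> x"
  by (simp add: wt'_def raise_lower_same a_assoc)

lemma wt_raise_lower_self: "x \<in> carrier M \<Longrightarrow> wt n x = raise n (lower n x) \<oplus> x"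
  by (simp add: raise_lower_same a_assoc)

lemma wt_wt': "x \<in> carrier M \<Longrightarrow> wt 0 (wt' x) = wt' (wt 0 x)"
  by (simp add: wt'_def wt_raise_other wt_lower_other)

lemma raise_wt_zero:
  assumes "x \<in> carrier M" "raise n x = \<zero>" "n \<noteq> 0 \<or> raise 0 x = \<zero>"
  shows "raise n (wt 0 x) = \<zero>"
  using assms by (cases "n = 0") (auto simp: wt_def raise_lower raise_raise[of x n 0])

text \<open>\<open>raise n\<close> for n \<ge> 1 and \<open>lower n\<close> for n \<le> - 2 commute
  with both operators; the product of \<open>raise 0\<close> and \<open>lower (- 1)\<close> can be
  moved next to y, where it vanishes.\<close>

lemma vac_space_props:
  assumes u: "roof_relations u" and "y \<in> vac_space u"
  shows "y \<in> carrier M \<and> (\<forall>n\<ge>1. raise n y = \<zero>) \<and> (\<forall>n\<le>- 2. lower n y = \<zero>) \<and>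
    raise 0 (lower (- 1) y) = \<zero> \<and> lower (- 1) (raise 0 y) = \<zero> \<and> nil (wt 0) y \<and> nil wt' y"
  using assms(2)
proof induction
  case base
  then show ?case
    using u by (auto simp: roof_relations_def raise_lower)
next
  case (wt y)
  then have y: "y \<in> carrier M" by blast
  have "raise n (wt 0 y) = \<zero>" if "n \<ge> 1" for n
    using that wt y by (intro raise_wt_zero) auto
  moreover have "lower n (wt 0 y) = \<zero>" if "n \<le> - 2" for n
    using that wt y wt_lower_other[of y 0 n] by simp
  moreover have l: "lower (- 1) (raise 0 (wt 0 y)) = \<zero>"
  proof -
    \<comment> \<open>Every term now ends in \<open>raise 0 y\<close>; \<open>lower (- 1)\<close>
      commutes with the modes of index 0 in front of it and kills it.\<close>
    have "raise 0 (wt 0 y) = lower 0 (raise 0 (raise 0 y)) \<oplus> (- 1) \<odot> raise 0 y"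
      using y by (simp add: wt_def raise_lower_same[of "raise 0 y" 0])
    also have "lower (- 1) \<dots> = lower 0 (raise 0 (lower (- 1) (raise 0 y)))"
      using y wt by (simp add: op_add op_sm lower_lower[of _ "- 1" 0] raise_lower[symmetric])
    finally show ?thesis using wt by simp
  qed
  moreover have "raise 0 (lower (- 1) (wt 0 y)) = \<zero>"
    using l y by (simp add: raise_lower)
  moreover have "nil (wt 0) (wt 0 y)" "nil wt' (wt 0 y)"
    using wt y nil_intertwine[of "wt 0" "wt 0" "wt 0" y] nil_intertwine[of wt' "wt 0" wt' y]
    by (auto simp: linop_wt' wt_wt')
  ultimately show ?case using y by blast
next
  case (wt' y)
  then have y: "y \<in> carrier M" by blast
  have w: "wt' y = wt (- 1) y \<oplus> (- 1) \<odot> y"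
    using y by (simp add: wt'_eq wts_def)
  have "raise n (wt' y) = \<zero>" if "n \<ge> 1" for n
    using that wt' y wt_raise_other[of y "- 1" n] by (simp add: w op_add op_sm)
  moreover have "lower n (wt' y) = \<zero>" if "n \<le> - 2" for n
    using that wt' y wt_lower_other[of y "- 1" n] by (simp add: w op_add op_sm)
  moreover have l: "raise 0 (lower (- 1) (wt' y)) = \<zero>"
  proof -
    have "lower (- 1) (wt' y) = wt (- 1) (lower (- 1) y)"
      using y by (simp add: wt'_def wt_def)
    then have "raise 0 (lower (- 1) (wt' y)) = wt (- 1) (raise 0 (lower (- 1) y))"
      using y by (simp add: wt_raise_other)
    then show ?thesis using wt' by simp
  qed
  moreover have "lower (- 1) (raise 0 (wt' y)) = \<zero>"
    using l y by (simp add: raise_lower)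
  moreover have "nil (wt 0) (wt' y)" "nil wt' (wt' y)"
    using wt' y nil_intertwine[of "wt 0" wt' "wt 0" y] nil_intertwine[of wt' wt' wt' y]
    by (auto simp: linop_wt' wt_wt')
  ultimately show ?case using y by (metis wt'_closed)
next
  case (add y z)
  then show ?case by (auto simp: op_add intro!: nil_add linop_wt')
next
  case (sm y c)
  then show ?case by (auto simp: op_sm intro!: nil_sm linop_wt')
qed

section \<open>Weights in the module generated by a vector with the roof relations\<close>

context
  fixes u
  assumes u: "roof_relations u"
begin

lemma vac_closed: "y \<in> vac_space u \<Longrightarrow> y \<in> carrier M"
  and vac_raise: "y \<in> vac_space u \<Longrightarrow> n \<ge> 1 \<Longrightarrow> raise n y = \<zero>"
  and vac_lower: "y \<in> vac_space u \<Longrightarrow> n \<le> - 2 \<Longrightarrow> lower n y = \<zero>"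
  and vac_raise_lower: "y \<in> vac_space u \<Longrightarrow> raise 0 (lower (- 1) y) = \<zero>"
  and vac_lower_raise: "y \<in> vac_space u \<Longrightarrow> lower (- 1) (raise 0 y) = \<zero>"
  and vac_nil: "y \<in> vac_space u \<Longrightarrow> nil (wt 0) y" "y \<in> vac_space u \<Longrightarrow> nil wt' y"
  using vac_space_props[OF u] by blast+

lemma vac_wt:
  assumes y: "y \<in> vac_space u"
  shows "wt n y \<in> vac_space u"
proof -
  have 0: "\<zero> \<in> vac_space u"
    using vac_space.sm[OF y, of 0] vac_closed[OF y] by simp
  consider "n \<ge> 1" | "n = 0" | "n = - 1" | "n \<le> - 2" by linarith
  then show ?thesis
  proof cases
    case 1
    then show ?thesis using vac_raise[OF y] 0 by (simp add: wt_def)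
  next
    case 2
    then show ?thesis using y by (simp add: vac_space.wt)
  next
    case 3
    then show ?thesis
      using y wt_via_wt'[OF vac_closed[OF y]] by (simp add: vac_space.wt' vac_space.add)
  next
    case 4
    then show ?thesis
      using vac_lower[OF y] wt_raise_lower_self[OF vac_closed[OF y], of n] vac_closed[OF y] y by simp
  qed
qed

lemma vac_gen_weight:
  assumes y: "y \<in> vac_space u"
  shows "gen_weight (\<lambda>n. of_int (vac_weight n)) y"
  unfolding gen_weight_def
proof (intro conjI allI)
  note c = vac_closed[OF y]
  fix n :: int
  \<comment> \<open>The operators agree only on the carrier, so their powers are compared along the
    orbit of y.\<close>
  have pow: "(T ^^ m) y = (S ^^ m) y" if "\<And>x. x \<in> carrier M \<Longrightarrow> T x = S x" "linop S" for T S m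
    using that pow_closed[OF that(2) c] by (induction m) auto
  consider "n \<ge> 1" | "n = 0" | "n = - 1" | "n \<le> - 2" by linarith
  then show "nil (wts n (of_int (vac_weight n))) y"
  proof cases
    case 1
    then have "wts n 0 y = \<zero>" using vac_raise[OF y] c by (simp add: wts_def wt_def)
    with 1 show ?thesis unfolding nil_def vac_weight_def by (intro exI[of _ 1]) simp
  next
    case 2
    then show ?thesis
      using vac_nil(1)[OF y] pow[OF wt_eq_wts] by (simp add: nil_def vac_weight_def)
  next
    case 3
    then show ?thesis
      using vac_nil(2)[OF y] pow[OF wt'_eq] by (simp add: nil_def vac_weight_def)
  next
    case 4
    then have "wts n 1 y = \<zero>"
      using vac_lower[OF y] wt_raise_lower_self[OF c, of n] c by (simp add: wts_def)
    with 4 show ?thesis unfolding nil_def vac_weight_def by (intro exI[of _ 1]) simp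
  qed
qed (rule vac_closed[OF y])

lemma gen_weight_raise_int:
  assumes "gen_weight (\<lambda>m. of_int (w m)) v" "w' = w(n := w n + 1)"
  shows "gen_weight (\<lambda>m. of_int (w' m)) (raise n v)"
proof -
  have "(\<lambda>m. of_int (w' m) :: complex) = (\<lambda>m. of_int (w m))(n := of_int (w n) + 1)"
    using assms(2) by (auto simp: fun_eq_iff)
  then show ?thesis using gen_weight_raise[OF assms(1), of n] by simp
qed

lemma gen_weight_lower_int:
  assumes "gen_weight (\<lambda>m. of_int (w m)) v" "w' = w(n := w n - 1)"
  shows "gen_weight (\<lambda>m. of_int (w' m)) (lower n v)"
proof -
  have "(\<lambda>m. of_int (w' m) :: complex) = (\<lambda>m. of_int (w m))(n := of_int (w n) - 1)"
    using assms(2) by (auto simp: fun_eq_iff)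
  then show ?thesis using gen_weight_lower[OF assms(1), of n] by simp
qed

lemma pure_gen_weight: "pure u w v \<Longrightarrow> gen_weight (\<lambda>n. of_int (w n)) v"
proof (induction rule: pure.induct)
  case (base y)
  then show ?case by (rule vac_gen_weight)
next
  case (base_raise y)
  then show ?case
    by (intro gen_weight_raise_int[OF vac_gen_weight]) (auto simp: vac_weight_def)
next
  case (base_lower y)
  then show ?case
    by (intro gen_weight_lower_int[OF vac_gen_weight]) (auto simp: vac_weight_def)
next
  case (step_lower w v n w')
  then show ?case by (intro gen_weight_lower_int)
next
  case (step_raise w v n w')
  then show ?case by (intro gen_weight_raise_int)
qed (simp_all add: gen_weight_zero gen_weight_add gen_weight_sm)

lemma pure_closed: "pure u w v \<Longrightarrow> v \<in> carrier M"
  using pure_gen_weight gen_weight_closed by blast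

lemma pure_sub: "pure u w v \<Longrightarrow> pure u w v' \<Longrightarrow> pure u w (v \<oplus> (- 1) \<odot> v')"
  by (intro pure.add pure.sm)

text \<open>A step of another index commutes with the last step of v and leaves its side condition
  intact. A step of the same index either prolongs v or undoes the last step up to
  \<open>wt k\<close>; hence stability under \<open>wt\<close> is carried through the same
  induction.\<close>

lemma pure_modes:
  "pure u w v \<Longrightarrow> (\<forall>n. pure u (w(n := w n + 1)) (raise n v)) \<and>
    (\<forall>n. pure u (w(n := w n - 1)) (lower n v)) \<and> (\<forall>n. pure u w (wt n v))"
proof (induction rule: pure.induct)
  case (base y)
  note c = vac_closed[OF base]
  have "pure u (vac_weight(n := vac_weight n + 1)) (raise n y)" for n
  proof -
    consider "n \<ge> 1" | "n = 0" | "n \<le> - 1" by linarith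
    then show ?thesis
    proof cases
      case 2
      then show ?thesis using pure.base_raise[OF base] by (simp add: vac_weight_def[of 0])
    next
      case 3
      then show ?thesis by (intro pure.step_raise[OF pure.base[OF base]]) (auto simp: vac_weight_def)
    qed (simp add: vac_raise[OF base] pure.zero)
  qed
  moreover have "pure u (vac_weight(n := vac_weight n - 1)) (lower n y)" for n
  proof -
    consider "n \<le> - 2" | "n = - 1" | "n \<ge> 0" by linarith
    then show ?thesis
    proof cases
      case 2
      then show ?thesis using pure.base_lower[OF base] by (simp add: vac_weight_def[of "- 1"])
    next
      case 3
      then show ?thesis by (intro pure.step_lower[OF pure.base[OF base]]) (auto simp: vac_weight_def)
    qed (simp add: vac_lower[OF base] pure.zero)
  qed
  ultimately show ?case using pure.base[OF vac_wt[OF base]] by blast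
next
  case (base_raise y)
  note c = vac_closed[OF base_raise] and p = pure.base_raise[OF base_raise]
  let ?w = "vac_weight(0 := 1)"
  have "pure u (?w(n := ?w n + 1)) (raise n (raise 0 y))" for n
  proof -
    consider "n \<ge> 1" | "n \<le> 0" by linarith
    then show ?thesis
    proof cases
      case 1
      then show ?thesis using c by (simp add: raise_raise[of y n] vac_raise[OF base_raise] pure.zero)
    qed (auto intro!: pure.step_raise[OF p] simp: vac_weight_def)
  qed
  moreover have "pure u (?w(n := ?w n - 1)) (lower n (raise 0 y))" for n
  proof -
    consider "n \<le> - 2" | "n = - 1" | "n = 0" | "n \<ge> 1" by linarith
    then show ?thesis
    proof cases
      case 1
      then show ?thesis
        using c by (simp add: raise_lower[of y 0 n, symmetric] vac_lower[OF base_raise] pure.zero)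
    next
      case 3
      then show ?thesis
        using pure.base[OF vac_space.wt[OF base_raise]] by (simp add: wt_def vac_weight_def fun_upd_idem)
    qed (auto intro!: pure.step_lower[OF p] simp: vac_weight_def vac_lower_raise[OF base_raise] pure.zero)
  qed
  moreover have "pure u ?w (wt n (raise 0 y))" for n
  proof (cases "n = 0")
    case True
    then show ?thesis
      using c pure.add[OF pure.base_raise[OF vac_space.wt[OF base_raise]] p] by (simp add: wt_raise)
  next
    case False
    then show ?thesis
      using c pure.base_raise[OF vac_wt[OF base_raise]] by (simp add: wt_raise_other)
  qed
  ultimately show ?case by blast
next
  case (base_lower y)
  note c = vac_closed[OF base_lower] and p = pure.base_lower[OF base_lower]
  let ?w = "vac_weight(- 1 := 0)"
  have "pure u (?w(n := ?w n - 1)) (lower n (lower (- 1) y))" for n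
  proof -
    consider "n \<le> - 2" | "n \<ge> - 1" by linarith
    then show ?thesis
    proof cases
      case 1
      then show ?thesis using c by (simp add: lower_lower[of y n] vac_lower[OF base_lower] pure.zero)
    qed (auto intro!: pure.step_lower[OF p] simp: vac_weight_def)
  qed
  moreover have "pure u (?w(n := ?w n + 1)) (raise n (lower (- 1) y))" for n
  proof -
    consider "n \<ge> 1" | "n = 0" | "n = - 1" | "n \<le> - 2" by linarith
    then show ?thesis
    proof cases
      case 1
      then show ?thesis
        using c raise_lower[of y n "- 1"] by (simp add: vac_raise[OF base_lower] pure.zero)
    next
      case 2
      then show ?thesis by (simp add: vac_raise_lower[OF base_lower] pure.zero)
    next
      case 3
      then show ?thesis
        using pure.base[OF vac_space.wt'[OF base_lower]]
        by (simp add: wt'_def vac_weight_def fun_upd_idem)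
    qed (auto intro!: pure.step_raise[OF p] simp: vac_weight_def)
  qed
  moreover have "pure u ?w (wt n (lower (- 1) y))" for n
  proof (cases "n = - 1")
    case True
    then show ?thesis
      using c pure_sub[OF pure.base_lower[OF vac_wt[OF base_lower]] p] by (simp add: wt_lower)
  next
    case False
    then show ?thesis
      using c pure.base_lower[OF vac_wt[OF base_lower]] by (simp add: wt_lower_other)
  qed
  ultimately show ?case by blast
next
  case (step_lower w v k w')
  note c = pure_closed[OF step_lower.hyps(1)]
  note IH = step_lower.IH[THEN conjunct1, rule_format] step_lower.IH[THEN conjunct2, THEN conjunct1, rule_format]
    step_lower.IH[THEN conjunct2, THEN conjunct2, rule_format]
  have p: "pure u w' (lower k v)"
    using step_lower by (intro pure.step_lower)
  have "pure u (w'(n := w' n + 1)) (raise n (lower k v))" for n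
  proof (cases "n = k")
    case True
    then show ?thesis
      using pure_sub[OF IH(3)[of k] step_lower.hyps(1)] step_lower.hyps(3) c
      by (simp add: raise_lower_same)
  next
    case False
    then have "pure u (w'(n := w' n + 1)) (lower k (raise n v))"
      using step_lower.hyps by (intro pure.step_lower[OF IH(1)[of n]]) (auto simp: fun_upd_twist)
    then show ?thesis using False c by (simp add: raise_lower)
  qed
  moreover have "pure u (w'(n := w' n - 1)) (lower n (lower k v))" for n
  proof (cases "n = k")
    case True
    then show ?thesis
      using step_lower.hyps by (intro pure.step_lower[OF p]) auto
  next
    case False
    then have "pure u (w'(n := w' n - 1)) (lower k (lower n v))"
      using step_lower.hyps by (intro pure.step_lower[OF IH(2)[of n]]) (auto simp: fun_upd_twist)
    then show ?thesis using c by (simp add: lower_lower[of v n k])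
  qed
  moreover have "pure u w' (wt n (lower k v))" for n
  proof -
    have "pure u w' (lower k (wt n v))"
      using step_lower.hyps by (intro pure.step_lower[OF IH(3)]) auto
    then show ?thesis
      using pure_sub[OF _ p] c by (cases "n = k") (auto simp: wt_lower wt_lower_other)
  qed
  ultimately show ?case by blast
next
  case (step_raise w v k w')
  note c = pure_closed[OF step_raise.hyps(1)]
  note IH = step_raise.IH[THEN conjunct1, rule_format] step_raise.IH[THEN conjunct2, THEN conjunct1, rule_format]
    step_raise.IH[THEN conjunct2, THEN conjunct2, rule_format]
  have p: "pure u w' (raise k v)"
    using step_raise by (intro pure.step_raise)
  have "pure u (w'(n := w' n - 1)) (lower n (raise k v))" for n
  proof (cases "n = k")
    case True
    then show ?thesis
      using IH(3)[of k] step_raise.hyps(3) by (simp add: wt_def)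
  next
    case False
    then have "pure u (w'(n := w' n - 1)) (raise k (lower n v))"
      using step_raise.hyps by (intro pure.step_raise[OF IH(2)[of n]]) (auto simp: fun_upd_twist)
    then show ?thesis using False c raise_lower[of v k n] by simp
  qed
  moreover have "pure u (w'(n := w' n + 1)) (raise n (raise k v))" for n
  proof (cases "n = k")
    case True
    then show ?thesis
      using step_raise.hyps by (intro pure.step_raise[OF p]) auto
  next
    case False
    then have "pure u (w'(n := w' n + 1)) (raise k (raise n v))"
      using step_raise.hyps by (intro pure.step_raise[OF IH(1)[of n]]) (auto simp: fun_upd_twist)
    then show ?thesis using c by (simp add: raise_raise[of v n k])
  qed
  moreover have "pure u w' (wt n (raise k v))" for n
  proof -
    have "pure u w' (raise k (wt n v))"
      using step_raise.hyps by (intro pure.step_raise[OF IH(3)]) auto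
    then show ?thesis
      using pure.add[OF _ p] c by (cases "n = k") (auto simp: wt_raise wt_raise_other)
  qed
  ultimately show ?case by blast
next
  case (add w v v')
  then show ?case using pure_closed[of w] by (auto simp: op_add intro!: pure.add)
next
  case (sm w v c)
  then show ?case using pure_closed[of w] by (auto simp: op_sm intro!: pure.sm)
qed (auto intro: pure.zero)

lemma pure_reach: "pure u w v \<Longrightarrow> v = \<zero> \<or> reach w"
proof (induction rule: pure.induct)
  case (step_lower w v n w')
  then show ?case using reach_lower op_zero(2) by metis
next
  case (step_raise w v n w')
  then show ?case using reach_raise op_zero(1) by metis
next
  case (add w v v')
  then show ?case by auto
next
  case (sm w v c)
  then show ?case by auto
qed (blast intro: reach.intros)+

lemma vac_zero: "\<zero> \<in> vac_space u"
  using vac_space.sm[OF vac_space.base[of u], of 0] vac_closed[OF vac_space.base] by simp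

text \<open>An allowed step produces a value below 0 or above 1, whereas the three weights have only
  the values 0 and 1. So these weights arise from the base rules and linear combinations
  alone.\<close>

lemma pure_standard:
  "pure u w v \<Longrightarrow> (w = vac_weight \<longrightarrow> v \<in> vac_space u) \<and>
    (w = vac_weight(0 := 1) \<longrightarrow> v \<in> raise 0 ` vac_space u) \<and>
    (w = vac_weight(- 1 := 0) \<longrightarrow> v \<in> lower (- 1) ` vac_space u)"
proof (induction rule: pure.induct)
  case (base y)
  then show ?case by (auto simp: fun_eq_iff vac_weight_def)
next
  case (base_raise y)
  then show ?case by (auto simp: fun_eq_iff vac_weight_def)
next
  case (base_lower y)
  then show ?case by (auto simp: fun_eq_iff vac_weight_def)
next
  case (step_lower w v n w')
  then have "w' n < 0" by simp
  then show ?case by (auto simp: vac_weight_def split: if_splits)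
next
  case (step_raise w v n w')
  then have "w' n > 1" by simp
  then show ?case by (auto simp: vac_weight_def split: if_splits)
next
  case (zero w)
  then show ?case using vac_zero op_zero by (metis imageI)
next
  case (add w v v')
  have "a \<oplus> b \<in> T ` vac_space u" if "a \<in> T ` vac_space u" "b \<in> T ` vac_space u" "linop T" for a b T
    using that vac_space.add by (auto simp: linopD(2)[symmetric] vac_closed)
  note this[OF _ _ linops(1)] this[OF _ _ linops(2)]
  then show ?case using add.IH vac_space.add by (intro conjI impI) simp_all
next
  case (sm w v c)
  have "c \<odot> a \<in> T ` vac_space u" if "a \<in> T ` vac_space u" "linop T" for a T
    using that vac_space.sm by (auto simp: linopD(3)[symmetric] vac_closed)
  note this[OF _ linops(1)] this[OF _ linops(2)]
  then show ?case using sm.IH vac_space.sm by (intro conjI impI) simp_all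
qed

text \<open>The inverse of the last weight step takes v to a vector covered by the induction
  hypothesis. Going forth again multiplies by \<open>wt n\<close> at an eigenvalue below 0, or by
  \<open>wt n - 1\<close> at an eigenvalue above 1; both are invertible, which recovers v.\<close>

lemma pure_in_span:
  assumes "reach w" "pure u w v"
  shows "v \<in> bg_span M (bg_span M {v} \<inter> standard u)"
  using assms
proof (induction arbitrary: v rule: reach.induct)
  case reach_vac
  have "v \<in> standard u"
    using pure_standard[OF reach_vac.prems, THEN conjunct1, THEN mp, OF refl] by (simp add: standard_def)
  then have "v \<in> bg_span M {v} \<inter> standard u"
    using bg_span_incl[of v "{v}"] by simp
  then show ?case by (rule bg_span_incl)
next
  case reach_vac_raise
  have "v \<in> standard u"
    using pure_standard[OF reach_vac_raise.prems, THEN conjunct2, THEN conjunct1, THEN mp, OF refl] by (simp add: standard_def)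
  then have "v \<in> bg_span M {v} \<inter> standard u"
    using bg_span_incl[of v "{v}"] by simp
  then show ?case by (rule bg_span_incl)
next
  case reach_vac_lower
  have "v \<in> standard u"
    using pure_standard[OF reach_vac_lower.prems, THEN conjunct2, THEN conjunct2, THEN mp, OF refl] by (simp add: standard_def)
  then have "v \<in> bg_span M {v} \<inter> standard u"
    using bg_span_incl[of v "{v}"] by simp
  then show ?case by (rule bg_span_incl)
next
  case (reach_lower w n)
  let ?F = "bg_span M (bg_span M {v} \<inter> standard u)"
  have v: "v \<in> carrier M" using pure_closed[OF reach_lower.prems] .
  have sv: "bg_submodule (bg_span M {v}) M"
    using v by (intro bg_span_submodule) auto
  have F: "bg_submodule ?F M"
    using bg_submoduleD(1)[OF sv] by (intro bg_span_submodule) auto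
  have "pure u w (raise n v)"
    using pure_modes[OF reach_lower.prems, THEN conjunct1, rule_format, of n] by simp
  note reach_lower.IH[OF this]
  moreover have "bg_span M {raise n v} \<subseteq> bg_span M {v}"
    using op_submodule(1)[OF sv bg_span_incl] by (intro bg_span_subset[OF sv]) auto
  then have "bg_span M (bg_span M {raise n v} \<inter> standard u) \<subseteq> ?F"
    by (intro bg_span_mono) auto
  ultimately have "raise n v \<in> ?F" by blast
  then have "wts n 0 v \<in> ?F"
    using op_submodule(2)[OF F] v by (auto simp: wts_def wt_def)
  then show ?case
    using reach_lower.hyps by (intro invert_gen_weight[OF F pure_gen_weight[OF reach_lower.prems], of n 0]) auto
next
  case (reach_raise w n)
  let ?F = "bg_span M (bg_span M {v} \<inter> standard u)"
  have v: "v \<in> carrier M" using pure_closed[OF reach_raise.prems] .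
  have sv: "bg_submodule (bg_span M {v}) M"
    using v by (intro bg_span_submodule) auto
  have F: "bg_submodule ?F M"
    using bg_submoduleD(1)[OF sv] by (intro bg_span_submodule) auto
  have "pure u w (lower n v)"
    using pure_modes[OF reach_raise.prems, THEN conjunct2, THEN conjunct1, rule_format, of n] by simp
  note reach_raise.IH[OF this]
  moreover have "bg_span M {lower n v} \<subseteq> bg_span M {v}"
    using op_submodule(2)[OF sv bg_span_incl] by (intro bg_span_subset[OF sv]) auto
  then have "bg_span M (bg_span M {lower n v} \<inter> standard u) \<subseteq> ?F"
    by (intro bg_span_mono) auto
  ultimately have "lower n v \<in> ?F" by blast
  from op_submodule(1)[OF F this, of n] have "wts n 1 v \<in> ?F"
    by (simp add: wts_def raise_lower_same[OF v])
  then show ?case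
    using reach_raise.hyps by (intro invert_gen_weight[OF F pure_gen_weight[OF reach_raise.prems], of n 1]) auto
qed

section \<open>Weight decomposition of the generated module\<close>

definition pure_sum :: "'v \<Rightarrow> bool" where
  "pure_sum v \<longleftrightarrow> (\<exists>D g. finite D \<and> (\<forall>w. pure u w (g w)) \<and> v = finsum M g D)"

lemma pure_sum_closed: "pure_sum v \<Longrightarrow> v \<in> carrier M"
  using pure_closed by (auto simp: pure_sum_def intro!: finsum_closed)

lemma finsum_extend:
  assumes "finite D" "D \<subseteq> E" "finite E" "g \<in> E \<rightarrow> carrier M"
  shows "finsum M g D = finsum M (\<lambda>w. if w \<in> D then g w else \<zero>) E"
  using assms by (intro add.finprod_mono_neutral_cong_left) auto

lemma pure_sum_add:
  assumes "pure_sum v" "pure_sum v'"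
  shows "pure_sum (v \<oplus> v')"
proof -
  obtain D g where D: "finite D" "\<And>w. pure u w (g w)" "v = finsum M g D"
    using assms(1) by (auto simp: pure_sum_def)
  obtain E h where E: "finite E" "\<And>w. pure u w (h w)" "v' = finsum M h E"
    using assms(2) by (auto simp: pure_sum_def)
  let ?g = "\<lambda>w. if w \<in> D then g w else \<zero>" and ?h = "\<lambda>w. if w \<in> E then h w else \<zero>"
  have "v \<oplus> v' = finsum M ?g (D \<union> E) \<oplus> finsum M ?h (D \<union> E)"
    using D(1) E(1) pure_closed[OF D(2)] pure_closed[OF E(2)] unfolding D(3) E(3)
    by (intro arg_cong2[of _ _ _ _ "(\<oplus>)"] finsum_extend) auto
  also have "\<dots> = finsum M (\<lambda>w. ?g w \<oplus> ?h w) (D \<union> E)"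
    using pure_closed[OF D(2)] pure_closed[OF E(2)] by (intro finsum_addf[symmetric]) auto
  finally show ?thesis
    unfolding pure_sum_def using D E
    by (intro exI[of _ "D \<union> E"] exI[of _ "\<lambda>w. ?g w \<oplus> ?h w"]) (auto intro!: pure.add pure.zero)
qed

lemma pure_sum_sm: "pure_sum v \<Longrightarrow> pure_sum (c \<odot> v)"
proof -
  assume "pure_sum v"
  then obtain D g where D: "finite D" "\<And>w. pure u w (g w)" "v = finsum M g D"
    by (auto simp: pure_sum_def)
  then have "c \<odot> v = finsum M (\<lambda>w. c \<odot> g w) D"
    using pure_closed by (auto intro!: linop_finsum[OF linop_sm])
  moreover have "\<forall>w. pure u w (c \<odot> g w)"
    using pure.sm[OF D(2)] by simp
  ultimately show ?thesis
    unfolding pure_sum_def using D(1) by (intro exI[of _ D] exI[of _ "\<lambda>w. c \<odot> g w"]) simp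
qed

text \<open>\<open>s\<close> is the shift of weights caused by T. Its injectivity keeps the
  components at distinct weights, so that the image is again a sum indexed by weights.\<close>

lemma pure_sum_op:
  assumes "linop T" "inj s" "\<And>w x. pure u w x \<Longrightarrow> pure u (s w) (T x)" "pure_sum v"
  shows "pure_sum (T v)"
proof -
  obtain D g where D: "finite D" "\<And>w. pure u w (g w)" "v = finsum M g D"
    using assms(4) by (auto simp: pure_sum_def)
  let ?g = "\<lambda>w. if w \<in> range s then T (g (inv_into UNIV s w)) else \<zero>"
  have g: "pure u w (?g w)" for w
    using assms(2,3) D(2) by (auto intro: pure.zero)
  have "T v = (\<Oplus>w\<in>D. T (g w))"
    using D pure_closed by (auto intro!: linop_finsum assms(1))
  also have "\<dots> = (\<Oplus>w\<in>D. ?g (s w))"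
    using assms(2) linopD(1)[OF assms(1) pure_closed[OF D(2)]] by (intro finsum_cong') auto
  also have "\<dots> = finsum M ?g (s ` D)"
    using inj_on_subset[OF assms(2)] pure_closed[OF g] by (intro finsum_reindex[symmetric]) auto
  finally show ?thesis
    unfolding pure_sum_def using D(1) g by (intro exI[of _ "s ` D"] exI[of _ ?g]) simp
qed

lemma pure_sum_submodule: "bg_submodule {v. pure_sum v} M"
proof (rule bg_submoduleI)
  show "\<zero> \<in> {v. pure_sum v}"
    unfolding pure_sum_def by (auto intro!: exI[of _ "{}"] exI[of _ "\<lambda>_. \<zero>"] pure.zero)
  have r: "pure_sum (raise n x)" if "pure_sum x" for n x
  proof (rule pure_sum_op[OF _ _ _ that])
    show "inj (\<lambda>w :: int \<Rightarrow> int. w(n := w n + 1))"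
      by (rule injI) (metis add_right_cancel fun_upd_eqD fun_upd_triv fun_upd_upd)
  qed (use pure_modes in auto)
  have l: "pure_sum (lower n x)" if "pure_sum x" for n x
  proof (rule pure_sum_op[OF _ _ _ that])
    show "inj (\<lambda>w :: int \<Rightarrow> int. w(n := w n - 1))"
      by (rule injI) (metis diff_add_cancel fun_upd_eqD fun_upd_triv fun_upd_upd)
  qed (use pure_modes in auto)
  show "act M a x \<in> {v. pure_sum v}" if "x \<in> {v. pure_sum v}" for a x
    using r[of x] l[of x "- n" for n] that by (cases a) (auto simp: raise_def lower_def)
qed (auto intro: pure_sum_closed pure_sum_add pure_sum_sm)

lemma span_pure_sum: "v \<in> bg_span M {u} \<Longrightarrow> pure_sum v"
proof -
  have "pure_sum u"
    unfolding pure_sum_def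
    by (intro exI[of _ "{vac_weight}"] exI[of _ "\<lambda>w. if w = vac_weight then u else \<zero>"])
      (use vac_closed[OF vac_space.base] in \<open>auto intro!: pure.zero pure.base vac_space.base\<close>)
  then have "bg_span M {u} \<subseteq> {v. pure_sum v}"
    by (intro bg_span_subset pure_sum_submodule) auto
  then show "v \<in> bg_span M {u} \<Longrightarrow> pure_sum v" by auto
qed

text \<open>S contains the weight components of its vectors by \<open>separate_weights\<close>, and
  each component lies in the span of the standard vectors that it generates by
  \<open>pure_in_span\<close>. Questions about S thereby reduce to polynomials in
  \<open>wt 0\<close> and \<open>wt'\<close>.\<close>

theorem submodule_standard:
  assumes S: "bg_submodule S M" and sub: "S \<subseteq> bg_span M {u}"
  shows "S = bg_span M (S \<inter> standard u)"
proof
  have F: "bg_submodule (bg_span M (S \<inter> standard u)) M"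
    using bg_submoduleD(1)[OF S] by (intro bg_span_submodule) auto
  show "S \<subseteq> bg_span M (S \<inter> standard u)"
  proof
    fix v assume v: "v \<in> S"
    then obtain D g where D: "finite D" "\<And>w. pure u w (g w)" "v = finsum M g D"
      using sub span_pure_sum unfolding pure_sum_def by blast
    have "inj_on (\<lambda>w n. of_int (w n) :: complex) D"
      by (rule inj_onI) (auto simp: fun_eq_iff)
    then have g: "g w \<in> S" if "w \<in> D" for w
      using separate_weights[OF S D(1) _ _ _ that, of "\<lambda>w n. of_int (w n)" g]
        pure_gen_weight[OF D(2)] v D(3) by auto
    have "g w \<in> bg_span M (S \<inter> standard u)" if "w \<in> D" for w
    proof (cases "g w = \<zero>")
      case True
      then show ?thesis using bg_submoduleD(2)[OF F] by simp
    next
      case False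
      then have "g w \<in> bg_span M (bg_span M {g w} \<inter> standard u)"
        using pure_reach[OF D(2)] by (intro pure_in_span[OF _ D(2)]) auto
      also have "\<dots> \<subseteq> bg_span M (S \<inter> standard u)"
        using bg_span_subset[OF S, of "{g w}"] g[OF that] by (intro bg_span_mono) auto
      finally show ?thesis .
    qed
    with D(1) have "finsum M g D \<in> bg_span M (S \<inter> standard u)"
    proof (induction D rule: finite_induct)
      case (insert w E)
      then show ?case
        using bg_submoduleD(4)[OF F] pure_closed[OF D(2)] by (subst finsum_insert) auto
    qed (simp add: bg_submoduleD(2)[OF F])
    then show "v \<in> bg_span M (S \<inter> standard u)"
      using D(3) by blast
  qed
  show "bg_span M (S \<inter> standard u) \<subseteq> S"
    by (rule bg_span_subset[OF S]) auto
qed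

end

end

section \<open>Spectral flow, direct sums and homomorphisms out of cyclic modules\<close>

lemma sigma_mode_inverse: "sigma_mode n (sigma_mode (- n) a) = a"
  by (cases a) (auto simp: sigma_mode_def)

lemma mode_comm_sigma: "mode_comm (sigma_mode n a) (sigma_mode n b) = mode_comm a b"
  by (cases a; cases b) (auto simp: sigma_mode_def)

lemma spectral_flow_simps [simp]:
  "carrier (spectral_flow n M) = carrier M" "zero (spectral_flow n M) = zero M"
  "add (spectral_flow n M) = add M" "smult (spectral_flow n M) = smult M"
  "act (spectral_flow n M) a = act M (sigma_mode (- n) a)"
  by (simp_all add: spectral_flow_def)

lemma spectral_flow_premodule:
  assumes "bg_premodule M"
  shows "bg_premodule (spectral_flow n M)"
proof -
  interpret bg_premodule M by fact
  show ?thesis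
  proof (rule bg_premoduleI)
    fix x assume "x \<in> carrier (spectral_flow n M)"
    then show "- 1 \<odot>\<^bsub>spectral_flow n M\<^esub> x \<oplus>\<^bsub>spectral_flow n M\<^esub> x = \<zero>\<^bsub>spectral_flow n M\<^esub>"
      by simp
  qed (simp_all add: a_ac sm_l_distr sm_r_distr sm_assoc act_add act_smult del: sm_collect)
qed

lemma spectral_flow_module:
  assumes "bg_module M"
  shows "bg_module (spectral_flow n M)"
proof -
  interpret bg_module M by fact
  show ?thesis
  proof (rule bg_moduleI[OF spectral_flow_premodule[OF bg_premodule_axioms]])
    fix a b x assume "x \<in> carrier (spectral_flow n M)"
    then show "act (spectral_flow n M) a (act (spectral_flow n M) b x) =
      act (spectral_flow n M) b (act (spectral_flow n M) a x)
        \<oplus>\<^bsub>spectral_flow n M\<^esub> mode_comm a b \<odot>\<^bsub>spectral_flow n M\<^esub> x"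
      using act_swap[of x "sigma_mode (- n) a" "sigma_mode (- n) b"] by (simp add: mode_comm_sigma)
  qed
qed

lemma spectral_flow_submodule_iff:
  assumes "bg_premodule M"
  shows "bg_submodule N (spectral_flow n M) \<longleftrightarrow> bg_submodule N M"
proof -
  interpret A: bg_premodule M by fact
  interpret B: bg_premodule "spectral_flow n M" by (rule spectral_flow_premodule[OF assms])
  show ?thesis
  proof
    assume N: "bg_submodule N (spectral_flow n M)"
    show "bg_submodule N M"
    proof (rule A.bg_submoduleI)
      fix a x assume "x \<in> N"
      then have "act (spectral_flow n M) (sigma_mode n a) x \<in> N"
        by (rule B.bg_submoduleD(6)[OF N])
      then show "act M a x \<in> N"
        using sigma_mode_inverse[of "- n" a] by simp
    qed (use B.bg_submoduleD[OF N] in simp_all)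
  next
    assume N: "bg_submodule N M"
    show "bg_submodule N (spectral_flow n M)"
      by (rule B.bg_submoduleI) (use A.bg_submoduleD[OF N] in simp_all)
  qed
qed

lemma spectral_flow_span:
  "bg_premodule M \<Longrightarrow> bg_span (spectral_flow n M) S = bg_span M S"
  by (simp add: bg_span_def spectral_flow_submodule_iff)

lemma spectral_flow_ops:
  assumes "bg_premodule M"
  shows "bg_premodule.raise (spectral_flow n M) m = bg_premodule.raise M (m + n)"
    "bg_premodule.lower (spectral_flow n M) m = bg_premodule.lower M (m + n)"
  using assms spectral_flow_premodule[OF assms, of n]
  by (simp_all add: bg_premodule.raise_def bg_premodule.lower_def sigma_mode_def)

text \<open>Turns maps from a roof into a module with the flow undone, as constructed below, into
  maps from the flow of the roof.\<close>

lemma spectral_flow_hom_iff: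
  "f \<in> bg_hom (spectral_flow n A) B \<longleftrightarrow> f \<in> bg_hom A (spectral_flow (- n) B)"
proof -
  have "(\<forall>a. \<forall>x\<in>carrier A. f (act A (sigma_mode (- n) a) x) = act B a (f x)) \<longleftrightarrow>
    (\<forall>a. \<forall>x\<in>carrier A. f (act A a x) = act B (sigma_mode n a) (f x))"
    using sigma_mode_inverse[of n] sigma_mode_inverse[of "- n"] by (metis minus_minus)
  then show ?thesis
    by (auto simp: bg_hom_def)
qed

section \<open>Sums of two modules and graphs of homomorphisms\<close>

lemma sum2_simps [simp]:
  "carrier (bg_sum2 A B) = carrier A \<times> carrier B" "\<zero>\<^bsub>bg_sum2 A B\<^esub> = (\<zero>\<^bsub>A\<^esub>, \<zero>\<^bsub>B\<^esub>)"
  "(x, y) \<oplus>\<^bsub>bg_sum2 A B\<^esub> (x', y') = (x \<oplus>\<^bsub>A\<^esub> x', y \<oplus>\<^bsub>B\<^esub> y')"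
  "c \<odot>\<^bsub>bg_sum2 A B\<^esub> (x, y) = (c \<odot>\<^bsub>A\<^esub> x, c \<odot>\<^bsub>B\<^esub> y)"
  "act (bg_sum2 A B) a (x, y) = (act A a x, act B a y)"
  by (simp_all add: bg_sum2_def)

lemma sum2_module:
  assumes "bg_module A" "bg_module B"
  shows "bg_module (bg_sum2 A B)"
proof -
  interpret A: bg_module A by fact
  interpret B: bg_module B by fact
  show ?thesis
  proof (rule bg_moduleI)
    show "bg_premodule (bg_sum2 A B)"
      by (rule bg_premoduleI) (auto simp: A.a_ac B.a_ac A.sm_l_distr B.sm_l_distr A.sm_r_distr B.sm_r_distr
          A.sm_assoc B.sm_assoc A.act_add B.act_add A.act_smult B.act_smult simp del: A.sm_collect B.sm_collect, simp_all)
    fix a b z assume "z \<in> carrier (bg_sum2 A B)"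
    then obtain x y where "z = (x, y)" "x \<in> carrier A" "y \<in> carrier B" by auto
    then show "act (bg_sum2 A B) a (act (bg_sum2 A B) b z) =
      act (bg_sum2 A B) b (act (bg_sum2 A B) a z) \<oplus>\<^bsub>bg_sum2 A B\<^esub> mode_comm a b \<odot>\<^bsub>bg_sum2 A B\<^esub> z"
      using A.act_swap[of x a b] B.act_swap[of y a b] by simp
  qed
qed

lemma fst_hom: "fst \<in> bg_hom (bg_sum2 A B) A" and snd_hom: "snd \<in> bg_hom (bg_sum2 A B) B"
  by (auto intro!: bg_homI)

context bg_morphism
begin

lemma f_ops: "x \<in> carrier M \<Longrightarrow> f (M.raise n x) = Q.raise n (f x)"
  "x \<in> carrier M \<Longrightarrow> f (M.lower n x) = Q.lower n (f x)"
  by (simp_all add: M.raise_def M.lower_def Q.raise_def Q.lower_def f_act)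

lemma f_wt: "x \<in> carrier M \<Longrightarrow> f (M.wt n x) = Q.wt n (f x)"
  by (simp add: M.wt_def Q.wt_def f_ops)

lemma f_pow:
  assumes "M.linop T" "\<And>x. x \<in> carrier M \<Longrightarrow> f (T x) = T' (f x)" "x \<in> carrier M"
  shows "f ((T ^^ m) x) = (T' ^^ m) (f x)"
  using assms(2,3) M.pow_closed[OF assms(1)] by (induction m) auto

end

lemma bg_morphismI: "bg_premodule M \<Longrightarrow> bg_premodule Q \<Longrightarrow> f \<in> bg_hom M Q \<Longrightarrow> bg_morphism M Q f"
  by (simp add: bg_morphism_def bg_morphism_axioms_def)

locale bg_module_morphism = M: bg_module M + Q: bg_module Q
  for M :: "'v bg_module" and Q :: "'w bg_module" +
  fixes f
  assumes hom': "f \<in> bg_hom M Q"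

sublocale bg_module_morphism \<subseteq> bg_morphism
  by unfold_locales (rule hom')

context bg_module_morphism
begin

lemma f_wt': "x \<in> carrier M \<Longrightarrow> f (M.wt' x) = Q.wt' (f x)"
  by (simp add: M.wt'_def Q.wt'_def f_ops)

end

lemma roof_relations_sum2:
  assumes A: "bg_module A" "bg_module.roof_relations A x" and B: "bg_module B" "bg_module.roof_relations B y"
  shows "bg_module.roof_relations (bg_sum2 A B) (x, y)"
proof -
  interpret A: bg_module A by fact
  interpret B: bg_module B by fact
  interpret S: bg_module "bg_sum2 A B" by (rule sum2_module[OF A(1) B(1)])
  have x: "x \<in> carrier A" and y: "y \<in> carrier B"
    using A(2) B(2) by (auto simp: A.roof_relations_def B.roof_relations_def)
  have r: "S.raise n (a, b) = (A.raise n a, B.raise n b)" "S.lower n (a, b) = (A.lower n a, B.lower n b)" for n a b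
    by (simp_all add: S.raise_def S.lower_def A.raise_def A.lower_def B.raise_def B.lower_def)
  have nil: "S.nil T (x, y)" if h: "A.nil T1 x" "B.nil T2 y" "\<And>a b. T (a, b) = (T1 a, T2 b)"
    "A.linop T1" "B.linop T2" for T T1 T2
  proof -
    obtain m k where m: "(T1 ^^ m) x = \<zero>\<^bsub>A\<^esub>" "(T2 ^^ k) y = \<zero>\<^bsub>B\<^esub>"
      using h(1,2) unfolding A.nil_def B.nil_def by blast
    have "(T ^^ j) (x, y) = ((T1 ^^ j) x, (T2 ^^ j) y)" for j
      by (induction j) (auto simp: h)
    then show ?thesis
      unfolding S.nil_def
      using A.pow_mono_zero[OF h(4) m(1), of "max m k"] B.pow_mono_zero[OF h(5) m(2), of "max m k"]
      by (intro exI[of _ "max m k"]) simp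
  qed
  have "S.nil (S.wt 0) (x, y)"
    using A(2) B(2) by (intro nil[of "A.wt 0" "B.wt 0"])
      (auto simp: A.roof_relations_def B.roof_relations_def S.wt_def A.wt_def B.wt_def r)
  moreover have "S.nil S.wt' (x, y)"
    using A(2) B(2) by (intro nil[of A.wt' B.wt'])
      (auto simp: A.roof_relations_def B.roof_relations_def S.wt'_def A.wt'_def B.wt'_def r A.linop_wt' B.linop_wt')
  ultimately show ?thesis
    using A(2) B(2) x y by (auto simp: S.roof_relations_def A.roof_relations_def B.roof_relations_def r)
qed

text \<open>The graph of the homomorphism is the submodule generated by the pair of generators.\<close>

theorem hom_from_cyclic:
  assumes A: "bg_module A" "bg_module.roof_relations A x" "bg_span A {x} = carrier A"
    and B: "bg_module B" "bg_module.roof_relations B y"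
    and std: "\<And>a b. (a, b) \<in> bg_module.standard (bg_sum2 A B) (x, y) \<Longrightarrow> a = \<zero>\<^bsub>A\<^esub> \<Longrightarrow> b = \<zero>\<^bsub>B\<^esub>"
  obtains f where "f \<in> bg_hom A B" "f x = y"
proof -
  interpret A: bg_module A by fact
  interpret B: bg_module B by fact
  interpret S: bg_module "bg_sum2 A B" by (rule sum2_module[OF A(1) B(1)])
  interpret F: bg_morphism "bg_sum2 A B" A fst
    by (rule bg_morphismI[OF S.bg_premodule_axioms A.bg_premodule_axioms fst_hom])
  have x: "x \<in> carrier A" and y: "y \<in> carrier B"
    using A(2) B(2) by (auto simp: A.roof_relations_def B.roof_relations_def)
  define D where "D = bg_span (bg_sum2 A B) {(x, y)}"
  have D: "bg_submodule D (bg_sum2 A B)"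
    unfolding D_def using x y by (intro S.bg_span_submodule) auto
  note DD = S.bg_submoduleD[OF D]
  \<comment> \<open>The part of the would-be graph over 0. The relation D is single-valued if K
    vanishes, and by \<open>submodule_standard\<close> only the standard vectors in K need to be
    examined.\<close>
  define K where "K = {z \<in> D. fst z = \<zero>\<^bsub>A\<^esub>}"
  have "K = D \<inter> {z \<in> carrier (bg_sum2 A B). fst z \<in> {\<zero>\<^bsub>A\<^esub>}}"
    using DD(1) by (auto simp: K_def)
  then have K: "bg_submodule K (bg_sum2 A B)"
    using S.bg_submodule_Int[OF D F.preimage_submodule[OF A.bg_submodule_zero]] by simp
  have "K \<inter> S.standard (x, y) \<subseteq> {\<zero>\<^bsub>bg_sum2 A B\<^esub>}"
    using std by (auto simp: K_def)
  then have "bg_span (bg_sum2 A B) (K \<inter> S.standard (x, y)) \<subseteq> {\<zero>\<^bsub>bg_sum2 A B\<^esub>}"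
    by (intro S.bg_span_subset S.bg_submodule_zero)
  then have K0: "K \<subseteq> {\<zero>\<^bsub>bg_sum2 A B\<^esub>}"
    using S.submodule_standard[OF roof_relations_sum2[OF A(1,2) B] K] by (auto simp: K_def D_def)
  have uniq: "b = b'" if "(a, b) \<in> D" "(a, b') \<in> D" for a b b'
  proof -
    have c: "a \<in> carrier A" "b \<in> carrier B" "b' \<in> carrier B"
      using DD(1) that by auto
    have "(a, b) \<oplus>\<^bsub>bg_sum2 A B\<^esub> ((- 1) \<odot>\<^bsub>bg_sum2 A B\<^esub> (a, b')) \<in> D"
      by (intro DD(4) DD(5) that)
    then have "(\<zero>\<^bsub>A\<^esub>, b \<oplus>\<^bsub>B\<^esub> (- 1) \<odot>\<^bsub>B\<^esub> b') \<in> K"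
      using c by (simp add: K_def)
    then have "b \<ominus>\<^bsub>B\<^esub> b' = \<zero>\<^bsub>B\<^esub>"
      using K0 c by (auto simp: B.minus_eq')
    then show ?thesis using B.minus_zero_iff c by simp
  qed
  have "fst ` D = carrier A"
    unfolding D_def using x y A(3) by (subst F.span_image) auto
  then have ex: "\<exists>b. (a, b) \<in> D" if "a \<in> carrier A" for a
    using that by force
  define f where "f a = (THE b. (a, b) \<in> D)" for a
  have f: "(a, f a) \<in> D" if "a \<in> carrier A" for a
    unfolding f_def using ex[OF that] uniq by (rule_tac theI') blast
  have fI: "f a = b" if "(a, b) \<in> D" for a b
  proof -
    have "a \<in> carrier A" using that DD(1) by auto
    then show ?thesis using uniq[OF f that] by simp
  qed
  show ?thesis
  proof
    show "f x = y"
      by (intro fI) (simp add: D_def S.bg_span_incl)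
    show "f \<in> bg_hom A B"
    proof (rule bg_homI)
      fix a assume a: "a \<in> carrier A"
      show "f a \<in> carrier B" using f[OF a] DD(1) by auto
      show "f (c \<odot>\<^bsub>A\<^esub> a) = c \<odot>\<^bsub>B\<^esub> f a" for c
        using DD(5)[OF f[OF a], of c] by (intro fI) simp
      show "f (act A m a) = act B m (f a)" for m
        using DD(6)[OF f[OF a], of m] by (intro fI) simp
      fix a' assume a': "a' \<in> carrier A"
      show "f (a \<oplus>\<^bsub>A\<^esub> a') = f a \<oplus>\<^bsub>B\<^esub> f a'"
        using DD(4)[OF f[OF a] f[OF a']] by (intro fI) simp
    qed
  qed
qed

section \<open>Polynomials in an operator, applied to a vector\<close>

context bg_premodule
begin

text \<open>The list holds the coefficients of a polynomial in T, constant term first. The recursion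
  is chosen so that prepending 0 is multiplication by T.\<close>

primrec horner :: "('v \<Rightarrow> 'v) \<Rightarrow> complex list \<Rightarrow> 'v \<Rightarrow> 'v" where
  "horner T [] v = \<zero>"
| "horner T (c # cs) v = c \<odot> v \<oplus> T (horner T cs v)"

lemma horner_closed [simp]: "linop T \<Longrightarrow> v \<in> carrier M \<Longrightarrow> horner T cs v \<in> carrier M"
  by (induction cs) (auto simp: linopD)

lemma horner_commute:
  assumes "linop T" "linop S" "\<And>x. x \<in> carrier M \<Longrightarrow> S (T x) = T (S x)" "v \<in> carrier M"
  shows "S (horner T cs v) = horner T cs (S v)"
  using assms by (induction cs) (auto simp: linop_zero linopD)

lemma horner_add:
  assumes T: "linop T" "v \<in> carrier M"
  shows "\<exists>es. horner T cs v \<oplus> horner T ds v = horner T es v"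
proof (induction cs arbitrary: ds)
  case Nil
  then show ?case using assms by (intro exI[of _ ds]) simp
next
  case (Cons c cs)
  show ?case
  proof (cases ds)
    case Nil
    then show ?thesis using assms Cons by (intro exI[of _ "c # cs"]) (simp add: linopD)
  next
    case (Cons d ds')
    obtain es where es: "horner T cs v \<oplus> horner T ds' v = horner T es v"
      using Cons.IH by blast
    have "horner T (c # cs) v \<oplus> horner T ds v = (c + d) \<odot> v \<oplus> (T (horner T cs v) \<oplus> T (horner T ds' v))"
      using T Cons by (simp add: linopD a_ac)
    also have "\<dots> = horner T ((c + d) # es) v"
      using T by (simp add: linopD es[symmetric])
    finally show ?thesis by blast
  qed
qed

lemma horner_sm: "linop T \<Longrightarrow> v \<in> carrier M \<Longrightarrow> c \<odot> horner T cs v = horner T (map ((*) c) cs) v"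
proof (induction cs)
  case (Cons d cs)
  then show ?case using linopD(3)[of T "horner T cs v" c] by (simp add: linopD sm_r_distr sm_assoc)
qed simp

text \<open>In terms of the polynomial with coefficient list cs: it is divisible by T^i.\<close>

lemma horner_eq_zero:
  assumes T: "linop T" and "v \<in> carrier M" "nil T v" "horner T cs v = \<zero>"
    "j < i" "j < length cs" "(T ^^ (i - 1)) v \<noteq> \<zero>"
  shows "cs ! j = 0"
  using assms(2-)
proof (induction cs arbitrary: v i j)
  case (Cons c cs)
  \<comment> \<open>The nilpotency order of v: the power one below it kills all terms but the
    constant one, which isolates the coefficient c. The tail is then treated at \<open>T v\<close>,
    whose order is smaller by one.\<close>
  define m where "m = (LEAST m. (T ^^ m) v = \<zero>)"
  have m: "(T ^^ m) v = \<zero>"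
    unfolding m_def by (rule LeastI_ex) (use Cons.prems(2) in \<open>simp add: nil_def\<close>)
  have "m \<noteq> 0"
  proof
    assume "m = 0"
    then have "v = \<zero>" using m by simp
    then show False using Cons.prems(6) pow_zero[OF T] by simp
  qed
  then obtain k where k: "m = Suc k" using not0_implies_Suc by blast
  have nz: "(T ^^ k) v \<noteq> \<zero>"
    using not_less_Least[of k "\<lambda>m. (T ^^ m) v = \<zero>"] k unfolding m_def by auto
  have Tk: "(T ^^ k) (T x) = T ((T ^^ k) x)" for x
    by (simp add: funpow_swap1)
  have "(T ^^ k) (T (horner T cs v)) = horner T cs ((T ^^ k) (T v))"
    by (rule horner_commute[OF T linop_comp[OF linop_pow[OF T] T] _ Cons.prems(1)]) (simp add: Tk)
  also have "(T ^^ k) (T v) = \<zero>"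
    using m k by (simp add: Tk)
  also have "horner T cs \<zero> = \<zero>"
    by (induction cs) (auto simp: linop_zero[OF T])
  finally have "(T ^^ k) (horner T (c # cs) v) = c \<odot> (T ^^ k) v"
    using T Cons.prems(1) by (simp add: linopD(1)[OF T] linopD(1-3)[OF linop_pow[OF T]])
  then have "c \<odot> (T ^^ k) v = \<zero>"
    using Cons.prems(3) pow_zero[OF T] by simp
  then have c: "c = 0"
    using nz sm_assoc[of "(T ^^ k) v" "inverse c" c] pow_closed[OF T Cons.prems(1)] by (cases "c = 0") auto
  show ?case
  proof (cases j)
    case 0
    then show ?thesis using c by simp
  next
    case (Suc j')
    have "horner T cs (T v) = \<zero>"
      using Cons.prems(1,3) c T horner_commute[OF T T _ Cons.prems(1), of cs] by (simp add: linopD)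
    moreover have "nil T (T v)"
      using m k unfolding nil_def by (intro exI[of _ k]) (simp add: Tk)
    moreover have "(T ^^ (i - 1 - 1)) (T v) \<noteq> \<zero>"
    proof -
      have "i - 1 = Suc (i - 1 - 1)" using Suc Cons.prems(4) by simp
      then show ?thesis
        using Cons.prems(6) by (metis funpow.simps(2) funpow_swap1 o_apply)
    qed
    ultimately show ?thesis
      using Cons.IH[of "T v" j' "i - 1"] Cons.prems(1,4,5) Suc T by (simp add: linopD)
  qed
qed simp

text \<open>Counterpart of \<open>horner_eq_zero\<close>. Together they carry a polynomial relation
  from a vector of high nilpotency order to one of low order.\<close>

lemma horner_zero_if:
  assumes T: "linop T" and "v \<in> carrier M" "(T ^^ i) v = \<zero>" "\<And>j. j < i \<Longrightarrow> j < length cs \<Longrightarrow> cs ! j = 0"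
  shows "horner T cs v = \<zero>"
  using assms(2-)
proof (induction cs arbitrary: v i)
  case (Cons c cs)
  show ?case
  proof (cases i)
    case 0
    then have "v = \<zero>" using Cons.prems by simp
    have "horner T ds \<zero> = \<zero>" for ds
      using T by (induction ds) (auto simp: linop_zero)
    then show ?thesis using \<open>v = \<zero>\<close> by blast
  next
    case (Suc i')
    have "horner T cs (T v) = \<zero>"
    proof (rule Cons.IH)
      show "(T ^^ i') (T v) = \<zero>" using Cons.prems(2) Suc by (simp add: funpow_swap1)
      show "cs ! j = 0" if "j < i'" "j < length cs" for j
        using Cons.prems(3)[of "Suc j"] that Suc by simp
    qed (use T Cons.prems in \<open>simp add: linopD\<close>)
    then show ?thesis
      using Cons.prems(1) Cons.prems(3)[of 0] Suc T horner_commute[OF T T _ Cons.prems(1), of cs] by simp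
  qed
qed simp

end

lemma (in bg_morphism) f_horner:
  assumes "M.linop T" "\<And>x. x \<in> carrier M \<Longrightarrow> f (T x) = T' (f x)" "x \<in> carrier M"
  shows "f (M.horner T cs x) = Q.horner T' cs (f x)"
  using assms M.linopD(1)[OF assms(1)] by (induction cs) (auto simp: f_add f_sm)

context bg_module
begin

context
  fixes u
  assumes u: "roof_relations u"
begin

text \<open>The product contains \<open>raise 0 (lower (- 1) _)\<close>, which the relations
  kill.\<close>

lemma vac_wt_wt': "y \<in> vac_space u \<Longrightarrow> wt 0 (wt' y) = \<zero>" "y \<in> vac_space u \<Longrightarrow> wt' (wt 0 y) = \<zero>"
proof -
  assume y: "y \<in> vac_space u"
  then show "wt 0 (wt' y) = \<zero>"
    using vac_raise_lower[OF u y] vac_closed[OF u y]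
    by (simp add: wt_def wt'_def raise_raise[of "lower (- 1) y" 0 "- 1"])
  then show "wt' (wt 0 y) = \<zero>"
    using wt_wt'[OF vac_closed[OF u y]] by simp
qed

lemma horner_vac:
  "horner (wt 0) cs u \<in> vac_space u" "horner wt' cs u \<in> vac_space u"
  by (induction cs) (auto intro: vac_space.intros vac_zero[OF u])

text \<open>Without mixed monomials, a polynomial in the two operators is a constant plus a multiple
  of each. The constant c stays apart because it can be counted with either of the one-variable
  polynomials.\<close>

lemma vac_space_horner:
  assumes "y \<in> vac_space u"
  shows "\<exists>c cs ds. y = c \<odot> u \<oplus> (wt 0 (horner (wt 0) cs u) \<oplus> wt' (horner wt' ds u))"
  using assms
proof induction
  case base
  have "u \<in> carrier M" using u by (simp add: roof_relations_def)
  then have "u = 1 \<odot> u \<oplus> (wt 0 (horner (wt 0) [] u) \<oplus> wt' (horner wt' [] u))"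
    by (simp add: linop_zero[OF linop_wt'])
  then show ?case by blast
next
  case (wt y)
  then obtain c cs ds where y: "y = c \<odot> u \<oplus> (wt 0 (horner (wt 0) cs u) \<oplus> wt' (horner wt' ds u))" by blast
  have uc: "u \<in> carrier M" using u by (simp add: roof_relations_def)
  have "wt 0 y = 0 \<odot> u \<oplus> (wt 0 (horner (wt 0) (c # cs) u) \<oplus> wt' (horner wt' [] u))"
    using uc vac_wt_wt'(1)[OF horner_vac(2)] unfolding y
    by (simp add: op_add op_sm linop_wt' linop_zero[OF linop_wt'])
  then show ?case by blast
next
  case (wt' y)
  then obtain c cs ds where y: "y = c \<odot> u \<oplus> (wt 0 (horner (wt 0) cs u) \<oplus> wt' (horner wt' ds u))" by blast
  have uc: "u \<in> carrier M" using u by (simp add: roof_relations_def)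
  have "wt' y = 0 \<odot> u \<oplus> (wt 0 (horner (wt 0) [] u) \<oplus> wt' (horner wt' (c # ds) u))"
    using uc vac_wt_wt'(2)[OF horner_vac(1)] unfolding y
    by (simp add: linopD(2,3)[OF linop_wt'] linop_wt')
  then show ?case by blast
next
  case (add y z)
  have uc: "u \<in> carrier M" using u by (simp add: roof_relations_def)
  obtain c cs ds where y: "y = c \<odot> u \<oplus> (wt 0 (horner (wt 0) cs u) \<oplus> wt' (horner wt' ds u))"
    using add by blast
  obtain c' cs' ds' where z: "z = c' \<odot> u \<oplus> (wt 0 (horner (wt 0) cs' u) \<oplus> wt' (horner wt' ds' u))"
    using add by blast
  obtain es where es: "horner (wt 0) cs u \<oplus> horner (wt 0) cs' u = horner (wt 0) es u"
    using horner_add[OF linops(3) uc] by blast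
  obtain fs where fs: "horner wt' ds u \<oplus> horner wt' ds' u = horner wt' fs u"
    using horner_add[OF linop_wt' uc] by blast
  have "y \<oplus> z = (c \<odot> u \<oplus> c' \<odot> u) \<oplus> ((wt 0 (horner (wt 0) cs u) \<oplus> wt 0 (horner (wt 0) cs' u)) \<oplus>
      (wt' (horner wt' ds u) \<oplus> wt' (horner wt' ds' u)))"
    unfolding y z using uc by (simp add: linop_wt' a_ac del: sm_collect)
  also have "\<dots> = (c + c') \<odot> u \<oplus> (wt 0 (horner (wt 0) es u) \<oplus> wt' (horner wt' fs u))"
    using uc by (simp add: es[symmetric] fs[symmetric] linopD(2,3)[OF linop_wt'] op_add linop_wt')
  finally show ?case by blast
next
  case (sm y c')
  then obtain c cs ds where y: "y = c \<odot> u \<oplus> (wt 0 (horner (wt 0) cs u) \<oplus> wt' (horner wt' ds u))" by blast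
  have uc: "u \<in> carrier M" using u by (simp add: roof_relations_def)
  have "c' \<odot> y = (c' * c) \<odot> u \<oplus> (wt 0 (c' \<odot> horner (wt 0) cs u) \<oplus> wt' (c' \<odot> horner wt' ds u))"
    using uc unfolding y by (simp add: sm_r_distr sm_assoc op_sm linopD(3)[OF linop_wt'] linop_wt')
  then show ?case
    unfolding horner_sm[OF linops(3) uc] horner_sm[OF linop_wt' uc] by blast
qed

end

section \<open>Vacuum vectors\<close>

definition vacuum :: "'v \<Rightarrow> bool" where
  "vacuum u \<longleftrightarrow> u \<in> carrier M \<and> (\<forall>n\<ge>0. raise n u = \<zero>) \<and> (\<forall>n<0. lower n u = \<zero>)"

lemma vacuum_wt: "vacuum u \<Longrightarrow> wt 0 u = \<zero>" "vacuum u \<Longrightarrow> wt' u = \<zero>"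
  by (simp_all add: vacuum_def wt_def wt'_def)

lemma vacuum_roof_relations: "vacuum u \<Longrightarrow> roof_relations u"
  using vacuum_wt[of u] unfolding roof_relations_def nil_def
  by (auto simp: vacuum_def intro!: exI[of _ "Suc 0"])

lemma vacuum_standard:
  assumes u: "vacuum u" and "s \<in> standard u"
  shows "\<exists>c. s = c \<odot> u"
proof -
  have uc: "u \<in> carrier M" using u by (simp add: vacuum_def)
  have Y: "\<exists>c. y = c \<odot> u" if "y \<in> vac_space u" for y
    using that
  proof induction
    case base
    show ?case using uc by (intro exI[of _ 1]) simp
  next
    case (wt y)
    then show ?case using vacuum_wt[OF u] uc by (auto intro!: exI[of _ 0] simp: op_sm)
  next
    case (wt' y)
    then show ?case
      using vacuum_wt[OF u] uc by (auto intro!: exI[of _ 0] simp: linopD(3)[OF linop_wt'])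
  next
    case (add y z)
    then show ?case using uc by (auto simp: sm_l_distr[symmetric])
  next
    case (sm y c)
    then show ?case using uc by (auto simp: sm_assoc)
  qed
  have z: "raise 0 u = \<zero>" "lower (- 1) u = \<zero>"
    using u by (auto simp: vacuum_def)
  consider "s \<in> vac_space u" | y where "y \<in> vac_space u" "s = raise 0 y \<or> s = lower (- 1) y"
    using assms(2) by (auto simp: standard_def)
  then show ?thesis
  proof cases
    case 1
    then show ?thesis by (rule Y)
  next
    case 2
    then obtain c where "y = c \<odot> u" using Y by blast
    then have "s = 0 \<odot> u" using 2 z uc by (auto simp: op_sm)
    then show ?thesis by blast
  qed
qed

end

section \<open>Linear maps between spaces of finitely supported functions\<close>

abbreviation single where "single \<equiv> Poly_Mapping.single"

lemma lookup_scale [simp]: "Poly_Mapping.lookup (pm_scale c f) x = c * Poly_Mapping.lookup f x"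
  for c :: complex
  by (simp add: Poly_Mapping.map.rep_eq when_def)

lemma scale_simps [simp]:
  fixes c :: complex
  shows "pm_scale c 0 = 0" "pm_scale 0 f = 0" "pm_scale 1 f = f" "pm_scale c (single x d) = single x (c * d)"
    "pm_scale c (pm_scale d f) = pm_scale (c * d) f"
    "pm_scale (- 1) f = - f"
  by (auto intro!: poly_mapping_eqI simp: lookup_single when_def)

lemma scale_add:
  fixes c :: complex
  shows "pm_scale c (f + h) = pm_scale c f + pm_scale c h" "pm_scale (c + d) f = pm_scale c f + pm_scale d f"
    "pm_scale c (f - h) = pm_scale c f - pm_scale c h" "pm_scale (- c) f = - pm_scale c f"
    "pm_scale c (- f) = - pm_scale c f"
  by (auto intro!: poly_mapping_eqI simp: lookup_add lookup_minus algebra_simps)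

lemma keys_scale: "Poly_Mapping.keys (pm_scale c f) \<subseteq> Poly_Mapping.keys f" for c :: complex
  by (auto simp: in_keys_iff)

definition pm_linear :: "(('a \<Rightarrow>\<^sub>0 complex) \<Rightarrow> ('b \<Rightarrow>\<^sub>0 complex)) \<Rightarrow> bool" where
  "pm_linear h \<longleftrightarrow> (\<forall>f f'. h (f + f') = h f + h f') \<and> (\<forall>c f. h (pm_scale c f) = pm_scale c (h f))"

lemma pm_linearD:
  assumes "pm_linear h"
  shows "h (f + f') = h f + h f'" "h (pm_scale c f) = pm_scale c (h f)" "h 0 = 0" "h (- f) = - h f"
    "h (f - f') = h f - h f'"
proof -
  show *: "h (f + f') = h f + h f'" "h (pm_scale c f) = pm_scale c (h f)" for f f' c
    using assms by (auto simp: pm_linear_def)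
  show "h 0 = 0" using *(2)[of 0 0] by simp
  show **: "h (- f) = - h f" for f using *(2)[of "- 1" f] by simp
  show "h (f - f') = h f - h f'" using *(1)[of f "- f'"] **[of f'] by simp
qed

lemma free_vectors_decompose:
  fixes f :: "'a \<Rightarrow>\<^sub>0 complex"
  shows "f = (\<Sum>x\<in>Poly_Mapping.keys f. single x (Poly_Mapping.lookup f x))"
proof (rule poly_mapping_eqI)
  fix k
  have "(\<Sum>x\<in>Poly_Mapping.keys f. Poly_Mapping.lookup (single x (Poly_Mapping.lookup f x)) k) =
    (\<Sum>x\<in>Poly_Mapping.keys f. if x = k then Poly_Mapping.lookup f k else 0)"
    by (intro sum.cong) (auto simp: lookup_single)
  then show "Poly_Mapping.lookup f k =
      Poly_Mapping.lookup (\<Sum>x\<in>Poly_Mapping.keys f. single x (Poly_Mapping.lookup f x)) k"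
    by (simp add: lookup_sum in_keys_iff)
qed

lemma free_vectors_add: "f \<in> free_vectors S \<Longrightarrow> h \<in> free_vectors S \<Longrightarrow> f + h \<in> free_vectors S"
  using keys_add[of f h] by auto

lemma free_vectors_induct [consumes 1, case_names zero single add]:
  fixes f :: "'a \<Rightarrow>\<^sub>0 complex"
  assumes "f \<in> free_vectors S" and "P 0" and s: "\<And>x c. x \<in> S \<Longrightarrow> P (single x c)"
    and add: "\<And>f h. f \<in> free_vectors S \<Longrightarrow> h \<in> free_vectors S \<Longrightarrow> P f \<Longrightarrow> P h \<Longrightarrow> P (f + h)"
  shows "P f"
proof -
  have "P (\<Sum>x\<in>A. single x (Poly_Mapping.lookup f x)) \<and> (\<Sum>x\<in>A. single x (Poly_Mapping.lookup f x)) \<in> free_vectors S"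
    if "finite A" "A \<subseteq> S" for A
    using that
  proof (induction A rule: finite_induct)
    case empty
    then show ?case using assms(2) by simp
  next
    case (insert x A)
    let ?t = "single x (Poly_Mapping.lookup f x)" and ?r = "\<Sum>x\<in>A. single x (Poly_Mapping.lookup f x)"
    have t: "?t \<in> free_vectors S" "P ?t"
      using insert.prems s by auto
    have r: "P ?r" "?r \<in> free_vectors S"
      using insert by blast+
    have "P (?t + ?r) \<and> ?t + ?r \<in> free_vectors S"
      using add[OF t(1) r(2) t(2) r(1)] free_vectors_add[OF t(1) r(2)] by blast
    then show ?case unfolding sum.insert[OF insert.hyps] by blast
  qed
  from this[of "Poly_Mapping.keys f"] show ?thesis
    using assms(1) free_vectors_decompose[of f] by simp
qed

lemma free_vectors_scale: "f \<in> free_vectors S \<Longrightarrow> pm_scale c f \<in> free_vectors S" for c :: complex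
  using keys_scale[of c f] by auto

lemma pm_linear_lin_ext: "pm_linear (lin_ext g)"
proof -
  \<comment> \<open>Supports can shrink by cancellation, so sums are compared over a common finite
    superset.\<close>
  have ext: "lin_ext g f = (\<Sum>x\<in>A. pm_scale (Poly_Mapping.lookup f x) (g x))"
    if "finite A" "Poly_Mapping.keys f \<subseteq> A" for f A
    unfolding lin_ext_def using that by (intro sum.mono_neutral_left) (auto simp: in_keys_iff)
  have "lin_ext g (f + h) = lin_ext g f + lin_ext g h" for f h
  proof -
    let ?A = "Poly_Mapping.keys f \<union> Poly_Mapping.keys h"
    have "Poly_Mapping.keys (f + h) \<subseteq> ?A" by (rule keys_add)
    then show ?thesis
      using ext[of ?A f] ext[of ?A h] ext[of ?A "f + h"]
      by (simp add: lookup_add scale_add sum.distrib)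
  qed
  moreover have "lin_ext g (pm_scale c f) = pm_scale c (lin_ext g f)" for c f
  proof -
    have lin: "pm_scale c (\<Sum>x\<in>A. h x) = (\<Sum>x\<in>A. pm_scale c (h x))" for A and h :: "'a \<Rightarrow> ('b \<Rightarrow>\<^sub>0 complex)"
      by (induction A rule: infinite_finite_induct) (auto simp: scale_add)
    show ?thesis
      using ext[of "Poly_Mapping.keys f" f] ext[OF _ keys_scale, of f c] by (simp add: lin)
  qed
  ultimately show ?thesis by (simp add: pm_linear_def)
qed

lemma lin_ext_single [simp]: "lin_ext g (single x c) = pm_scale c (g x)"
  by (cases "c = 0") (auto simp: lin_ext_def)

lemma pm_linear_eq_on:
  assumes "pm_linear h" "pm_linear h'" "\<And>x. x \<in> S \<Longrightarrow> h (single x 1) = h' (single x 1)"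
    and "f \<in> free_vectors S"
  shows "h f = h' f"
  using assms(4)
proof (induction rule: free_vectors_induct)
  case (single x c)
  then show ?case
    using assms(3)[OF single] pm_linearD(2)[OF assms(1), of c "single x 1"]
      pm_linearD(2)[OF assms(2), of c "single x 1"] by simp
qed (simp_all add: pm_linearD[OF assms(1)] pm_linearD[OF assms(2)])

lemma pm_linear_eq:
  assumes "pm_linear h" "pm_linear h'" "\<And>x. h (single x 1) = h' (single x 1)"
  shows "h f = h' f"
  using pm_linear_eq_on[OF assms(1,2), of UNIV f] assms(3) by simp

lemma pm_linear_free_vectors:
  assumes "pm_linear h" "\<And>x. x \<in> S \<Longrightarrow> h (single x 1) \<in> free_vectors T" "f \<in> free_vectors S"
  shows "h f \<in> free_vectors T"
  using assms(3)
proof (induction rule: free_vectors_induct)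
  case (single x c)
  then show ?case
    using free_vectors_scale[OF assms(2)[OF single], of c] pm_linearD(2)[OF assms(1), of c "single x 1"] by simp
next
  case (add f h)
  then show ?case by (simp add: pm_linearD[OF assms(1)] free_vectors_add[of _ T, simplified])
qed (simp add: pm_linearD[OF assms(1)])

section \<open>Induced modules\<close>

lemma free_words_simps [simp]:
  "carrier (free_words E) = free_vectors (UNIV \<times> carrier E)" "\<zero>\<^bsub>free_words E\<^esub> = 0"
  "f \<oplus>\<^bsub>free_words E\<^esub> h = f + h" "c \<odot>\<^bsub>free_words E\<^esub> f = pm_scale c f"
  "act (free_words E) a = lin_ext (\<lambda>(w, v). single (a # w, v) 1)"
  by (simp_all add: free_words_def)

lemma free_words_premodule: "bg_premodule (free_words E)"
proof (rule bg_premoduleI)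
  let ?F = "free_words E"
  fix f h a assume f: "f \<in> carrier ?F" and h: "h \<in> carrier ?F"
  show "f \<oplus>\<^bsub>?F\<^esub> h \<in> carrier ?F" using free_vectors_add[of f _ h] f h by simp
  show "c \<odot>\<^bsub>?F\<^esub> f \<in> carrier ?F" for c using free_vectors_scale[of f] f by simp
  show "act ?F a f \<in> carrier ?F"
    unfolding free_words_simps
    by (rule pm_linear_free_vectors[OF pm_linear_lin_ext _ f[unfolded free_words_simps]]) auto
qed (auto simp: scale_add pm_linearD[OF pm_linear_lin_ext])

definition ind_embed :: "'v bg_module \<Rightarrow> 'v \<Rightarrow> (mode list \<times> 'v \<Rightarrow>\<^sub>0 complex) set" where
  "ind_embed E e = bg_proj (free_words E) (bg_span (free_words E) (ind_relations E)) (single ([], e) 1)"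

lemma fw_minus: "f \<in> carrier (free_words E) \<Longrightarrow> h \<in> carrier (free_words E) \<Longrightarrow>
    f \<ominus>\<^bsub>free_words E\<^esub> h = f - h"
  using bg_premodule.minus_eq'[OF free_words_premodule, of f E h] by simp

locale inducing = E: bg_premodule E for E :: "'v bg_module"
begin

sublocale W: bg_premodule "free_words E"
  by (rule free_words_premodule)

definition "rels = bg_span (free_words E) (ind_relations E)"

lemma single_carrier: "v \<in> carrier E \<Longrightarrow> single (w, v) c \<in> carrier (free_words E)"
  by simp

lemma minus_carrier: "f \<in> carrier (free_words E) \<Longrightarrow> h \<in> carrier (free_words E) \<Longrightarrow> f - h \<in> carrier (free_words E)"
  using fw_minus[of f E h] W.minus_closed[of f h] by simp

lemma relations_carrier: "ind_relations E \<subseteq> carrier (free_words E)"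
  unfolding ind_relations_def by (auto simp del: free_words_simps intro!: minus_carrier single_carrier)

lemma rels_submodule: "bg_submodule rels (free_words E)"
  unfolding rels_def by (rule W.bg_span_submodule[OF relations_carrier])

lemma in_rels: "r \<in> ind_relations E \<Longrightarrow> r \<in> rels"
  unfolding rels_def by (rule W.bg_span_incl)

text \<open>The relations contain this for words, and the expression is linear in f. Prefixes in
  front of the two modes are covered since \<open>rels\<close> is stable under the action.\<close>

lemma comm_rels:
  assumes "f \<in> carrier (free_words E)"
  shows "act (free_words E) a (act (free_words E) b f)
    \<ominus>\<^bsub>free_words E\<^esub> (act (free_words E) b (act (free_words E) a f) \<oplus>\<^bsub>free_words E\<^esub> mode_comm a b \<odot>\<^bsub>free_words E\<^esub> f) \<in> rels"
proof -
  note D = W.bg_submoduleD[OF rels_submodule]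
  let ?A = "\<lambda>a. lin_ext (\<lambda>(w, v). single (a # w, v :: 'v) (1 :: complex))"
  let ?h = "\<lambda>f. ?A a (?A b f) - ?A b (?A a f) - pm_scale (mode_comm a b) f"
  have "?h f \<in> rels"
    using assms[unfolded free_words_simps]
  proof (induction rule: free_vectors_induct)
    case zero
    show ?case using D(2) by (simp add: pm_linearD[OF pm_linear_lin_ext])
  next
    case (single x c)
    obtain w v where x: "x = (w, v)" "v \<in> carrier E" using single by auto
    have "single (a # b # w, v) 1 - single (b # a # w, v) 1 - single (w, v) (mode_comm a b) \<in> rels"
      unfolding ind_relations_def using x by (intro in_rels) (auto simp: ind_relations_def)
    from D(5)[OF this, of c] show ?case
      by (simp add: x scale_add mult.commute)
  next
    case (add f h)
    have "?h (f + h) = ?h f + ?h h"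
      by (simp add: pm_linearD[OF pm_linear_lin_ext] scale_add)
    then show ?case using D(4)[OF add(3,4)] by simp
  qed
  moreover have "act (free_words E) a (act (free_words E) b f) \<in> carrier (free_words E)"
    "act (free_words E) b (act (free_words E) a f) \<oplus>\<^bsub>free_words E\<^esub> mode_comm a b \<odot>\<^bsub>free_words E\<^esub> f \<in> carrier (free_words E)"
    using assms by (auto simp del: free_words_simps)
  note fw_minus[OF this]
  ultimately show ?thesis by (simp add: diff_diff_eq)
qed

lemma Ind_eq: "Ind E = bg_quot (free_words E) rels"
  by (simp add: Ind_def rels_def)

lemma Ind_module: "bg_module (Ind E)"
  unfolding Ind_eq by (rule W.bg_quot_moduleI[OF rels_submodule comm_rels])

sublocale P: bg_morphism "free_words E" "Ind E" "bg_proj (free_words E) rels"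
  unfolding Ind_eq by (rule W.bg_proj_morphism[OF rels_submodule])

abbreviation "emb \<equiv> ind_embed E"

lemma emb_eq: "emb e = bg_proj (free_words E) rels (single ([], e) 1)"
  by (simp add: ind_embed_def rels_def)

lemma emb_closed: "e \<in> carrier E \<Longrightarrow> emb e \<in> carrier (Ind E)"
  unfolding emb_eq by (rule P.f_closed[OF single_carrier])

lemma proj_eqI:
  "f \<in> carrier (free_words E) \<Longrightarrow> h \<in> carrier (free_words E) \<Longrightarrow> f - h \<in> rels \<Longrightarrow>
    bg_proj (free_words E) rels f = bg_proj (free_words E) rels h"
  using W.bg_proj_eq_iff[OF rels_submodule, of f h] fw_minus[of f E h] by simp

lemma emb_add:
  assumes "x \<in> carrier E" "y \<in> carrier E"
  shows "emb (x \<oplus>\<^bsub>E\<^esub> y) = emb x \<oplus>\<^bsub>Ind E\<^esub> emb y"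
proof -
  have "single ([], x \<oplus>\<^bsub>E\<^esub> y) 1 - (single ([], x) 1 \<oplus>\<^bsub>free_words E\<^esub> single ([], y) 1) \<in> rels"
    using assms by (intro in_rels) (auto simp: ind_relations_def diff_diff_eq)
  then have "emb (x \<oplus>\<^bsub>E\<^esub> y) = bg_proj (free_words E) rels (single ([], x) 1 \<oplus>\<^bsub>free_words E\<^esub> single ([], y) 1)"
    unfolding emb_eq using assms
    by (intro proj_eqI single_carrier W.add.m_closed E.add.m_closed)
  then show ?thesis
    unfolding emb_eq P.f_add[OF single_carrier[OF assms(1)] single_carrier[OF assms(2)]] .
qed

lemma emb_sm:
  assumes "x \<in> carrier E"
  shows "emb (c \<odot>\<^bsub>E\<^esub> x) = c \<odot>\<^bsub>Ind E\<^esub> emb x"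
proof -
  have "single ([], c \<odot>\<^bsub>E\<^esub> x) 1 - (c \<odot>\<^bsub>free_words E\<^esub> single ([], x) 1) \<in> rels"
    using assms by (intro in_rels) (auto simp: ind_relations_def)
  then have "emb (c \<odot>\<^bsub>E\<^esub> x) = bg_proj (free_words E) rels (c \<odot>\<^bsub>free_words E\<^esub> single ([], x) 1)"
    unfolding emb_eq using assms
    by (intro proj_eqI single_carrier W.sm_closed E.sm_closed)
  then show ?thesis
    unfolding emb_eq P.f_sm[OF single_carrier[OF assms]] .
qed

lemma emb_act:
  assumes "x \<in> carrier E" "nonneg_mode a"
  shows "act (Ind E) a (emb x) = emb (act E a x)"
proof -
  have "act (free_words E) a (single ([], x) 1) - single ([], act E a x) 1 \<in> rels"
    using assms by (intro in_rels) (auto simp: ind_relations_def)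
  then have "bg_proj (free_words E) rels (act (free_words E) a (single ([], x) 1)) = emb (act E a x)"
    unfolding emb_eq using assms
    by (intro proj_eqI single_carrier W.act_closed E.act_closed)
  then show ?thesis
    unfolding emb_eq P.f_act[OF single_carrier[OF assms(1)]] .
qed

lemma Ind_generated: "bg_span (Ind E) (emb ` carrier E) = carrier (Ind E)"
proof
  have sub: "bg_submodule (bg_span (Ind E) (emb ` carrier E)) (Ind E)"
    using emb_closed by (intro P.Q.bg_span_submodule) auto
  note D = P.Q.bg_submoduleD[OF sub]
  show "bg_span (Ind E) (emb ` carrier E) \<subseteq> carrier (Ind E)" by (rule D(1))
  have word: "bg_proj (free_words E) rels (single (w, v) 1) \<in> bg_span (Ind E) (emb ` carrier E)"
    if "v \<in> carrier E" for w v
  proof (induction w)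
    case Nil
    then show ?case using that P.Q.bg_span_incl[of "emb v" "emb ` carrier E"] by (simp add: emb_eq)
  next
    case (Cons a w)
    have "single (a # w, v) 1 = act (free_words E) a (single (w, v) 1)" by simp
    then show ?case
      using D(6)[OF Cons, of a] P.f_act[OF single_carrier[OF that]] by metis
  qed
  have "bg_proj (free_words E) rels f \<in> bg_span (Ind E) (emb ` carrier E)"
    if "f \<in> free_vectors (UNIV \<times> carrier E)" for f
    using that
  proof (induction rule: free_vectors_induct)
    case zero
    show ?case using D(2) P.f_zero by simp
  next
    case (single x c)
    obtain w v where x: "x = (w, v)" "v \<in> carrier E" using single by auto
    have "single x c = c \<odot>\<^bsub>free_words E\<^esub> single (w, v) 1" using x by simp
    then show ?case
      using D(5)[OF word[OF x(2)], of c w] P.f_sm[OF single_carrier[OF x(2)]] by metis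
  next
    case (add f h)
    have "bg_proj (free_words E) rels (f \<oplus>\<^bsub>free_words E\<^esub> h) \<in> bg_span (Ind E) (emb ` carrier E)"
      using add by (subst P.f_add) (auto intro: D(4))
    then show ?case by simp
  qed
  note proj = this
  show "carrier (Ind E) \<subseteq> bg_span (Ind E) (emb ` carrier E)"
  proof
    fix X assume "X \<in> carrier (Ind E)"
    then obtain f where "f \<in> carrier (free_words E)" "X = bg_proj (free_words E) rels f"
      using W.bg_quot_cases[of X rels] unfolding Ind_eq by blast
    then show "X \<in> bg_span (Ind E) (emb ` carrier E)"
      using proj by simp
  qed
qed

end

section \<open>The Fock representation\<close>

fun mode_index :: "mode \<Rightarrow> int" where
  "mode_index (Beta_mode n) = n"
| "mode_index (Gamma_mode n) = n"

fun partner :: "mode \<Rightarrow> mode" where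
  "partner (Beta_mode n) = Gamma_mode (- n)"
| "partner (Gamma_mode n) = Beta_mode (- n)"

type_synonym fock_vec = "(mode \<Rightarrow> nat) \<Rightarrow> logfun"

text \<open>A function F stands for the formal sum over \<open>\<alpha>\<close> of the monomials with exponents
  \<open>\<alpha>\<close> in the modes of negative index, with coefficients \<open>F \<alpha>\<close>.\<close>

definition fock_act :: "(logfun \<Rightarrow> logfun) \<Rightarrow> (logfun \<Rightarrow> logfun) \<Rightarrow> mode \<Rightarrow> fock_vec \<Rightarrow> fock_vec" where
  "fock_act b g a F = (\<lambda>\<alpha>.
     if mode_index a = 0 then (if a = Beta_mode 0 then b else g) (F \<alpha>)
     else if mode_index a < 0 then if \<alpha> a = 0 then 0 else F (\<alpha>(a := \<alpha> a - 1))
     else pm_scale (mode_comm a (partner a) * (of_nat (\<alpha> (partner a)) + 1))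
       (F (\<alpha>(partner a := \<alpha> (partner a) + 1))))"

text \<open>\<open>Ind\<close> is given by generators and relations, so a module where the relations
  visibly hold is needed to prove that vectors are nonzero or lie outside a span. It is enough that
  \<open>fock_map\<close> kills the relations; a basis of \<open>Ind\<close> in the style of
  Poincare-Birkhoff-Witt is avoided.\<close>

locale fock =
  fixes b g :: "logfun \<Rightarrow> logfun"
  assumes b: "pm_linear b" and g: "pm_linear g" and bg: "b (g f) = g (b f) - f"
begin

lemma fock_act_linear:
  "fock_act b g a (\<lambda>\<alpha>. F \<alpha> + G \<alpha>) = (\<lambda>\<alpha>. fock_act b g a F \<alpha> + fock_act b g a G \<alpha>)"
  "fock_act b g a (\<lambda>\<alpha>. pm_scale c (F \<alpha>)) = (\<lambda>\<alpha>. pm_scale c (fock_act b g a F \<alpha>))"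
  "fock_act b g a (\<lambda>\<alpha>. 0) = (\<lambda>\<alpha>. 0)"
  by (auto simp: fock_act_def fun_eq_iff pm_linearD[OF b] pm_linearD[OF g] scale_add mult.commute)

lemma mode_comm_index: "mode_comm a a' \<noteq> 0 \<Longrightarrow> a' = partner a"
  by (cases a; cases a') (auto split: if_splits)

lemma mode_comm_antisym: "mode_comm a a' = - mode_comm a' a"
  by (cases a; cases a') auto

lemma partner_partner: "partner (partner a) = a" "mode_index (partner a) = - mode_index a"
  by (cases a; auto)+

text \<open>The product rule: a positive mode differentiates by its partner, a negative mode
  multiplies by a variable.\<close>

lemma fock_comm_pos_neg:
  assumes "mode_index a > 0" "mode_index a' < 0"
  shows "fock_act b g a (fock_act b g a' F) \<alpha> = fock_act b g a' (fock_act b g a F) \<alpha> + pm_scale (mode_comm a a') (F \<alpha>)"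
proof (cases "a' = partner a")
  case True
  show ?thesis
  proof (cases "\<alpha> a'")
    case 0
    then show ?thesis using True assms by (auto simp: fock_act_def fun_upd_idem)
  next
    case (Suc k)
    then have "\<alpha>(partner a := Suc k) = \<alpha>"
      using True by (simp add: fun_upd_idem)
    then show ?thesis
      using True assms Suc by (simp add: fock_act_def scale_add(2)[symmetric] algebra_simps)
  qed
next
  case False
  then have "mode_comm a a' = 0" using mode_comm_index by blast
  then show ?thesis using assms False by (auto simp: fock_act_def fun_upd_twist)
qed

lemma fock_comm:
  "fock_act b g a (fock_act b g a' F) \<alpha> = fock_act b g a' (fock_act b g a F) \<alpha> + pm_scale (mode_comm a a') (F \<alpha>)"
proof -
  have idx: "mode_comm a a' = 0" if "mode_index a \<noteq> - mode_index a'"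
    using that mode_comm_index partner_partner(2) by (metis add.inverse_inverse)
  consider "mode_index a > 0" "mode_index a' < 0" | "mode_index a < 0" "mode_index a' > 0"
    | "mode_index a = 0" "mode_index a' = 0" | "mode_index a = 0" "mode_index a' \<noteq> 0"
    | "mode_index a \<noteq> 0" "mode_index a' = 0" | "mode_index a > 0" "mode_index a' > 0"
    | "mode_index a < 0" "mode_index a' < 0" by linarith
  then show ?thesis
  proof cases
    case 1
    then show ?thesis by (rule fock_comm_pos_neg)
  next
    case 2
    then show ?thesis
      using fock_comm_pos_neg[of a' a F \<alpha>] mode_comm_antisym[of a a'] by (simp add: scale_add)
  next
    case 3
    then show ?thesis
      by (cases a; cases a') (auto simp: fock_act_def bg scale_add)
  next
    case 4
    then have "mode_comm a a' = 0" using idx by simp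
    with 4 show ?thesis by (auto simp: fock_act_def pm_linearD[OF b] pm_linearD[OF g])
  next
    case 5
    then have "mode_comm a a' = 0" using idx by simp
    with 5 show ?thesis by (auto simp: fock_act_def pm_linearD[OF b] pm_linearD[OF g])
  next
    case 6
    then have "mode_comm a a' = 0" using idx by simp
    with 6 show ?thesis
      by (cases "a = a'") (auto simp: fock_act_def fun_upd_twist mult_ac partner_partner dest: arg_cong[of _ _ partner])
  next
    case 7
    then have "mode_comm a a' = 0" using idx by simp
    with 7 show ?thesis by (cases "a = a'") (auto simp: fock_act_def fun_upd_twist)
  qed
qed

primrec fock_word :: "mode list \<Rightarrow> logfun \<Rightarrow> fock_vec" where
  "fock_word [] v = (\<lambda>\<alpha>. if \<alpha> = (\<lambda>_. 0) then v else 0)"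
| "fock_word (a # w) v = fock_act b g a (fock_word w v)"

definition fock_map :: "(mode list \<times> logfun \<Rightarrow>\<^sub>0 complex) \<Rightarrow> fock_vec" where
  "fock_map f = (\<lambda>\<alpha>. lin_ext (\<lambda>(w, v). fock_word w v \<alpha>) f)"

lemma fock_map_linear:
  "fock_map (f + h) = (\<lambda>\<alpha>. fock_map f \<alpha> + fock_map h \<alpha>)"
  "fock_map (f - h) = (\<lambda>\<alpha>. fock_map f \<alpha> - fock_map h \<alpha>)"
  "fock_map (pm_scale c f) = (\<lambda>\<alpha>. pm_scale c (fock_map f \<alpha>))"
  "fock_map 0 = (\<lambda>\<alpha>. 0)"
  "fock_map (single (w, v) c) = (\<lambda>\<alpha>. pm_scale c (fock_word w v \<alpha>))"
  by (auto simp: fock_map_def pm_linearD[OF pm_linear_lin_ext])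

lemma fock_map_act: "fock_map (lin_ext (\<lambda>(w, v). single (a # w, v) 1) f) = fock_act b g a (fock_map f)"
proof -
  have "f \<in> free_vectors UNIV" by simp
  then show ?thesis
  proof (induction rule: free_vectors_induct)
    case (single x c)
    then show ?case by (cases x) (simp add: fock_map_linear fock_act_linear)
  qed (simp_all add: fock_map_linear fock_act_linear pm_linearD[OF pm_linear_lin_ext])
qed

lemma fock_map_relations:
  assumes "\<And>v. v \<in> free_vectors S \<Longrightarrow> b v \<in> free_vectors S" "\<And>v. v \<in> free_vectors S \<Longrightarrow> g v \<in> free_vectors S"
    and "r \<in> ind_relations (logfun_space S b g)"
  shows "fock_map r = (\<lambda>\<alpha>. 0)"
proof -
  consider (comm) a a' w v where "r = single (a # a' # w, v) 1 - single (a' # a # w, v) 1 - single (w, v) (mode_comm a a')"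
    | (mode) a v where "nonneg_mode a" "r = single ([a], v) 1 - single ([], act (logfun_space S b g) a v) 1"
    | (add) u v where "r = single ([], u + v) 1 - single ([], u) 1 - single ([], v) 1"
    | (sm) c v where "r = single ([], pm_scale c v) 1 - single ([], v) c"
    using assms(3) unfolding ind_relations_def by (auto simp: logfun_space_def)
  then show ?thesis
  proof cases
    case comm
    then show ?thesis by (simp add: fock_map_linear fock_comm[of a a'])
  next
    case mode
    have "fock_act b g a (\<lambda>\<alpha>. if \<alpha> = (\<lambda>_. 0) then v else 0) =
      (\<lambda>\<alpha>. if \<alpha> = (\<lambda>_. 0) then act (logfun_space S b g) a v else 0)"
    proof (cases "mode_index a = 0")
      case True
      then show ?thesis
        using pm_linearD(3)[OF b] pm_linearD(3)[OF g]
        by (cases a) (auto simp: fock_act_def logfun_space_def fun_eq_iff)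
    next
      case False
      have "mode_index a > 0" using mode(1) False by (cases a) auto
      \<comment> \<open>A positive mode reads a coefficient of positive degree, while the vector is
        concentrated in degree 0.\<close>
      moreover have "\<alpha>(partner a := Suc (\<alpha> (partner a))) \<noteq> (\<lambda>_. 0)" for \<alpha> :: "mode \<Rightarrow> nat"
        by (metis fun_upd_same nat.simps(3))
      ultimately show ?thesis
        using False by (cases a) (auto simp: fock_act_def logfun_space_def fun_eq_iff)
    qed
    with mode show ?thesis by (simp add: fock_map_linear)
  next
    case add
    then show ?thesis by (auto simp: fock_map_linear fun_eq_iff)
  next
    case sm
    then show ?thesis by (auto simp: fock_map_linear fun_eq_iff)
  qed
qed

lemma logfun_space_simps [simp]:
  "carrier (logfun_space S b g) = free_vectors S" "\<zero>\<^bsub>logfun_space S b g\<^esub> = 0"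
  "f \<oplus>\<^bsub>logfun_space S b g\<^esub> h = f + h" "c \<odot>\<^bsub>logfun_space S b g\<^esub> f = pm_scale c f"
  "act (logfun_space S b g) a f = (if a = Beta_mode 0 then b f else if a = Gamma_mode 0 then g f else 0)"
  by (simp_all add: logfun_space_def)

end

section \<open>Comparing the induced module with the Fock representation\<close>

locale induced_fock = fock +
  fixes S
  assumes b_closed: "v \<in> free_vectors S \<Longrightarrow> b v \<in> free_vectors S"
    and g_closed: "v \<in> free_vectors S \<Longrightarrow> g v \<in> free_vectors S"
begin

abbreviation "E \<equiv> logfun_space S b g"

lemma E_premodule: "bg_premodule E"
proof (rule bg_premoduleI)
  fix f h assume f: "f \<in> carrier E" and h: "h \<in> carrier E"
  show "f \<oplus>\<^bsub>E\<^esub> h \<in> carrier E" using free_vectors_add[of f _ h] f h by simp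
  show "c \<odot>\<^bsub>E\<^esub> f \<in> carrier E" for c using free_vectors_scale[of f] f by simp
  show "act E a f \<in> carrier E" for a using f b_closed g_closed by simp
qed (auto simp: scale_add pm_linearD[OF b] pm_linearD[OF g])

sublocale inducing E
  by (simp add: inducing_def E_premodule)

text \<open>The Fock vectors with all coefficients in a stable subspace E' of the inducing space form a
  submodule.\<close>

theorem emb_in_span:
  assumes E': "0 \<in> E'" "\<And>u v. u \<in> E' \<Longrightarrow> v \<in> E' \<Longrightarrow> u + v \<in> E'" "\<And>c v. v \<in> E' \<Longrightarrow> pm_scale c v \<in> E'"
    "\<And>v. v \<in> E' \<Longrightarrow> b v \<in> E'" "\<And>v. v \<in> E' \<Longrightarrow> g v \<in> E'"
    and X: "X \<subseteq> free_vectors S" "X \<subseteq> E'"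
    and e: "e \<in> free_vectors S" "emb e \<in> bg_span (Ind E) (emb ` X)"
  shows "e \<in> E'"
proof -
  \<comment> \<open>Stable under the action, because \<open>fock_act\<close> builds its coefficients
    from those of its argument by b, g and scalars; it contains the relations, whose image is
    0.\<close>
  define N where "N = {f \<in> carrier (free_words E). \<forall>\<alpha>. fock_map f \<alpha> \<in> E'}"
  have stable: "fock_act b g a F \<alpha> \<in> E'" if "\<forall>\<alpha>. F \<alpha> \<in> E'" for a F \<alpha>
    using that E' by (simp add: fock_act_def)
  have N: "bg_submodule N (free_words E)"
  proof (rule W.bg_submoduleI)
    fix x y assume x: "x \<in> N"
    show "act (free_words E) a x \<in> N" for a
      using x W.act_closed[of x a] stable by (auto simp: N_def fock_map_act)
    show "c \<odot>\<^bsub>free_words E\<^esub> x \<in> N" for c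
      using x W.sm_closed[of x c] E'(3) by (auto simp: N_def fock_map_linear)
    assume y: "y \<in> N"
    show "x \<oplus>\<^bsub>free_words E\<^esub> y \<in> N"
      using x y W.add.m_closed[of x y] E'(2) by (auto simp: N_def fock_map_linear)
  qed (use E'(1) in \<open>auto simp: N_def fock_map_linear\<close>)
  have rN: "rels \<subseteq> N"
    unfolding rels_def using relations_carrier fock_map_relations[of S] b_closed g_closed E'(1)
    by (intro W.bg_span_subset[OF N]) (auto simp: N_def simp del: free_words_simps)
  have word: "(if \<alpha> = (\<lambda>_. 0) then v else 0) \<in> E'" if "v \<in> E'" for \<alpha> :: "mode \<Rightarrow> nat" and v
    using that E'(1) by simp
  have XN: "single ([], v) 1 \<in> N" if "v \<in> X" for v
    using that X word[of v] E'(1) by (auto simp: N_def fock_map_linear)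
  have "bg_span (Ind E) (emb ` X) \<subseteq> bg_proj (free_words E) rels ` N"
    using XN by (intro P.Q.bg_span_subset P.image_submodule[OF N]) (auto simp: emb_eq)
  then obtain f where f: "f \<in> N" "emb e = bg_proj (free_words E) rels f"
    using e(2) by auto
  have fc: "f \<in> carrier (free_words E)" and ec: "single ([], e) 1 \<in> carrier (free_words E)"
    using f(1) e(1) by (auto simp: N_def)
  have "single ([], e) 1 \<ominus>\<^bsub>free_words E\<^esub> f \<in> rels"
    using f(2) W.bg_proj_eq_iff[OF rels_submodule ec fc] by (simp add: emb_eq)
  then have "(single ([], e) 1 \<ominus>\<^bsub>free_words E\<^esub> f) \<oplus>\<^bsub>free_words E\<^esub> f \<in> N"
    using rN f(1) W.bg_submoduleD(4)[OF N] by blast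
  then have "single ([], e) 1 \<in> N"
    using W.sub_add[OF ec fc] by simp
  \<comment> \<open>The coefficient of the empty word at the trivial monomial is e itself.\<close>
  then have "fock_map (single ([], e) 1) (\<lambda>_. 0) \<in> E'"
    by (auto simp: N_def)
  then show "e \<in> E'" by (simp add: fock_map_linear)
qed

end

section \<open>Uniserial modules\<close>

text \<open>Uniserial of length n, with its submodules numbered by their length; the numbering
  allows radicals and quotients of prescribed length to be computed.\<close>

definition bg_chain :: "'v bg_module \<Rightarrow> (nat \<Rightarrow> 'v set) \<Rightarrow> nat \<Rightarrow> bool" where
  "bg_chain M G n \<longleftrightarrow> bg_module M \<and> (\<forall>S. bg_submodule S M \<longleftrightarrow> (\<exists>t\<le>n. S = G t)) \<and>
    (\<forall>s t. s < t \<longrightarrow> t \<le> n \<longrightarrow> G s \<subset> G t)"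

lemma bg_chainD:
  assumes "bg_chain M G n"
  shows "bg_module M" "t \<le> n \<Longrightarrow> bg_submodule (G t) M" "bg_submodule S M \<Longrightarrow> \<exists>t\<le>n. S = G t"
    "s < t \<Longrightarrow> t \<le> n \<Longrightarrow> G s \<subset> G t" "s \<le> t \<Longrightarrow> t \<le> n \<Longrightarrow> G s \<subseteq> G t"
    "s \<le> n \<Longrightarrow> t \<le> n \<Longrightarrow> G s = G t \<Longrightarrow> s = t" "s \<le> n \<Longrightarrow> t \<le> n \<Longrightarrow> G s \<subseteq> G t \<Longrightarrow> s \<le> t"
proof -
  show "bg_module M" "t \<le> n \<Longrightarrow> bg_submodule (G t) M" "bg_submodule S M \<Longrightarrow> \<exists>t\<le>n. S = G t"
    and *: "s < t \<Longrightarrow> t \<le> n \<Longrightarrow> G s \<subset> G t" for s t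
    using assms by (auto simp: bg_chain_def)
  show "s \<le> t \<Longrightarrow> t \<le> n \<Longrightarrow> G s \<subseteq> G t"
    using *[of s t] by (cases "s = t") auto
  show "s \<le> n \<Longrightarrow> t \<le> n \<Longrightarrow> G s = G t \<Longrightarrow> s = t"
    using *[of s t] *[of t s] by (cases s t rule: linorder_cases) auto
  show "s \<le> n \<Longrightarrow> t \<le> n \<Longrightarrow> G s \<subseteq> G t \<Longrightarrow> s \<le> t"
    using *[of t s] by (cases s t rule: linorder_cases) auto
qed

lemma bg_chain_ends:
  assumes "bg_chain M G n"
  shows "G 0 = {\<zero>\<^bsub>M\<^esub>}" "G n = carrier M"
proof -
  note D = bg_chainD[OF assms]
  interpret bg_module M by (rule D(1))
  obtain t where t: "t \<le> n" "{\<zero>\<^bsub>M\<^esub>} = G t"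
    using D(3)[OF bg_submodule_zero] by blast
  have "G 0 \<subseteq> {\<zero>\<^bsub>M\<^esub>}" using D(5)[of 0 t] t by simp
  then show "G 0 = {\<zero>\<^bsub>M\<^esub>}" using bg_submoduleD(2)[OF D(2)[of 0]] by auto
  obtain s where s: "s \<le> n" "carrier M = G s"
    using D(3)[OF bg_submodule_carrier] by blast
  have "carrier M \<subseteq> G n" using D(5)[of s n] s by simp
  then show "G n = carrier M" using bg_submoduleD(1)[OF D(2)[of n]] by auto
qed

lemma bg_chain_restrict:
  assumes "bg_chain M G n" "t \<le> n"
  shows "bg_chain (bg_restrict M (G t)) G t"
proof -
  note D = bg_chainD[OF assms(1)]
  interpret bg_module M by (rule D(1))
  have sub: "bg_submodule (G t) M" using D(2) assms(2) .
  show ?thesis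
    unfolding bg_chain_def
  proof (intro conjI allI impI)
    show "bg_module (bg_restrict M (G t))" by (rule restrict_module[OF sub])
    fix S
    show "bg_submodule S (bg_restrict M (G t)) \<longleftrightarrow> (\<exists>s\<le>t. S = G s)"
    proof
      assume "bg_submodule S (bg_restrict M (G t))"
      then have S: "bg_submodule S M" "S \<subseteq> G t"
        using restrict_submodule_iff[OF sub] by auto
      then obtain s where "s \<le> n" "S = G s" using D(3) by blast
      then show "\<exists>s\<le>t. S = G s" using S(2) D(7)[of s t] assms(2) by auto
    next
      assume "\<exists>s\<le>t. S = G s"
      then obtain s where s: "s \<le> t" "S = G s" by blast
      then have "bg_submodule S M" "S \<subseteq> G t"
        using D(2)[of s] D(5)[of s t] assms(2) by auto
      then show "bg_submodule S (bg_restrict M (G t))"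
        using restrict_submodule_iff[OF sub] by blast
    qed
  qed (use D(4) assms(2) in auto)
qed

lemma bg_chain_quot:
  assumes "bg_chain M G n" "t \<le> n"
  shows "bg_chain (bg_quot M (G t)) (\<lambda>s. bg_proj M (G t) ` G (t + s)) (n - t)"
proof -
  note D = bg_chainD[OF assms(1)]
  interpret bg_module M by (rule D(1))
  have sub: "bg_submodule (G t) M" using D(2) assms(2) .
  interpret P: bg_morphism M "bg_quot M (G t)" "bg_proj M (G t)"
    by (rule bg_proj_morphism[OF sub])
  show ?thesis
    unfolding bg_chain_def
  proof (intro conjI allI impI)
    show "bg_module (bg_quot M (G t))" by (rule bg_quot_module[OF sub])
    fix X
    show "bg_submodule X (bg_quot M (G t)) \<longleftrightarrow> (\<exists>s\<le>n - t. X = bg_proj M (G t) ` G (t + s))"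
    proof
      assume X: "bg_submodule X (bg_quot M (G t))"
      let ?S = "{x \<in> carrier M. bg_proj M (G t) x \<in> X}"
      obtain s where s: "s \<le> n" "?S = G s"
        using D(3)[OF P.preimage_submodule[OF X]] by blast
      have "bg_proj M (G t) x = \<zero>\<^bsub>bg_quot M (G t)\<^esub>" "x \<in> carrier M" if "x \<in> G t" for x
        using that bg_proj_eq_zero_iff[OF sub, of x] bg_submoduleD(1)[OF sub] by auto
      then have "G t \<subseteq> ?S"
        using P.Q.bg_submoduleD(2)[OF X] by auto
      then have "t \<le> s" using s D(7)[of t s] assms(2) by auto
      have "x \<in> bg_proj M (G t) ` ?S" if "x \<in> X" for x
      proof -
        have "x \<in> carrier (bg_quot M (G t))" using that P.Q.bg_submoduleD(1)[OF X] by blast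
        then show ?thesis using that bg_quot_cases[of x "G t"] by blast
      qed
      then have "X = bg_proj M (G t) ` ?S" by blast
      then show "\<exists>s\<le>n - t. X = bg_proj M (G t) ` G (t + s)"
        unfolding s(2) using \<open>t \<le> s\<close> s(1) by (intro exI[of _ "s - t"]) auto
    next
      assume "\<exists>s\<le>n - t. X = bg_proj M (G t) ` G (t + s)"
      then obtain s where "s \<le> n - t" "X = bg_proj M (G t) ` G (t + s)" by blast
      then show "bg_submodule X (bg_quot M (G t))"
        using P.image_submodule[OF D(2)[of "t + s"]] assms(2) by simp
    qed
  next
    fix s s' assume s: "s < s'" "s' \<le> n - t"
    then have lt: "t + s < t + s'" "t + s' \<le> n" using assms(2) by auto
    obtain x where x: "x \<in> G (t + s')" "x \<notin> G (t + s)"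
      using D(4)[OF lt] by blast
    note S = bg_submoduleD[OF D(2)[of "t + s"]]
    have c: "x \<in> carrier M"
      using x(1) bg_submoduleD(1)[OF D(2)[OF lt(2)]] by blast
    have "bg_proj M (G t) x \<notin> bg_proj M (G t) ` G (t + s)"
    proof
      assume "bg_proj M (G t) x \<in> bg_proj M (G t) ` G (t + s)"
      then obtain y where y: "y \<in> G (t + s)" "bg_proj M (G t) x = bg_proj M (G t) y" by auto
      have yc: "y \<in> carrier M" using S(1) y(1) lt by auto
      have "x \<ominus>\<^bsub>M\<^esub> y \<in> G t" using y(2) bg_proj_eq_iff[OF sub c yc] by simp
      then have "x \<ominus>\<^bsub>M\<^esub> y \<in> G (t + s)" using D(5)[of t "t + s"] lt by auto
      then have "(x \<ominus>\<^bsub>M\<^esub> y) \<oplus>\<^bsub>M\<^esub> y \<in> G (t + s)" using y(1) S(4) lt by auto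
      then show False using x(2) sub_add[OF c yc] by simp
    qed
    then show "bg_proj M (G t) ` G (t + s) \<subset> bg_proj M (G t) ` G (t + s')"
      using x(1) D(4)[OF lt] by blast
  qed
qed

lemma bg_chain_simple:
  assumes "bg_chain M G n"
  shows "bg_simple M \<longleftrightarrow> n = 1"
proof -
  note D = bg_chainD[OF assms] and E = bg_chain_ends[OF assms]
  show ?thesis
  proof
    assume s: "bg_simple M"
    then have "n \<noteq> 0" using E by (auto simp: bg_simple_def)
    then have "G 1 = G 0 \<or> G 1 = G n"
      using s D(2)[of 1] E by (auto simp: bg_simple_def)
    then show "n = 1"
      using \<open>n \<noteq> 0\<close> D(6)[of 1 0] D(6)[of 1 n] by auto
  next
    assume n: "n = 1"
    show "bg_simple M"
      unfolding bg_simple_def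
    proof (intro conjI allI impI)
      show "carrier M \<noteq> {\<zero>\<^bsub>M\<^esub>}" using E D(4)[of 0 1] n by auto
      fix N assume "bg_submodule N M"
      then obtain t where "t \<le> 1" "N = G t" using D(3) n by blast
      then show "N = {\<zero>\<^bsub>M\<^esub>} \<or> N = carrier M"
        using E n by (cases t) auto
    qed
  qed
qed

text \<open>A simple factor forces consecutive indices in the chain, so a filtration with simple
  factors climbs it one step at a time.\<close>

lemma bg_chain_length:
  assumes "bg_chain M G n"
  shows "bg_length M r \<longleftrightarrow> r = n"
proof -
  note D = bg_chainD[OF assms] and E = bg_chain_ends[OF assms]
  have simple: "bg_simple (bg_quot (bg_restrict M (G t)) (G s)) \<longleftrightarrow> t = Suc s" if "s \<le> t" "t \<le> n" for s t
    using bg_chain_simple[OF bg_chain_quot[OF bg_chain_restrict[OF assms that(2)] that(1)]] that by auto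
  show ?thesis
  proof
    assume "bg_length M r"
    then obtain F where "F 0 = {\<zero>\<^bsub>M\<^esub>} \<and> F r = carrier M \<and> (\<forall>i\<le>r. bg_submodule (F i) M) \<and>
      (\<forall>i<r. F i \<subseteq> F (Suc i) \<and> bg_simple (bg_quot (bg_restrict M (F (Suc i))) (F i)))"
      unfolding bg_filtration_def by (rule exE)
    then have F: "F 0 = {\<zero>\<^bsub>M\<^esub>}" "F r = carrier M" "\<And>i. i \<le> r \<Longrightarrow> bg_submodule (F i) M"
      "\<And>i. i < r \<Longrightarrow> F i \<subseteq> F (Suc i)" "\<And>i. i < r \<Longrightarrow> bg_simple (bg_quot (bg_restrict M (F (Suc i))) (F i))"
      by simp_all
    have "i \<le> r \<Longrightarrow> i \<le> n \<and> F i = G i" for i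
    proof (induction i)
      case 0
      then show ?case using F(1) E(1) by simp
    next
      case (Suc i)
      then have i: "i < r" "i \<le> n" "F i = G i" by auto
      obtain t where t: "t \<le> n" "F (Suc i) = G t" using D(3)[OF F(3)[OF Suc.prems]] by blast
      have "i \<le> t" using F(4)[OF i(1)] i t D(7)[of i t] by simp
      then have "t = Suc i" using simple[of i t] F(5)[OF i(1)] i t by simp
      then show ?case using t by simp
    qed
    then show "r = n" using F(2) E(2) D(6)[of r n] by auto
  next
    assume r: "r = n"
    show "bg_length M r"
      unfolding bg_filtration_def r using E D(2,5) simple
      by (intro exI[of _ G]) auto
  qed
qed

lemma bg_chain_radical:
  assumes "bg_chain M G (Suc n)"
  shows "bg_radical M = G n"
proof -
  note D = bg_chainD[OF assms] and E = bg_chain_ends[OF assms]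
  have "bg_maximal N M \<longleftrightarrow> N = G n" for N
  proof
    assume N: "bg_maximal N M"
    then obtain t where t: "t \<le> Suc n" "N = G t" using D(3)[of N] unfolding bg_maximal_def by blast
    have "t \<noteq> Suc n" using N t E by (auto simp: bg_maximal_def)
    then have "G n = N \<or> G n = carrier M"
      using N t D(2)[of n] D(5)[of t n] by (auto simp: bg_maximal_def)
    then show "N = G n" using E D(6)[of n "Suc n"] by auto
  next
    assume N: "N = G n"
    show "bg_maximal N M"
      unfolding bg_maximal_def
    proof (intro conjI allI impI)
      show "bg_submodule N M" using N D(2) by simp
      show "N \<noteq> carrier M" using N E D(6)[of n "Suc n"] by auto
      fix N' assume N': "bg_submodule N' M \<and> N \<subseteq> N'"
      then obtain t where t: "t \<le> Suc n" "N' = G t" using D(3) by blast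
      then have "n \<le> t" using N N' D(7)[of n t] by simp
      then show "N' = N \<or> N' = carrier M" using t N E by (cases "t = n") (auto simp: le_Suc_eq)
    qed
  qed
  then have "{N. bg_maximal N M} = {G n}" by auto
  then show ?thesis
    unfolding bg_radical_def using E D(5)[of n "Suc n"] by auto
qed

text \<open>The quotient by \<open>G t\<close> has length n - t, so the description in
  \<open>length_quot\<close> determines t.\<close>

lemma bg_chain_length_quot:
  assumes "bg_chain M G n" "k \<le> n"
  shows "length_quot M k = bg_quot M (G (n - k))"
proof -
  note D = bg_chainD[OF assms(1)]
  have "(THE N. bg_submodule N M \<and> bg_length (bg_quot M N) k) = G (n - k)"
  proof (rule the_equality)
    show "bg_submodule (G (n - k)) M \<and> bg_length (bg_quot M (G (n - k))) k"
      using D(2)[of "n - k"] bg_chain_length[OF bg_chain_quot[OF assms(1), of "n - k"]] assms(2) by simp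
    fix N assume N: "bg_submodule N M \<and> bg_length (bg_quot M N) k"
    then obtain t where t: "t \<le> n" "N = G t" using D(3) by blast
    then have "k = n - t"
      using N bg_chain_length[OF bg_chain_quot[OF assms(1), of t]] by simp
    then show "N = G (n - k)" using t by simp
  qed
  then show ?thesis by (simp add: length_quot_def)
qed

text \<open>The vectors \<open>eps t\<close> run through a uniserial module of length 2k from the socle to the head:
  P maps the odd ones to their predecessors, Q the even ones.\<close>

locale ladder = bg_module +
  fixes eps :: "nat \<Rightarrow> 'a" and \<kappa> :: "nat \<Rightarrow> complex" and k :: nat and P Q :: mode
  assumes k: "k \<ge> 1"
    and eps_closed: "t < 2 * k \<Longrightarrow> eps t \<in> carrier M"
    and P_eps: "a < k \<Longrightarrow> act M P (eps (2 * a + 1)) = eps (2 * a)"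
    and Q_eps: "Suc a < k \<Longrightarrow> act M Q (eps (2 * Suc a)) = \<kappa> (Suc a) \<odot> eps (2 * a + 1)"
    and Q_eps_0: "act M Q (eps 0) = \<zero>"
    and \<kappa>: "a \<ge> 1 \<Longrightarrow> \<kappa> a \<noteq> 0"
    and PQ: "(P = Beta_mode 0 \<and> Q = Gamma_mode 0 \<and> (\<forall>t<2 * k. lower (- 1) (eps t) = \<zero>)) \<or>
      (P = Gamma_mode 1 \<and> Q = Beta_mode (- 1) \<and> (\<forall>t<2 * k. raise 0 (eps t) = \<zero>))"
    and raise_eps: "t < 2 * k \<Longrightarrow> n \<ge> 1 \<Longrightarrow> raise n (eps t) = \<zero>"
    and lower_eps: "t < 2 * k \<Longrightarrow> n \<le> - 2 \<Longrightarrow> lower n (eps t) = \<zero>"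
    and top: "bg_span M {eps (2 * k - 1)} = carrier M"
    and strict: "Suc t < 2 * k \<Longrightarrow> eps (Suc t) \<notin> bg_span M {eps t}"
    and eps_0: "eps 0 \<noteq> \<zero>"
begin

definition flag :: "nat \<Rightarrow> 'a set" where
  "flag t = (if t = 0 then {\<zero>} else bg_span M {eps (t - 1)})"

text \<open>\<open>comb t\<close> is spanned by \<open>eps (t - 2)\<close>,
  \<open>eps (t - 4)\<close> and so on. The step is 2 because vectors of one parity share one
  weight, and standard vectors therefore combine indices of a single parity.\<close>

fun comb :: "nat \<Rightarrow> 'a set" where
  "comb 0 = {\<zero>}"
| "comb (Suc 0) = {\<zero>}"
| "comb (Suc (Suc t)) = {x \<oplus> c \<odot> eps t | x c. x \<in> comb t}"

abbreviation "u \<equiv> eps (2 * k - 1)"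

lemma u_closed: "u \<in> carrier M"
  using k by (intro eps_closed) simp

lemma comb_closed: "t \<le> Suc (2 * k) \<Longrightarrow> x \<in> comb t \<Longrightarrow> x \<in> carrier M"
  by (induction t arbitrary: x rule: comb.induct) (auto simp: eps_closed)

lemma comb_zero: "t \<le> Suc (2 * k) \<Longrightarrow> \<zero> \<in> comb t"
proof (induction t rule: comb.induct)
  case (3 t)
  then have "\<zero> = \<zero> \<oplus> 0 \<odot> eps t" using eps_closed[of t] by simp
  with 3 show ?case by fastforce
qed auto

lemma comb_add: "t \<le> Suc (2 * k) \<Longrightarrow> x \<in> comb t \<Longrightarrow> y \<in> comb t \<Longrightarrow> x \<oplus> y \<in> comb t"
proof (induction t arbitrary: x y rule: comb.induct)
  case (3 t)
  from 3(3) obtain x' c where x: "x = x' \<oplus> c \<odot> eps t" "x' \<in> comb t" by auto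
  from 3(4) obtain y' d where y: "y = y' \<oplus> d \<odot> eps t" "y' \<in> comb t" by auto
  have c: "eps t \<in> carrier M" "x' \<in> carrier M" "y' \<in> carrier M"
    using eps_closed[of t] 3(2) x y comb_closed[of t] by auto
  have "x \<oplus> y = (x' \<oplus> y') \<oplus> (c \<odot> eps t \<oplus> d \<odot> eps t)"
    unfolding x(1) y(1) using c by (simp add: a_ac del: sm_collect)
  also have "\<dots> = (x' \<oplus> y') \<oplus> (c + d) \<odot> eps t" using c by simp
  finally show ?case using 3(1)[of x' y'] 3(2) x(2) y(2) by auto
qed auto

lemma comb_sm: "t \<le> Suc (2 * k) \<Longrightarrow> x \<in> comb t \<Longrightarrow> c \<odot> x \<in> comb t"
proof (induction t arbitrary: x rule: comb.induct)
  case (3 t)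
  from 3(3) obtain x' d where x: "x = x' \<oplus> d \<odot> eps t" "x' \<in> comb t" by auto
  have "c \<odot> x = c \<odot> x' \<oplus> (c * d) \<odot> eps t"
    using eps_closed[of t] 3(2) x comb_closed[of t x'] by (simp add: sm_r_distr sm_assoc)
  then show ?case using 3(1)[of x'] 3(2) x(2) by auto
qed auto

lemma comb_mono: "Suc (Suc t) \<le> Suc (2 * k) \<Longrightarrow> comb t \<subseteq> comb (Suc (Suc t))"
proof
  fix x assume t: "Suc (Suc t) \<le> Suc (2 * k)" and x: "x \<in> comb t"
  then have "x = x \<oplus> 0 \<odot> eps t" using eps_closed[of t] comb_closed[of t x] by simp
  then show "x \<in> comb (Suc (Suc t))" using x by auto
qed

definition dn :: "nat \<Rightarrow> mode" where
  "dn t = (if odd t then P else Q)"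

lemma dn_eps: "Suc t < 2 * k \<Longrightarrow> \<exists>c. c \<noteq> 0 \<and> act M (dn (Suc t)) (eps (Suc t)) = c \<odot> eps t"
proof (cases "even t")
  case True
  assume t: "Suc t < 2 * k"
  obtain a where "t = 2 * a" using True by blast
  then show ?thesis using t P_eps[of a] eps_closed[of t] by (intro exI[of _ 1]) (simp add: dn_def)
next
  case False
  assume t: "Suc t < 2 * k"
  obtain a where a: "t = 2 * a + 1" using False by (metis oddE)
  then show ?thesis using t Q_eps[of a] \<kappa>[of "Suc a"] by (intro exI[of _ "\<kappa> (Suc a)"]) (simp add: dn_def)
qed

lemma comb_dn: "Suc t \<le> Suc (2 * k) \<Longrightarrow> x \<in> comb (Suc t) \<Longrightarrow> act M (dn (Suc t)) x \<in> comb t"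
proof (induction t arbitrary: x rule: less_induct)
  case (less t)
  consider "t = 0" | "t = 1" | s where "t = Suc (Suc s)"
    by (metis One_nat_def not0_implies_Suc)
  then show ?case
  proof cases
    case 1
    then show ?thesis using less.prems(2) by simp
  next
    case 2
    then obtain c where "x = c \<odot> eps 0" "eps 0 \<in> carrier M"
      using less.prems(2) eps_closed[of 0] k by auto
    then show ?thesis using 2 Q_eps_0 by (simp add: dn_def act_smult)
  next
    case 3
    then obtain x' c where x: "x = x' \<oplus> c \<odot> eps (Suc s)" "x' \<in> comb (Suc s)"
      using less.prems(2) by auto
    have s: "Suc s < 2 * k" using less.prems(1) 3 by simp
    have cl: "x' \<in> carrier M" "eps (Suc s) \<in> carrier M" "eps s \<in> carrier M"
      using comb_closed[OF _ x(2)] eps_closed s by auto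
    have d: "dn (Suc t) = dn (Suc s)" using 3 by (simp add: dn_def)
    obtain e where e: "act M (dn (Suc s)) (eps (Suc s)) = e \<odot> eps s"
      using dn_eps[OF s] by blast
    have "act M (dn (Suc t)) x = act M (dn (Suc s)) x' \<oplus> (c * e) \<odot> eps s"
      unfolding d x(1) using cl by (simp add: act_add act_smult e sm_assoc)
    moreover have "act M (dn (Suc s)) x' \<in> comb s"
      using less.IH[of s x'] 3 s x(2) by simp
    ultimately show ?thesis unfolding 3 by auto
  qed
qed

lemma eps_span_pred: "Suc t < 2 * k \<Longrightarrow> eps t \<in> bg_span M {eps (Suc t)}"
proof -
  assume t: "Suc t < 2 * k"
  obtain c where c: "c \<noteq> 0" "act M (dn (Suc t)) (eps (Suc t)) = c \<odot> eps t"
    using dn_eps[OF t] by blast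
  have S: "bg_submodule (bg_span M {eps (Suc t)}) M"
    using eps_closed[OF t] by (intro bg_span_submodule) auto
  have "inverse c \<odot> (c \<odot> eps t) \<in> bg_span M {eps (Suc t)}"
    using bg_submoduleD(5,6)[OF S] bg_span_incl[of "eps (Suc t)" "{eps (Suc t)}"] c(2) by (metis insertI1)
  then show ?thesis using c(1) eps_closed[of t] t by (simp add: sm_assoc)
qed

lemma flag_submodule: "t \<le> 2 * k \<Longrightarrow> bg_submodule (flag t) M"
  unfolding flag_def using eps_closed[of "t - 1"] bg_submodule_zero
  by (auto intro!: bg_span_submodule)

lemma flag_Suc: "flag (Suc t) = bg_span M {eps t}"
  by (simp add: flag_def)

lemma flag_step: "t < 2 * k \<Longrightarrow> flag t \<subset> flag (Suc t)"
proof (cases t)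
  case 0
  assume "t < 2 * k"
  then show ?thesis
    using bg_submoduleD(2)[OF flag_submodule[of "Suc t"]] bg_span_incl[of "eps 0" "{eps 0}"] eps_0 0
    by (auto simp: flag_def)
next
  case (Suc s)
  assume t: "t < 2 * k"
  have "flag t \<subseteq> flag (Suc t)"
    unfolding Suc flag_Suc using eps_span_pred[of s] t Suc eps_closed[of "Suc s"]
    by (intro bg_span_subset bg_span_submodule) auto
  moreover have "eps t \<in> flag (Suc t)" "eps t \<notin> flag t"
    using strict[of s] t Suc bg_span_incl[of "eps t" "{eps t}"] by (auto simp: flag_Suc)
  ultimately show ?thesis by blast
qed

lemma flag_strict: "s < t \<Longrightarrow> t \<le> 2 * k \<Longrightarrow> flag s \<subset> flag t"
proof (induction t)
  case (Suc t)
  then show ?case using flag_step[of t] by (cases "s = t") auto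
qed simp

lemma flag_mono: "s \<le> t \<Longrightarrow> t \<le> 2 * k \<Longrightarrow> flag s \<subseteq> flag t"
  using flag_strict[of s t] by (cases "s = t") auto

lemma comb_flag: "t \<le> Suc (2 * k) \<Longrightarrow> x \<in> comb t \<Longrightarrow> x \<in> flag (t - 1)"
proof (induction t arbitrary: x rule: comb.induct)
  case (3 t)
  from 3(3) obtain x' c where x: "x = x' \<oplus> c \<odot> eps t" "x' \<in> comb t" by auto
  note F = bg_submoduleD[OF flag_submodule[of "Suc t"]]
  have "x' \<in> flag (Suc t)"
    using 3(1)[of x'] 3(2) x(2) subsetD[OF flag_mono[of "t - 1" "Suc t"], of x'] by simp
  moreover have "eps t \<in> flag (Suc t)" by (simp add: flag_Suc bg_span_incl)
  ultimately show ?case using F(4,5) 3(2) x(1) by simp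
qed (auto simp: flag_def)

text \<open>Applying the mode lowering the index exhibits the leading vector of a combination.\<close>

lemma comb_leading:
  "t < 2 * k \<Longrightarrow> x \<in> comb t \<Longrightarrow> c \<noteq> 0 \<Longrightarrow> eps t \<in> bg_span M {x \<oplus> c \<odot> eps t}"
proof (induction t arbitrary: x c)
  case 0
  then have "x \<oplus> c \<odot> eps 0 = c \<odot> eps 0" using eps_closed[of 0] by simp
  moreover have S: "bg_submodule (bg_span M {c \<odot> eps 0}) M"
    using eps_closed[of 0] 0 by (intro bg_span_submodule) auto
  have "inverse c \<odot> (c \<odot> eps 0) \<in> bg_span M {c \<odot> eps 0}"
    by (rule bg_submoduleD(5)[OF S]) (simp add: bg_span_incl)
  ultimately show ?case using 0 eps_closed[of 0] by (simp add: sm_assoc)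
next
  case (Suc t)
  let ?y = "x \<oplus> c \<odot> eps (Suc t)"
  have cl: "x \<in> carrier M" "eps (Suc t) \<in> carrier M" "eps t \<in> carrier M"
    using comb_closed[of "Suc t" x] eps_closed Suc.prems by auto
  have S: "bg_submodule (bg_span M {?y}) M"
    using cl by (intro bg_span_submodule) auto
  obtain e where e: "e \<noteq> 0" "act M (dn (Suc t)) (eps (Suc t)) = e \<odot> eps t"
    using dn_eps[OF Suc.prems(1)] by blast
  have "act M (dn (Suc t)) ?y = act M (dn (Suc t)) x \<oplus> (c * e) \<odot> eps t"
    using cl by (simp add: act_add act_smult e sm_assoc)
  moreover have "act M (dn (Suc t)) ?y \<in> bg_span M {?y}"
    by (rule bg_submoduleD(6)[OF S]) (simp add: bg_span_incl)
  moreover have "eps t \<in> bg_span M {act M (dn (Suc t)) x \<oplus> (c * e) \<odot> eps t}"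
    using Suc.IH[of "act M (dn (Suc t)) x" "c * e"] comb_dn[of t x] Suc.prems e(1) by simp
  ultimately have "eps t \<in> bg_span M {?y}"
    using bg_span_in_submodule[OF S] by simp
  \<comment> \<open>With \<open>eps t\<close> recovered, everything below the leading vector is
    available, in particular x, and can be subtracted from \<open>?y\<close>.\<close>
  then have "flag (Suc t) \<subseteq> bg_span M {?y}"
    unfolding flag_Suc by (intro bg_span_subset[OF S]) simp
  then have "x \<in> bg_span M {?y}"
    using comb_flag[of "Suc t" x] flag_mono[of t "Suc t"] Suc.prems by auto
  moreover have "?y \<in> bg_span M {?y}" by (simp add: bg_span_incl)
  ultimately have "?y \<ominus> x \<in> bg_span M {?y}"
    by (rule_tac bg_submoduleD(7)[OF S])
  moreover have "?y \<ominus> x = c \<odot> eps (Suc t)"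
    using cl by (simp add: a_comm[of x] add_sub)
  ultimately have "inverse c \<odot> (c \<odot> eps (Suc t)) \<in> bg_span M {?y}"
    using bg_submoduleD(5)[OF S] by metis
  then show ?case using Suc.prems cl by (simp add: sm_assoc)
qed

lemma comb_cases: "T \<le> Suc (2 * k) \<Longrightarrow> y \<in> comb T \<Longrightarrow> y \<noteq> \<zero> \<Longrightarrow>
    \<exists>t x c. t < 2 * k \<and> y = x \<oplus> c \<odot> eps t \<and> x \<in> comb t \<and> c \<noteq> 0"
proof (induction T arbitrary: y rule: comb.induct)
  case (3 t)
  from 3(3) obtain x c where x: "y = x \<oplus> c \<odot> eps t" "x \<in> comb t" by auto
  show ?case
  proof (cases "c = 0")
    case True
    then have "y = x" using x eps_closed[of t] comb_closed[of t x] 3(2) by simp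
    then show ?thesis using 3 x(2) by simp
  next
    case False
    moreover have "t < 2 * k" using 3(2) by simp
    ultimately show ?thesis using x by blast
  qed
qed auto

lemma other_zero: "T \<le> Suc (2 * k) \<Longrightarrow> x \<in> comb T \<Longrightarrow>
    (P = Beta_mode 0 \<longrightarrow> lower (- 1) x = \<zero>) \<and> (P = Gamma_mode 1 \<longrightarrow> raise 0 x = \<zero>)"
proof (induction T arbitrary: x rule: comb.induct)
  case (3 t)
  from 3(3) obtain x' c where x: "x = x' \<oplus> c \<odot> eps t" "x' \<in> comb t" by auto
  have "eps t \<in> carrier M" "x' \<in> carrier M" "t < 2 * k"
    using eps_closed[of t] 3(2) x comb_closed[of t x'] by auto
  then show ?case
    unfolding x(1) using 3(1)[of x'] 3(2) x(2) PQ by (auto simp: op_add op_sm)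
qed auto

lemma PQ_comb:
  assumes "a \<le> k" "x \<in> comb (2 * a + 1)"
  shows "act M P x \<in> comb (2 * a)" "act M Q (act M P x) \<in> comb (2 * a - 1)"
proof -
  show P: "act M P x \<in> comb (2 * a)"
    using comb_dn[of "2 * a" x] assms by (simp add: dn_def)
  show "act M Q (act M P x) \<in> comb (2 * a - 1)"
  proof (cases a)
    case 0
    then show ?thesis using P by simp
  next
    case (Suc b)
    then show ?thesis
      using comb_dn[of "2 * a - 1" "act M P x"] P assms by (simp add: dn_def)
  qed
qed

text \<open>The two alternatives are the two legs: on one, \<open>wt 0\<close> is \<open>Q P\<close>
  and \<open>wt'\<close> vanishes, on the other the roles are exchanged. In this form both legs are
  treated at once.\<close>

lemma wt_ops:
  assumes "x \<in> comb (2 * k + 1)"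
  shows "(wt 0 x = act M Q (act M P x) \<and> wt' x = \<zero> \<and> raise 0 x = act M P x \<and> lower (- 1) x = \<zero>) \<or>
    (wt 0 x = \<zero> \<and> wt' x = act M Q (act M P x) \<and> raise 0 x = \<zero> \<and> lower (- 1) x = act M P x)"
  using PQ other_zero[OF _ assms] by (auto simp: wt_def wt'_def raise_def lower_def)

lemma u_comb: "u \<in> comb (2 * k + 1)"
proof -
  have e: "2 * k + 1 = Suc (Suc (2 * k - 1))" using k by simp
  have "u = \<zero> \<oplus> 1 \<odot> u" using u_closed by simp
  then show ?thesis unfolding e using comb_zero[of "2 * k - 1"] by auto
qed

text \<open>\<open>Q P\<close> lowers the top index by two.\<close>

lemma nil_comb:
  assumes T: "linop T" "\<And>x. x \<in> comb (2 * k + 1) \<Longrightarrow> T x = act M Q (act M P x) \<or> T x = \<zero>"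
    and "a \<le> k" "x \<in> comb (2 * a + 1)"
  shows "nil T x"
  using assms(3-)
proof (induction a arbitrary: x)
  case 0
  then show ?case by (simp add: nil_zero)
next
  case (Suc a)
  have sub: "x \<in> comb (2 * k + 1)" if "a \<le> k" "x \<in> comb (2 * a + 1)" for a x
    using that
  proof (induction "k - a" arbitrary: a)
    case (Suc d)
    have e: "2 * Suc a + 1 = Suc (Suc (2 * a + 1))" by simp
    have "a < k" using Suc.hyps(2) by simp
    then have "x \<in> comb (2 * Suc a + 1)"
      unfolding e by (intro subsetD[OF comb_mono Suc.prems(2)]) simp
    then show ?case using Suc.hyps(2) \<open>a < k\<close> by (intro Suc.hyps(1)[of "Suc a"]) auto
  next
    case 0
    then have "a = k" by simp
    then show ?case using 0 by simp
  qed
  have "T x \<in> comb (2 * a + 1)"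
    using T(2)[OF sub[OF Suc.prems]] PQ_comb(2)[OF Suc.prems] comb_zero[of "2 * a + 1"] Suc.prems(1) by auto
  then have "nil T (T x)" using Suc by simp
  then obtain m where "(T ^^ m) (T x) = \<zero>" by (auto simp: nil_def)
  then show ?case unfolding nil_def by (intro exI[of _ "Suc m"]) (simp add: funpow_swap1)
qed

lemma u_relations: "roof_relations u"
  unfolding roof_relations_def
proof (intro conjI allI impI)
  have k': "2 * k - 1 < 2 * k" using k by simp
  show "raise n u = \<zero>" if "n \<ge> 1" for n using raise_eps[OF k' that] .
  show "lower n u = \<zero>" if "n \<le> - 2" for n using lower_eps[OF k' that] .
  show "raise 0 (lower (- 1) u) = \<zero>"
    using wt_ops[OF u_comb] u_closed raise_lower[OF u_closed, of 0 "- 1"] by auto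
  show "nil (wt 0) u" "nil wt' u"
    by (rule nil_comb[OF _ _ order_refl u_comb]; use wt_ops linop_wt' in blast)+
qed (rule u_closed)

lemma vac_comb: "y \<in> vac_space u \<Longrightarrow> y \<in> comb (2 * k + 1)"
proof (induction rule: vac_space.induct)
  case base
  then show ?case by (rule u_comb)
next
  case (wt y)
  have "act M Q (act M P y) \<in> comb (2 * k + 1)"
    using PQ_comb(2)[OF order_refl wt(2)] comb_mono[of "2 * k - 1"] k by auto
  then show ?case using wt_ops[OF wt(2)] comb_zero[of "2 * k + 1"] by auto
next
  case (wt' y)
  have "act M Q (act M P y) \<in> comb (2 * k + 1)"
    using PQ_comb(2)[OF order_refl wt'(2)] comb_mono[of "2 * k - 1"] k by auto
  then show ?case using wt_ops[OF wt'(2)] comb_zero[of "2 * k + 1"] by auto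
qed (simp_all add: comb_add comb_sm del: comb.simps)

lemma standard_comb: "s \<in> standard u \<Longrightarrow> s \<in> comb (2 * k) \<or> s \<in> comb (2 * k + 1)"
proof -
  assume "s \<in> standard u"
  then consider "s \<in> vac_space u" | y where "y \<in> vac_space u" "s = raise 0 y \<or> s = lower (- 1) y"
    by (auto simp: standard_def)
  then show ?thesis
  proof cases
    case 2
    have "s = act M P y \<or> s = \<zero>" using wt_ops[OF vac_comb[OF 2(1)]] 2(2) by metis
    then show ?thesis
      using PQ_comb(1)[OF order_refl vac_comb[OF 2(1)]] comb_zero[of "2 * k"] by auto
  qed (use vac_comb in blast)
qed

text \<open>For a submodule S take the largest m with \<open>flag m \<subseteq> S\<close>. The
  leading vector of any standard vector in S lies in S by \<open>comb_leading\<close>, hence below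
  m, so \<open>flag m\<close> contains all standard vectors of S and thus S.\<close>

theorem ladder_chain: "bg_chain M flag (2 * k)"
  unfolding bg_chain_def
proof (intro conjI allI impI)
  show "bg_module M" by (rule bg_module_axioms)
  show "flag s \<subset> flag t" if "s < t" "t \<le> 2 * k" for s t
    by (rule flag_strict[OF that])
  fix S
  show "bg_submodule S M \<longleftrightarrow> (\<exists>t\<le>2 * k. S = flag t)"
  proof
    assume S: "bg_submodule S M"
    define A where "A = {t. t \<le> 2 * k \<and> flag t \<subseteq> S}"
    have A: "finite A" "0 \<in> A"
      using bg_submoduleD(2)[OF S] by (auto simp: A_def flag_def)
    define m where "m = Max A"
    have m: "m \<in> A" "\<And>t. t \<in> A \<Longrightarrow> t \<le> m"
      unfolding m_def using A by (auto intro: Max_in)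
    then have mk: "m \<le> 2 * k" "flag m \<subseteq> S" by (auto simp: A_def)
    have "S \<inter> standard u \<subseteq> flag m"
    proof
      fix s assume s: "s \<in> S \<inter> standard u"
      show "s \<in> flag m"
      proof (cases "s = \<zero>")
        case True
        then show ?thesis using bg_submoduleD(2)[OF flag_submodule[OF mk(1)]] by simp
      next
        case False
        have "s \<in> comb (2 * k) \<or> s \<in> comb (2 * k + 1)" using standard_comb[of s] s by blast
        then obtain T where T: "T \<le> Suc (2 * k)" "s \<in> comb T"
          by (metis Suc_eq_plus1 le_SucI order_refl)
        obtain t x c where t: "t < 2 * k" "s = x \<oplus> c \<odot> eps t" "x \<in> comb t" "c \<noteq> 0"
          using comb_cases[OF T False] by blast
        have "eps t \<in> S"
          using comb_leading[OF t(1,3,4)] t(2) s bg_span_in_submodule[OF S, of s] by auto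
        then have "Suc t \<in> A"
          using t(1) bg_span_subset[OF S, of "{eps t}"] by (simp add: A_def flag_Suc)
        then have "flag (Suc t) \<subseteq> flag m" using m(2) mk(1) by (intro flag_mono) auto
        moreover have "s \<in> flag (Suc t)"
        proof -
          have "s \<in> comb (Suc (Suc t))" using t(2,3) by auto
          then show ?thesis using comb_flag[of "Suc (Suc t)" s] t(1) by simp
        qed
        ultimately show ?thesis by blast
      qed
    qed
    then have "bg_span M (S \<inter> standard u) \<subseteq> flag m"
      by (rule bg_span_subset[OF flag_submodule[OF mk(1)]])
    moreover have "S = bg_span M (S \<inter> standard u)"
      using submodule_standard[OF u_relations S] bg_submoduleD(1)[OF S] top by simp
    ultimately show "\<exists>t\<le>2 * k. S = flag t" using mk by blast
  qed (use flag_submodule in blast)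
qed

end

section \<open>The modules V, W and their logarithmic extensions\<close>

lemma pm_linear_times: "pm_linear logfun_times"
  unfolding logfun_times_def by (rule pm_linear_lin_ext)

lemma pm_linear_deriv: "pm_linear (logfun_deriv \<mu>)"
  unfolding logfun_deriv_def by (rule pm_linear_lin_ext)

lemma pm_linear_neg: "pm_linear h \<Longrightarrow> pm_linear (\<lambda>f. - h f)"
  by (simp add: pm_linear_def scale_add)

lemma times_single [simp]: "logfun_times (single (n, j) c) = single (n + 1, j) c"
  by (simp add: logfun_times_def)

lemma deriv_single [simp]: "logfun_deriv \<mu> (single (n, j) c) =
    single (n - 1, j) (c * (\<mu> + of_int n)) + single (n - 1, j - 1) (c * of_nat j)"
  by (simp add: logfun_deriv_def scale_add)

lemma deriv_times: "logfun_deriv \<mu> (logfun_times f) = logfun_times (logfun_deriv \<mu> f) + f"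
proof (rule pm_linear_eq[of "\<lambda>f. logfun_deriv \<mu> (logfun_times f)"])
  show "pm_linear (\<lambda>f. logfun_deriv \<mu> (logfun_times f))" "pm_linear (\<lambda>f. logfun_times (logfun_deriv \<mu> f) + f)"
    by (simp_all add: pm_linear_def pm_linearD[OF pm_linear_times] pm_linearD[OF pm_linear_deriv] scale_add)
  fix x :: "int \<times> nat"
  obtain n j where x: "x = (n, j)" by (cases x)
  show "logfun_deriv \<mu> (logfun_times (single x 1)) = logfun_times (logfun_deriv \<mu> (single x 1)) + single x 1"
    by (simp add: x pm_linearD[OF pm_linear_times] single_add[symmetric] algebra_simps)
qed

lemma fock_gamma: "fock (\<lambda>f. - logfun_deriv \<mu> f) logfun_times"
  by unfold_locales (simp_all add: pm_linear_times pm_linear_neg pm_linear_deriv deriv_times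
      pm_linearD[OF pm_linear_times])

lemma fock_beta: "fock logfun_times (logfun_deriv 0)"
  by unfold_locales (simp_all add: pm_linear_times pm_linear_deriv deriv_times)

lemma times_free_vectors:
  assumes "\<And>n j. (n, j) \<in> S \<Longrightarrow> (n + 1, j) \<in> S" "v \<in> free_vectors S"
  shows "logfun_times v \<in> free_vectors S"
  by (rule pm_linear_free_vectors[OF pm_linear_times _ assms(2)]) (use assms(1) in auto)

lemma deriv_free_vectors:
  assumes "\<And>n j. (n, j) \<in> S \<Longrightarrow> \<mu> + of_int n \<noteq> 0 \<Longrightarrow> (n - 1, j) \<in> S"
    "\<And>n j. (n, Suc j) \<in> S \<Longrightarrow> (n - 1, j) \<in> S" "v \<in> free_vectors S"
  shows "logfun_deriv \<mu> v \<in> free_vectors S"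
proof (rule pm_linear_free_vectors[OF pm_linear_deriv _ assms(3)])
  fix x assume x: "x \<in> S"
  obtain n j where nj: "x = (n, j)" by (cases x)
  have "single (n - 1, j) (\<mu> + of_int n) \<in> free_vectors S"
    using assms(1)[of n j] x nj by auto
  moreover have "single (n - 1, j - 1) (of_nat j :: complex) \<in> free_vectors S"
    using assms(2)[of n "j - 1"] x nj by (cases j) auto
  ultimately show "logfun_deriv \<mu> (single x 1) \<in> free_vectors S"
    unfolding nj deriv_single mult_1 by (rule free_vectors_add)
qed

context induced_fock
begin

lemma emb_zero: "emb 0 = \<zero>\<^bsub>Ind E\<^esub>"
  using emb_sm[of 0 0] emb_closed[of 0] P.Q.sm_zero by simp

lemma emb_pos: "v \<in> free_vectors S \<Longrightarrow> mode_index a \<ge> 1 \<Longrightarrow> act (Ind E) a (emb v) = \<zero>\<^bsub>Ind E\<^esub>"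
  using emb_act[of v a] emb_zero by (cases a) auto

lemma emb_beta: "v \<in> free_vectors S \<Longrightarrow> act (Ind E) (Beta_mode 0) (emb v) = emb (b v)"
  and emb_gamma: "v \<in> free_vectors S \<Longrightarrow> act (Ind E) (Gamma_mode 0) (emb v) = emb (g v)"
  using emb_act[of v] by auto

text \<open>The case of \<open>emb_in_span\<close> with no generators and the zero subspace.\<close>

lemma emb_nonzero: "v \<in> free_vectors S \<Longrightarrow> v \<noteq> 0 \<Longrightarrow> emb v \<noteq> \<zero>\<^bsub>Ind E\<^esub>"
proof
  assume v: "v \<in> free_vectors S" "v \<noteq> 0" "emb v = \<zero>\<^bsub>Ind E\<^esub>"
  have "emb v \<in> bg_span (Ind E) (emb ` {})"
    unfolding v(3) by (rule P.Q.bg_submoduleD(2)[OF P.Q.bg_span_submodule]) simp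
  with v(1) have "v \<in> {0}"
    by (rule_tac emb_in_span[of "{0}" "{}"]) (simp_all add: pm_linearD(3)[OF b] pm_linearD(3)[OF g])
  then show False using v(2) by simp
qed

lemma emb_span_all:
  assumes T: "bg_submodule T (Ind E)" and "\<And>x. x \<in> S \<Longrightarrow> emb (single x 1) \<in> T"
  shows "carrier (Ind E) \<subseteq> T"
proof -
  note D = P.Q.bg_submoduleD[OF T]
  have "emb v \<in> T" if "v \<in> free_vectors S" for v
    using that
  proof (induction rule: free_vectors_induct)
    case zero
    show ?case using D(2) by (simp add: emb_zero)
  next
    case (single x c)
    then show ?case
      using D(5)[OF assms(2)[OF single], of c] emb_sm[of "single x 1" c] by simp
  next
    case (add f h)
    then show ?case using D(4) emb_add[of f h] by simp
  qed
  then have "bg_span (Ind E) (emb ` carrier E) \<subseteq> T"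
    by (intro P.Q.bg_span_subset[OF T]) auto
  then show ?thesis using Ind_generated by simp
qed

text \<open>Moves questions of generation in the induced module to the inducing space of
  functions.\<close>

lemma pullback_props:
  assumes T: "bg_submodule T (Ind E)"
  defines "X \<equiv> {v \<in> free_vectors S. emb v \<in> T}"
  shows "u \<in> X \<Longrightarrow> v \<in> X \<Longrightarrow> u + v \<in> X" "v \<in> X \<Longrightarrow> pm_scale c v \<in> X" "v \<in> X \<Longrightarrow> b v \<in> X" "v \<in> X \<Longrightarrow> g v \<in> X"
proof -
  note D = P.Q.bg_submoduleD[OF T]
  show "u \<in> X \<Longrightarrow> v \<in> X \<Longrightarrow> u + v \<in> X"
    using D(4) emb_add[of u v] free_vectors_add[of u S v] by (simp add: X_def)
  show "v \<in> X \<Longrightarrow> pm_scale c v \<in> X"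
    using D(5) emb_sm[of v c] free_vectors_scale[of v S c] by (simp add: X_def)
  show "v \<in> X \<Longrightarrow> b v \<in> X" "v \<in> X \<Longrightarrow> g v \<in> X"
    using D(6)[of "emb v" "Beta_mode 0"] D(6)[of "emb v" "Gamma_mode 0"] emb_beta[of v] emb_gamma[of v] b_closed[of v] g_closed[of v] unfolding X_def by auto
qed

end

section \<open>The simple modules V and W\<close>

interpretation V: induced_fock "\<lambda>f. - logfun_deriv 0 f" logfun_times "{0..} \<times> {0}"
proof (rule induced_fock.intro[OF fock_gamma], unfold_locales)
  fix v :: logfun assume v: "v \<in> free_vectors ({0..} \<times> {0})"
  show "logfun_times v \<in> free_vectors ({0..} \<times> {0})"
    by (rule times_free_vectors[OF _ v]) auto
  have "logfun_deriv 0 v \<in> free_vectors ({0..} \<times> {0})"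
    by (rule deriv_free_vectors[OF _ _ v]) auto
  then show "- logfun_deriv 0 v \<in> free_vectors ({0..} \<times> {0})" by simp
qed

lemma V_mod_eq: "V_mod = Ind V.E"
  by (simp add: V_mod_def)

lemma V_module: "bg_module V_mod"
  unfolding V_mod_eq by (rule V.Ind_module)

definition V_vac :: ind_vec where
  "V_vac = V.emb (single (0, 0) 1)"

lemma V_vacuum: "bg_module.vacuum V_mod V_vac"
proof -
  interpret VM: bg_module V_mod by (rule V_module)
  have c: "single (0 :: int, 0 :: nat) (1 :: complex) \<in> free_vectors ({0..} \<times> {0})" by simp
  have "V_vac \<in> carrier V_mod"
    unfolding V_vac_def V_mod_eq using c by (intro V.emb_closed) simp
  moreover have "VM.raise n V_vac = \<zero>\<^bsub>V_mod\<^esub>" if "n \<ge> 0" for n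
  proof (cases "n = 0")
    case True
    then show ?thesis
      using V.emb_beta[OF c] V.emb_zero by (simp add: VM.raise_def V.P.Q.raise_def V_vac_def V_mod_eq)
  next
    case False
    then show ?thesis
      using that V.emb_pos[OF c, of "Beta_mode n"] by (simp add: VM.raise_def V.P.Q.raise_def V_vac_def V_mod_eq)
  qed
  moreover have "VM.lower n V_vac = \<zero>\<^bsub>V_mod\<^esub>" if "n < 0" for n
    using that V.emb_pos[OF c, of "Gamma_mode (- n)"] by (simp add: VM.lower_def V.P.Q.lower_def V_vac_def V_mod_eq)
  ultimately show ?thesis by (simp add: VM.vacuum_def)
qed

lemma V_vac_nonzero: "V_vac \<noteq> \<zero>\<^bsub>V_mod\<^esub>"
proof -
  have "single (0 :: int, 0 :: nat) (1 :: complex) \<noteq> 0"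
    by (metis lookup_single_eq lookup_zero zero_neq_one)
  then show ?thesis
    unfolding V_vac_def V_mod_eq by (intro V.emb_nonzero) auto
qed

lemma V_generated: "bg_span V_mod {V_vac} = carrier V_mod"
proof
  interpret VM: bg_module V_mod by (rule V_module)
  have T: "bg_submodule (bg_span V_mod {V_vac}) V_mod"
    using V_vacuum by (intro VM.bg_span_submodule) (auto simp: VM.vacuum_def)
  then show "bg_span V_mod {V_vac} \<subseteq> carrier V_mod" by (rule VM.bg_submoduleD(1))
  have e: "V.emb (single (int n, 0) 1) \<in> bg_span V_mod {V_vac}" for n
  proof (induction n)
    case 0
    show ?case using VM.bg_span_incl[of V_vac "{V_vac}"] by (simp add: V_vac_def)
  next
    case (Suc n)
    have "act V_mod (Gamma_mode 0) (V.emb (single (int n, 0) 1)) = V.emb (single (int (Suc n), 0) 1)"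
      using V.emb_gamma[of "single (int n, 0) 1"] by (simp add: V_mod_eq add.commute)
    then show ?case using VM.bg_submoduleD(6)[OF T Suc, of "Gamma_mode 0"] by simp
  qed
  show "carrier V_mod \<subseteq> bg_span V_mod {V_vac}"
    unfolding V_mod_eq
  proof (rule V.emb_span_all)
    show "bg_submodule (bg_span (Ind V.E) {V_vac}) (Ind V.E)"
      using T by (simp add: V_mod_eq)
    fix x :: "int \<times> nat" assume "x \<in> {0..} \<times> {0}"
    then have "x = (int (nat (fst x)), 0)" by (cases x) simp
    then obtain n where "x = (int n, 0)" by blast
    then show "V.emb (single x 1) \<in> bg_span (Ind V.E) {V_vac}"
      using e[of n] by (simp add: V_mod_eq)
  qed
qed

lemma W_induced_fock: "induced_fock (\<lambda>f. - logfun_deriv \<mu> f) logfun_times (UNIV \<times> {0})"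
proof (rule induced_fock.intro[OF fock_gamma], unfold_locales)
  fix v :: logfun assume v: "v \<in> free_vectors (UNIV \<times> {0})"
  show "logfun_times v \<in> free_vectors (UNIV \<times> {0})"
    by (rule times_free_vectors[OF _ v]) auto
  have "logfun_deriv \<mu> v \<in> free_vectors (UNIV \<times> {0})"
    by (rule deriv_free_vectors[OF _ _ v]) auto
  then show "- logfun_deriv \<mu> v \<in> free_vectors (UNIV \<times> {0})" by simp
qed

lemma W_module: "bg_module (W_mod \<mu>)"
proof -
  interpret W: induced_fock "\<lambda>f. - logfun_deriv \<mu> f" logfun_times "UNIV \<times> {0}"
    by (rule W_induced_fock)
  show ?thesis unfolding W_mod_def by (rule W.Ind_module)
qed

text \<open>The generator is the function x^\<mu>: the variable raises the exponent, and the
  derivative lowers it with factors \<mu> + n, nonzero as \<mu> is not an integer. Its eigenvalue -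
  \<mu> under \<open>wt 0\<close> is what makes \<open>J0\<close> non-integral on W.\<close>

lemma W_generator:
  assumes \<mu>: "\<mu> \<notin> \<int>"
  obtains w where "w \<in> carrier (W_mod \<mu>)" "bg_span (W_mod \<mu>) {w} = carrier (W_mod \<mu>)"
    "\<And>n. n \<ge> 1 \<Longrightarrow> bg_premodule.raise (W_mod \<mu>) n w = \<zero>\<^bsub>W_mod \<mu>\<^esub>"
    "\<And>n. n \<le> - 1 \<Longrightarrow> bg_premodule.lower (W_mod \<mu>) n w = \<zero>\<^bsub>W_mod \<mu>\<^esub>"
    "bg_premodule.wt (W_mod \<mu>) 0 w = (- \<mu>) \<odot>\<^bsub>W_mod \<mu>\<^esub> w"
proof -
  interpret W: induced_fock "\<lambda>f. - logfun_deriv \<mu> f" logfun_times "UNIV \<times> {0}"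
    by (rule W_induced_fock)
  have eq: "W_mod \<mu> = Ind W.E" by (simp add: W_mod_def)
  interpret WM: bg_module "W_mod \<mu>" by (rule W_module)
  define e where "e n = W.emb (single (n, 0) 1)" for n
  have s: "single (n, 0) (c :: complex) \<in> free_vectors (UNIV \<times> {0})" for n :: int and c by simp
  have ec: "e n \<in> carrier (W_mod \<mu>)" for n
    unfolding e_def eq by (rule W.emb_closed) simp
  have g: "act (W_mod \<mu>) (Gamma_mode 0) (e n) = e (n + 1)" for n
    using W.emb_gamma[OF s, of n 1] by (simp add: e_def eq)
  have emb_s: "W.emb (single (n, 0) c) = c \<odot>\<^bsub>W_mod \<mu>\<^esub> e n" for n c
    using W.emb_sm[of "single (n, 0) 1" c] by (simp add: e_def eq)
  have b: "act (W_mod \<mu>) (Beta_mode 0) (e n) = (- (\<mu> + of_int n)) \<odot>\<^bsub>W_mod \<mu>\<^esub> e (n - 1)" for n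
  proof -
    have "- single (n - 1, 0) (\<mu> + of_int n) = (single (n - 1, 0) (- (\<mu> + of_int n)) :: logfun)"
      by (rule single_uminus[symmetric])
    then show ?thesis
      using W.emb_beta[OF s, of n 1] unfolding emb_s[symmetric] by (simp add: e_def eq)
  qed
  have T: "bg_submodule (bg_span (W_mod \<mu>) {e 0}) (W_mod \<mu>)"
    using ec by (intro WM.bg_span_submodule) auto
  note D = WM.bg_submoduleD[OF T]
  have "e (int n) \<in> bg_span (W_mod \<mu>) {e 0}" for n
  proof (induction n)
    case 0
    show ?case by (simp add: WM.bg_span_incl)
  next
    case (Suc n)
    then show ?case using D(6)[OF Suc, of "Gamma_mode 0"] g[of "int n"] by (simp add: add.commute)
  qed
  moreover have "e (- int n) \<in> bg_span (W_mod \<mu>) {e 0}" for n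
  proof (induction n)
    case 0
    show ?case by (simp add: WM.bg_span_incl)
  next
    case (Suc n)
    have nz: "- (\<mu> + of_int (- int n)) \<noteq> 0"
    proof
      assume "- (\<mu> + of_int (- int n)) = 0"
      then have "\<mu> = of_int (int n)" by (simp add: algebra_simps)
      then show False using \<mu> Ints_of_int by metis
    qed
    let ?c = "- (\<mu> + of_int (- int n))"
    have "inverse ?c \<odot>\<^bsub>W_mod \<mu>\<^esub> (?c \<odot>\<^bsub>W_mod \<mu>\<^esub> e (- int n - 1)) \<in> bg_span (W_mod \<mu>) {e 0}"
      using D(5,6) Suc b[of "- int n"] by metis
    then have "e (- int n - 1) \<in> bg_span (W_mod \<mu>) {e 0}"
      unfolding WM.sm_assoc[OF ec] left_inverse[OF nz] WM.sm_one[OF ec] .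
    moreover have "- int (Suc n) = - int n - 1" by simp
    ultimately show ?case by metis
  qed
  ultimately have all: "e n \<in> bg_span (W_mod \<mu>) {e 0}" for n
    by (metis int_cases2)
  have "carrier (Ind W.E) \<subseteq> bg_span (W_mod \<mu>) {e 0}"
    using T all by (intro W.emb_span_all) (auto simp: eq e_def)
  then have gen: "bg_span (W_mod \<mu>) {e 0} = carrier (W_mod \<mu>)"
    using D(1) by (auto simp: eq)
  show ?thesis
  proof (rule that[OF ec gen])
    show "WM.raise n (e 0) = \<zero>\<^bsub>W_mod \<mu>\<^esub>" if "n \<ge> 1" for n
      using that W.emb_pos[OF s, of "Beta_mode n"] by (simp add: WM.raise_def W.P.Q.raise_def e_def eq)
    show "WM.lower n (e 0) = \<zero>\<^bsub>W_mod \<mu>\<^esub>" if "n \<le> - 1" for n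
      using that W.emb_pos[OF s, of "Gamma_mode (- n)"] by (simp add: WM.lower_def W.P.Q.lower_def e_def eq)
    show "WM.wt 0 (e 0) = (- \<mu>) \<odot>\<^bsub>W_mod \<mu>\<^esub> e 0"
      using ec g[of "- 1"] b[of 0] by (simp add: WM.wt_def WM.lower_def WM.raise_def WM.act_smult)
  qed
qed

text \<open>Multiplying x^(-1) (log x)^(j+1) by x and differentiating gives a multiple of x^(-1)
  (log x)^j, which yields all powers of log at the exponent - 1. From there x leads upwards and the
  derivative downwards. The exponent - 1 is the place to start, since the derivative cannot pass
  from 0 to - 1 without lowering the power of log.\<close>

lemma logfun_generated:
  assumes add: "\<And>u v. u \<in> X \<Longrightarrow> v \<in> X \<Longrightarrow> u + v \<in> X" and sm: "\<And>c v. v \<in> X \<Longrightarrow> pm_scale c v \<in> X"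
    and t: "\<And>v. v \<in> X \<Longrightarrow> logfun_times v \<in> X" and d: "\<And>v. v \<in> X \<Longrightarrow> logfun_deriv 0 v \<in> X"
    and top: "single (- 1, k) 1 \<in> X" and "j \<le> k"
  shows "single (n, j) (1 :: complex) \<in> X"
proof -
  have cancel: "single x 1 \<in> X" if "single x c \<in> X" "c \<noteq> 0" for x and c :: complex
    using sm[OF that(1), of "inverse c"] that(2) by simp
  have 1: "single (- 1, j) (1 :: complex) \<in> X" if "j \<le> k" for j
    using that
  proof (induction "k - j" arbitrary: j)
    case 0
    then have "j = k" by simp
    then show ?case using top by simp
  next
    case (Suc i)
    then have "single (- 1, Suc j) (1 :: complex) \<in> X" by (intro Suc.hyps(1)) auto
    from d[OF t[OF this]] have "single (- 1, j) (of_nat (Suc j) :: complex) \<in> X" by simp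
    then show ?case by (rule cancel) (simp add: of_nat_eq_0_iff del: of_nat_Suc)
  qed
  have 2: "single (int m - 1, j) (1 :: complex) \<in> X" if "j \<le> k" for m j
  proof (induction m)
    case 0
    then show ?case using 1[OF that] by simp
  next
    case (Suc m)
    then show ?case using t[OF Suc] by (simp add: algebra_simps)
  qed
  have 3: "single (- 1 - int m, j) (1 :: complex) \<in> X" if "j \<le> k" for m j
    using that
  proof (induction j arbitrary: m)
    case 0
    show ?case
    proof (induction m)
      case 0
      show ?case using 1[of 0] by simp
    next
      case (Suc m)
      from d[OF Suc] have "single (- 1 - int m - 1, 0) (of_int (- 1 - int m) :: complex) \<in> X" by simp
      then have "single (- 1 - int m - 1, 0) (1 :: complex) \<in> X"
        by (rule cancel) (simp only: of_int_eq_0_iff)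
      then show ?case by (simp add: algebra_simps)
    qed
  next
    case (Suc j)
    note outer = Suc
    show ?case
    proof (induction m)
      case 0
      show ?case using 1[OF Suc.prems] by simp
    next
      case (Suc m)
      have "single (- 1 - int (Suc m), j) (1 :: complex) \<in> X"
        by (rule outer(1)) (use outer(2) in simp)
      \<comment> \<open>Cancels the term with the lower power of log that the derivative
        contributes.\<close>
      from sm[OF this, of "- of_nat (Suc j)"]
      have "single (- 1 - int m - 1, j) (- of_nat (Suc j) :: complex) \<in> X"
        by (simp add: algebra_simps)
      from add[OF d[OF Suc] this]
      have "single (- 1 - int m - 1, Suc j) (of_int (- 1 - int m) :: complex) \<in> X"
        by (simp add: add.assoc single_add[symmetric])
      then have "single (- 1 - int m - 1, Suc j) (1 :: complex) \<in> X"
        by (rule cancel) (simp only: of_int_eq_0_iff)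
      then show ?case by (simp add: algebra_simps)
    qed
  qed
  show ?thesis
  proof (cases "n \<ge> - 1")
    case True
    then have "n = int (nat (n + 1)) - 1" by simp
    then show ?thesis using 2[OF assms(6), of "nat (n + 1)"] by simp
  next
    case False
    then have "n = - 1 - int (nat (- 1 - n))" by simp
    then show ?thesis using 3[OF assms(6), of "nat (- 1 - n)"] by metis
  qed
qed

text \<open>The two kinds of logarithmic modules differ in which of the two zero modes acts as the
  variable.\<close>

locale log_induced = induced_fock b g "UNIV \<times> {..<k}" for b g k +
  fixes p q :: mode and s :: complex
  assumes k_pos: "k \<ge> 1" and s: "s \<noteq> 0"
    and pq: "(p = Beta_mode 0 \<and> q = Gamma_mode 0 \<and> b = logfun_times \<and> g = (\<lambda>f. pm_scale s (logfun_deriv 0 f))) \<or>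
      (p = Gamma_mode 0 \<and> q = Beta_mode 0 \<and> g = logfun_times \<and> b = (\<lambda>f. pm_scale s (logfun_deriv 0 f)))"
begin

text \<open>The sequence 1, 1/x, log x, (log x)/x, (log x)^2, ... from socle to head. Multiplication
  by x takes (log x)^a / x to its predecessor, and the derivative takes (log x)^a to a times its
  predecessor; this factor is the origin of \<open>\<kappa>\<close>.\<close>

definition logpow :: "nat \<Rightarrow> logfun" where
  "logpow t = single (if even t then 0 else - 1, t div 2) 1"

definition "eps t = emb (logpow t)"

lemma logpow_closed: "t < 2 * k \<Longrightarrow> logpow t \<in> free_vectors (UNIV \<times> {..<k})"
  by (auto simp: logpow_def)

lemma eps_carrier: "t < 2 * k \<Longrightarrow> eps t \<in> carrier (Ind E)"
  unfolding eps_def using logpow_closed[of t] by (intro emb_closed) simp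

lemma act_p: "v \<in> free_vectors (UNIV \<times> {..<k}) \<Longrightarrow> act (Ind E) p (emb v) = emb (logfun_times v)"
  and act_q: "v \<in> free_vectors (UNIV \<times> {..<k}) \<Longrightarrow> act (Ind E) q (emb v) = emb (pm_scale s (logfun_deriv 0 v))"
  using pq emb_beta[of v] emb_gamma[of v] by auto

lemma p_eps: "a < k \<Longrightarrow> act (Ind E) p (eps (2 * a + 1)) = eps (2 * a)"
  using act_p[OF logpow_closed[of "2 * a + 1"]] by (simp add: eps_def logpow_def)

lemma q_eps: "Suc a < k \<Longrightarrow> act (Ind E) q (eps (2 * Suc a)) = (s * of_nat (Suc a)) \<odot>\<^bsub>Ind E\<^esub> eps (2 * a + 1)"
proof -
  assume a: "Suc a < k"
  have "logpow (2 * a + 1) \<in> free_vectors (UNIV \<times> {..<k})"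
    using a by (intro logpow_closed) simp
  from emb_sm[of "logpow (2 * a + 1)" "s * of_nat (Suc a)"] this
  have "emb (pm_scale (s * of_nat (Suc a)) (logpow (2 * a + 1))) = (s * of_nat (Suc a)) \<odot>\<^bsub>Ind E\<^esub> eps (2 * a + 1)"
    by (simp add: eps_def)
  then show ?thesis
    using act_q[OF logpow_closed[of "2 * Suc a"]] a by (simp add: eps_def logpow_def)
qed

lemma q_eps_0: "act (Ind E) q (eps 0) = \<zero>\<^bsub>Ind E\<^esub>"
  using act_q[OF logpow_closed[of 0]] k_pos by (simp add: eps_def logpow_def emb_zero)

lemma eps_pos: "t < 2 * k \<Longrightarrow> mode_index a \<ge> 1 \<Longrightarrow> act (Ind E) a (eps t) = \<zero>\<^bsub>Ind E\<^esub>"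
  unfolding eps_def by (rule emb_pos[OF logpow_closed])

lemma eps_0_nonzero: "eps 0 \<noteq> \<zero>\<^bsub>Ind E\<^esub>"
proof -
  have "single (0 :: int, 0 :: nat) (1 :: complex) \<noteq> 0"
    by (metis lookup_single_eq lookup_zero zero_neq_one)
  then show ?thesis
    unfolding eps_def using logpow_closed[of 0] k_pos by (intro emb_nonzero) (auto simp: logpow_def)
qed

lemma eps_top: "bg_span (Ind E) {eps (2 * k - 1)} = carrier (Ind E)"
proof
  have lt: "2 * k - 1 < 2 * k" using k_pos by simp
  have T: "bg_submodule (bg_span (Ind E) {eps (2 * k - 1)}) (Ind E)"
    using eps_carrier[OF lt] by (intro P.Q.bg_span_submodule) auto
  then show "bg_span (Ind E) {eps (2 * k - 1)} \<subseteq> carrier (Ind E)" by (rule P.Q.bg_submoduleD(1))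
  let ?X = "{v \<in> free_vectors (UNIV \<times> {..<k}). emb v \<in> bg_span (Ind E) {eps (2 * k - 1)}}"
  note X = pullback_props[OF T]
  have tX: "logfun_times v \<in> ?X" if "v \<in> ?X" for v
    using pq X(3,4)[OF that] by auto
  have dX: "logfun_deriv 0 v \<in> ?X" if "v \<in> ?X" for v
  proof -
    have "pm_scale s (logfun_deriv 0 v) \<in> ?X"
      using pq X(3,4)[OF that] by auto
    from X(2)[OF this, of "inverse s"] show ?thesis using s by simp
  qed
  have e: "(2 * k - 1) div 2 = k - 1" "odd (2 * k - 1)" using k_pos by auto
  have "single (- 1, k - 1) 1 \<in> ?X"
  proof -
    have "logpow (2 * k - 1) \<in> ?X"
      using logpow_closed[OF lt] by (simp add: eps_def[symmetric] P.Q.bg_span_incl)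
    then show ?thesis unfolding logpow_def e(1) using e(2) k_pos by simp
  qed
  from logfun_generated[of ?X, OF X(1,2) tX dX this]
  have "single (n, j) 1 \<in> ?X" if "j < k" for n j
    using that k_pos by simp
  then show "carrier (Ind E) \<subseteq> bg_span (Ind E) {eps (2 * k - 1)}"
    by (intro emb_span_all[OF T]) auto
qed

lemma eps_strict:
  assumes t: "Suc t < 2 * k"
  shows "eps (Suc t) \<notin> bg_span (Ind E) {eps t}"
proof
  assume "eps (Suc t) \<in> bg_span (Ind E) {eps t}"
  then have e: "emb (logpow (Suc t)) \<in> bg_span (Ind E) (emb ` {logpow t})"
    by (simp add: eps_def)
  let ?a = "t div 2"
  \<comment> \<open>The functions up to level t: all smaller powers of log and, for even t, only
    nonnegative exponents at the top power. The derivative stays inside because it kills x^0 up to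
    smaller powers of log.\<close>
  define S where "S = {(n :: int, j). j < ?a \<or> j = ?a \<and> (even t \<longrightarrow> n \<ge> 0)}"
  have times: "logfun_times v \<in> free_vectors S" if "v \<in> free_vectors S" for v
    by (rule times_free_vectors[OF _ that]) (auto simp: S_def)
  have deriv: "pm_scale s (logfun_deriv 0 v) \<in> free_vectors S" if "v \<in> free_vectors S" for v
    by (intro free_vectors_scale deriv_free_vectors[OF _ _ that]) (auto simp: S_def)
  have bS: "b v \<in> free_vectors S" and gS: "g v \<in> free_vectors S" if "v \<in> free_vectors S" for v
    using pq times[OF that] deriv[OF that] by auto
  have "logpow (Suc t) \<in> free_vectors S"
  proof (rule emb_in_span[OF _ _ _ _ _ _ _ _ e])
    show "u + v \<in> free_vectors S" if "u \<in> free_vectors S" "v \<in> free_vectors S" for u v :: logfun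
      using that by (rule free_vectors_add)
    show "pm_scale c v \<in> free_vectors S" if "v \<in> free_vectors S" for v :: logfun and c
      using that by (rule free_vectors_scale)
    show "{logpow t} \<subseteq> free_vectors (UNIV \<times> {..<k})" using logpow_closed[of t] t by simp
    show "{logpow t} \<subseteq> free_vectors S" by (auto simp: logpow_def S_def)
    show "logpow (Suc t) \<in> free_vectors (UNIV \<times> {..<k})" using logpow_closed[OF t] .
  qed (use bS gS in auto)
  then show False
    by (cases "even t") (auto simp: logpow_def S_def)
qed

end

section \<open>The two logarithmic families as ladders\<close>

lemma log_closed:
  assumes "v \<in> free_vectors (UNIV \<times> {..<k})"
  shows "logfun_times v \<in> free_vectors (UNIV \<times> {..<k})" "logfun_deriv 0 v \<in> free_vectors (UNIV \<times> {..<k})"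
  by (rule times_free_vectors[OF _ assms] deriv_free_vectors[OF _ _ assms]; auto)+

lemma log_induced_minus: "k \<ge> 1 \<Longrightarrow> log_induced logfun_times (logfun_deriv 0) k (Beta_mode 0) (Gamma_mode 0) 1"
  using log_closed fock_beta
  by (simp add: log_induced_def log_induced_axioms_def induced_fock_def induced_fock_axioms_def)

lemma log_induced_plus:
  "k \<ge> 1 \<Longrightarrow> log_induced (\<lambda>f. - logfun_deriv 0 f) logfun_times k (Gamma_mode 0) (Beta_mode 0) (- 1)"
  using log_closed fock_gamma[of 0]
  by (simp add: log_induced_def log_induced_axioms_def induced_fock_def induced_fock_axioms_def)

definition "eps_minus k = log_induced.eps logfun_times (logfun_deriv 0) k"

definition "eps_plus k = log_induced.eps (\<lambda>f. - logfun_deriv 0 f) logfun_times k"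

lemma ladder_minus:
  assumes "k \<ge> 1"
  shows "ladder (W_minus k) (eps_minus k) (\<lambda>a. 1 * of_nat a) k (Beta_mode 0) (Gamma_mode 0)"
proof -
  interpret L: log_induced logfun_times "logfun_deriv 0" k "Beta_mode 0" "Gamma_mode 0" 1
    by (rule log_induced_minus[OF assms])
  have eq: "W_minus k = Ind L.E" by (simp add: W_minus_def)
  interpret M: bg_module "W_minus k" unfolding eq by (rule L.Ind_module)
  have e: "eps_minus k = L.eps" by (simp add: eps_minus_def)
  show ?thesis
  proof unfold_locales
    show "(Beta_mode 0 = Beta_mode 0 \<and> Gamma_mode 0 = Gamma_mode 0 \<and>
          (\<forall>t<2 * k. M.lower (- 1) (eps_minus k t) = \<zero>\<^bsub>W_minus k\<^esub>)) \<or>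
      Beta_mode 0 = Gamma_mode 1 \<and> Gamma_mode 0 = Beta_mode (- 1) \<and>
          (\<forall>t<2 * k. M.raise 0 (eps_minus k t) = \<zero>\<^bsub>W_minus k\<^esub>)"
      by (simp add: L.eps_pos L.P.Q.lower_def e eq)
  qed (use assms in \<open>simp_all add: e eq L.P.Q.raise_def L.P.Q.lower_def L.eps_carrier L.p_eps[simplified] L.q_eps[simplified] L.q_eps_0
      L.eps_pos L.eps_0_nonzero L.eps_top[simplified] L.eps_strict\<close>)
qed

text \<open>After the flow by one, \<open>Gamma_mode 1\<close> and \<open>Beta_mode (- 1)\<close>
  act as the zero modes gamma and beta do on \<open>W_plus k\<close>. Hence P is again the variable
  and Q, up to sign, the derivative.\<close>

lemma ladder_plus:
  assumes "k \<ge> 1"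
  shows "ladder (spectral_flow 1 (W_plus k)) (eps_plus k) (\<lambda>a. - 1 * of_nat a) k (Gamma_mode 1) (Beta_mode (- 1))"
proof -
  interpret L: log_induced "\<lambda>f. - logfun_deriv 0 f" logfun_times k "Gamma_mode 0" "Beta_mode 0" "- 1"
    by (rule log_induced_plus[OF assms])
  have eq: "W_plus k = Ind L.E" by (simp add: W_plus_def)
  interpret M: bg_module "spectral_flow 1 (W_plus k)"
    unfolding eq by (rule spectral_flow_module[OF L.Ind_module])
  have e: "eps_plus k = L.eps" by (simp add: eps_plus_def)
  have ops: "bg_premodule.raise (spectral_flow 1 (Ind L.E)) n x = act (Ind L.E) (Beta_mode (n + 1)) x"
    "bg_premodule.lower (spectral_flow 1 (Ind L.E)) n x = act (Ind L.E) (Gamma_mode (- n - 1)) x" for n x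
    by (simp_all add: spectral_flow_ops[OF L.P.Q.bg_premodule_axioms] L.P.Q.raise_def L.P.Q.lower_def)
  have span: "bg_span (spectral_flow 1 (W_plus k)) X = bg_span (Ind L.E) X" for X
    unfolding eq by (rule spectral_flow_span[OF L.P.Q.bg_premodule_axioms])
  show ?thesis
  proof unfold_locales
    show "(Gamma_mode 1 = Beta_mode 0 \<and> Beta_mode (- 1) = Gamma_mode 0 \<and>
          (\<forall>t<2 * k. M.lower (- 1) (eps_plus k t) = \<zero>\<^bsub>spectral_flow 1 (W_plus k)\<^esub>)) \<or>
      Gamma_mode 1 = Gamma_mode 1 \<and> Beta_mode (- 1) = Beta_mode (- 1) \<and>
          (\<forall>t<2 * k. M.raise 0 (eps_plus k t) = \<zero>\<^bsub>spectral_flow 1 (W_plus k)\<^esub>)"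
      by (simp add: L.eps_pos ops e eq)
  qed (use assms in \<open>simp_all add: e eq ops span[unfolded eq] sigma_mode_def L.eps_carrier L.p_eps[simplified] L.q_eps[simplified]
      L.q_eps_0 L.eps_pos L.eps_0_nonzero L.eps_top[simplified] L.eps_strict\<close>)
qed

section \<open>The roofs\<close>

lemma (in bg_premodule) restrict_span:
  assumes D: "bg_submodule D M" and X: "X \<subseteq> D"
  shows "bg_span (bg_restrict M D) X = bg_span M X"
proof
  interpret R: bg_premodule "bg_restrict M D" by (rule restrict_premodule[OF D])
  have XM: "X \<subseteq> carrier M" using X bg_submoduleD(1)[OF D] by blast
  have "bg_submodule (bg_span M X) (bg_restrict M D)"
    using restrict_submodule_iff[OF D] bg_span_submodule[OF XM] bg_span_subset[OF D X] by blast
  then show "bg_span (bg_restrict M D) X \<subseteq> bg_span M X"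
    by (rule R.bg_span_subset[OF _ bg_span_superset])
  have "X \<subseteq> carrier (bg_restrict M D)" using X by simp
  then have "bg_submodule (bg_span (bg_restrict M D) X) (bg_restrict M D)"
    by (rule R.bg_span_submodule)
  then have "bg_submodule (bg_span (bg_restrict M D) X) M"
    using restrict_submodule_iff[OF D] by blast
  then show "bg_span M X \<subseteq> bg_span (bg_restrict M D) X"
    by (rule bg_span_subset[OF _ R.bg_span_superset])
qed

lemma hom_eq_on_span:
  assumes "bg_premodule A" "bg_premodule B" "f \<in> bg_hom A B" "g \<in> bg_hom A B"
    and "a \<in> carrier A" "f a = g a" "x \<in> bg_span A {a}"
  shows "f x = g x"
proof -
  interpret A: bg_premodule A by fact
  interpret B: bg_premodule B by fact
  interpret F: bg_morphism A B f by (rule bg_morphismI[OF assms(1-3)])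
  interpret G: bg_morphism A B g by (rule bg_morphismI[OF assms(1,2,4)])
  have "bg_submodule {x \<in> carrier A. f x = g x} A"
    by (rule A.bg_submoduleI) (auto simp: F.f_add G.f_add F.f_sm G.f_sm F.f_act G.f_act)
  then have "bg_span A {a} \<subseteq> {x \<in> carrier A. f x = g x}"
    using assms(5,6) by (intro A.bg_span_subset) auto
  then show ?thesis using assms(7) by auto
qed

text \<open>All standard vectors over the pair (a, b) are multiples of it, so the graph is
  single-valued once a is nonzero.\<close>

lemma vacuum_hom:
  assumes A: "bg_module A" "bg_module.vacuum A a" "bg_span A {a} = carrier A" "a \<noteq> \<zero>\<^bsub>A\<^esub>"
    and B: "bg_module B" "bg_module.vacuum B b"
  obtains f where "f \<in> bg_hom A B" "f a = b"
proof -
  interpret A: bg_module A by fact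
  interpret B: bg_module B by fact
  interpret S: bg_module "bg_sum2 A B" by (rule sum2_module[OF A(1) B(1)])
  have ac: "a \<in> carrier A" and bc: "b \<in> carrier B"
    using A(2) B(2) by (auto simp: A.vacuum_def B.vacuum_def)
  have "S.vacuum (a, b)"
    using A(2) B(2) by (auto simp: A.vacuum_def B.vacuum_def S.vacuum_def S.raise_def S.lower_def
        A.raise_def A.lower_def B.raise_def B.lower_def)
  note vac = this
  have "y = \<zero>\<^bsub>B\<^esub>" if xy: "(x, y) \<in> S.standard (a, b)" "x = \<zero>\<^bsub>A\<^esub>" for x y
  proof -
    obtain c where c: "x = c \<odot>\<^bsub>A\<^esub> a" "y = c \<odot>\<^bsub>B\<^esub> b"
      using S.vacuum_standard[OF vac xy(1)] by auto
    have "c = 0"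
    proof (rule ccontr)
      assume "c \<noteq> 0"
      then have "a = inverse c \<odot>\<^bsub>A\<^esub> (c \<odot>\<^bsub>A\<^esub> a)" using ac by (simp add: A.sm_assoc)
      then show False using c(1) xy(2) A(4) A.sm_r_zero by metis
    qed
    then show ?thesis using c(2) bc by simp
  qed
  then show ?thesis
    using hom_from_cyclic[OF A(1) A.vacuum_roof_relations[OF A(2)] A(3) B(1) B.vacuum_roof_relations[OF B(2)]] that
    by blast
qed

text \<open>The maps in both directions exchange the generators, so their composites fix them and
  are identities.\<close>

lemma vacuum_iso:
  assumes A: "bg_module A" "bg_module.vacuum A a" "bg_span A {a} = carrier A" "a \<noteq> \<zero>\<^bsub>A\<^esub>"
    and B: "bg_module B" "bg_module.vacuum B b" "bg_span B {b} = carrier B" "b \<noteq> \<zero>\<^bsub>B\<^esub>"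
  shows "bg_iso A B \<noteq> {}"
proof -
  interpret A: bg_module A by fact
  interpret B: bg_module B by fact
  have ac: "a \<in> carrier A" and bc: "b \<in> carrier B"
    using A(2) B(2) by (auto simp: A.vacuum_def B.vacuum_def)
  obtain f where f: "f \<in> bg_hom A B" "f a = b" using vacuum_hom[OF A B(1,2)] .
  obtain g where g: "g \<in> bg_hom B A" "g b = a" using vacuum_hom[OF B A(1,2)] .
  have id: "id \<in> bg_hom A A" "id \<in> bg_hom B B" by (auto intro!: bg_homI)
  have gf: "g (f x) = x" if "x \<in> carrier A" for x
    using hom_eq_on_span[OF A.bg_premodule_axioms A.bg_premodule_axioms bg_hom_comp[OF f(1) g(1)] id(1) ac, of x]
      f(2) g(2) that A(3) by simp
  have fg: "f (g x) = x" if "x \<in> carrier B" for x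
    using hom_eq_on_span[OF B.bg_premodule_axioms B.bg_premodule_axioms bg_hom_comp[OF g(1) f(1)] id(2) bc, of x]
      f(2) g(2) that B(3) by simp
  have "bij_betw f (carrier A) (carrier B)"
    using gf fg bg_homD(1)[OF f(1)] bg_homD(1)[OF g(1)] by (intro bij_betw_byWitness[of _ g]) auto
  then show ?thesis using f(1) by (auto simp: bg_iso_def)
qed

text \<open>Subtract v, placed at its own weight, from its decomposition into pure components. The
  sum is 0, so the component at \<open>vac_weight\<close> is v, and \<open>pure_standard\<close>
  applies to it.\<close>

lemma (in bg_module) vac_weight_space:
  assumes u: "roof_relations u" and v: "v \<in> bg_span M {u}" "gen_weight (\<lambda>n. of_int (vac_weight n)) v"
  shows "v \<in> vac_space u"
proof -
  obtain D g where D: "finite D" "\<And>w. pure u w (g w)" "v = finsum M g D"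
    using span_pure_sum[OF u v(1)] unfolding pure_sum_def[OF u] by blast
  let ?D = "insert vac_weight D"
  define g' where "g' w = (if w \<in> D then g w else \<zero>)" for w
  define h where "h w = (if w = vac_weight then (- 1) \<odot> v else \<zero>)" for w
  have vc: "v \<in> carrier M" using v(2) by (rule gen_weight_closed)
  have gc: "g w \<in> carrier M" for w using pure_closed[OF u D(2)] .
  have g': "pure u w (g' w)" for w using D(2) by (auto simp: g'_def pure.zero)
  have g'c: "g' w \<in> carrier M" for w using pure_closed[OF u g'] .
  have hc: "h w \<in> carrier M" for w using vc by (simp add: h_def)
  have "finsum M g' ?D = v"
    unfolding D(3) g'_def using D(1) gc by (intro add.finprod_mono_neutral_cong_right) auto
  moreover have "finsum M h ?D = (- 1) \<odot> v"
  proof -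
    have "finsum M h {vac_weight} = finsum M h ?D"
      using D(1) vc by (intro add.finprod_mono_neutral_cong_left) (auto simp: h_def)
    then show ?thesis using vc by (simp add: h_def)
  qed
  moreover have "finsum M (\<lambda>w. g' w \<oplus> h w) ?D = finsum M g' ?D \<oplus> finsum M h ?D"
    using g'c hc by (intro finsum_addf) auto
  ultimately have sum: "finsum M (\<lambda>w. g' w \<oplus> h w) ?D = \<zero>"
    using vc by simp
  have "g' vac_weight \<oplus> h vac_weight \<in> {\<zero>}"
  proof (rule separate_weights[OF bg_submodule_zero, of ?D "\<lambda>w n. of_int (w n)" "\<lambda>w. g' w \<oplus> h w"])
    show "inj_on (\<lambda>w n. of_int (w n) :: complex) ?D"
      by (rule inj_onI) (auto simp: fun_eq_iff)
    show "gen_weight (\<lambda>n. of_int (w n)) (g' w \<oplus> h w)" for w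
      using pure_gen_weight[OF u g'] gen_weight_sm[OF v(2), of "- 1"] gen_weight_zero
      by (intro gen_weight_add) (auto simp: h_def)
  qed (use D(1) sum in auto)
  then have "g' vac_weight \<ominus> v = \<zero>"
    using vc g'c by (simp add: h_def minus_eq')
  then have "g' vac_weight = v" using vc g'c minus_zero_iff by blast
  then show ?thesis
    using pure_standard[OF u g', of vac_weight] by simp
qed

text \<open>Takes the place of Schur's lemma: whichever isomorphism \<open>head_map\<close> selects,
  it sends the generator of a leg to a multiple of \<open>V_vac\<close>.\<close>

lemma V_vacuum_unique:
  assumes "bg_module.vacuum V_mod h"
  obtains c where "h = c \<odot>\<^bsub>V_mod\<^esub> V_vac"
proof -
  interpret V: bg_module V_mod by (rule V_module)
  have "h \<in> carrier V_mod" using assms by (simp add: V.vacuum_def)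
  moreover have "V.gen_weight (\<lambda>n. of_int (V.vac_weight n)) h"
    by (rule V.vac_gen_weight[OF V.vacuum_roof_relations[OF assms] V.vac_space.base])
  ultimately have "h \<in> V.vac_space V_vac"
    using V_generated by (intro V.vac_weight_space V.vacuum_roof_relations V_vacuum) simp_all
  then show ?thesis
    using V.vacuum_standard[OF V_vacuum, of h] that by (auto simp: V.standard_def)
qed

lemma (in bg_morphism) vacuum_image:
  assumes "bg_module M" "bg_module Q" "x \<in> carrier M"
    "\<And>n. n \<ge> 0 \<Longrightarrow> f (M.raise n x) = \<zero>\<^bsub>Q\<^esub>" "\<And>n. n < 0 \<Longrightarrow> f (M.lower n x) = \<zero>\<^bsub>Q\<^esub>"
  shows "bg_module.vacuum Q (f x)"
  using assms by (simp add: bg_module.vacuum_def f_ops)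

text \<open>Of the modes that can move the generator x into the radical, only P does not kill it.\<close>

definition roof_leg :: "'v bg_module \<Rightarrow> mode \<Rightarrow> mode \<Rightarrow> nat \<Rightarrow> 'v \<Rightarrow> bool" where
  "roof_leg L P Q i x \<longleftrightarrow> bg_module L \<and> bg_module.roof_relations L x \<and> bg_span L {x} = carrier L \<and>
    head_map L \<in> bg_hom L V_mod \<and> (\<exists>a. a \<noteq> 0 \<and> head_map L x = a \<odot>\<^bsub>V_mod\<^esub> V_vac) \<and>
    (\<forall>y\<in>carrier L. head_map L y = \<zero>\<^bsub>V_mod\<^esub> \<longleftrightarrow> y \<in> bg_span L {act L P x}) \<and>
    act L (if P = Beta_mode 0 then Gamma_mode 1 else Beta_mode 0) x = \<zero>\<^bsub>L\<^esub> \<and>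
    ((\<lambda>y. act L Q (act L P y)) ^^ i) x \<noteq> \<zero>\<^bsub>L\<^esub>"

context ladder
begin

lemma eps_notin_flag: "t < 2 * k \<Longrightarrow> m \<le> t \<Longrightarrow> eps t \<notin> flag m"
proof
  assume t: "t < 2 * k" "m \<le> t" "eps t \<in> flag m"
  then have "eps t \<in> flag t" using flag_mono[of m t] by auto
  then have "flag (Suc t) \<subseteq> flag t"
    unfolding flag_Suc using flag_submodule[of t] t(1) by (intro bg_span_subset) auto
  then show False using flag_step[OF t(1)] by blast
qed

lemma PQ_pow: "a < k \<Longrightarrow> \<exists>c. c \<noteq> 0 \<and> ((\<lambda>y. act M Q (act M P y)) ^^ a) u = c \<odot> eps (2 * (k - 1 - a) + 1)"
proof (induction a)
  case 0
  have "2 * (k - 1) + 1 = 2 * k - 1" using k by simp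
  then show ?case using u_closed by (intro exI[of _ 1]) simp
next
  case (Suc a)
  then obtain c where c: "c \<noteq> 0" "((\<lambda>y. act M Q (act M P y)) ^^ a) u = c \<odot> eps (2 * (k - 1 - a) + 1)"
    by auto
  obtain b where b: "k - 1 - a = Suc b" "Suc b < k" "k - 1 - Suc a = b"
    using Suc.prems that[of "k - 1 - Suc a"] by (auto simp: Suc_diff_Suc)
  have "act M Q (act M P (c \<odot> eps (2 * Suc b + 1))) = (c * \<kappa> (Suc b)) \<odot> eps (2 * b + 1)"
    using P_eps[OF b(2)] Q_eps[OF b(2)] eps_closed[of "2 * Suc b + 1"] eps_closed[of "2 * Suc b"]
      eps_closed[of "2 * b + 1"] b(2) by (simp add: act_smult sm_assoc)
  then show ?case
    using c b \<kappa>[of "Suc b"] by (intro exI[of _ "c * \<kappa> (Suc b)"]) simp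
qed

text \<open>\<open>(Q P)^i\<close> takes u to a nonzero multiple of
  \<open>eps (2 * (k - 1 - i) + 1)\<close>, and the bound on m keeps this vector out of
  \<open>flag m\<close>. The modes that annihilate a vacuum send u to 0 or to
  \<open>act M P u\<close>, which generates the radical; so the head is generated by a vacuum and is
  a copy of V.\<close>

lemma ladder_roof_leg:
  assumes i: "i < k" "m \<le> 2 * (k - 1 - i) + 1" "m < 2 * k"
  shows "roof_leg (bg_quot M (flag m)) P Q i (bg_proj M (flag m) u)"
proof -
  have m: "m \<le> 2 * k" using i(3) by simp
  define L where "L = bg_quot M (flag m)"
  define x where "x = bg_proj M (flag m) u"
  have sub: "bg_submodule (flag m) M" by (rule flag_submodule[OF m])
  have chain: "bg_chain L (\<lambda>s. bg_proj M (flag m) ` flag (m + s)) (2 * k - m)"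
    unfolding L_def by (rule bg_chain_quot[OF ladder_chain m])
  interpret L: bg_module L by (rule bg_chainD(1)[OF chain])
  interpret p: bg_morphism M L "bg_proj M (flag m)"
    unfolding L_def by (rule bg_proj_morphism[OF sub])
  interpret pm: bg_module_morphism M L "bg_proj M (flag m)"
    by unfold_locales (rule p.hom)
  obtain j where e: "2 * k - m = Suc j" "m + j = 2 * k - 1"
    using i(3) that[of "2 * k - 1 - m"] by auto
  have rad: "bg_radical L = bg_proj M (flag m) ` flag (2 * k - 1)"
    using bg_chain_radical[OF chain[unfolded e(1)]] by (simp add: e(2))
  have k2: "2 * k - 1 = Suc (2 * (k - 1))" using k by simp
  have eps2: "eps (2 * (k - 1)) \<in> carrier M" using k by (intro eps_closed) simp
  have Pu: "act M P u = eps (2 * (k - 1))"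
    using P_eps[of "k - 1"] k k2 by simp
  have radspan: "bg_radical L = bg_span L {act L P x}"
  proof -
    have "act L P x = bg_proj M (flag m) (eps (2 * (k - 1)))"
      unfolding x_def p.f_act[OF u_closed, symmetric] Pu ..
    then show ?thesis
      unfolding rad k2 flag_Suc using p.span_image[of "{eps (2 * (k - 1))}"] eps2 by simp
  qed
  have xc: "x \<in> carrier L" unfolding x_def using u_closed by simp
  have gen: "bg_span L {x} = carrier L"
  proof -
    have "bg_span L {x} = bg_proj M (flag m) ` carrier M"
      unfolding x_def top[symmetric] using u_closed p.span_image[of "{u}"] by simp
    then show ?thesis using bg_proj_surj[of "flag m"] by (simp add: L_def)
  qed
  have radsub: "bg_submodule (bg_radical L) L"
    unfolding rad using p.image_submodule[OF flag_submodule[of "2 * k - 1"]] by simp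
  define H where "H = bg_head L"
  have H: "H = bg_quot L (bg_radical L)" by (simp add: H_def bg_head_def)
  interpret h: bg_morphism L H "bg_proj L (bg_radical L)"
    unfolding H by (rule L.bg_proj_morphism[OF radsub])
  have HM: "bg_module H" unfolding H by (rule L.bg_quot_module[OF radsub])
  have u_ops: "raise 0 u = act M P u \<or> raise 0 u = \<zero>" "lower (- 1) u = act M P u \<or> lower (- 1) u = \<zero>"
    using wt_ops[OF u_comb] by auto
  have k': "2 * k - 1 < 2 * k" using k by simp
  have xr: "L.raise n x = bg_proj M (flag m) (raise n u)" "L.lower n x = bg_proj M (flag m) (lower n u)" for n
    unfolding x_def using u_closed by (simp_all add: p.f_ops)
  have Px: "bg_proj M (flag m) (act M P u) \<in> bg_radical L"
  proof -
    have "eps (2 * (k - 1)) \<in> flag (2 * k - 1)"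
      unfolding k2 flag_Suc by (rule bg_span_incl) simp
    then show ?thesis unfolding rad Pu by (rule imageI)
  qed
  have zr: "\<zero>\<^bsub>L\<^esub> \<in> bg_radical L" by (rule L.bg_submoduleD(2)[OF radsub])
  have "L.raise n x \<in> bg_radical L" if "n \<ge> 0" for n
  proof (cases "n = 0")
    case True
    then show ?thesis using u_ops(1) Px zr xr(1)[of 0] by auto
  next
    case False
    then show ?thesis using that raise_eps[OF k', of n] zr by (simp add: xr)
  qed
  moreover have "L.lower n x \<in> bg_radical L" if "n < 0" for n
  proof (cases "n = - 1")
    case True
    then show ?thesis using u_ops(2) Px zr xr(2)[of "- 1"] by auto
  next
    case False
    then show ?thesis using that lower_eps[OF k', of n] zr by (simp add: xr)
  qed
  ultimately have vac: "bg_module.vacuum H (bg_proj L (bg_radical L) x)"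
    using L.bg_proj_eq_zero_iff[OF radsub] xc H
    by (intro h.vacuum_image[OF L.bg_module_axioms HM xc]) auto
  have xnr: "x \<notin> bg_radical L"
  proof
    assume "x \<in> bg_radical L"
    then obtain y where y: "y \<in> flag (2 * k - 1)" "bg_proj M (flag m) u = bg_proj M (flag m) y"
      unfolding x_def rad by auto
    note F = bg_submoduleD[OF flag_submodule[of "2 * k - 1"]]
    have yc: "y \<in> carrier M" using F(1) y(1) by auto
    have "u \<ominus> y \<in> flag m" using y(2) bg_proj_eq_iff[OF sub u_closed yc] by simp
    moreover have "flag m \<subseteq> flag (2 * k - 1)" by (rule flag_mono) (use i(3) in auto)
    ultimately have "u \<ominus> y \<in> flag (2 * k - 1)" by blast
    then have "(u \<ominus> y) \<oplus> y \<in> flag (2 * k - 1)" using y(1) F(4) by simp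
    then show False
      using eps_notin_flag[OF k', of "2 * k - 1"] sub_add[OF u_closed yc] by simp
  qed
  have hx: "bg_proj L (bg_radical L) x \<noteq> \<zero>\<^bsub>H\<^esub>"
    using L.bg_proj_eq_zero_iff[OF radsub xc] xnr by (simp add: H)
  have Hgen: "bg_span H {bg_proj L (bg_radical L) x} = carrier H"
  proof -
    have "bg_span H {bg_proj L (bg_radical L) x} = bg_proj L (bg_radical L) ` carrier L"
      unfolding gen[symmetric] using xc h.span_image[of "{x}"] by simp
    then show ?thesis using L.bg_proj_surj[of "bg_radical L"] by (simp add: H)
  qed
  have "bg_iso H V_mod \<noteq> {}"
    by (rule vacuum_iso[OF HM vac Hgen hx V_module V_vacuum V_generated V_vac_nonzero])
  define \<phi> where "\<phi> = (SOME \<phi>. \<phi> \<in> bg_iso H V_mod)"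
  have \<phi>: "\<phi> \<in> bg_iso H V_mod"
    unfolding \<phi>_def some_in_eq by fact
  have hm: "head_map L = \<phi> \<circ> bg_proj L (bg_radical L)"
    by (simp add: fun_eq_iff head_map_def \<phi>_def bg_proj_def H_def)
  interpret V: bg_module V_mod by (rule V_module)
  interpret f: bg_morphism H V_mod \<phi>
    using \<phi> bg_module_def h.Q.bg_premodule_axioms V.bg_premodule_axioms by (intro bg_morphismI) (auto simp: bg_iso_def)
  have hom: "head_map L \<in> bg_hom L V_mod"
    unfolding hm by (rule bg_hom_comp[OF h.hom f.hom])
  have inj: "\<phi> z = \<zero>\<^bsub>V_mod\<^esub> \<longleftrightarrow> z = \<zero>\<^bsub>H\<^esub>" if "z \<in> carrier H" for z
  proof
    assume "\<phi> z = \<zero>\<^bsub>V_mod\<^esub>"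
    then have "\<phi> z = \<phi> \<zero>\<^bsub>H\<^esub>" by simp
    moreover have "inj_on \<phi> (carrier H)" using \<phi> by (auto simp: bg_iso_def bij_betw_def)
    ultimately show "z = \<zero>\<^bsub>H\<^esub>" using that h.Q.zero_closed by (rule_tac inj_onD)
  qed simp
  have ker: "head_map L y = \<zero>\<^bsub>V_mod\<^esub> \<longleftrightarrow> y \<in> bg_span L {act L P x}" if "y \<in> carrier L" for y
    using that inj[OF h.f_closed[OF that]] L.bg_proj_eq_zero_iff[OF radsub that]
    by (simp add: hm H radspan[symmetric])
  have "V.vacuum (head_map L x)"
    unfolding hm comp_def using vac h.f_closed[OF xc] bg_module.vacuum_def[OF HM]
    by (intro f.vacuum_image[OF HM V_module]) auto
  then obtain a where a: "head_map L x = a \<odot>\<^bsub>V_mod\<^esub> V_vac" by (rule V_vacuum_unique)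
  have "a \<noteq> 0"
  proof
    assume "a = 0"
    then have "head_map L x = \<zero>\<^bsub>V_mod\<^esub>"
      using a V_vacuum by (simp add: V.vacuum_def)
    then show False using inj[OF h.f_closed[OF xc]] hx by (simp add: hm)
  qed
  have rr: "L.roof_relations x"
    unfolding L.roof_relations_def
  proof (intro conjI allI impI)
    note R = u_relations[unfolded roof_relations_def]
    show "x \<in> carrier L" by (rule xc)
    show "L.raise n x = \<zero>\<^bsub>L\<^esub>" if "n \<ge> 1" for n using R that by (simp add: xr)
    show "L.lower n x = \<zero>\<^bsub>L\<^esub>" if "n \<le> - 2" for n using R that by (simp add: xr)
    show "L.raise 0 (L.lower (- 1) x) = \<zero>\<^bsub>L\<^esub>"
      using R p.f_ops(1)[of "lower (- 1) u" 0] u_closed by (simp add: xr)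
    show "L.nil (L.wt 0) x"
    proof -
      obtain j where "(wt 0 ^^ j) u = \<zero>" using R by (auto simp: nil_def)
      then have "(L.wt 0 ^^ j) x = \<zero>\<^bsub>L\<^esub>"
        unfolding x_def using p.f_pow[OF linops(3) p.f_wt u_closed, of j 0] by simp
      then show ?thesis by (auto simp: L.nil_def)
    qed
    show "L.nil L.wt' x"
    proof -
      obtain j where "(wt' ^^ j) u = \<zero>" using R by (auto simp: nil_def)
      then have "(L.wt' ^^ j) x = \<zero>\<^bsub>L\<^esub>"
        unfolding x_def using p.f_pow[OF linop_wt' pm.f_wt' u_closed, of j] by simp
      then show ?thesis by (auto simp: L.nil_def)
    qed
  qed
  have other: "act L (if P = Beta_mode 0 then Gamma_mode 1 else Beta_mode 0) x = \<zero>\<^bsub>L\<^esub>"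
  proof -
    have "act M (if P = Beta_mode 0 then Gamma_mode 1 else Beta_mode 0) u = \<zero>"
      using PQ k' by (auto simp: raise_def lower_def)
    then show ?thesis unfolding x_def using p.f_act[OF u_closed] p.f_zero by metis
  qed
  have pw: "((\<lambda>y. act L Q (act L P y)) ^^ i) x \<noteq> \<zero>\<^bsub>L\<^esub>"
  proof -
    obtain c where c: "c \<noteq> 0" "((\<lambda>y. act M Q (act M P y)) ^^ i) u = c \<odot> eps (2 * (k - 1 - i) + 1)"
      using PQ_pow[OF i(1)] by blast
    have lt: "2 * (k - 1 - i) + 1 < 2 * k" using i(1) by simp
    note ec = eps_closed[OF lt]
    have "linop (\<lambda>y. act M Q (act M P y))"
      using linop_comp[OF linop_act linop_act] .
    from p.f_pow[OF this _ u_closed, of "\<lambda>y. act L Q (act L P y)" i]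
    have "((\<lambda>y. act L Q (act L P y)) ^^ i) x = bg_proj M (flag m) (c \<odot> eps (2 * (k - 1 - i) + 1))"
      unfolding x_def c(2)[symmetric] by (simp add: p.f_act)
    moreover have "c \<odot> eps (2 * (k - 1 - i) + 1) \<notin> flag m"
    proof
      assume "c \<odot> eps (2 * (k - 1 - i) + 1) \<in> flag m"
      from bg_submoduleD(5)[OF sub this, of "inverse c"] show False
        using c(1) ec eps_notin_flag[OF lt i(2)] by (simp add: sm_assoc)
    qed
    ultimately show ?thesis
      using bg_proj_eq_zero_iff[OF sub, of "c \<odot> eps (2 * (k - 1 - i) + 1)"] ec by (simp add: L_def)
  qed
  show ?thesis
    unfolding roof_leg_def L_def[symmetric] x_def[symmetric]
    using L.bg_module_axioms rr gen hom a \<open>a \<noteq> 0\<close> ker other pw by blast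
qed

end

text \<open>The generator sits on top of 2 i + 2 composition factors, and \<open>(Q P)^i\<close>
  moves it down by 2 i of them, so it does not yet vanish.\<close>

lemma roof_left_leg:
  assumes "k = 2 * i + 2"
  obtains x where "roof_leg (roof_left k) (Beta_mode 0) (Gamma_mode 0) i x"
proof -
  have k: "k \<ge> 1" using assms by simp
  interpret ladder "W_minus k" "eps_minus k" "\<lambda>a. 1 * of_nat a" k "Beta_mode 0" "Gamma_mode 0"
    by (rule ladder_minus[OF k])
  have "roof_left k = bg_quot (W_minus k) (flag k)"
    unfolding roof_left_def using bg_chain_length_quot[OF ladder_chain, of k] by simp
  then show ?thesis
    using ladder_roof_leg[of i k] assms that by auto
qed

lemma roof_right_leg:
  assumes "k = 2 * i + 2"
  obtains x where "roof_leg (roof_right k) (Gamma_mode 1) (Beta_mode (- 1)) i x"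
proof -
  have k: "k \<ge> 1" using assms by simp
  interpret ladder "spectral_flow 1 (W_plus k)" "eps_plus k" "\<lambda>a. - 1 * of_nat a" k "Gamma_mode 1" "Beta_mode (- 1)"
    by (rule ladder_plus[OF k])
  have "roof_right k = bg_quot (spectral_flow 1 (W_plus k)) (flag k)"
    unfolding roof_right_def using bg_chain_length_quot[OF ladder_chain, of k] by simp
  then show ?thesis
    using ladder_roof_leg[of i k] assms that by auto
qed

text \<open>Once the generators of both legs lie over the same vector \<open>V_vac\<close>, their
  pair belongs to the fiber product.\<close>

lemma roof_leg_normalize:
  assumes "roof_leg L P Q i x"
  obtains x' where "roof_leg L P Q i x'" "head_map L x' = V_vac"
proof -
  interpret L: bg_module L using assms by (simp add: roof_leg_def)
  interpret V: bg_module V_mod by (rule V_module)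
  note leg = assms[unfolded roof_leg_def]
  obtain a where a: "a \<noteq> 0" "head_map L x = a \<odot>\<^bsub>V_mod\<^esub> V_vac" using leg by blast
  have hom: "head_map L \<in> bg_hom L V_mod" using leg by blast
  have rr: "L.roof_relations x" using leg by blast
  then have x: "x \<in> carrier L" by (simp add: L.roof_relations_def)
  have vac: "V_vac \<in> carrier V_mod" using V_vacuum by (simp add: V.vacuum_def)
  define c where "c = inverse a"
  have c: "c \<noteq> 0" using a(1) by (simp add: c_def)
  define x' where "x' = c \<odot>\<^bsub>L\<^esub> x"
  have x': "x' \<in> carrier L" using x by (simp add: x'_def)
  have span_sm: "bg_span L {c \<odot>\<^bsub>L\<^esub> z} = bg_span L {z}" if z: "z \<in> carrier L" for z
  proof
    have S: "bg_submodule (bg_span L {z}) L" "bg_submodule (bg_span L {c \<odot>\<^bsub>L\<^esub> z}) L"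
      using z by (intro L.bg_span_submodule; simp)+
    have "z \<in> bg_span L {z}" "c \<odot>\<^bsub>L\<^esub> z \<in> bg_span L {c \<odot>\<^bsub>L\<^esub> z}" by (simp_all add: L.bg_span_incl)
    then show "bg_span L {c \<odot>\<^bsub>L\<^esub> z} \<subseteq> bg_span L {z}"
      using L.bg_submoduleD(5)[OF S(1)] by (intro L.bg_span_subset[OF S(1)]) simp
    have "inverse c \<odot>\<^bsub>L\<^esub> (c \<odot>\<^bsub>L\<^esub> z) \<in> bg_span L {c \<odot>\<^bsub>L\<^esub> z}"
      using \<open>c \<odot>\<^bsub>L\<^esub> z \<in> bg_span L {c \<odot>\<^bsub>L\<^esub> z}\<close> by (rule L.bg_submoduleD(5)[OF S(2)])
    then show "bg_span L {z} \<subseteq> bg_span L {c \<odot>\<^bsub>L\<^esub> z}"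
      using c z by (intro L.bg_span_subset[OF S(2)]) (simp add: L.sm_assoc)
  qed
  have hx: "head_map L x' = V_vac"
    unfolding x'_def bg_homD(3)[OF hom x] a(2) using a(1) vac by (simp add: V.sm_assoc c_def)
  have "L.roof_relations x'"
    using rr x unfolding L.roof_relations_def x'_def by (auto simp: L.op_sm intro!: L.nil_sm L.linop_wt')
  moreover have "act L P x' = c \<odot>\<^bsub>L\<^esub> act L P x" using x by (simp add: x'_def L.act_smult)
  moreover have "((\<lambda>y. act L Q (act L P y)) ^^ i) x' \<noteq> \<zero>\<^bsub>L\<^esub>"
  proof
    have lin: "L.linop ((\<lambda>y. act L Q (act L P y)) ^^ i)"
      by (intro L.linop_pow L.linop_comp[OF L.linop_act L.linop_act])
    assume "((\<lambda>y. act L Q (act L P y)) ^^ i) x' = \<zero>\<^bsub>L\<^esub>"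
    then have "c \<odot>\<^bsub>L\<^esub> ((\<lambda>y. act L Q (act L P y)) ^^ i) x = \<zero>\<^bsub>L\<^esub>"
      using L.linopD(3)[OF lin x, of c] by (simp add: x'_def)
    then have "inverse c \<odot>\<^bsub>L\<^esub> (c \<odot>\<^bsub>L\<^esub> ((\<lambda>y. act L Q (act L P y)) ^^ i) x) = \<zero>\<^bsub>L\<^esub>" by simp
    then have "((\<lambda>y. act L Q (act L P y)) ^^ i) x = \<zero>\<^bsub>L\<^esub>"
      using c L.linopD(1)[OF lin x] by (simp add: L.sm_assoc)
    then show False using leg by blast
  qed
  moreover have "act L (if P = Beta_mode 0 then Gamma_mode 1 else Beta_mode 0) x' = \<zero>\<^bsub>L\<^esub>"
    using leg x by (simp add: x'_def L.act_smult)
  moreover have "\<exists>a. a \<noteq> 0 \<and> head_map L x' = a \<odot>\<^bsub>V_mod\<^esub> V_vac"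
    unfolding hx using vac by (intro exI[of _ 1]) simp
  moreover have "bg_span L {x'} = carrier L" "bg_span L {act L P x'} = bg_span L {act L P x}"
    using leg span_sm[OF x] span_sm[of "act L P x"] x \<open>act L P x' = c \<odot>\<^bsub>L\<^esub> act L P x\<close>
    by (simp_all add: x'_def)
  ultimately have "roof_leg L P Q i x'"
    unfolding roof_leg_def using leg by simp
  then show ?thesis using hx that by blast
qed

section \<open>Homomorphisms out of a roof\<close>

lemma restrict_ops:
  assumes M: "bg_module M" and D: "bg_submodule D M"
  shows "bg_premodule.raise (bg_restrict M D) = bg_premodule.raise M"
    "bg_premodule.lower (bg_restrict M D) = bg_premodule.lower M"
    "bg_module.roof_relations (bg_restrict M D) v \<longleftrightarrow> v \<in> D \<and> bg_module.roof_relations M v"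
proof -
  interpret M: bg_module M by fact
  interpret R: bg_module "bg_restrict M D" by (rule M.restrict_module[OF D])
  show 1: "R.raise = M.raise" "R.lower = M.lower"
    by (auto simp: fun_eq_iff R.raise_def M.raise_def R.lower_def M.lower_def)
  have 2: "R.wt = M.wt" "R.wt' = M.wt'"
    by (auto simp: fun_eq_iff R.wt_def M.wt_def R.wt'_def M.wt'_def 1)
  have 3: "R.nil T v \<longleftrightarrow> M.nil T v" for T by (simp add: R.nil_def M.nil_def)
  show "R.roof_relations v \<longleftrightarrow> v \<in> D \<and> M.roof_relations v"
    using M.bg_submoduleD(1)[OF D]
    by (auto simp: R.roof_relations_def M.roof_relations_def 1 2 3)
qed

text \<open>The pair of the generators of the legs generates the fiber product, so
  \<open>hom_from_cyclic\<close> applies. On the standard vectors the left leg detects the low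
  coefficients of the polynomial in \<open>wt 0\<close>, the right leg those of the polynomial in
  \<open>wt'\<close>; the higher ones act as 0 on u.\<close>

theorem roof_hom:
  assumes M: "bg_module M" "bg_module.roof_relations M u"
    "(bg_premodule.wt M 0 ^^ i) u = \<zero>\<^bsub>M\<^esub>" "(bg_module.wt' M ^^ i) u = \<zero>\<^bsub>M\<^esub>"
  obtains f where "bg_module (roof (2 * i + 2))" "f \<in> bg_hom (roof (2 * i + 2)) M" "u \<in> f ` carrier (roof (2 * i + 2))"
    "f ` carrier (roof (2 * i + 2)) \<subseteq> bg_span M {u}"
proof -
  define k where "k = 2 * i + 2"
  define L where "L = roof_left k"
  define R where "R = roof_right k"
  obtain x0 where "roof_leg L (Beta_mode 0) (Gamma_mode 0) i x0"
    using roof_left_leg[OF k_def] unfolding L_def .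
  then obtain x where legL: "roof_leg L (Beta_mode 0) (Gamma_mode 0) i x" and hx: "head_map L x = V_vac"
    by (rule roof_leg_normalize)
  obtain y0 where "roof_leg R (Gamma_mode 1) (Beta_mode (- 1)) i y0"
    using roof_right_leg[OF k_def] unfolding R_def .
  then obtain y where legR: "roof_leg R (Gamma_mode 1) (Beta_mode (- 1)) i y" and hy: "head_map R y = V_vac"
    by (rule roof_leg_normalize)
  interpret M: bg_module M by fact
  interpret L: bg_module L using legL by (simp add: roof_leg_def)
  interpret R: bg_module R using legR by (simp add: roof_leg_def)
  interpret V: bg_module V_mod by (rule V_module)
  interpret hL: bg_morphism L V_mod "head_map L"
    using legL by (intro bg_morphismI L.bg_premodule_axioms V.bg_premodule_axioms) (simp add: roof_leg_def)
  interpret hR: bg_morphism R V_mod "head_map R"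
    using legR by (intro bg_morphismI R.bg_premodule_axioms V.bg_premodule_axioms) (simp add: roof_leg_def)
  have rL: "L.roof_relations x" and gL: "bg_span L {x} = carrier L"
    and kL: "\<And>z. z \<in> carrier L \<Longrightarrow> head_map L z = \<zero>\<^bsub>V_mod\<^esub> \<Longrightarrow> z \<in> bg_span L {L.raise 0 x}"
    and oL: "L.lower (- 1) x = \<zero>\<^bsub>L\<^esub>" and pL: "(L.wt 0 ^^ i) x \<noteq> \<zero>\<^bsub>L\<^esub>"
    using legL by (auto simp: roof_leg_def L.raise_def L.lower_def L.wt_def[abs_def])
  have rR: "R.roof_relations y" and gR: "bg_span R {y} = carrier R"
    and kR: "\<And>z. z \<in> carrier R \<Longrightarrow> head_map R z = \<zero>\<^bsub>V_mod\<^esub> \<Longrightarrow> z \<in> bg_span R {R.lower (- 1) y}"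
    and oR: "R.raise 0 y = \<zero>\<^bsub>R\<^esub>" and pR: "(R.wt' ^^ i) y \<noteq> \<zero>\<^bsub>R\<^esub>"
    using legR by (auto simp: roof_leg_def R.raise_def R.lower_def R.wt'_def[abs_def])
  have xc: "x \<in> carrier L" and yc: "y \<in> carrier R"
    using rL rR by (simp_all add: L.roof_relations_def R.roof_relations_def)
  interpret S: bg_module "bg_sum2 L R" by (rule sum2_module[OF L.bg_module_axioms R.bg_module_axioms])
  have S_ops: "S.raise n (a, b) = (L.raise n a, R.raise n b)" "S.lower n (a, b) = (L.lower n a, R.lower n b)" for n a b
    by (simp_all add: S.raise_def S.lower_def L.raise_def L.lower_def R.raise_def R.lower_def)
  define D where "D = {(p, q) \<in> carrier (bg_sum2 L R). head_map L p = head_map R q}"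
  have D: "bg_submodule D (bg_sum2 L R)"
    by (rule S.bg_submoduleI)
      (auto simp: D_def hL.f_add hR.f_add hL.f_sm hR.f_sm hL.f_act hR.f_act)
  define A where "A = bg_restrict (bg_sum2 L R) D"
  have roof: "roof (2 * i + 2) = A"
    by (simp add: roof_def Let_def A_def D_def L_def R_def k_def)
  have AM: "bg_module A" unfolding A_def by (rule S.restrict_module[OF D])
  interpret A: bg_module A by (rule AM)
  have v0: "(x, y) \<in> D" using xc yc hx hy by (simp add: D_def)
  define T where "T = bg_span (bg_sum2 L R) {(x, y)}"
  have T: "bg_submodule T (bg_sum2 L R)"
    unfolding T_def using xc yc by (intro S.bg_span_submodule) simp
  note TD = S.bg_submoduleD[OF T]
  have v0T: "(x, y) \<in> T" by (simp add: T_def S.bg_span_incl)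
  have TsubD: "T \<subseteq> D" unfolding T_def using v0 by (intro S.bg_span_subset[OF D]) simp
  have radL: "(z, \<zero>\<^bsub>R\<^esub>) \<in> T" if "z \<in> bg_span L {L.raise 0 x}" for z
  proof -
    have "bg_submodule {z \<in> carrier L. (z, \<zero>\<^bsub>R\<^esub>) \<in> T} L"
    proof (rule L.bg_submoduleI)
      show "\<zero>\<^bsub>L\<^esub> \<in> {z \<in> carrier L. (z, \<zero>\<^bsub>R\<^esub>) \<in> T}" using TD(2) by simp
      fix p assume p: "p \<in> {z \<in> carrier L. (z, \<zero>\<^bsub>R\<^esub>) \<in> T}"
      show "c \<odot>\<^bsub>L\<^esub> p \<in> {z \<in> carrier L. (z, \<zero>\<^bsub>R\<^esub>) \<in> T}" for c
        using p TD(5)[of "(p, \<zero>\<^bsub>R\<^esub>)" c] by simp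
      show "act L a p \<in> {z \<in> carrier L. (z, \<zero>\<^bsub>R\<^esub>) \<in> T}" for a
        using p TD(6)[of "(p, \<zero>\<^bsub>R\<^esub>)" a] by simp
      fix q assume q: "q \<in> {z \<in> carrier L. (z, \<zero>\<^bsub>R\<^esub>) \<in> T}"
      show "p \<oplus>\<^bsub>L\<^esub> q \<in> {z \<in> carrier L. (z, \<zero>\<^bsub>R\<^esub>) \<in> T}"
        using p q TD(4)[of "(p, \<zero>\<^bsub>R\<^esub>)" "(q, \<zero>\<^bsub>R\<^esub>)"] by simp
    qed auto
    moreover have "(L.raise 0 x, \<zero>\<^bsub>R\<^esub>) \<in> T"
      using S.op_submodule(1)[OF T v0T, of 0] by (simp add: S_ops oR)
    ultimately have "bg_span L {L.raise 0 x} \<subseteq> {z \<in> carrier L. (z, \<zero>\<^bsub>R\<^esub>) \<in> T}"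
      using xc by (intro L.bg_span_subset) simp_all
    then show ?thesis using that by blast
  qed
  \<comment> \<open>\<open>lower (- 1)\<close> kills x, so applied to (x, y) it isolates the right
    component and brings the radical of R alone into T.\<close>
  have radR: "(\<zero>\<^bsub>L\<^esub>, z) \<in> T" if "z \<in> bg_span R {R.lower (- 1) y}" for z
  proof -
    have "bg_submodule {z \<in> carrier R. (\<zero>\<^bsub>L\<^esub>, z) \<in> T} R"
    proof (rule R.bg_submoduleI)
      show "\<zero>\<^bsub>R\<^esub> \<in> {z \<in> carrier R. (\<zero>\<^bsub>L\<^esub>, z) \<in> T}" using TD(2) by simp
      fix p assume p: "p \<in> {z \<in> carrier R. (\<zero>\<^bsub>L\<^esub>, z) \<in> T}"
      show "c \<odot>\<^bsub>R\<^esub> p \<in> {z \<in> carrier R. (\<zero>\<^bsub>L\<^esub>, z) \<in> T}" for c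
        using p TD(5)[of "(\<zero>\<^bsub>L\<^esub>, p)" c] by simp
      show "act R a p \<in> {z \<in> carrier R. (\<zero>\<^bsub>L\<^esub>, z) \<in> T}" for a
        using p TD(6)[of "(\<zero>\<^bsub>L\<^esub>, p)" a] by simp
      fix q assume q: "q \<in> {z \<in> carrier R. (\<zero>\<^bsub>L\<^esub>, z) \<in> T}"
      show "p \<oplus>\<^bsub>R\<^esub> q \<in> {z \<in> carrier R. (\<zero>\<^bsub>L\<^esub>, z) \<in> T}"
        using p q TD(4)[of "(\<zero>\<^bsub>L\<^esub>, p)" "(\<zero>\<^bsub>L\<^esub>, q)"] by simp
    qed auto
    moreover have "(\<zero>\<^bsub>L\<^esub>, R.lower (- 1) y) \<in> T"
      using S.op_submodule(2)[OF T v0T, of "- 1"] by (simp add: S_ops oL)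
    ultimately have "bg_span R {R.lower (- 1) y} \<subseteq> {z \<in> carrier R. (\<zero>\<^bsub>L\<^esub>, z) \<in> T}"
      using yc by (intro R.bg_span_subset) simp_all
    then show ?thesis using that by blast
  qed
  \<comment> \<open>T projects onto L, so an element of D differs from one of T by some (0, q) with
    q in the kernel of the head map, which \<open>radR\<close> covers.\<close>
  have "D \<subseteq> T"
  proof
    fix z assume z: "z \<in> D"
    then obtain p q where pq: "z = (p, q)" "p \<in> carrier L" "q \<in> carrier R" "head_map L p = head_map R q"
      by (auto simp: D_def)
    interpret F: bg_morphism "bg_sum2 L R" L fst
      by (rule bg_morphismI[OF S.bg_premodule_axioms L.bg_premodule_axioms fst_hom])
    have "fst ` T = carrier L"
      unfolding T_def gL[symmetric] using F.span_image[of "{(x, y)}"] xc yc by simp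
    then obtain q' where q': "(p, q') \<in> T" using pq(2) by force
    then have "(p, q') \<in> D" using TsubD by blast
    then have q'c: "q' \<in> carrier R" "head_map R q' = head_map R q" using pq(4) by (auto simp: D_def)
    have "head_map R (q \<ominus>\<^bsub>R\<^esub> q') = \<zero>\<^bsub>V_mod\<^esub>"
      using hR.f_minus[OF pq(3) q'c(1)] q'c V.minus_zero_iff[OF hR.f_closed[OF pq(3)] hR.f_closed[OF pq(3)]] by simp
    then have "(\<zero>\<^bsub>L\<^esub>, q \<ominus>\<^bsub>R\<^esub> q') \<in> T"
      using pq(3) q'c(1) by (intro radR kR) simp_all
    from TD(4)[OF this q'] show "z \<in> T"
      using pq q'c(1) by simp
  qed
  with TsubD have TD_eq: "T = D" by blast
  have gA: "bg_span A {(x, y)} = carrier A"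
    unfolding A_def using S.restrict_span[OF D, of "{(x, y)}"] v0 TD_eq by (simp add: T_def)
  have rA: "A.roof_relations (x, y)"
    unfolding A_def using restrict_ops(3)[OF S.bg_module_axioms D] v0
      roof_relations_sum2[OF L.bg_module_axioms rL R.bg_module_axioms rR] by blast
  interpret X: bg_module "bg_sum2 A M" by (rule sum2_module[OF AM M(1)])
  have Ac: "z \<in> carrier A \<Longrightarrow> fst z \<in> carrier L \<and> snd z \<in> carrier R" for z
    using S.bg_submoduleD(1)[OF D] by (auto simp: A_def)
  interpret fL: bg_module_morphism "bg_sum2 A M" L "\<lambda>z. fst (fst z)"
    by unfold_locales (use Ac in \<open>auto intro!: bg_homI simp: A_def\<close>)
  interpret fR: bg_module_morphism "bg_sum2 A M" R "\<lambda>z. snd (fst z)"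
    by unfold_locales (use Ac in \<open>auto intro!: bg_homI simp: A_def\<close>)
  interpret fM: bg_module_morphism "bg_sum2 A M" M snd
    by unfold_locales (auto intro!: bg_homI)
  have uc: "u \<in> carrier M" using M(2) by (simp add: M.roof_relations_def)
  let ?v = "((x, y), u)"
  have vc: "?v \<in> carrier (bg_sum2 A M)" using v0 uc by (simp add: A_def)
  have rX: "X.roof_relations ?v" by (rule roof_relations_sum2[OF AM rA M(1,2)])
  have wx: "L.wt' x = \<zero>\<^bsub>L\<^esub>" and wy: "R.wt 0 y = \<zero>\<^bsub>R\<^esub>"
    using oL oR by (simp_all add: L.wt'_def R.wt_def)
  have hz: "L.horner L.wt' ds \<zero>\<^bsub>L\<^esub> = \<zero>\<^bsub>L\<^esub>" "R.horner (R.wt 0) ds \<zero>\<^bsub>R\<^esub> = \<zero>\<^bsub>R\<^esub>" for ds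
    by (induction ds) (auto simp: L.linop_zero[OF L.linop_wt'])
  have hL0: "L.wt' (L.horner L.wt' ds x) = \<zero>\<^bsub>L\<^esub>" for ds
    using L.horner_commute[where T = L.wt' and S = L.wt' and v = x and cs = ds] by (simp add: wx hz xc L.linop_wt')
  have hR0: "R.wt 0 (R.horner (R.wt 0) cs y) = \<zero>\<^bsub>R\<^esub>" for cs
    using R.horner_commute[where T = "R.wt 0" and S = "R.wt 0" and v = y and cs = cs] by (simp add: wy hz yc)
  \<comment> \<open>The component in M is written in two ways, with the constant term counted in the
    first or in the second polynomial. The case of \<open>raise 0\<close> below uses the first form,
    that of \<open>lower (- 1)\<close> the second.\<close>
  have vacX: "\<exists>c cs ds. fst (fst s) = L.horner (L.wt 0) (c # cs) x \<and> snd (fst s) = R.horner R.wt' (c # ds) y \<and>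
      snd s = M.horner (M.wt 0) (c # cs) u \<oplus>\<^bsub>M\<^esub> M.wt' (M.horner M.wt' ds u) \<and>
      snd s = M.wt 0 (M.horner (M.wt 0) cs u) \<oplus>\<^bsub>M\<^esub> M.horner M.wt' (c # ds) u"
    if sv: "s \<in> X.vac_space ?v" for s
  proof -
    obtain c cs ds where s: "s = c \<odot>\<^bsub>bg_sum2 A M\<^esub> ?v \<oplus>\<^bsub>bg_sum2 A M\<^esub>
        (X.wt 0 (X.horner (X.wt 0) cs ?v) \<oplus>\<^bsub>bg_sum2 A M\<^esub> X.wt' (X.horner X.wt' ds ?v))"
      using X.vac_space_horner[OF rX sv] by blast
    have cl: "c \<odot>\<^bsub>bg_sum2 A M\<^esub> ?v \<in> carrier (bg_sum2 A M)" "X.horner (X.wt 0) cs ?v \<in> carrier (bg_sum2 A M)"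
      "X.horner X.wt' ds ?v \<in> carrier (bg_sum2 A M)"
      "X.wt 0 (X.horner (X.wt 0) cs ?v) \<in> carrier (bg_sum2 A M)" "X.wt' (X.horner X.wt' ds ?v) \<in> carrier (bg_sum2 A M)"
      using vc X.linop_wt' by (simp_all del: sum2_simps)
    have hfL: "fst (fst (X.horner (X.wt 0) cs ?v)) = L.horner (L.wt 0) cs x" "fst (fst (X.horner X.wt' ds ?v)) = L.horner L.wt' ds x"
      using fL.f_horner[where T = "X.wt 0" and T' = "L.wt 0" and x = ?v and cs = cs] fL.f_wt vc
        fL.f_horner[where T = X.wt' and T' = L.wt' and x = ?v and cs = ds] fL.f_wt' X.linop_wt'
      by (simp_all del: sum2_simps)
    have hfR: "snd (fst (X.horner (X.wt 0) cs ?v)) = R.horner (R.wt 0) cs y" "snd (fst (X.horner X.wt' ds ?v)) = R.horner R.wt' ds y"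
      using fR.f_horner[where T = "X.wt 0" and T' = "R.wt 0" and x = ?v and cs = cs] fR.f_wt vc
        fR.f_horner[where T = X.wt' and T' = R.wt' and x = ?v and cs = ds] fR.f_wt' X.linop_wt'
      by (simp_all del: sum2_simps)
    have hfM: "snd (X.horner (X.wt 0) cs ?v) = M.horner (M.wt 0) cs u" "snd (X.horner X.wt' ds ?v) = M.horner M.wt' ds u"
      using fM.f_horner[where T = "X.wt 0" and T' = "M.wt 0" and x = ?v and cs = cs] fM.f_wt vc
        fM.f_horner[where T = X.wt' and T' = M.wt' and x = ?v and cs = ds] fM.f_wt' X.linop_wt'
      by (simp_all del: sum2_simps)
    note cl' = cl(1) X.add.m_closed[OF cl(4,5)]
    have "fst (fst s) = c \<odot>\<^bsub>L\<^esub> x \<oplus>\<^bsub>L\<^esub> (L.wt 0 (L.horner (L.wt 0) cs x) \<oplus>\<^bsub>L\<^esub> L.wt' (L.horner L.wt' ds x))"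
      unfolding s fL.f_add[OF cl'] fL.f_add[OF cl(4,5)] fL.f_sm[OF vc] fL.f_wt[OF cl(2)] fL.f_wt'[OF cl(3)]
        hfL by simp
    then have 1: "fst (fst s) = L.horner (L.wt 0) (c # cs) x"
      using xc by (simp add: hL0)
    have "snd (fst s) = c \<odot>\<^bsub>R\<^esub> y \<oplus>\<^bsub>R\<^esub> (R.wt 0 (R.horner (R.wt 0) cs y) \<oplus>\<^bsub>R\<^esub> R.wt' (R.horner R.wt' ds y))"
      unfolding s fR.f_add[OF cl'] fR.f_add[OF cl(4,5)] fR.f_sm[OF vc] fR.f_wt[OF cl(2)] fR.f_wt'[OF cl(3)]
        hfR by simp
    then have 2: "snd (fst s) = R.horner R.wt' (c # ds) y"
      using yc by (simp add: hR0 R.linop_wt')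
    have 3: "snd s = c \<odot>\<^bsub>M\<^esub> u \<oplus>\<^bsub>M\<^esub> (M.wt 0 (M.horner (M.wt 0) cs u) \<oplus>\<^bsub>M\<^esub> M.wt' (M.horner M.wt' ds u))"
      unfolding s fM.f_add[OF cl'] fM.f_add[OF cl(4,5)] fM.f_sm[OF vc] fM.f_wt[OF cl(2)] fM.f_wt'[OF cl(3)]
        hfM by simp
    have mc: "M.wt 0 (M.horner (M.wt 0) cs u) \<in> carrier M" "M.wt' (M.horner M.wt' ds u) \<in> carrier M" "c \<odot>\<^bsub>M\<^esub> u \<in> carrier M"
      using uc by (simp_all add: M.linop_wt')
    have "snd s = M.horner (M.wt 0) (c # cs) u \<oplus>\<^bsub>M\<^esub> M.wt' (M.horner M.wt' ds u)"
      using mc by (simp add: 3 M.a_assoc)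
    moreover have "snd s = M.wt 0 (M.horner (M.wt 0) cs u) \<oplus>\<^bsub>M\<^esub> M.horner M.wt' (c # ds) u"
      using mc by (simp add: 3 M.a_lcomm)
    ultimately show ?thesis using 1 2 by blast
  qed
  have nilx: "L.nil (L.wt 0) x" and nily: "R.nil R.wt' y"
    using rL rR by (simp_all add: L.roof_relations_def R.roof_relations_def)
  have pi: "Suc i - 1 = i" by simp
  have std: "b = \<zero>\<^bsub>M\<^esub>" if ab: "(a, b) \<in> X.standard ?v" "a = \<zero>\<^bsub>A\<^esub>" for a b
  proof -
    have a0: "fst a = \<zero>\<^bsub>L\<^esub>" "snd a = \<zero>\<^bsub>R\<^esub>" using ab(2) by (simp_all add: A_def)
    consider "(a, b) \<in> X.vac_space ?v" | s where "s \<in> X.vac_space ?v" "(a, b) = X.raise 0 s"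
      | s where "s \<in> X.vac_space ?v" "(a, b) = X.lower (- 1) s"
      using ab(1) by (auto simp: X.standard_def)
    then show ?thesis
    proof cases
      case 1
      obtain c cs ds where s: "\<zero>\<^bsub>L\<^esub> = L.horner (L.wt 0) (c # cs) x" "\<zero>\<^bsub>R\<^esub> = R.horner R.wt' (c # ds) y"
        "b = M.horner (M.wt 0) (c # cs) u \<oplus>\<^bsub>M\<^esub> M.wt' (M.horner M.wt' ds u)"
        using vacX[OF 1] a0 unfolding fst_conv snd_conv by metis
      \<comment> \<open>As \<open>wt 0 ^^ i\<close> does not kill x, a polynomial in
        \<open>wt 0\<close> that kills x starts in degree i + 1 or later; then it kills u as
        well.\<close>
      have "(c # cs) ! j = 0" if "j < Suc i" "j < length (c # cs)" for j
        by (rule L.horner_eq_zero[OF L.linops(3) xc nilx s(1)[symmetric] that]) (simp only: pi pL not_False_eq_True)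
      note z = this
      have "c = 0" using z[of 0] by simp
      moreover have "M.horner (M.wt 0) (c # cs) u = \<zero>\<^bsub>M\<^esub>"
        by (rule M.horner_zero_if[OF M.linops(3) uc M(3)]) (use z in simp)
      ultimately have c1: "M.horner (M.wt 0) (c # cs) u = \<zero>\<^bsub>M\<^esub>" "c = 0" by simp_all
      have "(c # ds) ! j = 0" if "j < Suc i" "j < length (c # ds)" for j
        by (rule R.horner_eq_zero[OF R.linop_wt' yc nily s(2)[symmetric] that]) (simp only: pi pR not_False_eq_True)
      then have "M.horner M.wt' (c # ds) u = \<zero>\<^bsub>M\<^esub>"
        by (rule_tac M.horner_zero_if[OF M.linop_wt' uc M(4)]) simp
      then show ?thesis using c1 s(3) uc by (simp add: M.linop_wt')
    next
      case 2
      have sc: "s \<in> carrier (bg_sum2 A M)" using X.vac_closed[OF rX 2(1)] .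
      have r: "fst a = L.raise 0 (fst (fst s))" "b = M.raise 0 (snd s)"
        using fL.f_ops(1)[OF sc, of 0] fM.f_ops(1)[OF sc, of 0] by (simp_all add: 2(2)[symmetric])
      obtain c cs ds where s: "fst (fst s) = L.horner (L.wt 0) (c # cs) x"
        "snd s = M.horner (M.wt 0) (c # cs) u \<oplus>\<^bsub>M\<^esub> M.wt' (M.horner M.wt' ds u)"
        using vacX[OF 2(1)] by metis
      \<comment> \<open>Only the product of \<open>wt 0\<close> with the polynomial is known to kill
        x, so one degree is lost and the polynomial starts in degree i. This is why the i-th power
        must vanish at u but not at x.\<close>
      have "L.wt 0 (L.horner (L.wt 0) (c # cs) x) = \<zero>\<^bsub>L\<^esub>"
        using r(1) a0(1) unfolding s(1) L.wt_def by (metis L.op_zero(2))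
      then have z: "L.horner (L.wt 0) (0 # c # cs) x = \<zero>\<^bsub>L\<^esub>" using xc by simp
      have "(0 # c # cs) ! j = 0" if "j < Suc i" "j < length (0 # c # cs)" for j
        by (rule L.horner_eq_zero[OF L.linops(3) xc nilx z that]) (simp only: pi pL not_False_eq_True)
      then have "(c # cs) ! j = 0" if "j < i" "j < length (c # cs)" for j
        using that by (metis Suc_less_eq length_Cons nth_Cons_Suc)
      then have h0: "M.horner (M.wt 0) (c # cs) u = \<zero>\<^bsub>M\<^esub>"
        by (rule M.horner_zero_if[OF M.linops(3) uc M(3)])
      let ?z = "M.horner M.wt' ds u"
      have zv: "?z \<in> M.vac_space u" by (rule M.horner_vac(2)[OF M(2)])
      have zc: "?z \<in> carrier M" using M.vac_closed[OF M(2) zv] .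
      have "b = M.raise 0 (M.wt' ?z)" using r(2) s(2) h0 zc by simp
      also have "\<dots> = M.raise (- 1) (M.raise 0 (M.lower (- 1) ?z))"
        using zc by (simp add: M.wt'_def M.raise_raise[of "M.lower (- 1) ?z" 0 "- 1"])
      also have "\<dots> = \<zero>\<^bsub>M\<^esub>" by (simp add: M.vac_raise_lower[OF M(2) zv])
      finally show ?thesis .
    next
      case 3
      have sc: "s \<in> carrier (bg_sum2 A M)" using X.vac_closed[OF rX 3(1)] .
      have r: "snd a = R.lower (- 1) (snd (fst s))" "b = M.lower (- 1) (snd s)"
        using fR.f_ops(2)[OF sc, of "- 1"] fM.f_ops(2)[OF sc, of "- 1"] by (simp_all add: 3(2)[symmetric])
      obtain c cs ds where s: "snd (fst s) = R.horner R.wt' (c # ds) y"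
        "snd s = M.wt 0 (M.horner (M.wt 0) cs u) \<oplus>\<^bsub>M\<^esub> M.horner M.wt' (c # ds) u"
        using vacX[OF 3(1)] by metis
      have "R.wt' (R.horner R.wt' (c # ds) y) = \<zero>\<^bsub>R\<^esub>"
        using r(1) a0(2) unfolding s(1) R.wt'_def by (metis R.op_zero(1))
      then have z: "R.horner R.wt' (0 # c # ds) y = \<zero>\<^bsub>R\<^esub>" using yc by (simp add: R.linop_wt')
      have "(0 # c # ds) ! j = 0" if "j < Suc i" "j < length (0 # c # ds)" for j
        by (rule R.horner_eq_zero[OF R.linop_wt' yc nily z that]) (simp only: pi pR not_False_eq_True)
      then have "(c # ds) ! j = 0" if "j < i" "j < length (c # ds)" for j
        using that by (metis Suc_less_eq length_Cons nth_Cons_Suc)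
      then have h0: "M.horner M.wt' (c # ds) u = \<zero>\<^bsub>M\<^esub>"
        by (rule M.horner_zero_if[OF M.linop_wt' uc M(4)])
      let ?z = "M.horner (M.wt 0) cs u"
      have zv: "?z \<in> M.vac_space u" by (rule M.horner_vac(1)[OF M(2)])
      have zc: "?z \<in> carrier M" using M.vac_closed[OF M(2) zv] .
      have "b = M.lower (- 1) (M.wt 0 ?z)" using r(2) s(2) h0 zc by simp
      also have "\<dots> = M.lower 0 (M.lower (- 1) (M.raise 0 ?z))"
        using zc by (simp add: M.wt_def M.lower_lower[of "M.raise 0 ?z" "- 1" 0])
      also have "\<dots> = \<zero>\<^bsub>M\<^esub>" by (simp add: M.vac_lower_raise[OF M(2) zv])
      finally show ?thesis .
    qed
  qed
  obtain f where f: "f \<in> bg_hom A M" "f (x, y) = u"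
  proof (rule hom_from_cyclic[OF AM rA gA M(1,2)])
    fix a b assume "(a, b) \<in> X.standard ?v" "a = \<zero>\<^bsub>A\<^esub>"
    then show "b = \<zero>\<^bsub>M\<^esub>" by (rule std)
  qed (rule that)
  interpret f: bg_morphism A M f
    by (rule bg_morphismI[OF A.bg_premodule_axioms M.bg_premodule_axioms f(1)])
  have v0A: "(x, y) \<in> carrier A" using v0 by (simp add: A_def)
  have "f ` carrier A = bg_span M {u}"
    unfolding gA[symmetric] using f.span_image[of "{(x, y)}"] v0A f(2) by simp
  moreover have "u \<in> f ` carrier A" using f(2) v0A by (metis imageI)
  ultimately show ?thesis
    using that AM f(1) unfolding roof by blast
qed

section \<open>Lifting weight vectors through a filtration\<close>

context bg_module
begin

lemma submodule_modesI:
  assumes "N \<subseteq> carrier M" "\<zero> \<in> N" "\<And>x y. x \<in> N \<Longrightarrow> y \<in> N \<Longrightarrow> x \<oplus> y \<in> N"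
    "\<And>c x. x \<in> N \<Longrightarrow> c \<odot> x \<in> N" "\<And>n x. x \<in> N \<Longrightarrow> raise n x \<in> N" "\<And>n x. x \<in> N \<Longrightarrow> lower n x \<in> N"
  shows "bg_submodule N M"
proof (rule bg_submoduleI[OF assms(1-4)])
  fix a x assume x: "x \<in> N"
  show "act M a x \<in> N"
    using assms(5)[OF x] assms(6)[OF x, of "- n" for n] by (cases a) (auto simp: raise_def lower_def)
qed

abbreviation "wtprod n cs x \<equiv> foldr (wts n) cs x"

lemma wtprod_closed [simp]: "x \<in> carrier M \<Longrightarrow> wtprod n cs x \<in> carrier M"
  by (induction cs) auto

lemma wtprod_linop: "linop (\<lambda>x. wtprod n cs x)"
proof (induction cs)
  case Nil
  then show ?case by (simp add: linop_def)
next
  case (Cons c cs)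
  then show ?case using linop_comp[OF linops(4) Cons] by simp
qed

lemma wtprod_commute:
  assumes "linop S" "\<And>c x. x \<in> carrier M \<Longrightarrow> S (wts n c x) = wts n c (S x)" "x \<in> carrier M"
  shows "S (wtprod n cs x) = wtprod n cs (S x)"
  using assms(3) by (induction cs) (simp_all add: assms(2))

lemma wtprod_submodule: "bg_submodule A M \<Longrightarrow> x \<in> A \<Longrightarrow> wtprod n cs x \<in> A"
  by (induction cs) (auto intro: op_submodule)

text \<open>A mode shifts the roots of the polynomial \<open>wtprod n cs\<close> by one or leaves
  them alone, and a sum of two vectors is handled by the product of their polynomials. So it
  suffices to test generators.\<close>

lemma locally_finite_submodule:
  assumes A: "bg_submodule A M"
  shows "bg_submodule {x \<in> carrier M. \<exists>cs. wtprod n cs x \<in> A} M"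
proof (rule submodule_modesI)
  note D = bg_submoduleD[OF A]
  show "\<zero> \<in> {x \<in> carrier M. \<exists>cs. wtprod n cs x \<in> A}"
    using D(2) by (auto intro!: exI[of _ "[]"])
  fix x assume "x \<in> {x \<in> carrier M. \<exists>cs. wtprod n cs x \<in> A}"
  then obtain cs where x: "x \<in> carrier M" "wtprod n cs x \<in> A" by blast
  show "c \<odot> x \<in> {x \<in> carrier M. \<exists>cs. wtprod n cs x \<in> A}" for c
    using x D(5) linopD(3)[OF wtprod_linop x(1)] by (auto intro!: exI[of _ cs])
  have "wtprod n (map (\<lambda>c. c + 1) cs) (raise n x) = raise n (wtprod n cs x)" for cs
    using x(1) by (induction cs) (simp_all add: wts_raise)
  moreover have "wtprod n cs (raise m x) = raise m (wtprod n cs x)" if "m \<noteq> n" for m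
    using that x(1) by (intro wtprod_commute[symmetric]) (simp_all add: wts_raise_other)
  ultimately show "raise m x \<in> {x \<in> carrier M. \<exists>cs. wtprod n cs x \<in> A}" for m
    using op_submodule(1)[OF A x(2), of m] op_closed(1)[OF x(1)] by (cases "m = n") (simp, metis)+
  have "wtprod n (map (\<lambda>c. c - 1) cs) (lower n x) = lower n (wtprod n cs x)" for cs
    using x(1) by (induction cs) (simp_all add: wts_lower)
  moreover have "wtprod n cs (lower m x) = lower m (wtprod n cs x)" if "m \<noteq> n" for m
    using that x(1) by (intro wtprod_commute[symmetric]) (simp_all add: wts_lower_other)
  ultimately show "lower m x \<in> {x \<in> carrier M. \<exists>cs. wtprod n cs x \<in> A}" for m
    using op_submodule(2)[OF A x(2), of m] op_closed(2)[OF x(1)] by (cases "m = n") (simp, metis)+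
  fix y assume "y \<in> {x \<in> carrier M. \<exists>cs. wtprod n cs x \<in> A}"
  then obtain ds where y: "y \<in> carrier M" "wtprod n ds y \<in> A" by blast
  have "wtprod n cs (wtprod n ds x) = wtprod n ds (wtprod n cs x)"
  proof (rule wtprod_commute[symmetric])
    show "linop (\<lambda>x. wtprod n ds x)" by (rule wtprod_linop)
    show "wtprod n ds (wts n c z) = wts n c (wtprod n ds z)" if "z \<in> carrier M" for c z
      using that by (intro wtprod_commute[symmetric]) (auto simp: wts_wts)
  qed (rule x(1))
  then have "wtprod n (cs @ ds) (x \<oplus> y) = wtprod n ds (wtprod n cs x) \<oplus> wtprod n cs (wtprod n ds y)"
    using x(1) y(1) linopD(2)[OF wtprod_linop] by simp
  then have "wtprod n (cs @ ds) (x \<oplus> y) \<in> A"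
    using D(4) wtprod_submodule[OF A] x(2) y(2) by metis
  then show "x \<oplus> y \<in> {x \<in> carrier M. \<exists>cs. wtprod n cs x \<in> A}"
    using x(1) y(1) by blast
qed auto

text \<open>\<open>lower n\<close> commutes with \<open>raise n\<close> up to a scalar, and one
  additional power absorbs the resulting term.\<close>

lemma raise_pow_lower:
  assumes A: "bg_submodule A M"
  shows "x \<in> carrier M \<Longrightarrow> (raise n ^^ m) x \<in> A \<Longrightarrow> (raise n ^^ Suc m) (lower n x) \<in> A"
proof (induction m arbitrary: x)
  case 0
  then show ?case by (simp add: op_submodule[OF A])
next
  case (Suc m)
  have 1: "(raise n ^^ Suc m) (lower n (raise n x)) \<in> A"
    using Suc by (intro Suc.IH) (simp_all add: funpow_swap1)
  have "(raise n ^^ Suc (Suc m)) (lower n x) = (raise n ^^ Suc m) (raise n (lower n x))"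
    by (simp only: funpow_Suc_right o_apply)
  also have "raise n (lower n x) = lower n (raise n x) \<oplus> (- 1) \<odot> x"
    using Suc.prems(1) raise_lower_same[of x n] by (simp add: wt_def)
  also have "(raise n ^^ Suc m) \<dots> = (raise n ^^ Suc m) (lower n (raise n x)) \<oplus> (- 1) \<odot> (raise n ^^ Suc m) x"
    using Suc.prems(1) by (simp only: linopD[OF linop_pow[OF linops(1)]] op_closed sm_closed)
  finally show ?case
    using 1 Suc.prems(2) bg_submoduleD(4,5)[OF A] by metis
qed

lemma lower_pow_raise:
  assumes A: "bg_submodule A M"
  shows "x \<in> carrier M \<Longrightarrow> (lower n ^^ m) x \<in> A \<Longrightarrow> (lower n ^^ Suc m) (raise n x) \<in> A"
proof (induction m arbitrary: x)
  case 0
  then show ?case by (simp add: op_submodule[OF A])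
next
  case (Suc m)
  have 1: "(lower n ^^ Suc m) (raise n (lower n x)) \<in> A"
    using Suc by (intro Suc.IH) (simp_all add: funpow_swap1)
  have "(lower n ^^ Suc (Suc m)) (raise n x) = (lower n ^^ Suc m) (lower n (raise n x))"
    by (simp only: funpow_Suc_right o_apply)
  also have "lower n (raise n x) = raise n (lower n x) \<oplus> x"
    using Suc.prems(1) wt_raise_lower_self[of x n] by (simp add: wt_def)
  also have "(lower n ^^ Suc m) \<dots> = (lower n ^^ Suc m) (raise n (lower n x)) \<oplus> (lower n ^^ Suc m) x"
    using Suc.prems(1) by (simp only: linopD[OF linop_pow[OF linops(2)]] op_closed sm_closed)
  finally show ?case
    using 1 Suc.prems(2) bg_submoduleD(4)[OF A] by metis
qed

lemma submodule_pow_act: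
  assumes "bg_submodule A M" "T = raise n \<or> T = lower n" "(T ^^ m) x \<in> A" "m \<le> k"
  shows "(T ^^ k) x \<in> A"
proof -
  have "(T ^^ j) y \<in> A" if "y \<in> A" for j y
    using that assms(1,2) by (induction j) (auto intro: op_submodule)
  from this[OF assms(3), of "k - m"] show ?thesis
    using assms(4) by (metis comp_apply funpow_add le_add_diff_inverse2)
qed

text \<open>Local nilpotency of a mode modulo A spreads from a generator: every mode but its
  conjugate commutes with it, and the conjugate costs one more power.\<close>

lemma nilpotent_submodule:
  assumes A: "bg_submodule A M" and T: "T = raise n \<or> T = lower n"
  shows "bg_submodule {x \<in> carrier M. \<exists>m. (T ^^ m) x \<in> A} M"
proof (rule submodule_modesI)
  note D = bg_submoduleD[OF A]
  have lin: "linop T" using T by auto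
  show "\<zero> \<in> {x \<in> carrier M. \<exists>m. (T ^^ m) x \<in> A}"
    using D(2) by (auto intro!: exI[of _ 0])
  fix x assume "x \<in> {x \<in> carrier M. \<exists>m. (T ^^ m) x \<in> A}"
  then obtain m where x: "x \<in> carrier M" "(T ^^ m) x \<in> A" by blast
  show "c \<odot> x \<in> {x \<in> carrier M. \<exists>m. (T ^^ m) x \<in> A}" for c
    using x D(5) linopD(3)[OF linop_pow[OF lin] x(1)] by (auto intro!: exI[of _ m])
  have comm: "(T ^^ m) (S x) \<in> A" if "linop S" "\<And>z. z \<in> carrier M \<Longrightarrow> T (S z) = S (T z)" "S = raise l \<or> S = lower l" for S l
    using pow_intertwine[of T T S, OF lin that(2) x(1), of m] op_submodule(1,2)[OF A x(2), of l] that(3) by auto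
  show "raise l x \<in> {x \<in> carrier M. \<exists>m. (T ^^ m) x \<in> A}" for l
  proof (cases "T = lower n \<and> l = n")
    case True
    then have "(T ^^ Suc m) (raise l x) \<in> A" using lower_pow_raise[OF A x(1)] x(2) by simp
    then show ?thesis using x(1) by blast
  next
    case False
    then have "T (raise l z) = raise l (T z)" if "z \<in> carrier M" for z
      using T that raise_lower[of z l n] raise_raise[of z n l] by (cases "l = n") auto
    from comm[of "raise l" l, OF linops(1) this] show ?thesis using x(1) by blast
  qed
  show "lower l x \<in> {x \<in> carrier M. \<exists>m. (T ^^ m) x \<in> A}" for l
  proof (cases "T = raise n \<and> l = n")
    case True
    then have "(T ^^ Suc m) (lower l x) \<in> A" using raise_pow_lower[OF A x(1)] x(2) by simp
    then show ?thesis using x(1) by blast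
  next
    case False
    then have "T (lower l z) = lower l (T z)" if "z \<in> carrier M" for z
      using T that raise_lower[of z n l] lower_lower[of z n l] by (cases "l = n") auto
    from comm[of "lower l" l, OF linops(2) this] show ?thesis using x(1) by blast
  qed
  fix y assume "y \<in> {x \<in> carrier M. \<exists>m. (T ^^ m) x \<in> A}"
  then obtain k where y: "y \<in> carrier M" "(T ^^ k) y \<in> A" by blast
  have "(T ^^ max m k) (x \<oplus> y) \<in> A"
    using submodule_pow_act[OF A T x(2), of "max m k"] submodule_pow_act[OF A T y(2), of "max m k"]
      D(4) linopD(2)[OF linop_pow[OF lin] x(1) y(1)] by simp
  then show "x \<oplus> y \<in> {x \<in> carrier M. \<exists>m. (T ^^ m) x \<in> A}"
    using x(1) y(1) by blast
qed auto

text \<open>Follow the string y, \<open>raise n y\<close>, ... to its last member outside A. There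
  \<open>lower n (raise n _)\<close> lies in A, so \<open>wt n\<close> has the eigenvalue 0, and
  each step had added 1.\<close>

lemma gen_weight_raise_nilpotent:
  assumes A: "bg_submodule A M"
  shows "gen_weight w y \<Longrightarrow> (raise n ^^ m) y \<in> A \<Longrightarrow> y \<in> A \<or> (\<exists>i. w n = - of_nat i)"
proof (induction m arbitrary: y w)
  case (Suc m)
  have "(raise n ^^ m) (raise n y) \<in> A" using Suc.prems(2) by (simp add: funpow_swap1)
  from Suc.IH[OF gen_weight_raise[OF Suc.prems(1), of n] this]
  consider "raise n y \<in> A" | i where "w n + 1 = - of_nat i" by auto
  then show ?case
  proof cases
    case 1
    then have "lower n (raise n y) \<in> A" by (rule op_submodule(2)[OF A])
    then have "wts n 0 y \<in> A" using gen_weight_closed[OF Suc.prems(1)] by (simp add: wts_def wt_def)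
    then show ?thesis
      using invert_gen_weight[OF A Suc.prems(1), of n 0] by (cases "w n = 0") (auto intro: exI[of _ 0])
  next
    case 2
    then have "w n = - of_nat (Suc i)" by (simp add: algebra_simps eq_neg_iff_add_eq_0)
    then show ?thesis by blast
  qed
qed simp

text \<open>The downward string ends where \<open>raise n (lower n _)\<close>, that is
  \<open>wt n - 1\<close>, has the eigenvalue 0.\<close>

lemma gen_weight_lower_nilpotent:
  assumes A: "bg_submodule A M"
  shows "gen_weight w y \<Longrightarrow> (lower n ^^ m) y \<in> A \<Longrightarrow> y \<in> A \<or> (\<exists>i. w n = 1 + of_nat i)"
proof (induction m arbitrary: y w)
  case (Suc m)
  have "(lower n ^^ m) (lower n y) \<in> A" using Suc.prems(2) by (simp add: funpow_swap1)
  from Suc.IH[OF gen_weight_lower[OF Suc.prems(1), of n] this]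
  consider "lower n y \<in> A" | i where "w n - 1 = 1 + of_nat i" by auto
  then show ?case
  proof cases
    case 1
    then have "raise n (lower n y) \<in> A" by (rule op_submodule(1)[OF A])
    then have "wts n 1 y \<in> A"
      using gen_weight_closed[OF Suc.prems(1)] by (simp add: wts_def raise_lower_same)
    then show ?thesis
      using invert_gen_weight[OF A Suc.prems(1), of n 1] by (cases "w n = 1") (auto intro: exI[of _ 0])
  next
    case 2
    then have "w n = 1 + of_nat (Suc i)" by (simp add: algebra_simps)
    then show ?thesis by blast
  qed
qed simp

text \<open>Describes the quotient B / A by representatives in M, because v has to be lifted to an
  eigenvector inside M itself.\<close>

definition cyclic_factor :: "'v set \<Rightarrow> 'v set \<Rightarrow> (int \<Rightarrow> complex) \<Rightarrow> 'v \<Rightarrow> bool" where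
  "cyclic_factor A B \<chi> v \<longleftrightarrow> bg_submodule A M \<and> bg_submodule B M \<and> A \<subseteq> B \<and> v \<in> B \<and>
    B \<subseteq> bg_span M (insert v A) \<and> (\<forall>n. wts n (\<chi> n) v \<in> A)"

definition flow_weight :: "int \<Rightarrow> int \<Rightarrow> complex" where
  "flow_weight j n = (if n \<ge> - j then 0 else 1)"

definition vacuum_factor :: "'v set \<Rightarrow> 'v set \<Rightarrow> int \<Rightarrow> 'v \<Rightarrow> bool" where
  "vacuum_factor A B j v \<longleftrightarrow> cyclic_factor A B (flow_weight j) v \<and>
    (\<forall>n. n \<ge> - j \<longrightarrow> raise n v \<in> A) \<and> (\<forall>n. n < - j \<longrightarrow> lower n v \<in> A)"

lemma cyclic_factorD:
  assumes "cyclic_factor A B \<chi> v"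
  shows "bg_submodule A M" "bg_submodule B M" "A \<subseteq> B" "v \<in> B" "v \<in> carrier M"
    "bg_submodule X M \<Longrightarrow> A \<subseteq> X \<Longrightarrow> v \<in> X \<Longrightarrow> B \<subseteq> X" "wts n (\<chi> n) v \<in> A"
proof -
  show 1: "bg_submodule A M" "bg_submodule B M" "A \<subseteq> B" "v \<in> B" "wts n (\<chi> n) v \<in> A"
    using assms by (auto simp: cyclic_factor_def)
  show "v \<in> carrier M" using 1 bg_submoduleD(3) by blast
  show "bg_submodule X M \<Longrightarrow> A \<subseteq> X \<Longrightarrow> v \<in> X \<Longrightarrow> B \<subseteq> X"
    using assms bg_span_subset[of X "insert v A"] by (auto simp: cyclic_factor_def)
qed

lemma cyclic_factor_locally_finite:
  assumes "cyclic_factor A B \<chi> v" "x \<in> B"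
  shows "\<exists>cs. wtprod n cs x \<in> A"
proof -
  note F = cyclic_factorD[OF assms(1)]
  have "B \<subseteq> {x \<in> carrier M. \<exists>cs. wtprod n cs x \<in> A}"
  proof (rule F(6)[OF locally_finite_submodule[OF F(1)]])
    show "A \<subseteq> {x \<in> carrier M. \<exists>cs. wtprod n cs x \<in> A}"
      using bg_submoduleD(1)[OF F(1)] by (auto intro!: exI[of _ "[]"])
    show "v \<in> {x \<in> carrier M. \<exists>cs. wtprod n cs x \<in> A}"
      using F(5,7) by (auto intro!: exI[of _ "[\<chi> n]"])
  qed
  then show ?thesis using assms(2) by blast
qed

lemma vacuum_factor_weight:
  assumes F: "vacuum_factor A B j v" and y: "gen_weight w y" "y \<in> B" "y \<notin> A"
  shows "n \<ge> - j \<Longrightarrow> \<exists>i. w n = - of_nat i" "n < - j \<Longrightarrow> \<exists>i. w n = 1 + of_nat i"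
proof -
  have C: "cyclic_factor A B (flow_weight j) v" using F by (simp add: vacuum_factor_def)
  note D = cyclic_factorD[OF C]
  have nilp: "\<exists>m. (T ^^ m) y \<in> A" if "T = raise n \<or> T = lower n" "T v \<in> A" for T
  proof -
    have "B \<subseteq> {x \<in> carrier M. \<exists>m. (T ^^ m) x \<in> A}"
    proof (rule D(6)[OF nilpotent_submodule[OF D(1) that(1)]])
      show "A \<subseteq> {x \<in> carrier M. \<exists>m. (T ^^ m) x \<in> A}"
        using bg_submoduleD(1)[OF D(1)] by (auto intro!: exI[of _ 0])
      show "v \<in> {x \<in> carrier M. \<exists>m. (T ^^ m) x \<in> A}"
        using D(5) that(2) by (auto intro!: exI[of _ 1])
    qed
    then show ?thesis using y(2) by blast
  qed
  show "\<exists>i. w n = - of_nat i" if "n \<ge> - j"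
    using nilp[of "raise n"] F that gen_weight_raise_nilpotent[OF D(1) y(1)] y(3)
    by (auto simp: vacuum_factor_def)
  show "\<exists>i. w n = 1 + of_nat i" if "n < - j"
    using nilp[of "lower n"] F that gen_weight_lower_nilpotent[OF D(1) y(1)] y(3)
    by (auto simp: vacuum_factor_def)
qed

text \<open>Projection to the generalized eigenvalue l. For each root c other than l one applies
  \<open>(wt n - c) / (l - c)\<close>, which fixes v modulo A because v has the eigenvalue l there.
  R collects the properties already arranged for other indices.\<close>

lemma lift_step:
  assumes A: "bg_submodule A M" and v: "v \<in> carrier M" "wts n l v \<in> A"
    and R: "\<And>x. R x \<Longrightarrow> x \<in> carrier M" "\<And>x c. R x \<Longrightarrow> R (c \<odot> x)" "\<And>x c. R x \<Longrightarrow> R (wts n c x)"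
  shows "R x \<Longrightarrow> x \<ominus> v \<in> A \<Longrightarrow> nil (wts n l) (wtprod n cs x) \<Longrightarrow>
    \<exists>y. R y \<and> y \<ominus> v \<in> A \<and> nil (wts n l) y"
proof (induction cs arbitrary: x)
  case (Cons c cs)
  note D = bg_submoduleD[OF A]
  have x: "x \<in> carrier M" using R(1) Cons.prems(1) .
  show ?case
  proof (cases "c = l")
    case True
    then obtain m where "(wts n l ^^ m) (wts n l (wtprod n cs x)) = \<zero>"
      using Cons.prems(3) by (auto simp: nil_def)
    then have "nil (wts n l) (wtprod n cs x)"
      unfolding nil_def by (intro exI[of _ "Suc m"]) (simp add: funpow_swap1)
    then show ?thesis by (rule Cons.IH[OF Cons.prems(1,2)])
  next
    case False
    define k where "k = inverse (l - c)"
    define x' where "x' = k \<odot> wts n c x"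
    have "wtprod n cs x' = k \<odot> wtprod n cs (wts n c x)"
      unfolding x'_def using x by (intro linopD(3)[OF wtprod_linop]) simp
    also have "wtprod n cs (wts n c x) = wts n c (wtprod n cs x)"
      using x by (intro wtprod_commute[symmetric]) (auto simp: wts_wts)
    finally have "nil (wts n l) (wtprod n cs x')"
      using Cons.prems(3) x by (simp add: nil_sm)
    moreover have "x' \<ominus> v \<in> A"
    proof -
      have "wts n c v = wts n l v \<oplus> (l - c) \<odot> v"
        using wts_diff[OF v(1), of n c l] v(1) sub_add[of "wts n c v" "wts n l v"] by (simp add: a_comm)
      moreover have "wts n c x = wts n c (x \<ominus> v) \<oplus> wts n c v"
        using x v(1) by (simp add: op_add(4)[symmetric])
      ultimately have "x' = k \<odot> (wts n c (x \<ominus> v) \<oplus> wts n l v) \<oplus> (k * (l - c)) \<odot> v"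
        unfolding x'_def using x v(1) by (simp add: sm_r_distr sm_assoc a_assoc)
      also have "k * (l - c) = 1" using False by (simp add: k_def)
      finally have "x' \<ominus> v = k \<odot> (wts n c (x \<ominus> v) \<oplus> wts n l v)"
        using x v(1) by (simp add: add_sub)
      also have "\<dots> \<in> A"
        using D(4,5) op_submodule(4)[OF A Cons.prems(2)] v(2) by metis
      finally show ?thesis .
    qed
    moreover have "R x'" unfolding x'_def using R(2,3) Cons.prems(1) by blast
    ultimately show ?thesis using Cons.IH by blast
  qed
qed auto

text \<open>The projections are carried out for the finitely many n in T. Outside T, v is an exact
  eigenvector, and this survives because the operators \<open>wts\<close> commute.\<close>

lemma lift_gen_weight:
  assumes F: "cyclic_factor A B \<chi> v"
    and lf: "\<And>n x. x \<in> carrier M \<Longrightarrow> \<exists>cs. wtprod n cs x = \<zero>"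
    and T: "finite T" "\<And>n. n \<notin> T \<Longrightarrow> wts n (\<chi> n) v = \<zero>"
  obtains y where "gen_weight \<chi> y" "y \<in> B" "y \<ominus> v \<in> A" "\<And>n. n \<notin> T \<Longrightarrow> wts n (\<chi> n) y = \<zero>"
proof -
  note D = cyclic_factorD[OF F]
  have "\<exists>y\<in>carrier M. (\<forall>n\<in>T'. nil (wts n (\<chi> n)) y) \<and> (\<forall>n. n \<notin> T \<longrightarrow> wts n (\<chi> n) y = \<zero>) \<and> y \<ominus> v \<in> A"
    if "finite T'" for T'
    using that
  proof (induction T' rule: finite_induct)
    case empty
    have "v \<ominus> v \<in> A" using minus_zero_iff[OF D(5,5)] bg_submoduleD(2)[OF D(1)] by simp
    then show ?case using D(5) T(2) by blast
  next
    case (insert m T')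
    define R where "R y \<longleftrightarrow> y \<in> carrier M \<and> (\<forall>n\<in>T'. nil (wts n (\<chi> n)) y) \<and>
      (\<forall>n. n \<notin> T \<longrightarrow> wts n (\<chi> n) y = \<zero>)" for y
    obtain x where x: "R x" "x \<ominus> v \<in> A" using insert.IH by (auto simp: R_def)
    obtain cs where cs: "wtprod m cs x = \<zero>" using lf x(1) unfolding R_def by blast
    have nw: "nil (wts n (\<chi> n)) (wts m c x)" if "nil (wts n (\<chi> n)) x" "x \<in> carrier M" for n c x
      using that nil_intertwine[of "wts n (\<chi> n)" "wts m c" "wts n (\<chi> n)" x] by (simp add: wts_wts[of _ n _ m])
    have zw: "wts n (\<chi> n) (wts m c x) = \<zero>" if "wts n (\<chi> n) x = \<zero>" "x \<in> carrier M" for n c x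
      using that by (simp add: wts_wts[of _ _ _ m])
    have "\<exists>y. R y \<and> y \<ominus> v \<in> A \<and> nil (wts m (\<chi> m)) y"
    proof (rule lift_step[OF D(1,5,7), where R = R and x = x and cs = cs])
      show "nil (wts m (\<chi> m)) (wtprod m cs x)" unfolding cs by (rule nil_zero)
      show "R (c \<odot> z)" if "R z" for z c
        using that by (auto simp: R_def op_sm intro!: nil_sm)
      show "R (wts m c z)" if "R z" for z c
        using that nw zw by (simp add: R_def)
    qed (use x in \<open>simp_all add: R_def\<close>)
    then obtain y where "R y" "y \<ominus> v \<in> A" "nil (wts m (\<chi> m)) y" by blast
    then show ?case by (intro bexI[of _ y]) (auto simp: R_def)
  qed
  then obtain y where y: "y \<in> carrier M" "\<forall>n\<in>T. nil (wts n (\<chi> n)) y" "\<forall>n. n \<notin> T \<longrightarrow> wts n (\<chi> n) y = \<zero>" "y \<ominus> v \<in> A"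
    using T(1) by blast
  have "nil (wts n (\<chi> n)) y" for n
  proof (cases "n \<in> T")
    case False
    then show ?thesis using y(3) unfolding nil_def by (intro exI[of _ 1]) simp
  qed (use y(2) in blast)
  then have "gen_weight \<chi> y" using y(1) by (simp add: gen_weight_def)
  moreover have "(y \<ominus> v) \<oplus> v \<in> B"
    using D(3,4) y(4) bg_submoduleD(4)[OF D(2)] by blast
  then have "y \<in> B" using sub_add[OF y(1) D(5)] by simp
  ultimately show ?thesis using that y by blast
qed

section \<open>Eigenvalues of the charge \<open>J0\<close> on weight vectors\<close>

lemma nil_sum2:
  assumes "linop S" "linop T" "\<And>x. x \<in> carrier M \<Longrightarrow> S (T x) = T (S x)"
  shows "v \<in> carrier M \<Longrightarrow> (S ^^ p) v = \<zero> \<Longrightarrow> (T ^^ q) v = \<zero> \<Longrightarrow> ((\<lambda>x. S x \<oplus> T x) ^^ (p + q)) v = \<zero>"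
proof (induction "p + q" arbitrary: p q v)
  case 0
  then show ?case by simp
next
  case (Suc m)
  have lin: "linop (\<lambda>x. S x \<oplus> T x)" by (rule linop_add[OF assms(1,2)])
  show ?case
  proof (cases "p = 0 \<or> q = 0")
    case True
    then have "v = \<zero>" using Suc.prems by auto
    then show ?thesis using pow_zero[OF lin] by simp
  next
    case False
    then obtain p' q' where pq: "p = Suc p'" "q = Suc q'" by (metis not0_implies_Suc)
    have Sv: "S v \<in> carrier M" "T v \<in> carrier M" using linopD(1) assms(1,2) Suc.prems(1) by auto
    have 1: "((\<lambda>x. S x \<oplus> T x) ^^ (p' + q)) (S v) = \<zero>"
    proof (rule Suc.hyps(1))
      show "m = p' + q" using Suc.hyps(2) pq by simp
      show "(S ^^ p') (S v) = \<zero>" using Suc.prems(2) pq by (simp add: funpow_swap1)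
      show "(T ^^ q) (S v) = \<zero>"
        using pow_intertwine[of T T S v q] assms Suc.prems by (simp add: linop_zero)
    qed (rule Sv(1))
    have 2: "((\<lambda>x. S x \<oplus> T x) ^^ (p + q')) (T v) = \<zero>"
    proof (rule Suc.hyps(1))
      show "m = p + q'" using Suc.hyps(2) pq by simp
      show "(T ^^ q') (T v) = \<zero>" using Suc.prems(3) pq by (simp add: funpow_swap1)
      show "(S ^^ p) (T v) = \<zero>"
        using pow_intertwine[of S S T v p] assms Suc.prems by (simp add: linop_zero)
    qed (rule Sv(2))
    have e: "p + q = Suc (p' + q)" "p + q' = p' + q" using pq by simp_all
    have "((\<lambda>x. S x \<oplus> T x) ^^ (p + q)) v = ((\<lambda>x. S x \<oplus> T x) ^^ (p' + q)) (S v \<oplus> T v)"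
      unfolding e(1) by (simp only: funpow_Suc_right o_apply)
    also have "\<dots> = \<zero>"
      using linopD(2)[OF linop_pow[OF lin] Sv] 1 2 e(2) by simp
    finally show ?thesis .
  qed
qed

lemma linop_finsum_wts: "finite I \<Longrightarrow> linop (\<lambda>x. \<Oplus>n\<in>I. wts n (\<chi> n) x)"
  unfolding linop_def
proof (intro conjI ballI allI)
  fix x y c assume I: "finite I" and x: "x \<in> carrier M"
  show "(\<Oplus>n\<in>I. wts n (\<chi> n) x) \<in> carrier M" using x by (auto intro: finsum_closed)
  show "(\<Oplus>n\<in>I. wts n (\<chi> n) (c \<odot> x)) = c \<odot> (\<Oplus>n\<in>I. wts n (\<chi> n) x)"
    using x I by (subst linop_finsum[OF linop_sm]) (auto simp: op_sm intro!: finsum_cong')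
  assume y: "y \<in> carrier M"
  show "(\<Oplus>n\<in>I. wts n (\<chi> n) (x \<oplus> y)) = (\<Oplus>n\<in>I. wts n (\<chi> n) x) \<oplus> (\<Oplus>n\<in>I. wts n (\<chi> n) y)"
    using x y by (subst finsum_addf[symmetric]) (auto simp: op_add intro!: finsum_cong')
qed

lemma nil_finsum_wts:
  assumes "finite I" "gen_weight \<chi> v"
  shows "nil (\<lambda>x. \<Oplus>n\<in>I. wts n (\<chi> n) x) v"
  using assms(1)
proof (induction I rule: finite_induct)
  case empty
  show ?case unfolding nil_def by (intro exI[of _ 1]) simp
next
  case (insert m I)
  have v: "v \<in> carrier M" using assms(2) by (rule gen_weight_closed)
  let ?T = "\<lambda>x. \<Oplus>n\<in>I. wts n (\<chi> n) x"
  obtain p where p: "(wts m (\<chi> m) ^^ p) v = \<zero>"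
    using assms(2) unfolding nil_def gen_weight_def by blast
  obtain q where q: "(?T ^^ q) v = \<zero>"
    using insert.IH unfolding nil_def by blast
  have comm: "wts m (\<chi> m) (?T x) = ?T (wts m (\<chi> m) x)" if "x \<in> carrier M" for x
    using that insert.hyps(1)
    by (subst linop_finsum[OF linops(4)]) (auto simp: wts_wts[of _ m] intro!: finsum_cong')
  have eq: "(\<Oplus>n\<in>insert m I. wts n (\<chi> n) x) = wts m (\<chi> m) x \<oplus> ?T x" if "x \<in> carrier M" for x
    using that insert.hyps by (intro finsum_insert) auto
  have lin: "linop (\<lambda>x. wts m (\<chi> m) x \<oplus> ?T x)"
    by (rule linop_add[OF linops(4) linop_finsum_wts[OF insert.hyps(1)]])
  have "((\<lambda>x. \<Oplus>n\<in>insert m I. wts n (\<chi> n) x) ^^ j) v = ((\<lambda>x. wts m (\<chi> m) x \<oplus> ?T x) ^^ j) v" for j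
    using pow_closed[OF lin v] by (induction j) (simp_all add: eq)
  moreover have "((\<lambda>x. wts m (\<chi> m) x \<oplus> ?T x) ^^ (p + q)) v = \<zero>"
    by (rule nil_sum2[OF linops(4) linop_finsum_wts[OF insert.hyps(1)] comm v p q])
  ultimately show ?case unfolding nil_def by (intro exI[of _ "p + q"]) simp
qed

text \<open>\<open>J0\<close> sums \<open>wt n\<close> over n \<ge> 0 and \<open>wt n - 1\<close>
  over n < 0, the latter being \<open>raise n (lower n _)\<close>. Outside a finite range the
  summands vanish on v; inside, they are commuting operators whose generalized eigenvalues add
  up.\<close>

lemma J0_eigenvector:
  fixes N :: nat
  assumes v: "gen_weight \<chi> v" "v \<noteq> \<zero>"
    and N: "\<And>n. n > int N \<Longrightarrow> wts n 0 v = \<zero>" "\<And>n. n < - int N \<Longrightarrow> wts n 1 v = \<zero>"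
  shows "gen_eigenspace M (J0 M) (\<Sum>n\<in>{- int N..int N}. \<chi> n - (if n \<ge> 0 then 0 else 1)) \<noteq> {\<zero>}"
proof -
  let ?I = "{- int N..int N}"
  define e where "e n = (if n \<ge> 0 then 0 else 1 :: complex)" for n :: int
  define K where "K x = (\<Oplus>n\<in>?I. wts n (\<chi> n) x)" for x
  define \<kappa> where "\<kappa> = (\<Sum>n\<in>?I. \<chi> n - e n)"
  \<comment> \<open>On Z the sums in \<open>J0\<close> reduce to the indices in \<open>?I\<close>. Z
    is stable under K, so the powers of \<open>J0 - \<kappa>\<close> and of K agree on v.\<close>
  define Z where "Z = {x \<in> carrier M. \<forall>n. n \<notin> ?I \<longrightarrow> wts n (e n) x = \<zero>}"
  have vc: "v \<in> carrier M" using v(1) by (rule gen_weight_closed)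
  have vZ: "v \<in> Z" using vc N by (auto simp: Z_def e_def)
  have J: "J0 M x = (\<Oplus>n\<in>?I. wts n (e n) x)" if x: "x \<in> Z" for x
  proof -
    have xc: "x \<in> carrier M" using x by (simp add: Z_def)
    have z: "wts n (e n) x = \<zero>" if "n \<notin> ?I" for n using x that by (simp add: Z_def)
    have z': "- int N \<le> n \<and> n \<le> int N" if "wts n (e n) x \<noteq> \<zero>" for n
      using z[of n] that by auto
    have 1: "act M (Gamma_mode (- n)) (act M (Beta_mode n) x) = wts n (e n) x" if "n \<ge> 0" for n
      using that xc by (simp add: e_def wts_def wt_def lower_def raise_def)
    have 2: "act M (Beta_mode (- n)) (act M (Gamma_mode n) x) = wts (- n) (e (- n)) x" if "n \<ge> 1" for n
      using that xc raise_lower_same[of x "- n"] by (simp add: e_def wts_def lower_def raise_def)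
    have "supp_sum M (\<lambda>n. act M (Gamma_mode (- n)) (act M (Beta_mode n) x)) {0..} = (\<Oplus>n\<in>{0..int N}. wts n (e n) x)"
      unfolding supp_sum_def using xc z' 1
      by (intro add.finprod_mono_neutral_cong_left) (auto dest: z')
    moreover have "supp_sum M (\<lambda>n. act M (Beta_mode (- n)) (act M (Gamma_mode n) x)) {1..} = (\<Oplus>n\<in>{1..int N}. wts (- n) (e (- n)) x)"
      unfolding supp_sum_def using xc 2
      by (intro add.finprod_mono_neutral_cong_left) (auto dest!: z')
    moreover have "(\<Oplus>n\<in>{1..int N}. wts (- n) (e (- n)) x) = (\<Oplus>n\<in>uminus ` {1..int N}. wts n (e n) x)"
      using xc by (intro finsum_reindex[symmetric]) (auto simp: inj_on_def)
    moreover have "(\<Oplus>n\<in>{0..int N} \<union> uminus ` {1..int N}. wts n (e n) x) =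
        (\<Oplus>n\<in>{0..int N}. wts n (e n) x) \<oplus> (\<Oplus>n\<in>uminus ` {1..int N}. wts n (e n) x)"
      using xc by (intro finsum_Un_disjoint) auto
    moreover have "{0..int N} \<union> uminus ` {1..int N} = ?I"
    proof -
      have "n \<in> uminus ` {1..int N}" if "n \<in> ?I" "n < 0" for n
        using that by (intro image_eqI[of _ _ "- n"]) auto
      then show ?thesis by force
    qed
    ultimately show ?thesis by (simp add: J0_def)
  qed
  have JK: "J0 M x \<ominus> \<kappa> \<odot> x = K x" if x: "x \<in> Z" for x
  proof -
    have xc: "x \<in> carrier M" using x by (simp add: Z_def)
    have sm_sum: "(\<Oplus>n\<in>I. c n \<odot> x) = (\<Sum>n\<in>I. c n) \<odot> x" if "finite I" for I :: "int set" and c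
      using that xc
    proof (induction I rule: finite_induct)
      case (insert n I)
      then have "(\<Oplus>n\<in>insert n I. c n \<odot> x) = c n \<odot> x \<oplus> (\<Oplus>n\<in>I. c n \<odot> x)"
        by (intro finsum_insert) auto
      then show ?case using insert by simp
    qed simp
    have "wts n (\<chi> n) x = wts n (e n) x \<oplus> (- (\<chi> n - e n)) \<odot> x" for n
      using xc by (simp add: wts_def a_assoc)
    then have "K x = (\<Oplus>n\<in>?I. wts n (e n) x \<oplus> (- (\<chi> n - e n)) \<odot> x)"
      by (simp add: K_def)
    also have "\<dots> = J0 M x \<oplus> (\<Oplus>n\<in>?I. (- (\<chi> n - e n)) \<odot> x)"
      unfolding J[OF x] using xc by (intro finsum_addf) auto
    also have "(\<Oplus>n\<in>?I. (- (\<chi> n - e n)) \<odot> x) = (- \<kappa>) \<odot> x"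
      unfolding sm_sum[OF finite_atLeastAtMost_int] \<kappa>_def sum_negf ..
    finally show ?thesis
      using xc by (simp add: J[OF x] minus_eq' sm_assoc finsum_closed)
  qed
  have KZ: "K x \<in> Z" if x: "x \<in> Z" for x
  proof -
    have xc: "x \<in> carrier M" using x by (simp add: Z_def)
    have "wts m (e m) (K x) = \<zero>" if m: "m \<notin> ?I" for m
    proof -
      have z: "wts m (e m) x = \<zero>" using x m by (simp add: Z_def)
      have "wts m (e m) (K x) = (\<Oplus>n\<in>?I. wts m (e m) (wts n (\<chi> n) x))"
        unfolding K_def using xc by (intro linop_finsum) auto
      also have "\<dots> = (\<Oplus>n\<in>?I. \<zero>)"
        using xc z by (intro finsum_cong') (auto simp: wts_wts[of _ m])
      finally show ?thesis by (simp add: finsum_zero)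
    qed
    then show ?thesis using linopD(1)[OF linop_finsum_wts xc] by (simp add: Z_def K_def)
  qed
  have powZ: "(K ^^ p) v \<in> Z" for p using vZ KZ by (induction p) auto
  have "((\<lambda>x. J0 M x \<ominus> \<kappa> \<odot> x) ^^ p) v = (K ^^ p) v" for p
    using JK powZ by (induction p) simp_all
  moreover obtain p where "(K ^^ p) v = \<zero>"
    using nil_finsum_wts[OF _ v(1), of ?I] by (auto simp: nil_def K_def[abs_def])
  ultimately have "v \<in> gen_eigenspace M (J0 M) \<kappa>"
    using vc by (auto simp: gen_eigenspace_def)
  then show ?thesis using v(2) unfolding \<kappa>_def e_def by blast
qed

end

section \<open>The factors of a filtration\<close>

context bg_module
begin

lemma vacuum_factorI:
  assumes "bg_submodule A M" "bg_submodule B M" "A \<subseteq> B" "v \<in> B" "B \<subseteq> bg_span M (insert v A)"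
    and r: "\<And>n. n \<ge> - j \<Longrightarrow> raise n v \<in> A" and l: "\<And>n. n < - j \<Longrightarrow> lower n v \<in> A"
  shows "vacuum_factor A B j v"
proof -
  have v: "v \<in> carrier M" using bg_submoduleD(3)[OF assms(2,4)] .
  have "wts n (flow_weight j n) v \<in> A" for n
  proof (cases "n \<ge> - j")
    case True
    then show ?thesis
      using op_submodule(2)[OF assms(1) r[OF True], of n] v by (simp add: wts_def wt_def flow_weight_def)
  next
    case False
    then show ?thesis
      using op_submodule(1)[OF assms(1) l, of n n] v by (simp add: wts_def raise_lower_same flow_weight_def)
  qed
  then show ?thesis
    using assms by (simp add: vacuum_factor_def cyclic_factor_def)
qed

text \<open>Replaces the isomorphism with the factor by a homomorphism on B with kernel A, so that
  relations at the generator g become memberships in A.\<close>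

lemma factor_map:
  fixes N :: "'w bg_module"
  assumes A: "bg_submodule A M" and B: "bg_submodule B M" and AB: "A \<subseteq> B"
    and iso: "bg_quot (bg_restrict M B) A \<cong>\<^sub>b\<^sub>g spectral_flow n N"
    and N: "bg_module N" "g \<in> carrier N" "bg_span N {g} = carrier N"
  obtains v \<psi> where "v \<in> B" "B \<subseteq> bg_span M (insert v A)" "\<psi> \<in> bg_hom (bg_restrict M B) (spectral_flow n N)"
    "\<psi> v = g" "\<forall>x\<in>B. \<psi> x = \<zero>\<^bsub>N\<^esub> \<longleftrightarrow> x \<in> A"
proof -
  interpret N: bg_module N by fact
  interpret R: bg_module "bg_restrict M B" by (rule restrict_module[OF B])
  interpret sN: bg_module "spectral_flow n N" by (rule spectral_flow_module[OF N(1)])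
  have AR: "bg_submodule A (bg_restrict M B)" using restrict_submodule_iff[OF B] A AB by blast
  let ?Q = "bg_quot (bg_restrict M B) A"
  interpret P: bg_morphism "bg_restrict M B" ?Q "bg_proj (bg_restrict M B) A"
    by (rule R.bg_proj_morphism[OF AR])
  obtain \<phi> where \<phi>: "\<phi> \<in> bg_hom ?Q (spectral_flow n N)" "bij_betw \<phi> (carrier ?Q) (carrier N)"
    using iso by (auto simp: bg_isomorphic_def bg_iso_def)
  interpret F: bg_morphism ?Q "spectral_flow n N" \<phi>
    by (rule bg_morphismI[OF P.Q.bg_premodule_axioms sN.bg_premodule_axioms \<phi>(1)])
  define \<psi> where "\<psi> = \<phi> \<circ> bg_proj (bg_restrict M B) A"
  have hom: "\<psi> \<in> bg_hom (bg_restrict M B) (spectral_flow n N)"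
    unfolding \<psi>_def by (rule bg_hom_comp[OF P.hom \<phi>(1)])
  interpret G: bg_morphism "bg_restrict M B" "spectral_flow n N" \<psi>
    by (rule bg_morphismI[OF R.bg_premodule_axioms sN.bg_premodule_axioms hom])
  have inj: "inj_on \<phi> (carrier ?Q)" and surj: "\<phi> ` carrier ?Q = carrier N"
    using \<phi>(2) by (auto simp: bij_betw_def)
  have ker: "\<psi> x = \<zero>\<^bsub>N\<^esub> \<longleftrightarrow> x \<in> A" if x: "x \<in> B" for x
  proof -
    have xc: "x \<in> carrier (bg_restrict M B)" using x by simp
    have "\<psi> x = \<zero>\<^bsub>N\<^esub> \<longleftrightarrow> \<phi> (bg_proj (bg_restrict M B) A x) = \<phi> \<zero>\<^bsub>?Q\<^esub>"
      using F.f_zero by (simp add: \<psi>_def)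
    also have "\<dots> \<longleftrightarrow> bg_proj (bg_restrict M B) A x = \<zero>\<^bsub>?Q\<^esub>"
      by (rule inj_on_eq_iff[OF inj P.f_closed[OF xc] P.Q.zero_closed])
    also have "\<dots> \<longleftrightarrow> x \<in> A" by (rule R.bg_proj_eq_zero_iff[OF AR xc])
    finally show ?thesis .
  qed
  have "\<psi> ` B = carrier N"
    unfolding \<psi>_def image_comp[symmetric] using R.bg_proj_surj[of A] surj by simp
  then obtain v where v: "v \<in> B" "\<psi> v = g" using N(2) by (metis imageE)
  \<comment> \<open>\<open>?X\<close> contains the kernel A of \<open>\<psi>\<close> and maps onto
    N, as its image contains g; hence it is all of B.\<close>
  let ?X = "bg_span M (insert v A)"
  have sub: "insert v A \<subseteq> B" using v(1) AB by blast
  have X: "bg_submodule ?X M" using sub bg_submoduleD(1)[OF B] by (intro bg_span_submodule) blast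
  have XB: "?X \<subseteq> B" by (rule bg_span_subset[OF B sub])
  have "bg_submodule (\<psi> ` ?X) (spectral_flow n N)"
    using restrict_submodule_iff[OF B] X XB by (intro G.image_submodule) blast
  then have "bg_submodule (\<psi> ` ?X) N" using spectral_flow_submodule_iff[OF N.bg_premodule_axioms] by blast
  moreover have "g \<in> \<psi> ` ?X" using v(2) bg_span_incl[of v "insert v A"] by blast
  ultimately have img: "carrier N \<subseteq> \<psi> ` ?X"
    unfolding N(3)[symmetric] by (intro N.bg_span_subset) simp_all
  have "B \<subseteq> ?X"
  proof
    fix b assume b: "b \<in> B"
    then have "\<psi> b \<in> carrier N" using G.f_closed[of b] by simp
    then obtain x where x: "x \<in> ?X" "\<psi> b = \<psi> x" using img by blast
    have xB: "x \<in> B" using XB x(1) by blast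
    have bc: "b \<in> carrier M" "x \<in> carrier M" using bg_submoduleD(3)[OF B] b xB by auto
    have "\<psi> (b \<oplus> (- 1) \<odot> x) = \<zero>\<^bsub>N\<^esub>"
      using G.f_add[of b "(- 1) \<odot> x"] G.f_sm[of x "- 1"] b xB x(2) bg_submoduleD(5)[OF B xB, of "- 1"] N.sm_collect(2)[of "\<psi> x"] G.f_closed[of x]
      by simp
    then have "b \<oplus> (- 1) \<odot> x \<in> A"
      using ker bg_submoduleD(4,5)[OF B] b xB by simp
    then have "b \<oplus> (- 1) \<odot> x \<in> ?X" using bg_span_superset by blast
    then have "(b \<oplus> (- 1) \<odot> x) \<oplus> x \<in> ?X" using x(1) bg_submoduleD(4)[OF X] by blast
    then show "b \<in> ?X" using bc by (simp add: a_assoc)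
  qed
  then show ?thesis using that[OF v(1) _ hom v(2)] ker by blast
qed

lemma factor_cases:
  assumes A: "bg_submodule A M" and B: "bg_submodule B M" and AB: "A \<subseteq> B"
    and S: "C_simple (bg_quot (bg_restrict M B) A)"
  obtains (V) j v where "vacuum_factor A B j v"
  | (W) n \<mu> v where "\<mu> \<notin> \<int>" "cyclic_factor A B (\<lambda>m. if m + n \<ge> 1 then 0 else if m + n = 0 then - \<mu> else 1) v"
proof -
  interpret R: bg_module "bg_restrict M B" by (rule restrict_module[OF B])
  have ops: "R.raise = raise" "R.lower = lower"
    by (rule restrict_ops[OF bg_module_axioms B])+
  consider n where "bg_quot (bg_restrict M B) A \<cong>\<^sub>b\<^sub>g spectral_flow n V_mod"
    | n \<mu> where "\<mu> \<notin> \<int>" "bg_quot (bg_restrict M B) A \<cong>\<^sub>b\<^sub>g spectral_flow n (W_mod \<mu>)"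
    using S by (auto simp: C_simple_def)
  then show ?thesis
  proof cases
    case 1
    interpret N: bg_module V_mod by (rule V_module)
    have vc: "V_vac \<in> carrier V_mod" using V_vacuum by (simp add: N.vacuum_def)
    obtain v \<psi> where v: "v \<in> B" "B \<subseteq> bg_span M (insert v A)"
      "\<psi> \<in> bg_hom (bg_restrict M B) (spectral_flow n V_mod)" "\<psi> v = V_vac" "\<forall>x\<in>B. \<psi> x = \<zero>\<^bsub>V_mod\<^esub> \<longleftrightarrow> x \<in> A"
      by (rule factor_map[OF A B AB 1 V_module vc V_generated])
    interpret G: bg_morphism "bg_restrict M B" "spectral_flow n V_mod" \<psi>
      using spectral_flow_premodule[OF N.bg_premodule_axioms] by (intro bg_morphismI R.bg_premodule_axioms v(3))
    have "raise m v \<in> A" if "m \<ge> - n" for m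
      using G.f_ops(1)[of v m] v that V_vacuum op_submodule(1)[OF B v(1), of m]
      by (simp add: ops spectral_flow_ops[OF N.bg_premodule_axioms] N.vacuum_def)
    moreover have "lower m v \<in> A" if "m < - n" for m
      using G.f_ops(2)[of v m] v that V_vacuum op_submodule(2)[OF B v(1), of m]
      by (simp add: ops spectral_flow_ops[OF N.bg_premodule_axioms] N.vacuum_def)
    ultimately show ?thesis using V vacuum_factorI[OF A B AB v(1,2)] by blast
  next
    case 2
    interpret N: bg_module "W_mod \<mu>" by (rule W_module)
    obtain w where w: "w \<in> carrier (W_mod \<mu>)" "bg_span (W_mod \<mu>) {w} = carrier (W_mod \<mu>)"
      "\<And>n. n \<ge> 1 \<Longrightarrow> N.raise n w = \<zero>\<^bsub>W_mod \<mu>\<^esub>" "\<And>n. n \<le> - 1 \<Longrightarrow> N.lower n w = \<zero>\<^bsub>W_mod \<mu>\<^esub>"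
      "N.wt 0 w = (- \<mu>) \<odot>\<^bsub>W_mod \<mu>\<^esub> w"
      by (rule W_generator[OF 2(1)], rule that)
    obtain v \<psi> where v: "v \<in> B" "B \<subseteq> bg_span M (insert v A)"
      "\<psi> \<in> bg_hom (bg_restrict M B) (spectral_flow n (W_mod \<mu>))" "\<psi> v = w" "\<forall>x\<in>B. \<psi> x = \<zero>\<^bsub>W_mod \<mu>\<^esub> \<longleftrightarrow> x \<in> A"
      by (rule factor_map[OF A B AB 2(2) W_module w(1,2)])
    interpret sN: bg_premodule "spectral_flow n (W_mod \<mu>)"
      by (rule spectral_flow_premodule[OF N.bg_premodule_axioms])
    interpret G: bg_morphism "bg_restrict M B" "spectral_flow n (W_mod \<mu>)" \<psi>
      by (intro bg_morphismI R.bg_premodule_axioms sN.bg_premodule_axioms v(3))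
    have sops: "sN.raise m = N.raise (m + n)" "sN.lower m = N.lower (m + n)" for m
      by (rule spectral_flow_ops[OF N.bg_premodule_axioms])+
    have vc: "v \<in> carrier M" using bg_submoduleD(3)[OF B v(1)] .
    have r: "\<psi> (raise m x) = N.raise (m + n) (\<psi> x)" "\<psi> (lower m x) = N.lower (m + n) (\<psi> x)" if "x \<in> B" for m x
      using G.f_ops[of x m] that by (simp_all add: ops sops)
    \<comment> \<open>Index m in the flow by n is index m + n of W, so the exceptional eigenvalue -
      \<mu> sits at m = - n.\<close>
    let ?\<chi> = "\<lambda>m. if m + n \<ge> 1 then 0 else if m + n = 0 then - \<mu> else 1"
    have "wts m (?\<chi> m) v \<in> A" for m
    proof -
      consider "m + n \<ge> 1" | "m + n = 0" | "m + n \<le> - 1" by linarith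
      then show ?thesis
      proof cases
        case 1
        have "raise m v \<in> A"
          using v(5)[rule_format, OF op_submodule(1)[OF B v(1)], of m] r(1)[OF v(1), of m] w(3)[OF 1] v(4) by simp
        then have "lower m (raise m v) \<in> A" by (rule op_submodule(2)[OF A])
        then show ?thesis using 1 vc by (simp add: wts_def wt_def)
      next
        case 2
        have "\<psi> (wts m (- \<mu>) v) = \<psi> (wt m v) \<oplus>\<^bsub>W_mod \<mu>\<^esub> \<mu> \<odot>\<^bsub>W_mod \<mu>\<^esub> \<psi> v"
          using G.f_add[of "wt m v" "\<mu> \<odot> v"] G.f_sm[of v \<mu>] v(1) op_submodule(3)[OF B v(1), of m] bg_submoduleD(5)[OF B v(1)]
          by (simp add: wts_def)
        also have "\<psi> (wt m v) = N.wt 0 w"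
          using r(2)[OF op_submodule(1)[OF B v(1)], of m m] r(1)[OF v(1), of m] 2 v(4) by (simp add: wt_def N.wt_def)
        finally have "\<psi> (wts m (- \<mu>) v) = \<zero>\<^bsub>W_mod \<mu>\<^esub>"
          using w(1,5) v(4) by simp
        then show ?thesis using 2 v(5)[rule_format, OF op_submodule(4)[OF B v(1)]] by simp
      next
        case 3
        have "lower m v \<in> A"
          using v(5)[rule_format, OF op_submodule(2)[OF B v(1)], of m] r(2)[OF v(1), of m] w(4)[OF 3] v(4) by simp
        then have "raise m (lower m v) \<in> A" by (rule op_submodule(1)[OF A])
        then show ?thesis using 3 vc by (simp add: wts_def raise_lower_same)
      qed
    qed
    then have "cyclic_factor A B ?\<chi> v"
      using A B AB v(1,2) by (simp add: cyclic_factor_def)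
    then show ?thesis using W 2(1) by blast
  qed
qed

end

section \<open>Filtered modules on which \<open>J0\<close> has integral eigenvalues\<close>

locale integral_filtration = bg_module M for M :: "'v bg_module" +
  fixes F :: "nat \<Rightarrow> 'v set" and r :: nat
  assumes smooth: "bg_smooth M"
    and integral: "\<And>\<mu>. gen_eigenspace M (J0 M) \<mu> \<noteq> {\<zero>\<^bsub>M\<^esub>} \<Longrightarrow> \<mu> \<in> \<int>"
    and F_0: "F 0 = {\<zero>\<^bsub>M\<^esub>}" and F_r: "F r = carrier M"
    and F_sub: "i \<le> r \<Longrightarrow> bg_submodule (F i) M"
    and F_step: "i < r \<Longrightarrow> F i \<subseteq> F (Suc i)"
    and F_simple: "i < r \<Longrightarrow> C_simple (bg_quot (bg_restrict M (F (Suc i))) (F i))"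
begin

text \<open>The annihilating polynomials of successive factors multiply.\<close>

lemma locally_finite: "x \<in> carrier M \<Longrightarrow> \<exists>cs. wtprod n cs x = \<zero>\<^bsub>M\<^esub>"
proof -
  have "x \<in> F i \<Longrightarrow> \<exists>cs. wtprod n cs x = \<zero>\<^bsub>M\<^esub>" if "i \<le> r" for i x
    using that
  proof (induction i arbitrary: x)
    case 0
    then show ?case using F_0 by (intro exI[of _ "[]"]) simp
  next
    case (Suc i)
    then have i: "i < r" "i \<le> r" by auto
    have "\<exists>\<chi> v. cyclic_factor (F i) (F (Suc i)) \<chi> v"
    proof (cases rule: factor_cases[OF F_sub[OF i(2)] F_sub[OF Suc.prems(2)] F_step[OF i(1)] F_simple[OF i(1)]])
      case (1 j v)
      then have "cyclic_factor (F i) (F (Suc i)) (flow_weight j) v" by (simp add: vacuum_factor_def)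
      then show ?thesis by (intro exI)
    next
      case (2 n \<mu> v)
      from 2(2) show ?thesis by (intro exI)
    qed
    then obtain \<chi> v where \<chi>: "cyclic_factor (F i) (F (Suc i)) \<chi> v" by (elim exE)
    obtain cs where "wtprod n cs x \<in> F i"
      using cyclic_factor_locally_finite[OF \<chi> Suc.prems(1)] by blast
    then obtain ds where "wtprod n ds (wtprod n cs x) = \<zero>\<^bsub>M\<^esub>" using Suc.IH i(2) by blast
    then show ?case by (intro exI[of _ "ds @ cs"]) simp
  qed
  then show "x \<in> carrier M \<Longrightarrow> \<exists>cs. wtprod n cs x = \<zero>\<^bsub>M\<^esub>" using F_r by blast
qed

lemma smooth_bound:
  assumes "v \<in> carrier M"
  obtains N :: nat where "\<And>n. n > int N \<Longrightarrow> raise n v = \<zero>\<^bsub>M\<^esub>" "\<And>n. n < - int N \<Longrightarrow> lower n v = \<zero>\<^bsub>M\<^esub>" "N \<ge> K"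
proof -
  obtain N0 where N0: "\<And>n. n \<ge> N0 \<Longrightarrow> act M (Beta_mode n) v = \<zero>\<^bsub>M\<^esub> \<and> act M (Gamma_mode n) v = \<zero>\<^bsub>M\<^esub>"
    using smooth assms unfolding bg_smooth_def by blast
  show ?thesis
    by (rule that[of "max K (nat N0)"]) (use N0 in \<open>auto simp: raise_def lower_def\<close>)
qed

text \<open>Smoothness makes v an exact eigenvector for all but finitely many n. The lift keeps this
  property, which \<open>J0_eigenvector\<close> needs in order to have a finite sum.\<close>

lemma lift_vector:
  assumes C: "cyclic_factor A B \<chi> v"
    and \<chi>: "\<And>n. n > int K \<Longrightarrow> \<chi> n = 0" "\<And>n. n < - int K \<Longrightarrow> \<chi> n = 1"
  obtains y and N :: nat where "gen_weight \<chi> y" "y \<in> B" "y \<ominus>\<^bsub>M\<^esub> v \<in> A" "N \<ge> K"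
    "\<And>n. n > int N \<Longrightarrow> wts n 0 y = \<zero>\<^bsub>M\<^esub>" "\<And>n. n < - int N \<Longrightarrow> wts n 1 y = \<zero>\<^bsub>M\<^esub>"
proof -
  have v: "v \<in> carrier M" using cyclic_factorD(5)[OF C] .
  obtain N :: nat where N: "\<And>n. n > int N \<Longrightarrow> raise n v = \<zero>\<^bsub>M\<^esub>" "\<And>n. n < - int N \<Longrightarrow> lower n v = \<zero>\<^bsub>M\<^esub>" "N \<ge> K"
    using smooth_bound[OF v] by blast
  have hi: "\<chi> n = 0" if "n > int N" for n using \<chi>(1) that N(3) by simp
  have lo: "\<chi> n = 1" if "n < - int N" for n using \<chi>(2) that N(3) by simp
  have "wts n (\<chi> n) v = \<zero>\<^bsub>M\<^esub>" if "n \<notin> {- int N..int N}" for n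
  proof (cases "n > int N")
    case True
    then show ?thesis using N(1) hi v by (simp add: wts_def wt_def)
  next
    case False
    then have "n < - int N" using that by auto
    then show ?thesis using N(2) lo wt_raise_lower_self[OF v, of n] v by (simp add: wts_def)
  qed
  then obtain y where y: "gen_weight \<chi> y" "y \<in> B" "y \<ominus>\<^bsub>M\<^esub> v \<in> A" "\<And>n. n \<notin> {- int N..int N} \<Longrightarrow> wts n (\<chi> n) y = \<zero>\<^bsub>M\<^esub>"
    using lift_gen_weight[OF C locally_finite, of "{- int N..int N}"] finite_atLeastAtMost_int by blast
  have "wts n 0 y = \<zero>\<^bsub>M\<^esub>" if "n > int N" for n using y(4)[of n] hi[OF that] that by simp
  moreover have "wts n 1 y = \<zero>\<^bsub>M\<^esub>" if "n < - int N" for n using y(4)[of n] lo[OF that] that by simp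
  ultimately show ?thesis using that y(1-3) N(3) by blast
qed

text \<open>A factor W would contribute non-integral eigenvalues of J0.\<close>

lemma vacuum_factors:
  assumes i: "i < r"
  shows "\<exists>j v. vacuum_factor (F i) (F (Suc i)) j v"
proof -
  have sub: "bg_submodule (F i) M" "bg_submodule (F (Suc i)) M" using F_sub i by auto
  show ?thesis
  proof (cases rule: factor_cases[OF sub F_step[OF i] F_simple[OF i]])
    case (1 j v)
    then show ?thesis by blast
  next
    case (2 n \<mu> v)
    let ?\<chi> = "\<lambda>m. if m + n \<ge> 1 then 0 else if m + n = 0 then - \<mu> else 1"
    have v: "v \<in> carrier M" using cyclic_factorD(5)[OF 2(2)] .
    obtain y and N :: nat where y: "gen_weight ?\<chi> y" "y \<ominus>\<^bsub>M\<^esub> v \<in> F i" "N \<ge> nat \<bar>n\<bar> + 1"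
      "\<And>n. n > int N \<Longrightarrow> wts n 0 y = \<zero>\<^bsub>M\<^esub>" "\<And>n. n < - int N \<Longrightarrow> wts n 1 y = \<zero>\<^bsub>M\<^esub>"
    proof (rule lift_vector[OF 2(2), of "nat \<bar>n\<bar> + 1"])
      show "?\<chi> m = 0" if m: "m > int (nat \<bar>n\<bar> + 1)" for m
      proof -
        have "m + n \<ge> 1" using m by linarith
        then show ?thesis by simp
      qed
      show "?\<chi> m = 1" if m: "m < - int (nat \<bar>n\<bar> + 1)" for m
      proof -
        have "m + n \<le> - 1" using m by linarith
        then show ?thesis by simp
      qed
    qed (rule that)
    have "y = \<zero>\<^bsub>M\<^esub>"
    proof (rule ccontr)
      assume "y \<noteq> \<zero>\<^bsub>M\<^esub>"
      let ?e = "\<lambda>m :: int. if m \<ge> 0 then 0 else 1 :: complex"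
      let ?I = "{- int N..int N}"
      have "(\<Sum>m\<in>?I. ?\<chi> m - ?e m) \<in> \<int>"
        using integral[OF J0_eigenvector[OF y(1) \<open>y \<noteq> \<zero>\<^bsub>M\<^esub>\<close> y(4,5)]] .
      \<comment> \<open>All summands are integers except the one at - n, where \<mu> enters.\<close>
      moreover have "- n \<in> ?I" using y(3) by auto
      then have "(\<Sum>m\<in>?I. ?\<chi> m - ?e m) = (?\<chi> (- n) - ?e (- n)) + (\<Sum>m\<in>?I - {- n}. ?\<chi> m - ?e m)"
        by (intro sum.remove) auto
      moreover have "(\<Sum>m\<in>?I - {- n}. ?\<chi> m - ?e m) \<in> \<int>"
        by (intro Ints_sum) auto
      ultimately have "(- \<mu> - ?e (- n) + (\<Sum>m\<in>?I - {- n}. ?\<chi> m - ?e m)) - (\<Sum>m\<in>?I - {- n}. ?\<chi> m - ?e m) \<in> \<int>"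
        by (intro Ints_diff) auto
      then have "- \<mu> - ?e (- n) \<in> \<int>" by simp
      moreover have "?e (- n) \<in> \<int>" by auto
      ultimately have "- (- \<mu> - ?e (- n) + ?e (- n)) \<in> \<int>" by (intro Ints_minus Ints_add)
      then show False using 2(1) by simp
    qed
    \<comment> \<open>y = 0 means that this step of the filtration is not strict; it is then
      recorded as a vacuum factor with the zero vector.\<close>
    then have "v \<in> F i"
      using y(2) bg_submoduleD(5)[OF sub(1), of "\<zero>\<^bsub>M\<^esub> \<ominus>\<^bsub>M\<^esub> v" "- 1"] v by (simp add: minus_eq' sm_assoc)
    then have "F (Suc i) \<subseteq> F i" using cyclic_factorD(6)[OF 2(2) sub(1)] by blast
    then have "vacuum_factor (F i) (F (Suc i)) 0 \<zero>\<^bsub>M\<^esub>"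
      using sub F_step[OF i] bg_submoduleD(2)[OF sub(1)] bg_submoduleD(2)[OF sub(2)] bg_span_superset[of "insert \<zero>\<^bsub>M\<^esub> (F i)"]
      by (intro vacuum_factorI) auto
    then show ?thesis by blast
  qed
qed

text \<open>For the least step of the filtration that contains y, the vector survives in the
  corresponding factor and has there a weight of some \<open>\<sigma>\<^sup>j V\<close>. Excluding
  the values 1 and 0 on the two sides of the threshold is what the weights tested below
  contradict.\<close>

lemma weight_type:
  assumes y: "gen_weight w y" "y \<noteq> \<zero>\<^bsub>M\<^esub>"
  obtains j where "\<And>n. n \<ge> - j \<Longrightarrow> w n \<noteq> 1" "\<And>n. n < - j \<Longrightarrow> w n \<noteq> 0"
proof -
  have "y \<in> F r" using F_r gen_weight_closed[OF y(1)] by simp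
  define i where "i = (LEAST i. y \<in> F i)"
  have i: "y \<in> F i" unfolding i_def using \<open>y \<in> F r\<close> by (rule LeastI)
  have ir: "i \<le> r" unfolding i_def using \<open>y \<in> F r\<close> by (rule Least_le)
  have "i \<noteq> 0" using i y(2) F_0 by (cases "i = 0") auto
  then obtain i' where i': "i = Suc i'" using not0_implies_Suc by blast
  then have "y \<notin> F i'" using not_less_Least[of i' "\<lambda>i. y \<in> F i"] by (simp add: i_def)
  obtain j v where F: "vacuum_factor (F i') (F (Suc i')) j v"
    using vacuum_factors[of i'] ir i' by auto
  note W = vacuum_factor_weight[OF F y(1) i[unfolded i'] \<open>y \<notin> F i'\<close>]
  show ?thesis
  proof (rule that[of j])
    fix n assume "n \<ge> - j"
    then obtain k where k: "w n = - of_nat k" using W(1) by blast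
    have "(- of_nat k :: complex) \<noteq> 1"
    proof
      assume "(- of_nat k :: complex) = 1"
      then have "of_nat (Suc k) = (0 :: complex)" by (simp add: eq_neg_iff_add_eq_0 neg_eq_iff_add_eq_0 add.commute)
      then show False by (simp only: of_nat_eq_0_iff)
    qed
    then show "w n \<noteq> 1" using k by simp
  next
    fix n assume "n < - j"
    then obtain k where k: "w n = 1 + of_nat k" using W(2) by blast
    have "(1 + of_nat k :: complex) = of_nat (Suc k)" by simp
    then show "w n \<noteq> 0" using k by (metis of_nat_eq_0_iff nat.simps(3))
  qed
qed

text \<open>The image of f contains y, which agrees with the generator v modulo A. Quantifying over
  X lets the images for several factors be combined without forming sums of submodules.\<close>

lemma roof_to_factor:
  assumes V: "vacuum_factor A B j v"
  obtains k f where "bg_module (roof k)" "f \<in> bg_hom (spectral_flow j (roof k)) M"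
    "\<And>X. bg_submodule X M \<Longrightarrow> A \<subseteq> X \<Longrightarrow> f ` carrier (roof k) \<subseteq> X \<Longrightarrow> B \<subseteq> X"
proof -
  have C: "cyclic_factor A B (flow_weight j) v" using V by (simp add: vacuum_factor_def)
  note D = cyclic_factorD[OF C]
  obtain y and N :: nat where y: "gen_weight (flow_weight j) y" "y \<ominus>\<^bsub>M\<^esub> v \<in> A"
  proof (rule lift_vector[OF C, of "nat \<bar>j\<bar> + 1"])
    show "flow_weight j m = 0" if "m > int (nat \<bar>j\<bar> + 1)" for m using that by (simp add: flow_weight_def)
    show "flow_weight j m = 1" if "m < - int (nat \<bar>j\<bar> + 1)" for m using that by (simp add: flow_weight_def)
  qed (rule that)
  have yc: "y \<in> carrier M" using gen_weight_closed[OF y(1)] .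
  \<comment> \<open>Undoing the flow moves the threshold from - j to 0, where
    \<open>roof_relations\<close> is stated.\<close>
  define M' where "M' = spectral_flow (- j) M"
  interpret M': bg_module M' unfolding M'_def by (rule spectral_flow_module[OF bg_module_axioms])
  have ops: "M'.raise n = raise (n - j)" "M'.lower n = lower (n - j)" for n
    unfolding M'_def using spectral_flow_ops[OF bg_premodule_axioms, of "- j" n] by simp_all
  have M'_simps: "carrier M' = carrier M" "\<zero>\<^bsub>M'\<^esub> = \<zero>\<^bsub>M\<^esub>" by (simp_all add: M'_def)
  \<comment> \<open>The weight would have the value 1 at n - j, to the right of the value 0 at -
    j.\<close>
  have 1: "raise (n - j) y = \<zero>\<^bsub>M\<^esub>" if n: "n \<ge> 1" for n
  proof (rule ccontr)
    assume nz: "raise (n - j) y \<noteq> \<zero>\<^bsub>M\<^esub>"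
    obtain l where l: "\<And>m. m \<ge> - l \<Longrightarrow> ((flow_weight j)(n - j := flow_weight j (n - j) + 1)) m \<noteq> 1"
      "\<And>m. m < - l \<Longrightarrow> ((flow_weight j)(n - j := flow_weight j (n - j) + 1)) m \<noteq> 0"
      using weight_type[OF gen_weight_raise[OF y(1), of "n - j"] nz] by blast
    show False
    proof -
      have "\<not> n - j \<ge> - l" using l(1)[of "n - j"] n by (auto simp: flow_weight_def)
      moreover have "\<not> - j < - l" using l(2)[of "- j"] n by (auto simp: flow_weight_def)
      ultimately show ?thesis using n by linarith
    qed
  qed
  \<comment> \<open>The weight would have the value 0 at n - j, to the left of the value 1 at - 1 -
    j.\<close>
  have 2: "lower (n - j) y = \<zero>\<^bsub>M\<^esub>" if n: "n \<le> - 2" for n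
  proof (rule ccontr)
    assume nz: "lower (n - j) y \<noteq> \<zero>\<^bsub>M\<^esub>"
    obtain l where l: "\<And>m. m \<ge> - l \<Longrightarrow> ((flow_weight j)(n - j := flow_weight j (n - j) - 1)) m \<noteq> 1"
      "\<And>m. m < - l \<Longrightarrow> ((flow_weight j)(n - j := flow_weight j (n - j) - 1)) m \<noteq> 0"
      using weight_type[OF gen_weight_lower[OF y(1), of "n - j"] nz] by blast
    show False
    proof -
      have "\<not> n - j < - l" using l(2)[of "n - j"] n by (auto simp: flow_weight_def)
      moreover have "\<not> - 1 - j \<ge> - l" using l(1)[of "- 1 - j"] n by (auto simp: flow_weight_def)
      ultimately show ?thesis using n by linarith
    qed
  qed
  \<comment> \<open>Each of the two modes alone merely moves the threshold by one; together they put
    1 at - j and 0 at - 1 - j, which fits no threshold.\<close>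
  have 3: "raise (- j) (lower (- 1 - j) y) = \<zero>\<^bsub>M\<^esub>"
  proof (rule ccontr)
    assume nz: "raise (- j) (lower (- 1 - j) y) \<noteq> \<zero>\<^bsub>M\<^esub>"
    let ?w = "(flow_weight j)(- 1 - j := flow_weight j (- 1 - j) - 1)"
    obtain l where l: "\<And>m. m \<ge> - l \<Longrightarrow> (?w(- j := ?w (- j) + 1)) m \<noteq> 1" "\<And>m. m < - l \<Longrightarrow> (?w(- j := ?w (- j) + 1)) m \<noteq> 0"
      using weight_type[OF gen_weight_raise[OF gen_weight_lower[OF y(1), of "- 1 - j"], of "- j"] nz] by blast
    show False
    proof -
      have "\<not> - j \<ge> - l" using l(1)[of "- j"] by (auto simp: flow_weight_def)
      moreover have "\<not> - 1 - j < - l" using l(2)[of "- 1 - j"] by (auto simp: flow_weight_def)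
      ultimately show ?thesis by linarith
    qed
  qed
  have pow: "(T ^^ m) y = (S ^^ m) y" if "\<And>x. x \<in> carrier M \<Longrightarrow> T x = S x" "linop S" for T S m
    using that pow_closed[OF that(2) yc] by (induction m) auto
  obtain p where p: "(wts (- j) 0 ^^ p) y = \<zero>\<^bsub>M\<^esub>"
    using y(1) unfolding gen_weight_def nil_def by (metis flow_weight_def order_refl)
  obtain q where q: "(wts (- 1 - j) 1 ^^ q) y = \<zero>\<^bsub>M\<^esub>"
  proof -
    have "flow_weight j (- 1 - j) = 1" by (simp add: flow_weight_def)
    then have "nil (wts (- 1 - j) 1) y" using y(1) unfolding gen_weight_def by metis
    then show ?thesis using that unfolding nil_def by blast
  qed
  \<comment> \<open>One bound for both operators, since the two legs of the roof have equal
    length.\<close>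
  define i where "i = max p q"
  have wt0: "(M'.wt 0 ^^ m) y = (wts (- j) 0 ^^ m) y" for m
    by (rule pow) (auto simp: M'.wt_def ops wts_def wt_def)
  have wt1: "(M'.wt' ^^ m) y = (wts (- 1 - j) 1 ^^ m) y" for m
    by (rule pow) (auto simp: M'.wt'_def ops wts_def raise_lower_same)
  have i: "(M'.wt 0 ^^ i) y = \<zero>\<^bsub>M'\<^esub>" "(M'.wt' ^^ i) y = \<zero>\<^bsub>M'\<^esub>"
    using pow_mono_zero[OF linops(4) p, of i] pow_mono_zero[OF linops(4) q, of i]
    by (simp_all add: wt0 wt1 M'_simps i_def)
  have "M'.roof_relations y"
    unfolding M'.roof_relations_def M'.nil_def
  proof (intro conjI allI impI)
    show "M'.raise n y = \<zero>\<^bsub>M'\<^esub>" if "n \<ge> 1" for n using 1[OF that] by (simp add: ops M'_simps)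
    show "M'.lower n y = \<zero>\<^bsub>M'\<^esub>" if "n \<le> - 2" for n using 2[OF that] by (simp add: ops M'_simps)
    show "M'.raise 0 (M'.lower (- 1) y) = \<zero>\<^bsub>M'\<^esub>" using 3 by (simp add: ops M'_simps)
    show "y \<in> carrier M'" using yc by (simp add: M'_simps)
    show "\<exists>n. (M'.wt 0 ^^ n) y = \<zero>\<^bsub>M'\<^esub>" "\<exists>n. (M'.wt' ^^ n) y = \<zero>\<^bsub>M'\<^esub>"
      by (rule exI[of _ i], rule i)+
  qed
  then obtain f where f: "bg_module (roof (2 * i + 2))" "f \<in> bg_hom (roof (2 * i + 2)) M'" "y \<in> f ` carrier (roof (2 * i + 2))"
    by (rule roof_hom[OF M'.bg_module_axioms _ i])
  have "f \<in> bg_hom (spectral_flow j (roof (2 * i + 2))) M"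
    using f(2) spectral_flow_hom_iff[of f j "roof (2 * i + 2)" M] by (simp add: M'_def)
  moreover have "B \<subseteq> X" if X: "bg_submodule X M" "A \<subseteq> X" "f ` carrier (roof (2 * i + 2)) \<subseteq> X" for X
  proof (rule D(6)[OF X(1,2)])
    have "y \<in> X" using f(3) X(3) by blast
    moreover have "y \<ominus>\<^bsub>M\<^esub> v \<in> X" using y(2) X(2) by blast
    ultimately have "y \<ominus>\<^bsub>M\<^esub> (y \<ominus>\<^bsub>M\<^esub> v) \<in> X" using bg_submoduleD(7)[OF X(1)] by blast
    moreover have "y \<ominus>\<^bsub>M\<^esub> (y \<ominus>\<^bsub>M\<^esub> v) = v"
      using yc D(5) by (simp add: minus_eq' sm_r_distr sm_assoc a_assoc[symmetric])
    ultimately show "v \<in> X" by simp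
  qed
  ultimately show ?thesis using that[OF f(1)] by blast
qed

definition roof_maps :: "(int \<times> nat \<times> _) list \<Rightarrow> bool" where
  "roof_maps fs \<longleftrightarrow> (\<forall>(n, k, f)\<in>set fs. bg_module (roof k) \<and> f \<in> bg_hom (spectral_flow n (roof k)) M)"

definition images_in :: "'v set \<Rightarrow> (int \<times> nat \<times> _) list \<Rightarrow> bool" where
  "images_in X fs \<longleftrightarrow> (\<forall>(n, k, f)\<in>set fs. f ` carrier (roof k) \<subseteq> X)"

lemma roofs_generate:
  obtains fs where "roof_maps fs" "\<And>X. bg_submodule X M \<Longrightarrow> images_in X fs \<Longrightarrow> carrier M \<subseteq> X"
proof -
  \<comment> \<open>Descends from \<open>F r\<close> to \<open>F 0\<close>: each further roof lowers
    by one the step of the filtration that X is required to contain, and \<open>F 0\<close> lies in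
    every submodule.\<close>
  have ex: "\<exists>fs. roof_maps fs \<and> (\<forall>X. bg_submodule X M \<longrightarrow> F (r - d) \<subseteq> X \<longrightarrow> images_in X fs \<longrightarrow> carrier M \<subseteq> X)"
    if "d \<le> r" for d
    using that
  proof (induction d)
    case 0
    show ?case using F_r by (intro exI[of _ "[]"]) (simp add: roof_maps_def)
  next
    case (Suc d)
    from Suc.IH[OF Suc_leD[OF Suc.prems]] obtain fs where fs: "roof_maps fs"
      "\<forall>X. bg_submodule X M \<longrightarrow> F (r - d) \<subseteq> X \<longrightarrow> images_in X fs \<longrightarrow> carrier M \<subseteq> X"
      by (elim exE conjE)
    define i where "i = r - Suc d"
    have i: "i < r" "Suc i = r - d" using Suc.prems by (auto simp: i_def)
    obtain j v where "vacuum_factor (F i) (F (Suc i)) j v" using vacuum_factors[OF i(1)] by blast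
    then obtain k f where f: "bg_module (roof k)" "f \<in> bg_hom (spectral_flow j (roof k)) M"
      "\<forall>X. bg_submodule X M \<longrightarrow> F i \<subseteq> X \<longrightarrow> f ` carrier (roof k) \<subseteq> X \<longrightarrow> F (Suc i) \<subseteq> X"
      by (rule roof_to_factor) blast
    show ?case
    proof (rule exI[of _ "(j, k, f) # fs"], rule conjI, use fs(1) f(1,2) in \<open>simp add: roof_maps_def\<close>, intro allI impI)
      fix X assume X: "bg_submodule X M" "F (r - Suc d) \<subseteq> X" "images_in X ((j, k, f) # fs)"
      have fX: "f ` carrier (roof k) \<subseteq> X" "images_in X fs" using X(3) by (simp_all add: images_in_def)
      have "F (r - d) \<subseteq> X" using f(3) X(1,2) fX(1) i by (simp add: i_def)
      then show "carrier M \<subseteq> X" using fs(2) X(1) fX(2) by simp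
    qed
  qed
  from ex[OF order_refl] obtain fs where fs: "roof_maps fs"
    "\<forall>X. bg_submodule X M \<longrightarrow> F (r - r) \<subseteq> X \<longrightarrow> images_in X fs \<longrightarrow> carrier M \<subseteq> X"
    by (elim exE conjE)
  have gen: "carrier M \<subseteq> X" if "bg_submodule X M" "images_in X fs" for X
    using fs(2) that F_0 bg_submoduleD(2)[OF that(1)] by simp
  show thesis by (rule that[OF fs(1) gen])
qed

end

section \<open>Quotients of direct sums\<close>

lemma direct_sum_premodule:
  assumes "\<And>i. i \<in> I \<Longrightarrow> bg_premodule (Mi i)"
  shows "bg_premodule (bg_direct_sum I Mi)"
proof -
  have pm: "bg_premodule (Mi i)" if "i \<in> I" for i using assms that .
  have ag: "abelian_group (Mi i)" if "i \<in> I" for i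
    using pm[OF that] by (simp add: bg_premodule_def module_def)
  note am = abelian_group.axioms(1)[OF ag]
  have minus: "x \<oplus>\<^bsub>Mi i\<^esub> (- 1) \<odot>\<^bsub>Mi i\<^esub> x = \<zero>\<^bsub>Mi i\<^esub>" if "i \<in> I" "x \<in> carrier (Mi i)" for i x
    using bg_premodule.sm_collect(2)[OF pm[OF that(1)] that(2) that(2), of "- 1"] bg_premodule.sm_zero[OF pm[OF that(1)] that(2)] by simp
  show ?thesis
    by (rule bg_premoduleI)
      (auto simp: bg_direct_sum_def fun_eq_iff PiE_iff extensional_def restrict_def
        abelian_monoid.a_closed[OF am] abelian_monoid.zero_closed[OF am] abelian_monoid.a_assoc[OF am]
        abelian_monoid.a_comm[OF am] abelian_monoid.a_lcomm[OF am] abelian_monoid.l_zero[OF am] abelian_monoid.r_zero[OF am]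
        bg_premodule.sm_closed[OF pm] bg_premodule.sm_l_distr[OF pm] bg_premodule.sm_r_distr[OF pm]
        bg_premodule.sm_assoc[OF pm] bg_premodule.sm_one[OF pm] bg_premodule.act_closed[OF pm]
        bg_premodule.act_add[OF pm] bg_premodule.act_smult[OF pm] bg_premodule.sm_collect(3)[OF pm]
        bg_premodule.sm_zero[OF pm] minus)
qed

lemma first_isomorphism:
  assumes "bg_morphism A B h" "h ` carrier A = carrier B"
  shows "B \<cong>\<^sub>b\<^sub>g bg_quot A {x \<in> carrier A. h x = \<zero>\<^bsub>B\<^esub>}" "bg_submodule {x \<in> carrier A. h x = \<zero>\<^bsub>B\<^esub>} A"
proof -
  interpret bg_morphism A B h by fact
  let ?N = "{x \<in> carrier A. h x = \<zero>\<^bsub>B\<^esub>}"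
  show N: "bg_submodule ?N A"
    using preimage_submodule[OF Q.bg_submodule_zero] by simp
  interpret P: bg_morphism A "bg_quot A ?N" "bg_proj A ?N"
    by (rule M.bg_proj_morphism[OF N])
  \<comment> \<open>A section of h as a map of sets. The class of \<open>s b\<close> does not depend
    on the choice, since preimages of b differ by elements of the kernel.\<close>
  define s where "s b = (SOME x. x \<in> carrier A \<and> h x = b)" for b
  have s: "s b \<in> carrier A \<and> h (s b) = b" if "b \<in> carrier B" for b
  proof -
    have "b \<in> h ` carrier A" using assms(2) that by simp
    then have "\<exists>x. x \<in> carrier A \<and> h x = b" by blast
    then show ?thesis unfolding s_def by (rule someI_ex)
  qed
  have eq: "bg_proj A ?N x = bg_proj A ?N y \<longleftrightarrow> h x = h y" if "x \<in> carrier A" "y \<in> carrier A" for x y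
    using M.bg_proj_eq_iff[OF N that] that Q.minus_zero_iff[of "h x" "h y"] by (simp add: f_minus)
  define g where "g b = bg_proj A ?N (s b)" for b
  have gh: "g (h x) = bg_proj A ?N x" if "x \<in> carrier A" for x
    unfolding g_def using eq[of "s (h x)" x] s[of "h x"] that by simp
  have "g \<in> bg_hom B (bg_quot A ?N)"
  proof (rule bg_homI)
    fix b assume b: "b \<in> carrier B"
    note sb = s[OF b]
    show "g b \<in> carrier (bg_quot A ?N)" unfolding g_def using sb by simp
    have "g (c \<odot>\<^bsub>B\<^esub> h (s b)) = c \<odot>\<^bsub>bg_quot A ?N\<^esub> bg_proj A ?N (s b)" for c
      using gh[of "c \<odot>\<^bsub>A\<^esub> s b"] sb by (simp add: f_sm P.f_sm)
    then show "g (c \<odot>\<^bsub>B\<^esub> b) = c \<odot>\<^bsub>bg_quot A ?N\<^esub> g b" for c using sb by (simp add: g_def)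
    have "g (act B a (h (s b))) = act (bg_quot A ?N) a (bg_proj A ?N (s b))" for a
      using gh[of "act A a (s b)"] sb by (simp add: f_act P.f_act)
    then show "g (act B a b) = act (bg_quot A ?N) a (g b)" for a using sb by (simp add: g_def)
    fix b' assume b': "b' \<in> carrier B"
    note sb' = s[OF b']
    have "g (h (s b) \<oplus>\<^bsub>B\<^esub> h (s b')) = bg_proj A ?N (s b) \<oplus>\<^bsub>bg_quot A ?N\<^esub> bg_proj A ?N (s b')"
      using gh[of "s b \<oplus>\<^bsub>A\<^esub> s b'"] sb sb' by (simp add: f_add P.f_add)
    then show "g (b \<oplus>\<^bsub>B\<^esub> b') = g b \<oplus>\<^bsub>bg_quot A ?N\<^esub> g b'" using sb sb' by (simp add: g_def)
  qed
  moreover have "bij_betw g (carrier B) (carrier (bg_quot A ?N))"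
    unfolding bij_betw_def
  proof
    show "inj_on g (carrier B)"
    proof (rule inj_onI)
      fix b b' assume "b \<in> carrier B" "b' \<in> carrier B" "g b = g b'"
      then show "b = b'" using eq[of "s b" "s b'"] s[of b] s[of b'] by (simp add: g_def)
    qed
    have "g ` h ` carrier A = bg_proj A ?N ` carrier A"
      unfolding image_image using gh by (rule image_cong[OF refl])
    then show "g ` carrier B = carrier (bg_quot A ?N)"
      unfolding assms(2) M.bg_proj_surj .
  qed
  ultimately show "B \<cong>\<^sub>b\<^sub>g bg_quot A ?N"
    by (auto simp: bg_isomorphic_def bg_iso_def)
qed

text \<open>The sum of the maps \<open>g i\<close> has a submodule as image, and \<open>gen\<close>
  applied to that image gives surjectivity; N is the kernel.\<close>

lemma quotient_of_direct_sum:
  assumes M: "bg_premodule M" and I: "finite I"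
    and Mi: "\<And>i. i \<in> I \<Longrightarrow> bg_premodule (Mi i)" "\<And>i. i \<in> I \<Longrightarrow> g i \<in> bg_hom (Mi i) M"
    and gen: "\<And>X. bg_submodule X M \<Longrightarrow> (\<And>i. i \<in> I \<Longrightarrow> g i ` carrier (Mi i) \<subseteq> X) \<Longrightarrow> carrier M \<subseteq> X"
  obtains N where "bg_submodule N (bg_direct_sum I Mi)" "M \<cong>\<^sub>b\<^sub>g bg_quot (bg_direct_sum I Mi) N"
proof -
  interpret M: bg_premodule M by fact
  let ?D = "bg_direct_sum I Mi"
  define h where "h x = finsum M (\<lambda>i. g i (x i)) I" for x
  have D: "x \<in> carrier ?D \<Longrightarrow> i \<in> I \<Longrightarrow> x i \<in> carrier (Mi i)" for x i
    by (auto simp: bg_direct_sum_def)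
  have gc: "(\<lambda>i. g i (x i)) \<in> I \<rightarrow> carrier M" if "x \<in> carrier ?D" for x
    using bg_homD(1)[OF Mi(2)] D[OF that] by auto
  have "h \<in> bg_hom ?D M"
  proof (rule bg_homI)
    fix x assume x: "x \<in> carrier ?D"
    show "h x \<in> carrier M" unfolding h_def using gc[OF x] by (rule M.finsum_closed)
    show "h (c \<odot>\<^bsub>?D\<^esub> x) = c \<odot>\<^bsub>M\<^esub> h x" for c
    proof -
      have "c \<odot>\<^bsub>M\<^esub> h x = finsum M (\<lambda>i. c \<odot>\<^bsub>M\<^esub> g i (x i)) I"
        unfolding h_def using I gc[OF x]
      proof (induction I rule: finite_induct)
        case (insert i J)
        then have "g i (x i) \<in> carrier M" "(\<lambda>i. g i (x i)) \<in> J \<rightarrow> carrier M" by auto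
        with insert show ?case by (simp add: M.sm_r_distr Pi_def)
      qed simp
      also have "\<dots> = h (c \<odot>\<^bsub>?D\<^esub> x)"
        unfolding h_def using gc[OF x] D[OF x] bg_homD(3)[OF Mi(2)] M.sm_closed
        by (intro M.finsum_cong') (auto simp: bg_direct_sum_def Pi_def)
      finally show ?thesis ..
    qed
    show "h (act ?D a x) = act M a (h x)" for a
    proof -
      have "act M a (h x) = finsum M (\<lambda>i. act M a (g i (x i))) I"
        unfolding h_def using I gc[OF x]
      proof (induction I rule: finite_induct)
        case (insert i J)
        then have "g i (x i) \<in> carrier M" "(\<lambda>i. g i (x i)) \<in> J \<rightarrow> carrier M" by auto
        with insert show ?case by (simp add: M.act_add Pi_def)
      qed simp
      also have "\<dots> = h (act ?D a x)"
        unfolding h_def using gc[OF x] D[OF x] bg_homD(1,4)[OF Mi(2)] bg_premodule.act_closed[OF Mi(1)]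
        by (intro M.finsum_cong') (auto simp: bg_direct_sum_def)
      finally show ?thesis ..
    qed
    fix y assume y: "y \<in> carrier ?D"
    show "h (x \<oplus>\<^bsub>?D\<^esub> y) = h x \<oplus>\<^bsub>M\<^esub> h y"
      unfolding h_def M.finsum_addf[OF gc[OF x] gc[OF y], symmetric]
      using gc[OF x] gc[OF y] D[OF x] D[OF y] bg_homD(2)[OF Mi(2)]
      by (intro M.finsum_cong') (auto simp: bg_direct_sum_def Pi_def)
  qed
  then interpret h: bg_morphism ?D M h
    by (intro bg_morphismI direct_sum_premodule Mi(1) M)
  have "g i z \<in> h ` carrier ?D" if i: "i \<in> I" and z: "z \<in> carrier (Mi i)" for i z
  proof -
    define x where "x = (\<lambda>m\<in>I. if m = i then z else \<zero>\<^bsub>Mi m\<^esub>)"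
    have zc: "\<zero>\<^bsub>Mi m\<^esub> \<in> carrier (Mi m)" if "m \<in> I" for m
      using bg_premodule.bg_submoduleD(2)[OF Mi(1)[OF that] bg_premodule.bg_submodule_carrier[OF Mi(1)[OF that]]] .
    have x: "x \<in> carrier ?D" using z zc by (auto simp: x_def bg_direct_sum_def)
    have g0: "g m \<zero>\<^bsub>Mi m\<^esub> = \<zero>\<^bsub>M\<^esub>" if "m \<in> I" for m
      using bg_morphism.f_zero[OF bg_morphismI[OF Mi(1)[OF that] M Mi(2)[OF that]]] .
    have gz: "g i z \<in> carrier M" using bg_homD(1)[OF Mi(2)[OF i] z] .
    have "h x = finsum M (\<lambda>m. if m = i then g i z else \<zero>\<^bsub>M\<^esub>) I"
      unfolding h_def using gz g0 by (intro M.finsum_cong') (auto simp: x_def)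
    also have "\<dots> = finsum M (\<lambda>m. g i z) {i}"
      using gz i I by (intro M.add.finprod_mono_neutral_cong_right) auto
    also have "\<dots> = g i z" using gz by simp
    finally show ?thesis using x by (rule image_eqI[OF sym])
  qed
  then have "carrier M \<subseteq> h ` carrier ?D"
    by (intro gen h.image_submodule h.M.bg_submodule_carrier) auto
  then have surj: "h ` carrier ?D = carrier M" by auto
  show thesis
    by (rule that[OF first_isomorphism(2,1)[OF h.bg_morphism_axioms surj]])
qed

theorem theorem2p4:
  fixes M :: "'v bg_module"
  assumes "C_bg_int M" and "bg_indecomposable M"
  shows "\<exists>(r :: nat) (n :: nat \<Rightarrow> int) (k :: nat \<Rightarrow> nat) N.
    bg_submodule N (bg_direct_sum {..<r} (\<lambda>i. spectral_flow (n i) (roof (k i)))) \<and>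
    M \<cong>\<^sub>b\<^sub>g bg_quot (bg_direct_sum {..<r} (\<lambda>i. spectral_flow (n i) (roof (k i)))) N"
proof -
  have M: "bg_module M" "bg_smooth M" "\<And>\<mu>. gen_eigenspace M (J0 M) \<mu> \<noteq> {\<zero>\<^bsub>M\<^esub>} \<Longrightarrow> \<mu> \<in> \<int>"
    using assms(1) by (auto simp: C_bg_int_def C_bg_def)
  obtain r where "bg_filtration C_simple M r"
    using assms(1) by (auto simp: C_bg_int_def C_bg_def)
  then obtain F where F: "F 0 = {\<zero>\<^bsub>M\<^esub>} \<and> F r = carrier M \<and> (\<forall>i\<le>r. bg_submodule (F i) M) \<and>
      (\<forall>i<r. F i \<subseteq> F (Suc i) \<and> C_simple (bg_quot (bg_restrict M (F (Suc i))) (F i)))"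
    unfolding bg_filtration_def by (rule exE)
  interpret integral_filtration M F r
    using M F by (intro integral_filtration.intro integral_filtration_axioms.intro) simp_all
  obtain fs where fs: "roof_maps fs" "\<And>X. bg_submodule X M \<Longrightarrow> images_in X fs \<Longrightarrow> carrier M \<subseteq> X"
    by (rule roofs_generate, rule that)
  define n where "n i = fst (fs ! i)" for i
  define k where "k i = fst (snd (fs ! i))" for i
  define g where "g i = snd (snd (fs ! i))" for i
  have eq: "fs ! i = (n i, k i, g i)" for i by (simp add: n_def k_def g_def)
  have mem: "bg_module (roof (k i))" "g i \<in> bg_hom (spectral_flow (n i) (roof (k i))) M" if "i < length fs" for i
    using fs(1) nth_mem[OF that] unfolding eq by (auto simp: roof_maps_def)
  obtain N where "bg_submodule N (bg_direct_sum {..<length fs} (\<lambda>i. spectral_flow (n i) (roof (k i))))"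
    "M \<cong>\<^sub>b\<^sub>g bg_quot (bg_direct_sum {..<length fs} (\<lambda>i. spectral_flow (n i) (roof (k i)))) N"
  proof (rule quotient_of_direct_sum[OF bg_premodule_axioms finite_lessThan, of "length fs"
        "\<lambda>i. spectral_flow (n i) (roof (k i))" g])
    fix i assume "i \<in> {..<length fs}"
    then have i: "i < length fs" by simp
    interpret R: bg_module "roof (k i)" by (rule mem(1)[OF i])
    show "bg_premodule (spectral_flow (n i) (roof (k i)))"
      by (rule spectral_flow_premodule[OF R.bg_premodule_axioms])
    show "g i \<in> bg_hom (spectral_flow (n i) (roof (k i))) M" by (rule mem(2)[OF i])
  next
    fix X assume X: "bg_submodule X M"
      "\<And>i. i \<in> {..<length fs} \<Longrightarrow> g i ` carrier (spectral_flow (n i) (roof (k i))) \<subseteq> X"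
    have "f ` carrier (roof k') \<subseteq> X" if f: "(n', k', f) \<in> set fs" for n' k' f
    proof -
      obtain i where "i < length fs" "fs ! i = (n', k', f)" using f by (auto simp: in_set_conv_nth)
      then show ?thesis using X(2)[of i] eq[of i] by simp
    qed
    then have "images_in X fs" unfolding images_in_def by blast
    then show "carrier M \<subseteq> X" by (rule fs(2)[OF X(1)])
  qed (rule that)
  then show ?thesis by blast
qed

end
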